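(* Assume that the Markov independence assumption and the analyticity assumption stated in the context are satisfied (with the associated $\delta$, $\tilde C_0$, $\Psi_0$), and that $$\mathbb E\big[e^{-\nu\xi(X_0)}\tilde C_0(X_0)\big]+\mathbb E\big[e^{-(\nu-\delta)\xi(X_0)}\Psi_0(X_0)\big]+\sum_{k=0}^\infty\kappa_1^k\,\mathbb E\big[\tilde C_0^2(X_k)e^{-2\nu S_k}\big]<\infty,$$ $$\sum_{k=0}^\infty\kappa_1^k\,\mathbb E\big[\tilde C_0(X_k)\Psi_0(X_k)e^{-(2\nu-\delta)S_k}+\Psi_0^2(X_k)e^{-2(\nu-\delta)S_k}\big]<\infty,$$ $$\sum_{k=0}^\infty\kappa_1^k\,\mathbb E\big[(\tilde C_0(X_k)+\Psi_0(X_k)+k)e^{-(\nu+\delta)S_k}\big]<\infty.$$ Then there exists a square integrable random variable $W$ such that $(e^{-\nu t}N_t)_{t\ge0}$ converges in quadratic mean to $W$ as $t\to\infty$, with $$\mathbb E[W]=\kappa_1\,\mathbb E\big[e^{-\nu\xi(X_0)}\tilde C_0(X_0)\big],$$ $$\mathrm{Var}(W)=\kappa_2\sum_{k=0}^\infty\kappa_1^k\,\mathbb E\big[\tilde C_0^2(X_k)e^{-2\nu S_k}\big]-\kappa_1^2\Big(\mathbb E\big[e^{-\nu\xi(X_0)}\tilde C_0(X_0)\big]\Big)^2.$$ If, moreover, $W>0$ almost surely, then $e^{-\nu t}N_t$ converges almost surely to $W$ as $t\to\infty$.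
   Context: Branching model. $(\mathbb X,\mathcal X)$ is a measurable space, $\xi:\mathbb X\to[0,+\infty)$ and $\kappa:\mathbb X\to\{2,3,\dots\}$ are measurable functions, and $(X_n)_{n\ge 0}$ is an $\mathbb X$-valued process. Cells are labelled by finite sequences $v=(k_1,\dots,k_n)$ of positive integers ($n$ is the generation of $v$; the empty sequence labels the single initial cell, born at time $0$). To each label $v$ is attached an $\mathbb X$-valued random variable $X_v$ in such a way that, along every infinite line of descent $(v_n)_{n\ge0}$ ($v_0=\emptyset$ and $v_{n+1}$ is obtained from $v_n$ by appending one positive integer), the process $(X_{v_n})_{n\ge 0}$ has the same law as $(X_n)_{n\ge 0}$. A cell $v$ has lifetime $\xi(X_v)$ and at the end of its lifetime it splits into $\kappa(X_v)$ new cells, labelled by appending $1,\dots,\kappa(X_v)$ to $v$. $N_t$ is the number of cells alive at time $t$ (a cell being alive from its birth time, included, to its death time, excluded). $S_n:=\sum_{j=0}^n\xi(X_j)$ and $\nu:=\inf\big\{\gamma>0:\ \sum_{n\ge0}\mathbb E\big[(\prod_{j=0}^{n-1}\kappa(X_j))(\kappa(X_n)-1)e^{-\gamma S_n}\big]<\infty\big\}$. Markov independence assumption. (1) For each integer $k\ge0$ there is a process $X^{(k)}=(X^{(k)}_n)_{n\ge0}$ (defined jointly with $X=(X_n)_{n\ge0}$) such that $(X^{(k)}_n)_{0\le n\le k}=(X_n)_{0\le n\le k}$ a.s., $X^{(k)}$ has the same law as $X$, and, for every pair of lines of cells coinciding up to the $k$-th generation but not at the $(k+1)$-th generation, the corresponding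 pair of sequences of parameters has the same distribution as $(X,X^{(k)})$. (2) $(X_n)_n$ is a stationary Markov process; $(\kappa(X_n))_n$ is a sequence of i.i.d. square integrable random variables with expectation $\kappa_1$, independent of $(\xi(X_n))_n$; for all $k\ge0$, $(X^{(k)}_n)_{n\ge k+1}$ and $(X_n)_{n\ge k+1}$ are independent given $X_k$; and $$\forall x\in\mathbb X,\quad\nu=\inf\Big\{\gamma>0:\ \sum_{n\ge0}\kappa_1^n\,\mathbb E\big[e^{-\gamma S_{n+1}}\,\big|\,X_0=x\big]<\infty\Big\}<\infty.$$ Set $\kappa_2:=\mathbb E[\kappa(X_1)(\kappa(X_1)-1)]$. Analyticity assumption. Let $f_{x,0}(t)=(\kappa_1-1)e^{-\nu t}\sum_{n\ge0}\kappa_1^n\,\mathbb P(S_{n+1}-S_0\le t\,|\,X_0=x)$ and, for $\gamma>0$, $\tilde f_{x,0}(\gamma)=\int_0^\infty e^{-\gamma t}f_{x,0}(t)\,dt=\frac{\kappa_1-1}{\gamma+\nu}\sum_{n\ge0}\kappa_1^n\,\mathbb E[e^{-(\gamma+\nu)(S_{n+1}-S_0)}|X_0=x]$. There exist positive reals $\delta<\nu$ and $\epsilon$ such that, for every $x\in\mathbb X$, the Laplace transform $\tilde f_{x,0}$, extended on the complex plane, satisfies: (1) it is analytic in $\{z=u+iy:|u|<\delta+\epsilon,\ y\in\mathbb R\}\setminus\{0\}$; (2) it has a simple pole at $0$, with residue denoted $\tilde C_0(x)$; (3) $\int_{-\infty}^{+\infty}|\tilde f_{x,0}(\delta+iy)|\,dy<\infty$;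 (4) $\lim_{y\to\pm\infty}\tilde f_{x,0}(u+iy)=0$ uniformly in $u\in[-\delta,\delta]$; (5) $\Psi_0(x):=\int_{-\infty}^{+\infty}|\tilde f_{x,0}(-\delta+iy)|\,dy<\infty$.
   Formalization: The numbers of children are assumed independent, and independent of the lifetimes, over all distinct cells of each pair of lines (X, X^(k)), not only along one line; with the one-line assumption alone the variance formula fails. *)

theory Defs
  imports "HOL-Probability.Probability" "HOL-Complex_Analysis.Complex_Analysis"
begin

section \<open>The branching model\<close>

text \<open>
  A process with values in the measurable space \<open>E\<close> is a path-valued random variable
  \<open>X :: 'w \<Rightarrow> nat \<Rightarrow> 'x\<close>, measurable into the product sigma-algebra.
\<close>

definition path_space :: "'x measure \<Rightarrow> (nat \<Rightarrow> 'x) measure" where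
  "path_space E = (\<Pi>\<^sub>M n\<in>UNIV. E)"

definition lifetime_sum :: "('x \<Rightarrow> real) \<Rightarrow> (nat \<Rightarrow> 'x) \<Rightarrow> nat \<Rightarrow> real" where
  "lifetime_sum \<xi> p n = (\<Sum>j\<le>n. \<xi> (p j))"

text \<open>
  The infimum is taken in the extended reals, so that it is \<open>\<infinity>\<close> when no \<open>\<gamma>\<close> qualifies.
\<close>

definition malthus :: "'w measure \<Rightarrow> ('x \<Rightarrow> real) \<Rightarrow> ('x \<Rightarrow> nat) \<Rightarrow> ('w \<Rightarrow> nat \<Rightarrow> 'x) \<Rightarrow> ereal" where
  "malthus M \<xi> \<kappa> X = Inf (ereal ` {\<gamma>. \<gamma> > 0 \<and>
     (\<Sum>n. \<integral>\<^sup>+\<omega>. ennreal ((\<Prod>j<n. real (\<kappa> (X \<omega> j))) * (real (\<kappa> (X \<omega> n)) - 1)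
        * exp (- \<gamma> * lifetime_sum \<xi> (X \<omega>) n)) \<partial>M) < \<infinity>})"

text \<open>
  A label is a list of positive integers, the most recent index last. In the next three
  definitions \<open>T :: nat list \<Rightarrow> 'x\<close> is one realisation of the parameters of all labels,
  including the labels of cells that are never born.
\<close>

definition cell_exists :: "('x \<Rightarrow> nat) \<Rightarrow> (nat list \<Rightarrow> 'x) \<Rightarrow> nat list \<Rightarrow> bool" where
  "cell_exists \<kappa> T v \<longleftrightarrow> (\<forall>j<length v. 1 \<le> v ! j \<and> v ! j \<le> \<kappa> (T (take j v)))"

definition birth_time :: "('x \<Rightarrow> real) \<Rightarrow> (nat list \<Rightarrow> 'x) \<Rightarrow> nat list \<Rightarrow> real" where
  "birth_time \<xi> T v = (\<Sum>j<length v. \<xi> (T (take j v)))"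

text \<open>Valued in \<open>ennreal\<close>, so that infinitely many living cells count as \<open>\<infinity>\<close>.\<close>

definition num_alive :: "('x \<Rightarrow> real) \<Rightarrow> ('x \<Rightarrow> nat) \<Rightarrow> (nat list \<Rightarrow> 'x) \<Rightarrow> real \<Rightarrow> ennreal" where
  "num_alive \<xi> \<kappa> T t = emeasure (count_space UNIV)
     {v. cell_exists \<kappa> T v \<and> birth_time \<xi> T v \<le> t \<and> t < birth_time \<xi> T v + \<xi> (T v)}"

definition descent_line :: "(nat \<Rightarrow> nat list) \<Rightarrow> bool" where
  "descent_line v \<longleftrightarrow> v 0 = [] \<and> (\<forall>n. \<exists>i\<ge>1. v (Suc n) = v n @ [i])"

locale branching_model = prob_space M
  for M :: "'w measure" +
  fixes E :: "'x measure"
    and \<xi> :: "'x \<Rightarrow> real"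
    and \<kappa> :: "'x \<Rightarrow> nat"
    and X :: "'w \<Rightarrow> nat \<Rightarrow> 'x"
    and T :: "'w \<Rightarrow> nat list \<Rightarrow> 'x"
  assumes xi_measurable: "\<xi> \<in> borel_measurable E"
    and xi_nonneg: "\<And>x. x \<in> space E \<Longrightarrow> 0 \<le> \<xi> x"
    and kappa_measurable: "\<kappa> \<in> measurable E (count_space UNIV)"
    and kappa_ge_2: "\<And>x. x \<in> space E \<Longrightarrow> 2 \<le> \<kappa> x"
    and X_measurable: "X \<in> measurable M (path_space E)"
    and T_measurable: "T \<in> measurable M (\<Pi>\<^sub>M v\<in>UNIV. E)"
    and line_law: "\<And>v. descent_line v \<Longrightarrow>
      distr M (path_space E) (\<lambda>\<omega> n. T \<omega> (v n)) = distr M (path_space E) X"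

section \<open>Conditioning and Markov processes\<close>

definition sigma_gen :: "'w measure \<Rightarrow> 'a measure \<Rightarrow> ('w \<Rightarrow> 'a) \<Rightarrow> 'w measure" where
  "sigma_gen M N Y = vimage_algebra (space M) Y N"

definition cond_pr :: "'w measure \<Rightarrow> 'w measure \<Rightarrow> ('w \<Rightarrow> bool) \<Rightarrow> 'w \<Rightarrow> real" where
  "cond_pr M F Q = real_cond_exp M F (indicator {\<omega> \<in> space M. Q \<omega>})"

definition cond_indep_var ::
  "'w measure \<Rightarrow> 'w measure \<Rightarrow> 'a measure \<Rightarrow> ('w \<Rightarrow> 'a) \<Rightarrow> 'b measure \<Rightarrow> ('w \<Rightarrow> 'b) \<Rightarrow> bool" where
  "cond_indep_var M F N1 Y1 N2 Y2 \<longleftrightarrow>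
     Y1 \<in> measurable M N1 \<and> Y2 \<in> measurable M N2 \<and>
     (\<forall>A\<in>sets N1. \<forall>B\<in>sets N2. AE \<omega> in M.
        cond_pr M F (\<lambda>\<omega>. Y1 \<omega> \<in> A \<and> Y2 \<omega> \<in> B) \<omega>
          = cond_pr M F (\<lambda>\<omega>. Y1 \<omega> \<in> A) \<omega> * cond_pr M F (\<lambda>\<omega>. Y2 \<omega> \<in> B) \<omega>)"

text \<open>
  Conditional laws given \<open>X\<^sub>0 = x\<close> are used for every \<open>x\<close>, so the process comes with a transition
  kernel \<open>P\<close>. ``Stationary'' means that the transition mechanism \<open>P\<close> does not depend on time; the
  law of \<open>X\<^sub>0\<close> is arbitrary. Strictly stationary chains with kernel \<open>P\<close> are a special case.
\<close>

definition stationary_markov ::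
  "'w measure \<Rightarrow> 'x measure \<Rightarrow> ('x \<Rightarrow> 'x measure) \<Rightarrow> ('w \<Rightarrow> nat \<Rightarrow> 'x) \<Rightarrow> bool" where
  "stationary_markov M E P X \<longleftrightarrow>
     P \<in> measurable E (prob_algebra E) \<and>
     (\<forall>n. \<forall>A\<in>sets E. AE \<omega> in M.
        cond_pr M (sigma_gen M (\<Pi>\<^sub>M j\<in>{..n}. E) (\<lambda>\<omega>. restrict (X \<omega>) {..n}))
            (\<lambda>\<omega>. X \<omega> (Suc n) \<in> A) \<omega>
          = measure (P (X \<omega> n)) A)"

text \<open>
  The law of the chain with kernel \<open>P\<close> started at \<open>x\<close>, i.e.\ the conditional law of the whole
  process given \<open>X\<^sub>0 = x\<close>, is the measure of the Ionescu-Tulcea theorem.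
\<close>

definition chain_step ::
  "'x measure \<Rightarrow> ('x \<Rightarrow> 'x measure) \<Rightarrow> 'x \<Rightarrow> nat \<Rightarrow> (nat \<Rightarrow> 'x) \<Rightarrow> 'x measure" where
  "chain_step E P x i p = (if i = 0 then return E x else P (p (i - 1)))"

definition chain_law ::
  "'x measure \<Rightarrow> ('x \<Rightarrow> 'x measure) \<Rightarrow> 'x \<Rightarrow> (nat \<Rightarrow> 'x) measure" where
  "chain_law E P x =
     projective_family.lim UNIV (Ionescu_Tulcea.CI (chain_step E P x) (\<lambda>_. E)) (\<lambda>_. E)"

lemma Ionescu_Tulcea_chain_step:
  assumes P: "P \<in> measurable E (prob_algebra E)" and x: "x \<in> space E"
  shows "Ionescu_Tulcea (chain_step E P x) (\<lambda>_. E)"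
proof (rule Ionescu_Tulcea.intro)
  have Ps: "P \<in> measurable E (subprob_algebra E)"
    using P by (rule measurable_prob_algebraD)
  fix i
  show "chain_step E P x i \<in> measurable (\<Pi>\<^sub>M j\<in>{0..<i}. E) (subprob_algebra E)"
  proof (cases "i = 0")
    case True
    have "return E x \<in> space (subprob_algebra E)"
      using measurable_space[OF return_measurable x] .
    then show ?thesis
      using True by (simp add: chain_step_def[abs_def])
  next
    case False
    have "(\<lambda>p. p (i - 1)) \<in> measurable (\<Pi>\<^sub>M j\<in>{0..<i}. E) E"
      using False by (intro measurable_component_singleton) auto
    from measurable_compose[OF this Ps] show ?thesis
      using False by (simp add: chain_step_def[abs_def])
  qed
  fix p assume p: "p \<in> space (\<Pi>\<^sub>M j\<in>{0..<i}. E)"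
  show "prob_space (chain_step E P x i p)"
  proof (cases "i = 0")
    case True
    then show ?thesis using x by (simp add: chain_step_def prob_space_return)
  next
    case False
    then have "p (i - 1) \<in> space E"
      using p by (auto simp: space_PiM PiE_iff)
    from measurable_space[OF P this] show ?thesis
      using False by (simp add: chain_step_def space_prob_algebra)
  qed
qed

lemma
  assumes "P \<in> measurable E (prob_algebra E)" and "x \<in> space E"
  shows prob_space_chain_law: "prob_space (chain_law E P x)"
    and sets_chain_law: "sets (chain_law E P x) = sets (path_space E)"
proof -
  interpret IT: Ionescu_Tulcea "chain_step E P x" "\<lambda>_. E"
    using assms by (rule Ionescu_Tulcea_chain_step)
  show "prob_space (chain_law E P x)"
  proof (rule prob_spaceI)
    have "emeasure IT.PF.lim (IT.PF.emb UNIV {} (space (\<Pi>\<^sub>M j\<in>{}. E)))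
        = emeasure (IT.CI {}) (space (\<Pi>\<^sub>M j\<in>{}. E))"
      by (rule IT.lim) auto
    also have "\<dots> = emeasure (IT.CI {}) (space (IT.CI {}))"
      using IT.PF.space_P[of "{}"] by simp
    also have "\<dots> = 1"
      using IT.PF.prob_space_P[of "{}"] by (intro prob_space.emeasure_space_1) auto
    also have "IT.PF.emb UNIV {} (space (\<Pi>\<^sub>M j\<in>{}. E)) = space IT.PF.lim"
      by (auto simp: prod_emb_def space_PiM)
    finally show "emeasure (chain_law E P x) (space (chain_law E P x)) = 1"
      by (simp add: chain_law_def)
  qed
  show "sets (chain_law E P x) = sets (path_space E)"
    unfolding chain_law_def path_space_def by simp
qed

section \<open>The Markov independence assumption\<close>

definition kappa_mean :: "'w measure \<Rightarrow> ('x \<Rightarrow> nat) \<Rightarrow> ('w \<Rightarrow> nat \<Rightarrow> 'x) \<Rightarrow> real" where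
  "kappa_mean M \<kappa> X = (\<integral>\<omega>. real (\<kappa> (X \<omega> 0)) \<partial>M)"

definition kappa_fact2 :: "'w measure \<Rightarrow> ('x \<Rightarrow> nat) \<Rightarrow> ('w \<Rightarrow> nat \<Rightarrow> 'x) \<Rightarrow> real" where
  "kappa_fact2 M \<kappa> X = (\<integral>\<omega>. real (\<kappa> (X \<omega> 1)) * (real (\<kappa> (X \<omega> 1)) - 1) \<partial>M)"

text \<open>
  The cells of the pair of lines \<open>(X, X\<^sup>(\<^sup>k\<^sup>))\<close>, each counted once: \<open>(False, n)\<close> is the cell of
  generation \<open>n\<close> on the first line, and \<open>(True, n)\<close> with \<open>n > k\<close> is the cell of generation \<open>n\<close> on
  the second line, after the two lines have separated.
\<close>

definition pair_cells :: "nat \<Rightarrow> (bool \<times> nat) set" where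
  "pair_cells k = {(b, n). b \<longrightarrow> k < n}"

definition pair_param ::
  "('w \<Rightarrow> nat \<Rightarrow> 'x) \<Rightarrow> ('w \<Rightarrow> nat \<Rightarrow> 'x) \<Rightarrow> bool \<times> nat \<Rightarrow> 'w \<Rightarrow> 'x" where
  "pair_param X Y c \<omega> = (if fst c then Y \<omega> else X \<omega>) (snd c)"

text \<open>
  The independence of the numbers of children, among themselves and from the lifetimes, is
  required along a single line (\<open>kappa_indep\<close>, \<open>kappa_indep_lifetimes\<close>) and also for all the cells
  of a pair of lines (\<open>pair_kappa_indep\<close>, \<open>pair_kappa_indep_lifetimes\<close>). The single-line version
  alone does not imply the second-moment formula: with \<open>X\<^sub>n = (\<xi>\<^sub>n, \<kappa>\<^sub>n, \<kappa>\<^sub>n\<^sub>+\<^sub>1)\<close>, all \<open>\<xi>\<^sub>n\<close> and \<open>\<kappa>\<^sub>n\<close>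
  independent, it holds although sister cells have the same number of children.
\<close>

locale markov_independence = branching_model M E \<xi> \<kappa> X T
  for M :: "'w measure" and E :: "'x measure" and \<xi> :: "'x \<Rightarrow> real" and \<kappa> :: "'x \<Rightarrow> nat"
    and X :: "'w \<Rightarrow> nat \<Rightarrow> 'x" and T :: "'w \<Rightarrow> nat list \<Rightarrow> 'x" +
  fixes Xk :: "nat \<Rightarrow> 'w \<Rightarrow> nat \<Rightarrow> 'x"
    and P :: "'x \<Rightarrow> 'x measure"
    and \<nu> :: real
  assumes Xk_measurable: "\<And>k. Xk k \<in> measurable M (path_space E)"
    and Xk_eq: "\<And>k. AE \<omega> in M. \<forall>n\<le>k. Xk k \<omega> n = X \<omega> n"
    and Xk_law: "\<And>k. distr M (path_space E) (Xk k) = distr M (path_space E) X"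
    and pair_law: "\<And>k v w. descent_line v \<Longrightarrow> descent_line w \<Longrightarrow>
      (\<And>n. n \<le> k \<Longrightarrow> v n = w n) \<Longrightarrow> v (Suc k) \<noteq> w (Suc k) \<Longrightarrow>
      distr M (path_space E \<Otimes>\<^sub>M path_space E) (\<lambda>\<omega>. (\<lambda>n. T \<omega> (v n), \<lambda>n. T \<omega> (w n)))
        = distr M (path_space E \<Otimes>\<^sub>M path_space E) (\<lambda>\<omega>. (X \<omega>, Xk k \<omega>))"
    and markov: "stationary_markov M E P X"
    and kappa_indep: "indep_vars (\<lambda>_. count_space UNIV) (\<lambda>n \<omega>. \<kappa> (X \<omega> n)) UNIV"
    and kappa_ident: "\<And>n. distr M (count_space UNIV) (\<lambda>\<omega>. \<kappa> (X \<omega> n))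
      = distr M (count_space UNIV) (\<lambda>\<omega>. \<kappa> (X \<omega> 0))"
    and kappa_square_integrable: "\<And>n. integrable M (\<lambda>\<omega>. (real (\<kappa> (X \<omega> n)))\<^sup>2)"
    and kappa_indep_lifetimes:
      "indep_var (\<Pi>\<^sub>M n\<in>UNIV. borel) (\<lambda>\<omega> n. real (\<kappa> (X \<omega> n)))
                 (\<Pi>\<^sub>M n\<in>UNIV. borel) (\<lambda>\<omega> n. \<xi> (X \<omega> n))"
    and pair_kappa_indep: "\<And>k.
      indep_vars (\<lambda>_. count_space UNIV) (\<lambda>c \<omega>. \<kappa> (pair_param X (Xk k) c \<omega>)) (pair_cells k)"
    and pair_kappa_indep_lifetimes: "\<And>k.
      indep_var
        (\<Pi>\<^sub>M c\<in>pair_cells k. borel) (\<lambda>\<omega>. \<lambda>c\<in>pair_cells k. real (\<kappa> (pair_param X (Xk k) c \<omega>)))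
        (\<Pi>\<^sub>M c\<in>pair_cells k. borel) (\<lambda>\<omega>. \<lambda>c\<in>pair_cells k. \<xi> (pair_param X (Xk k) c \<omega>))"
    and cond_indep: "\<And>k. cond_indep_var M (sigma_gen M E (\<lambda>\<omega>. X \<omega> k))
      (\<Pi>\<^sub>M n\<in>{Suc k..}. E) (\<lambda>\<omega>. restrict (Xk k \<omega>) {Suc k..})
      (\<Pi>\<^sub>M n\<in>{Suc k..}. E) (\<lambda>\<omega>. restrict (X \<omega>) {Suc k..})"
    and nu: "ereal \<nu> = malthus M \<xi> \<kappa> X"
    and nu_start: "\<And>x. x \<in> space E \<Longrightarrow>
      ereal \<nu> = Inf (ereal ` {\<gamma>. \<gamma> > 0 \<and>
        (\<Sum>n. ennreal (kappa_mean M \<kappa> X ^ n)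
           * (\<integral>\<^sup>+p. ennreal (exp (- \<gamma> * lifetime_sum \<xi> p (Suc n))) \<partial>chain_law E P x)) < \<infinity>})"

section \<open>The analyticity assumption\<close>

definition f0 ::
  "'x measure \<Rightarrow> ('x \<Rightarrow> real) \<Rightarrow> ('x \<Rightarrow> 'x measure) \<Rightarrow> real \<Rightarrow> real \<Rightarrow> 'x \<Rightarrow> real \<Rightarrow> real" where
  "f0 E \<xi> P \<kappa>1 \<nu> x t = (\<kappa>1 - 1) * exp (- \<nu> * t) *
     (\<Sum>n. \<kappa>1 ^ n * \<P>(p in chain_law E P x. lifetime_sum \<xi> p (Suc n) - lifetime_sum \<xi> p 0 \<le> t))"

definition laplace :: "(real \<Rightarrow> real) \<Rightarrow> real \<Rightarrow> real" where
  "laplace f \<gamma> = (LINT t:{0..}|lborel. exp (- \<gamma> * t) * f t)"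

text \<open>\<open>F x\<close> is the extension to the complex plane of the Laplace transform of \<open>f\<^sub>x\<^sub>,\<^sub>0\<close>.\<close>

locale analyticity =
  fixes E :: "'x measure" and \<xi> :: "'x \<Rightarrow> real" and P :: "'x \<Rightarrow> 'x measure" and \<kappa>1 \<nu> :: real
    and F :: "'x \<Rightarrow> complex \<Rightarrow> complex" and \<delta> \<epsilon> :: real
  assumes delta_pos: "0 < \<delta>" and delta_less: "\<delta> < \<nu>" and eps_pos: "0 < \<epsilon>"
    and extends_laplace: "\<And>x \<gamma>. x \<in> space E \<Longrightarrow> 0 < \<gamma> \<Longrightarrow>
      F x (of_real \<gamma>) = of_real (laplace (f0 E \<xi> P \<kappa>1 \<nu> x) \<gamma>)"
    and analytic: "\<And>x. x \<in> space E \<Longrightarrow> F x analytic_on ({z. \<bar>Re z\<bar> < \<delta> + \<epsilon>} - {0})"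
    and simple_pole: "\<And>x. x \<in> space E \<Longrightarrow> is_pole (F x) 0 \<and> zorder (F x) 0 = -1"
    and integrable_right: "\<And>x. x \<in> space E \<Longrightarrow> integrable lborel (\<lambda>y. F x (Complex \<delta> y))"
    and decay_top: "\<And>x. x \<in> space E \<Longrightarrow>
      uniform_limit {-\<delta>..\<delta>} (\<lambda>y u. F x (Complex u y)) (\<lambda>_. 0) at_top"
    and decay_bot: "\<And>x. x \<in> space E \<Longrightarrow>
      uniform_limit {-\<delta>..\<delta>} (\<lambda>y u. F x (Complex u y)) (\<lambda>_. 0) at_bot"
    and integrable_left: "\<And>x. x \<in> space E \<Longrightarrow> integrable lborel (\<lambda>y. F x (Complex (- \<delta>) y))"

text \<open>
  The residue is real, being the limit of \<open>\<gamma> * F x \<gamma>\<close> as the real number \<open>\<gamma> > 0\<close> tends to \<open>0\<close>.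
\<close>

definition C0 :: "('x \<Rightarrow> complex \<Rightarrow> complex) \<Rightarrow> 'x \<Rightarrow> real" where
  "C0 F x = Re (residue (F x) 0)"

definition Psi0 :: "('x \<Rightarrow> complex \<Rightarrow> complex) \<Rightarrow> real \<Rightarrow> 'x \<Rightarrow> real" where
  "Psi0 F \<delta> x = (\<integral>y. cmod (F x (Complex (- \<delta>) y)) \<partial>lborel)"

section \<open>Convergence in quadratic mean\<close>

text \<open>
  The family \<open>Z\<close> is \<open>ennreal\<close>-valued: being square integrable includes being finite almost surely.
\<close>

definition tends_in_quadratic_mean ::
  "'w measure \<Rightarrow> (real \<Rightarrow> 'w \<Rightarrow> ennreal) \<Rightarrow> ('w \<Rightarrow> real) \<Rightarrow> bool" where
  "tends_in_quadratic_mean M Z W \<longleftrightarrow>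
     (\<forall>t\<ge>0. Z t \<in> borel_measurable M \<and> (AE \<omega> in M. Z t \<omega> < \<infinity>)
        \<and> integrable M (\<lambda>\<omega>. (enn2real (Z t \<omega>))\<^sup>2)) \<and>
     W \<in> borel_measurable M \<and> integrable M (\<lambda>\<omega>. (W \<omega>)\<^sup>2) \<and>
     ((\<lambda>t. \<integral>\<omega>. (enn2real (Z t \<omega>) - W \<omega>)\<^sup>2 \<partial>M) \<longlongrightarrow> 0) at_top"

end

theory Submission
  imports Defs "HOL-Library.Sublist"
begin

text \<open>
  Every division by time \<open>t\<close> adds \<open>\<kappa> - 1\<close> living cells, so \<open>N\<^sub>t - 1\<close> is a sum over labels. Its first
  two moments follow by splitting a pair of labels at their last common ancestor, of generation
  \<open>k\<close> say: given the past up to \<open>k\<close>, the two lines evolve independently, each contributing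
  \<open>exp (\<nu> * u) * f\<^sub>x\<^sub>,\<^sub>0 u\<close> with \<open>x = X\<^sub>k\<close> and \<open>u = t - S\<^sub>k\<close>. Shifting the contour in the Laplace inversion
  formula past the pole at \<open>0\<close> gives \<open>\<bar>f\<^sub>x\<^sub>,\<^sub>0 u - C x\<bar> \<le> \<Psi> x * exp (- \<delta> * u)\<close> for all real \<open>u\<close>.
  Hence \<open>E[G\<^sub>s G\<^sub>t]\<close>, where \<open>G\<^sub>t = exp (- \<nu> * t) * (N\<^sub>t - 1)\<close>, differs from
  \<open>\<kappa>\<^sub>2 * (\<Sum>k. \<kappa>\<^sub>1 ^ k * E[C(X\<^sub>k)\<^sup>2 * exp (- 2 * \<nu> * S\<^sub>k)])\<close> by at most a constant times
  \<open>exp (- \<eta> * min s t)\<close>, so that \<open>G\<close> is Cauchy in quadratic mean. The exponential rate gives almost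
  sure convergence along every grid of times, and \<open>exp (\<nu> * t) * G\<^sub>t\<close> being nondecreasing in \<open>t\<close>
  fills the gaps between grid points.
\<close>

section \<open>Laplace inversion\<close>

text \<open>The conditional independence that is assumed concerns the two futures given
  \<open>X \<omega> k\<close> alone, whereas a product of two gains also depends on the generations
  before k. The gap is closed by symmetry: a cell has infinitely many labelled children, so the pair
  law supplies arbitrarily large families with equal pairwise covariances, which therefore cannot be
  negative; nonnegative covariances on a past event and on its complement that add up to 0 both
  vanish. Measurability of \<Psi> in x is not given, so the estimates run with the smaller
  measurable function \<open>err\<close>, and \<Psi> enters only by monotonicity. The rate \<eta> is
  the minimum of \<delta> and \<nu> - \<delta>: the first is the speed at which f approaches C, the
  second is what remains of exp(-\<nu> * s) once a factor exp(-\<delta> * S) has been spent on the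
  weight exp(-(\<nu> + \<delta>) * S) when one label is an ancestor of the other. Until finiteness
  is known, a two-sided estimate is a pair of inequalities between extended nonnegative
  numbers.\<close>

lemma right_continuous_average:
  fixes g :: "real \<Rightarrow> real"
  assumes g: "integrable lborel g" and cont: "continuous (at_right t) g"
  shows "(\<lambda>n. real (Suc n) * (LINT s:{t<..t + 1 / real (Suc n)}|lborel. g s)) \<longlonglongrightarrow> g t"
proof (rule LIMSEQ_I)
  fix e :: real assume e: "0 < e"
  have "(g \<longlongrightarrow> g t) (at_right t)"
    using cont by (simp add: continuous_within)
  then have "eventually (\<lambda>s. dist (g s) (g t) < e / 2) (at_right t)"
    using e by (auto dest!: tendstoD[where e="e/2"])
  then obtain d where d: "t < d" "\<And>s. t < s \<Longrightarrow> s < d \<Longrightarrow> dist (g s) (g t) < e / 2"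
    unfolding eventually_at_right_field by blast
  obtain N where N: "1 / real (Suc N) < d - t"
    using d(1) reals_Archimedean[of "d - t"] by (auto simp: inverse_eq_divide)
  show "\<exists>n0. \<forall>n\<ge>n0. norm (real (Suc n) * (LINT s:{t<..t + 1 / real (Suc n)}|lborel. g s) - g t) < e"
  proof (intro exI allI impI)
    fix n assume n: "N \<le> n"
    let ?r = "1 / real (Suc n)" let ?A = "{t<..t + ?r}"
    have "?r \<le> 1 / real (Suc N)" using n by (simp add: frac_le)
    then have r: "t + ?r < d" using N by simp
    have ig: "set_integrable lborel ?A g"
      using g unfolding set_integrable_def by (intro integrable_mult_indicator) auto
    have ic: "set_integrable lborel ?A (\<lambda>s. c)" for c :: real
      by (simp add: set_integrable_def)
    have cI: "(LINT s:?A|lborel. c) = ?r * c" for c :: real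
      by (simp add: set_lebesgue_integral_def)
    have ub: "g t - e/2 \<le> g s" "g s \<le> g t + e/2" if "s \<in> ?A" for s
    proof -
      have "t < s" "s < d" using that r by auto
      from d(2)[OF this] show "g t - e/2 \<le> g s" "g s \<le> g t + e/2"
        unfolding dist_real_def abs_less_iff by linarith+
    qed
    have "(LINT s:?A|lborel. g s) \<le> (LINT s:?A|lborel. g t + e/2)"
      by (rule set_integral_mono[OF ig ic], drule ub(2)) simp
    moreover have "(LINT s:?A|lborel. g t - e/2) \<le> (LINT s:?A|lborel. g s)"
      by (rule set_integral_mono[OF ic ig], drule ub(1)) simp
    ultimately have "?r * (g t - e/2) \<le> (LINT s:?A|lborel. g s)" "(LINT s:?A|lborel. g s) \<le> ?r * (g t + e/2)"
      by (simp_all only: cI)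
    then have "g t - e/2 \<le> real (Suc n) * (LINT s:?A|lborel. g s)"
        "real (Suc n) * (LINT s:?A|lborel. g s) \<le> g t + e/2"
      by (simp_all add: field_simps)
    then have "\<bar>real (Suc n) * (LINT s:?A|lborel. g s) - g t\<bar> \<le> e/2" unfolding abs_le_iff by linarith
    then show "norm (real (Suc n) * (LINT s:?A|lborel. g s) - g t) < e" using e by simp
  qed
qed

text \<open>Divided by its mass, g is a probability density whose characteristic function is a
  multiple of \<open>\<phi>\<close>, so Levy's formula gives its integrals over intervals (a, b].
  Integrability of \<open>\<phi>\<close> turns the truncated integrals into full ones and allows
  division by the length of (t, t + r] as r tends to 0; right continuity then yields the value at
  every t rather than almost every t.\<close>

lemma fourier_inversion_nonneg:
  fixes g :: "real \<Rightarrow> real" and \<phi> :: "real \<Rightarrow> complex"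
  assumes g: "integrable lborel g" and nonneg: "\<And>t. 0 \<le> g t"
    and cont: "continuous (at_right t) g"
    and \<phi>: "\<And>\<theta>. \<phi> \<theta> = (LINT s|lborel. iexp (\<theta> * s) * complex_of_real (g s))"
    and int: "integrable lborel \<phi>"
  shows "complex_of_real (2 * pi * g t) = (LINT \<theta>|lborel. iexp (- (\<theta> * t)) * \<phi> \<theta>)"
proof -
  have [measurable]: "g \<in> borel_measurable borel" "\<phi> \<in> borel_measurable borel"
    using g int by auto
  define c where "c = (LINT s|lborel. g s)"
  have key: "(\<lambda>T. CLBINT \<theta>=-real T..real T. (iexp (- (\<theta> * a)) - iexp (- (\<theta> * b))) / (\<i> * \<theta>) * \<phi> \<theta>)
      \<longlonglongrightarrow> complex_of_real (2 * pi * (LINT s:{a<..b}|lborel. g s))" if ab: "a \<le> b" for a b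
  \<comment> \<open>Normalising needs positive mass; when the mass is 0 both sides vanish.\<close>
  proof (cases "c = 0")
    case True
    then have "AE s in lborel. g s = 0"
      using integral_nonneg_eq_0_iff_AE[OF g] nonneg by (simp add: c_def)
    then have "\<phi> \<theta> = 0" for \<theta>
      unfolding \<phi> by (intro integral_eq_zero_AE) auto
    moreover have "(LINT s:{a<..b}|lborel. g s) = 0"
      unfolding set_lebesgue_integral_def using \<open>AE s in lborel. g s = 0\<close>
      by (intro integral_eq_zero_AE) auto
    ultimately show ?thesis by simp
  next
    case False
    have c: "c > 0"
      using False integral_nonneg_AE[of g lborel] nonneg by (simp add: c_def less_le)
    define M where "M = density lborel (\<lambda>s. ennreal (g s / c))"
    have em: "emeasure M A = ennreal ((LINT s:A|lborel. g s) / c)" if [measurable]: "A \<in> sets borel" for A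
    proof -
      have "emeasure M A = (\<integral>\<^sup>+s. ennreal (indicator A s * g s / c) \<partial>lborel)"
        using c nonneg unfolding M_def
        by (subst emeasure_density) (auto intro!: nn_integral_cong split: split_indicator)
      also have "\<dots> = ennreal (LINT s|lborel. indicator A s * g s / c)"
        using c nonneg by (intro nn_integral_eq_integral integrable_divide)
          (auto intro!: integrable_real_mult_indicator g simp: mult.commute)
      finally show ?thesis by (simp add: set_lebesgue_integral_def)
    qed
    have "prob_space M"
      by (rule prob_spaceI) (use em[of UNIV] c in \<open>simp add: M_def c_def set_lebesgue_integral_def\<close>)
    then interpret M: real_distribution M
      unfolding real_distribution_def real_distribution_axioms_def by (simp add: M_def)
    have me: "measure M A = (LINT s:A|lborel. g s) / c" if "A \<in> sets borel" for A
      using em[OF that] c nonneg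
      by (simp add: measure_def set_lebesgue_integral_def integral_nonneg_AE)
    have "char M \<theta> = \<phi> \<theta> / c" for \<theta>
    proof -
      have "char M \<theta> = (LINT s|lborel. (g s / c) *\<^sub>R iexp (\<theta> * s))"
        unfolding char_def M_def using c nonneg by (subst integral_density) auto
      also have "\<dots> = (LINT s|lborel. (iexp (\<theta> * s) * complex_of_real (g s)) / c)"
        by (intro Bochner_Integration.integral_cong) (auto simp: scaleR_conv_of_real)
      finally show ?thesis by (simp add: \<phi>)
    qed
    then have ch: "char M = (\<lambda>\<theta>. \<phi> \<theta> / c)" by auto
    \<comment> \<open>Levy's formula requires endpoints that are not atoms; this law has a
      density.\<close>
    have z: "measure M {x} = 0" for x
    proof -
      have "AE s in lborel. indicator {x} s *\<^sub>R g s = 0"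
        using AE_lborel_singleton[of x] by eventually_elim (auto split: split_indicator)
      then show ?thesis by (subst me) (auto simp: set_lebesgue_integral_def intro!: integral_eq_zero_AE)
    qed
    have "(\<lambda>T. 1 / (2 * pi) * (CLBINT \<theta>=-real T..real T. (iexp (- (\<theta> * a)) - iexp (- (\<theta> * b))) / (\<i> * \<theta>) * (\<phi> \<theta> / c)))
        \<longlonglongrightarrow> complex_of_real ((LINT s:{a<..b}|lborel. g s) / c)"
      using M.Levy_Inversion[OF ab z z] by (simp add: me ch)
    then have "(\<lambda>T. (2 * pi * c) * (1 / (2 * pi) * (CLBINT \<theta>=-real T..real T. ((iexp (- (\<theta> * a)) - iexp (- (\<theta> * b))) / (\<i> * \<theta>) * \<phi> \<theta>) / c)))
        \<longlonglongrightarrow> (2 * pi * c) * complex_of_real ((LINT s:{a<..b}|lborel. g s) / c)"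
      by (intro tendsto_mult_left) simp
    then show ?thesis
      using c by (simp only: times_divide_eq_right interval_lebesgue_integral_divide) (simp add: field_simps)
  qed
  define K where "K a b \<theta> = (iexp (- (\<theta> * a)) - iexp (- (\<theta> * b))) / (\<i> * \<theta>) * \<phi> \<theta>" for a b \<theta> :: real
  have [measurable]: "K a b \<in> borel_measurable borel" for a b
    unfolding K_def[abs_def] by measurable
  \<comment> \<open>The kernel is bounded by the interval length uniformly in \<theta>. This makes
    \<open>K a b\<close> integrable, and on an interval of length r it leaves
    \<open>cmod (\<phi> \<theta>)\<close> as dominating function after division by r.\<close>
  have bound: "cmod (K a b \<theta>) \<le> (b - a) * cmod (\<phi> \<theta>)" if "a \<le> b" for a b \<theta>
  proof (cases "\<theta> = 0")
    case False
    have "cmod ((iexp (- (\<theta> * a)) - iexp (- (\<theta> * b))) / (\<i> * \<theta>)) \<le> b - a"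
      using Levy_Inversion_aux2[of "-b" "-a" \<theta>] that False by simp
    then show ?thesis
      unfolding norm_mult K_def by (intro mult_right_mono) auto
  qed (use that in \<open>auto simp: K_def\<close>)
  have intK: "integrable lborel (K a b)" if "a \<le> b" for a b
    by (rule Bochner_Integration.integrable_bound[where f="\<lambda>\<theta>. (b - a) * cmod (\<phi> \<theta>)"])
       (use bound[OF that] int that in \<open>auto intro!: integrable_mult_right integrable_norm AE_I2\<close>)
  have lev: "(LINT \<theta>|lborel. K a b \<theta>) = complex_of_real (2 * pi * (LINT s:{a<..b}|lborel. g s))"
    if ab: "a \<le> b" for a b
  proof (rule LIMSEQ_unique[OF _ key[OF ab, folded K_def]])
    have "(\<lambda>T. LINT \<theta>|lborel. indicator {-real T<..<real T} \<theta> *\<^sub>R K a b \<theta>) \<longlonglongrightarrow> (LINT \<theta>|lborel. K a b \<theta>)"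
    proof (rule integral_dominated_convergence[where w="\<lambda>\<theta>. cmod (K a b \<theta>)"])
      show "AE \<theta> in lborel. (\<lambda>T. indicator {-real T<..<real T} \<theta> *\<^sub>R K a b \<theta>) \<longlonglongrightarrow> K a b \<theta>"
      proof (rule AE_I2)
        fix \<theta> :: real
        obtain N where "\<bar>\<theta>\<bar> < real N" using reals_Archimedean2 by blast
        then have "eventually (\<lambda>T. indicator {-real T<..<real T} \<theta> *\<^sub>R K a b \<theta> = K a b \<theta>) sequentially"
          by (intro eventually_sequentiallyI[of N]) (auto simp: abs_less_iff)
        then show "(\<lambda>T. indicator {-real T<..<real T} \<theta> *\<^sub>R K a b \<theta>) \<longlonglongrightarrow> K a b \<theta>"
          by (rule tendsto_eventually)
      qed
      show "integrable lborel (\<lambda>\<theta>. cmod (K a b \<theta>))" using intK[OF ab] by (rule integrable_norm)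
    qed (auto split: split_indicator)
    then show "(\<lambda>T. CLBINT \<theta>=-real T..real T. K a b \<theta>) \<longlonglongrightarrow> (LINT \<theta>|lborel. K a b \<theta>)"
      by (simp add: interval_lebesgue_integral_def set_lebesgue_integral_def einterval_eq)
  qed
  define r where "r n = 1 / real (Suc n)" for n
  have r: "r n > 0" for n by (simp add: r_def)
  have r0: "r \<longlonglongrightarrow> 0" unfolding r_def using LIMSEQ_Suc[OF lim_1_over_n] by simp
  have "(\<lambda>n. LINT \<theta>|lborel. K t (t + r n) \<theta> / r n) \<longlonglongrightarrow> (LINT \<theta>|lborel. iexp (- (\<theta> * t)) * \<phi> \<theta>)"
  proof (rule integral_dominated_convergence[where w="\<lambda>\<theta>. cmod (\<phi> \<theta>)"])
    show "AE \<theta> in lborel. (\<lambda>n. K t (t + r n) \<theta> / r n) \<longlonglongrightarrow> iexp (- (\<theta> * t)) * \<phi> \<theta>"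
      using AE_lborel_singleton[of 0]
    proof eventually_elim
      fix \<theta> :: real assume \<theta>: "\<theta> \<noteq> 0"
      \<comment> \<open>\<open>K t (t + r n) \<theta> / r n\<close> contains minus a difference
        quotient of this exponential at t, divided by \<i> * \<theta>; the derivative brings down
        the factor that cancels the denominator.\<close>
      have "((\<lambda>z. exp (- (\<i> * \<theta>) * z)) has_field_derivative - (\<i> * \<theta>) * exp (- (\<i> * \<theta>) * t)) (at (complex_of_real t))"
        by (auto intro!: derivative_eq_intros)
      then have lim: "((\<lambda>h. (exp (- (\<i> * \<theta>) * (t + h)) - exp (- (\<i> * \<theta>) * t)) / h) \<longlongrightarrow> - (\<i> * \<theta>) * exp (- (\<i> * \<theta>) * t)) (at (0::complex))"
        by (simp add: DERIV_def)
      have fl: "filterlim (\<lambda>n. complex_of_real (r n)) (at 0) sequentially"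
        using tendsto_of_real[OF r0, where 'a=complex] r
        by (auto simp: filterlim_at less_imp_neq[THEN not_sym] intro!: always_eventually)
      have "(\<lambda>n. (exp (- (\<i> * \<theta>) * (t + complex_of_real (r n))) - exp (- (\<i> * \<theta>) * t)) / complex_of_real (r n)) \<longlonglongrightarrow> - (\<i> * \<theta>) * exp (- (\<i> * \<theta>) * t)"
        using filterlim_compose[OF lim fl] .
      then have "(\<lambda>n. - ((exp (- (\<i> * \<theta>) * (t + complex_of_real (r n))) - exp (- (\<i> * \<theta>) * t)) / complex_of_real (r n)) / (\<i> * \<theta>) * \<phi> \<theta>)
         \<longlonglongrightarrow> - (- (\<i> * \<theta>) * exp (- (\<i> * \<theta>) * t)) / (\<i> * \<theta>) * \<phi> \<theta>"
        using \<theta> by (intro tendsto_intros) auto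
      moreover have "- (- (\<i> * \<theta>) * exp (- (\<i> * \<theta>) * t)) / (\<i> * \<theta>) * \<phi> \<theta> = iexp (- (\<theta> * t)) * \<phi> \<theta>"
        using \<theta> by (simp add: algebra_simps)
      moreover have "- ((exp (- (\<i> * \<theta>) * (t + complex_of_real (r n))) - exp (- (\<i> * \<theta>) * t)) / complex_of_real (r n)) / (\<i> * \<theta>) * \<phi> \<theta>
          = K t (t + r n) \<theta> / r n" for n
        using \<theta> r[of n] by (simp add: K_def field_simps)
      ultimately show "(\<lambda>n. K t (t + r n) \<theta> / r n) \<longlonglongrightarrow> iexp (- (\<theta> * t)) * \<phi> \<theta>" by (simp only:)
    qed
    show "AE \<theta> in lborel. cmod (K t (t + r n) \<theta> / r n) \<le> cmod (\<phi> \<theta>)" for n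
    proof (rule AE_I2)
      fix \<theta>
      have "cmod (K t (t + r n) \<theta>) \<le> r n * cmod (\<phi> \<theta>)" using bound[of t "t + r n" \<theta>] r[of n] by simp
      then show "cmod (K t (t + r n) \<theta> / r n) \<le> cmod (\<phi> \<theta>)"
        using r[of n] by (simp add: norm_divide pos_divide_le_eq mult.commute)
    qed
    show "integrable lborel (\<lambda>\<theta>. cmod (\<phi> \<theta>))" using int by (rule integrable_norm)
  qed auto
  moreover have "(LINT \<theta>|lborel. K t (t + r n) \<theta> / r n) = complex_of_real (2 * pi * (real (Suc n) * (LINT s:{t<..t + 1 / real (Suc n)}|lborel. g s)))" for n
    using lev[of t "t + r n"] r[of n] by (simp add: r_def del: of_nat_Suc)
  ultimately have "(\<lambda>n. complex_of_real (2 * pi * (real (Suc n) * (LINT s:{t<..t + 1 / real (Suc n)}|lborel. g s))))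
      \<longlonglongrightarrow> (LINT \<theta>|lborel. iexp (- (\<theta> * t)) * \<phi> \<theta>)" by simp
  moreover have "(\<lambda>n. complex_of_real (2 * pi * (real (Suc n) * (LINT s:{t<..t + 1 / real (Suc n)}|lborel. g s))))
      \<longlonglongrightarrow> complex_of_real (2 * pi * g t)"
    by (intro tendsto_of_real tendsto_mult_left right_continuous_average g cont)
  ultimately show ?thesis using LIMSEQ_unique by blast
qed

section \<open>Contour shift across a simple pole\<close>

lemma LIMSEQ_integral_symmetric_interval:
  fixes f :: "real \<Rightarrow> complex"
  assumes f: "integrable lborel f"
  shows "(\<lambda>n. integral {-real n..real n} f) \<longlonglongrightarrow> (LINT y|lborel. f y)"
proof -
  have [measurable]: "f \<in> borel_measurable borel" using f by auto
  have "(\<lambda>n. LINT y|lborel. indicator {-real n..real n} y *\<^sub>R f y) \<longlonglongrightarrow> (LINT y|lborel. f y)"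
  proof (rule integral_dominated_convergence[where w="\<lambda>y. cmod (f y)"])
    show "AE y in lborel. (\<lambda>n. indicator {-real n..real n} y *\<^sub>R f y) \<longlonglongrightarrow> f y"
    proof (rule AE_I2)
      fix y :: real
      obtain N where "\<bar>y\<bar> < real N" using reals_Archimedean2 by blast
      then have "eventually (\<lambda>n. indicator {-real n..real n} y *\<^sub>R f y = f y) sequentially"
        by (intro eventually_sequentiallyI[of N]) (auto simp: abs_less_iff)
      then show "(\<lambda>n. indicator {-real n..real n} y *\<^sub>R f y) \<longlonglongrightarrow> f y" by (rule tendsto_eventually)
    qed
  qed (use f in \<open>auto split: split_indicator\<close>)
  moreover have "integral {-real n..real n} f = (LINT y|lborel. indicator {-real n..real n} y *\<^sub>R f y)" for n
  proof -
    have "set_integrable lborel {-real n..real n} f"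
      using f unfolding set_integrable_def by (intro integrable_mult_indicator) auto
    then show ?thesis
      by (simp add: set_borel_integral_eq_integral(2) flip: set_lebesgue_integral_def)
  qed
  ultimately show ?thesis by simp
qed

text \<open>The usual residue criterion read backwards. Since exp(t * w) tends to 1 at the pole, it
  shows in \<open>contour_shift_simple_pole\<close> that the exponential factor leaves the residue
  unchanged.\<close>

lemma simple_pole_tendsto_residue:
  assumes iso: "isolated_singularity_at G 0" and "is_pole G 0" "zorder G 0 = -1"
  shows "((\<lambda>w. G w * w) \<longlongrightarrow> residue G 0) (at 0)"
proof -
  obtain e where e: "e > 0" "G analytic_on ball 0 e - {0}"
    using iso unfolding isolated_singularity_at_def by blast
  have "G holomorphic_on ball 0 e - {0}" using e(2) analytic_imp_holomorphic by blast
  from zorder_exist_pole[OF this _ _ assms(2)] e(1) obtain r where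
    r: "r > 0" "zor_poly G 0 holomorphic_on cball 0 r" by auto
  have "continuous_on (ball 0 r) (zor_poly G 0)"
    using r(2) holomorphic_on_subset[OF _ ball_subset_cball] by (blast intro: holomorphic_on_imp_continuous_on)
  then have "isCont (zor_poly G 0) 0" using r(1) by (auto simp: continuous_on_eq_continuous_at)
  then have "(zor_poly G 0 \<longlongrightarrow> residue G 0) (at 0)"
    by (simp add: isCont_def residue_simple_pole[OF assms])
  moreover have "eventually (\<lambda>w. zor_poly G 0 w = G w * w) (at 0)"
    using zor_poly_pole_eq[OF assms(1,2)] assms(3) by simp
  ultimately show ?thesis by (rule Lim_transform_eventually)
qed

text \<open>Residue theorem on the rectangles whose vertices have real part d or -d and imaginary
  part n or -n. The vertical sides converge by integrability on the two lines, the horizontal ones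
  vanish by the uniform decay, and 0 is the only singularity enclosed. The sign of t is free because
  exp(t * z) is bounded on the strip.\<close>

lemma contour_shift_simple_pole:
  fixes G :: "complex \<Rightarrow> complex" and d e t :: real
  assumes d: "0 < d" and e: "0 < e"
    and an: "G analytic_on ({z. \<bar>Re z\<bar> < d + e} - {0})"
    and pole: "is_pole G 0" "zorder G 0 = -1"
    and right: "integrable lborel (\<lambda>y. G (Complex d y))"
    and left: "integrable lborel (\<lambda>y. G (Complex (- d) y))"
    and top: "uniform_limit {-d..d} (\<lambda>y u. G (Complex u y)) (\<lambda>_. 0) at_top"
    and bot: "uniform_limit {-d..d} (\<lambda>y u. G (Complex u y)) (\<lambda>_. 0) at_bot"
  shows "(LINT y|lborel. exp (of_real t * Complex d y) * G (Complex d y))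
       - (LINT y|lborel. exp (of_real t * Complex (- d) y) * G (Complex (- d) y)) = 2 * pi * residue G 0"
proof -
  define S where "S = {z. \<bar>Re z\<bar> < d + e}"
  define h where "h z = exp (of_real t * z) * G z" for z
  have "S = {z. Re z < d + e} \<inter> {z. Re z > - (d + e)}" by (auto simp: S_def)
  then have S: "open S" "convex S"
    by (auto intro!: open_Int open_halfspace_Re_lt open_halfspace_Re_gt convex_Int convex_halfspace_Re_lt convex_halfspace_Re_gt)
  have holG: "G holomorphic_on S - {0}" using an S_def analytic_imp_holomorphic by auto
  then have hol: "h holomorphic_on S - {0}" unfolding h_def[abs_def] by (intro holomorphic_intros)
  have "0 \<in> S" using d e by (simp add: S_def)
  have iso: "isolated_singularity_at G 0"
    using isolated_singularity_at_holomorphic[OF holG S(1) \<open>0 \<in> S\<close>] .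
  have "((\<lambda>w. exp (of_real t * w) * (G w * w)) \<longlongrightarrow> exp (of_real t * 0) * residue G 0) (at 0)"
    by (intro tendsto_intros simple_pole_tendsto_residue iso pole)
  then have res: "residue h 0 = residue G 0"
    by (intro residue_simple'[OF S(1) \<open>0 \<in> S\<close> hol]) (simp add: h_def mult.assoc)
  define J1 where "J1 n = contour_integral (linepath (Complex (-d) (-real n)) (Complex d (-real n))) h" for n :: nat
  define J3 where "J3 n = contour_integral (linepath (Complex d (real n)) (Complex (-d) (real n))) h" for n :: nat
  have ch: "continuous_on (S - {0}) h" using hol by (rule holomorphic_on_imp_continuous_on)
  have cint: "h contour_integrable_on linepath a b" if "closed_segment a b \<subseteq> S - {0}" for a b
    using continuous_on_subset[OF ch that] by (rule contour_integrable_continuous_linepath)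
  have segV: "closed_segment (Complex a b) (Complex a c) \<subseteq> S - {0}" if "\<bar>a\<bar> = d" for a b c
    using that d e by (auto simp: closed_segment_same_Re S_def)
  have segH: "closed_segment (Complex a c) (Complex b c) \<subseteq> S - {0}" if "\<bar>a\<bar> = d" "\<bar>b\<bar> = d" "c \<noteq> 0" for a b c
  proof -
    have "closed_segment (Complex a c) (Complex b c) \<subseteq> S"
      using that e by (intro closed_segment_subset S) (auto simp: S_def)
    then show ?thesis using that(3) by (auto simp: closed_segment_same_Im)
  qed
  have rect: "\<i> * integral {-real n..real n} (\<lambda>y. h (Complex d y)) - \<i> * integral {-real n..real n} (\<lambda>y. h (Complex (- d) y))
      + (J1 n + J3 n) = 2 * pi * \<i> * residue G 0" if n: "n > 0" for n
  proof -
    let ?a1 = "Complex (-d) (-real n)" and ?a2 = "Complex d (-real n)"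
      and ?a3 = "Complex d (real n)" and ?a4 = "Complex (-d) (real n)"
    have z: "0 \<in> box ?a1 ?a3" using d n by (simp add: in_box_complex_iff)
    have pim: "path_image (rectpath ?a1 ?a3) = cbox ?a1 ?a3 - box ?a1 ?a3"
      using d n by (intro path_image_rectpath_cbox_minus_box) auto
    have cS: "cbox ?a1 ?a3 \<subseteq> S" using e by (auto simp: in_cbox_complex_iff S_def)
    have "contour_integral (rectpath ?a1 ?a3) h = 2 * pi * \<i> * (\<Sum>p\<in>{0}. winding_number (rectpath ?a1 ?a3) p * residue h p)"
    proof (rule Residue_theorem[OF S(1) convex_connected[OF S(2)] _ hol])
      show "path_image (rectpath ?a1 ?a3) \<subseteq> S - {0}"
        using cS z by (auto simp: pim)
      show "\<forall>z. z \<notin> S \<longrightarrow> winding_number (rectpath ?a1 ?a3) z = 0"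
        using cS d n by (auto intro!: winding_number_rectpath_outside)
    qed auto
    then have 1: "contour_integral (rectpath ?a1 ?a3) h = 2 * pi * \<i> * residue G 0"
      using winding_number_rectpath[OF z] by (simp add: res)
    have c: "h contour_integrable_on linepath ?a1 ?a2" "h contour_integrable_on linepath ?a2 ?a3"
      "h contour_integrable_on linepath ?a3 ?a4" "h contour_integrable_on linepath ?a4 ?a1"
      using n d by (intro cint segV segH; simp)+
    have "contour_integral (rectpath ?a1 ?a3) h = J1 n + (contour_integral (linepath ?a2 ?a3) h + (J3 n + contour_integral (linepath ?a4 ?a1) h))"
      using c by (simp add: Let_def rectpath_def J1_def J3_def contour_integrable_joinI)
    moreover have "contour_integral (linepath ?a2 ?a3) h = \<i> * integral {-real n..real n} (\<lambda>y. h (Complex d y))"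
      using n by (intro contour_integral_linepath_same_Re) auto
    moreover have "contour_integral (linepath ?a4 ?a1) h = - (\<i> * integral {-real n..real n} (\<lambda>y. h (Complex (-d) y)))"
      using n contour_integral_linepath_same_Re[of ?a1 "-d" ?a4 "-real n" "real n" h]
        contour_integral_reversepath[of "linepath ?a1 ?a4" h] by simp
    ultimately show ?thesis using 1 by simp
  qed
  \<comment> \<open>One statement serves the top and the bottom side, traversed in either direction.
    At n = 0 the segment would meet the pole, hence the restriction to positive n.\<close>
  have bnd: "(\<lambda>n. contour_integral (linepath (Complex (a n) (c n)) (Complex (b n) (c n))) h) \<longlonglongrightarrow> 0"
    if ab: "\<And>n. \<bar>a n\<bar> = d" "\<And>n. \<bar>b n\<bar> = d" and c0: "\<And>n. n > 0 \<Longrightarrow> c n \<noteq> 0"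
      and ul: "uniform_limit {-d..d} (\<lambda>n u. G (Complex u (c n))) (\<lambda>_. 0) sequentially"
    for a b c :: "nat \<Rightarrow> real"
  proof (rule tendstoI)
    fix \<epsilon> :: real assume \<epsilon>: "0 < \<epsilon>"
    \<comment> \<open>On a horizontal side exp(t * z) has modulus at most exp(\<bar>t\<bar> * d) and
      the length is at most 2 * d; the last factor 2 makes the final estimate strict.\<close>
    define \<eta> where "\<eta> = \<epsilon> / (exp (\<bar>t\<bar> * d) * (2 * d) * 2)"
    have \<eta>: "\<eta> > 0" using \<epsilon> d by (simp add: \<eta>_def)
    have "\<forall>\<^sub>F n in sequentially. \<forall>u\<in>{-d..d}. dist (G (Complex u (c n))) 0 < \<eta>"
      using uniform_limitD[OF ul \<eta>] .
    moreover have "\<forall>\<^sub>F n in sequentially. n > (0::nat)" by (rule eventually_gt_at_top)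
    ultimately show "\<forall>\<^sub>F n in sequentially. dist (contour_integral (linepath (Complex (a n) (c n)) (Complex (b n) (c n))) h) 0 < \<epsilon>"
    proof eventually_elim
      fix n assume A: "\<forall>u\<in>{-d..d}. dist (G (Complex u (c n))) 0 < \<eta>" and n: "n > 0"
      let ?a = "Complex (a n) (c n)" and ?b = "Complex (b n) (c n)"
      have "cmod (h z) \<le> exp (\<bar>t\<bar> * d) * \<eta>" if z: "z \<in> closed_segment ?a ?b" for z
      proof -
        have "closed_segment (a n) (b n) \<subseteq> {-d..d}"
          using ab[of n] by (intro closed_segment_subset) auto
        then have im: "Im z = c n" and re: "Re z \<in> {-d..d}"
          using z by (auto simp: closed_segment_same_Im)
        then have "dist (G (Complex (Re z) (c n))) 0 < \<eta>" using A by blast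
        moreover have "Complex (Re z) (c n) = z" using im by (simp add: complex_eq_iff)
        ultimately have "cmod (G z) < \<eta>" by simp
        moreover have "t * Re z \<le> \<bar>t\<bar> * d"
          using re abs_ge_self[of "t * Re z"] mult_left_mono[of "\<bar>Re z\<bar>" d "\<bar>t\<bar>"] by (simp add: abs_mult abs_le_iff)
        then have "cmod (exp (of_real t * z)) \<le> exp (\<bar>t\<bar> * d)" by simp
        ultimately show ?thesis unfolding h_def norm_mult by (intro mult_mono) auto
      qed
      moreover have "(h has_contour_integral contour_integral (linepath ?a ?b) h) (linepath ?a ?b)"
        by (intro has_contour_integral_integral cint segH ab c0 n)
      ultimately have "cmod (contour_integral (linepath ?a ?b) h) \<le> exp (\<bar>t\<bar> * d) * \<eta> * cmod (?b - ?a)"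
        using \<eta> by (intro has_contour_integral_bound_linepath) auto
      also have "?b - ?a = of_real (b n - a n)" by (simp add: complex_eq_iff)
      also have "cmod (of_real (b n - a n)) = \<bar>b n - a n\<bar>" by (rule norm_of_real)
      also have "exp (\<bar>t\<bar> * d) * \<eta> * \<bar>b n - a n\<bar> \<le> exp (\<bar>t\<bar> * d) * \<eta> * (2 * d)"
        using ab[of n] \<eta> by (intro mult_left_mono) (auto simp: abs_if split: if_splits)
      also have "\<dots> = \<epsilon> / 2" using d by (simp add: \<eta>_def)
      also have "\<dots> < \<epsilon>" using \<epsilon> by simp
      finally show "dist (contour_integral (linepath ?a ?b) h) 0 < \<epsilon>" by simp
    qed
  qed
  have J1: "J1 \<longlonglongrightarrow> 0" unfolding J1_def[abs_def]
  proof (rule bnd)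
    have "filterlim (\<lambda>n. - real n) at_bot sequentially"
      by (rule filterlim_compose[OF filterlim_uminus_at_bot_at_top filterlim_real_sequentially])
    then show "uniform_limit {-d..d} (\<lambda>n u. G (Complex u (- real n))) (\<lambda>_. 0) sequentially"
      using bot by (rule filterlim_compose[rotated])
  qed (use d in auto)
  have J3: "J3 \<longlonglongrightarrow> 0" unfolding J3_def[abs_def]
  proof (rule bnd)
    show "uniform_limit {-d..d} (\<lambda>n u. G (Complex u (real n))) (\<lambda>_. 0) sequentially"
      using top filterlim_real_sequentially by (rule filterlim_compose)
  qed (use d in auto)
  have ih: "integrable lborel (\<lambda>y. h (Complex a y))" if "integrable lborel (\<lambda>y. G (Complex a y))" for a
  proof (rule Bochner_Integration.integrable_bound[where f="\<lambda>y. exp (t * a) * cmod (G (Complex a y))"])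
    have [measurable]: "(\<lambda>y. G (Complex a y)) \<in> borel_measurable borel" using that by auto
    have "continuous_on UNIV (\<lambda>y. exp (of_real t * Complex a y))" by (auto simp: Complex_eq intro!: continuous_intros)
    then have [measurable]: "(\<lambda>y. exp (of_real t * Complex a y)) \<in> borel_measurable borel"
      by (rule borel_measurable_continuous_onI)
    show "(\<lambda>y. h (Complex a y)) \<in> borel_measurable lborel" unfolding h_def by measurable
  qed (use that in \<open>auto simp: h_def norm_mult\<close>)
  have "(\<lambda>n. \<i> * integral {-real n..real n} (\<lambda>y. h (Complex d y)) - \<i> * integral {-real n..real n} (\<lambda>y. h (Complex (- d) y)) + (J1 n + J3 n))
      \<longlonglongrightarrow> \<i> * (LINT y|lborel. h (Complex d y)) - \<i> * (LINT y|lborel. h (Complex (- d) y)) + (0 + 0)"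
    by (intro tendsto_intros J1 J3 LIMSEQ_integral_symmetric_interval ih right left)
  moreover have "(\<lambda>n. \<i> * integral {-real n..real n} (\<lambda>y. h (Complex d y)) - \<i> * integral {-real n..real n} (\<lambda>y. h (Complex (- d) y)) + (J1 n + J3 n))
      \<longlonglongrightarrow> 2 * pi * \<i> * residue G 0"
    by (rule tendsto_eventually) (use rect in \<open>auto intro!: eventually_sequentiallyI[of 1]\<close>)
  ultimately have "\<i> * (LINT y|lborel. h (Complex d y)) - \<i> * (LINT y|lborel. h (Complex (- d) y)) = 2 * pi * \<i> * residue G 0"
    using LIMSEQ_unique by fastforce
  then have "\<i> * ((LINT y|lborel. h (Complex d y)) - (LINT y|lborel. h (Complex (- d) y))) = \<i> * (2 * pi * residue G 0)"
    by (simp add: algebra_simps)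
  then show ?thesis unfolding h_def by simp
qed

section \<open>Laplace transforms in a half plane and their inversion with a residue\<close>

lemma norm_exp_diff_quotient_le:
  fixes h :: complex
  assumes "h \<noteq> 0" "0 \<le> t"
  shows "cmod ((exp (- h * of_real t) - 1) / h) \<le> t * exp (cmod h * t)"
proof -
  have "cmod (exp (- h * of_real t) - 1) \<le> exp \<bar>Re (- h * of_real t)\<bar> * cmod (- h * of_real t)"
    using Taylor_exp[of "- h * of_real t" 0] by simp
  also have "\<dots> \<le> exp (cmod h * t) * (cmod h * t)"
    using assms(2) abs_Re_le_cmod[of h] by (intro mult_mono) (auto simp: norm_mult abs_mult intro: mult_right_mono)
  finally show ?thesis using assms by (simp add: norm_divide divide_le_eq ac_simps)
qed

text \<open>Differentiation under the integral sign, tested on sequences of increments so that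
  dominated convergence applies. Near z a part of the decay rate Re z can be given up to dominate
  the difference quotients.\<close>

lemma holomorphic_laplace:
  fixes f :: "real \<Rightarrow> real"
  assumes [measurable]: "f \<in> borel_measurable borel"
    and nonneg: "\<And>t. 0 \<le> f t" and neg: "\<And>t. t < 0 \<Longrightarrow> f t = 0"
    and int: "\<And>\<gamma>. 0 < \<gamma> \<Longrightarrow> integrable lborel (\<lambda>t. exp (- \<gamma> * t) * f t)"
  shows "(\<lambda>z. LINT t|lborel. exp (- z * of_real t) * complex_of_real (f t)) holomorphic_on {z. 0 < Re z}"
proof (rule holomorphic_onI)
  fix z :: complex assume "z \<in> {z. 0 < Re z}"
  define r where "r = Re z"
  have r: "0 < r" using \<open>z \<in> _\<close> by (simp add: r_def)
  let ?f = "\<lambda>z t. exp (- z * of_real t) * complex_of_real (f t)"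
  let ?L = "\<lambda>z. LINT t|lborel. ?f z t"
  let ?D = "LINT t|lborel. - of_real t * ?f z t"
  have intf: "integrable lborel (?f w)" if "0 < Re w" for w
    by (rule Bochner_Integration.integrable_bound[OF int[OF that]]) (use nonneg in \<open>auto simp: norm_mult\<close>)
  have "(?L has_field_derivative ?D) (at z)"
    unfolding DERIV_def tendsto_at_iff_sequentially
  proof (intro allI impI)
    fix X :: "nat \<Rightarrow> complex" assume X: "\<forall>i. X i \<in> UNIV - {0}" and X0: "X \<longlonglongrightarrow> 0"
    from LIMSEQ_D[OF X0, of "r/2"] r obtain N where N: "\<And>i. N \<le> i \<Longrightarrow> cmod (X i) < r/2" by auto
    define Y where "Y i = X (i + N)" for i
    have Y: "Y i \<noteq> 0" "cmod (Y i) < r/2" for i using X N by (auto simp: Y_def)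
    have Y0: "Y \<longlonglongrightarrow> 0" unfolding Y_def using X0 by (rule LIMSEQ_ignore_initial_segment)
    have "(\<lambda>i. LINT t|lborel. (?f (z + Y i) t - ?f z t) / Y i) \<longlonglongrightarrow> ?D"
    \<comment> \<open>With r = Re z, increments below r/2 cost a factor exp(r/2 * t), and the factor
      t from the difference quotient is at most 4/r * exp(r/4 * t). Of the decay exp(-r * t) there
      remains exp(-(r/4) * t), which is integrable against f.\<close>
    proof (rule integral_dominated_convergence[where w="\<lambda>t. 4 / r * (exp (- (r/4) * t) * f t)"])
      show "integrable lborel (\<lambda>t. 4 / r * (exp (- (r/4) * t) * f t))"
        using r by (intro integrable_mult_right int) auto
      show "AE t in lborel. (\<lambda>i. (?f (z + Y i) t - ?f z t) / Y i) \<longlonglongrightarrow> - of_real t * ?f z t"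
      proof (rule AE_I2)
        fix t :: real
        have "((\<lambda>z. ?f z t) has_field_derivative - of_real t * ?f z t) (at z)"
          by (auto intro!: derivative_eq_intros)
        then have "((\<lambda>h. (?f (z + h) t - ?f z t) / h) \<longlongrightarrow> - of_real t * ?f z t) (at 0)"
          by (simp only: DERIV_def)
        moreover have "filterlim Y (at 0) sequentially" using Y0 Y by (auto simp: filterlim_at)
        ultimately show "(\<lambda>i. (?f (z + Y i) t - ?f z t) / Y i) \<longlonglongrightarrow> - of_real t * ?f z t"
          by (rule filterlim_compose)
      qed
      show "AE t in lborel. norm ((?f (z + Y i) t - ?f z t) / Y i) \<le> 4 / r * (exp (- (r/4) * t) * f t)" for i
      proof (rule AE_I2)
        fix t :: real
        show "norm ((?f (z + Y i) t - ?f z t) / Y i) \<le> 4 / r * (exp (- (r/4) * t) * f t)"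
        proof (cases "t < 0")
          case False
          have "(?f (z + Y i) t - ?f z t) / Y i = (exp (- Y i * of_real t) - 1) / Y i * ?f z t"
            using Y by (simp add: field_simps exp_add[symmetric] exp_diff)
          also have "cmod \<dots> \<le> (t * exp (cmod (Y i) * t)) * (exp (- r * t) * f t)"
            unfolding norm_mult[of "_ / _"]
            by (intro mult_mono norm_exp_diff_quotient_le Y) (use False nonneg in \<open>auto simp: norm_mult r_def\<close>)
          also have "\<dots> \<le> (4 / r * exp (r / 4 * t) * exp (r / 2 * t)) * (exp (- r * t) * f t)"
          proof (intro mult_right_mono mult_mono)
            have "r / 4 * t \<le> exp (r / 4 * t)" using exp_ge_add_one_self[of "r / 4 * t"] by linarith
            then show "t \<le> 4 / r * exp (r / 4 * t)" using r by (simp add: field_simps)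
            show "exp (cmod (Y i) * t) \<le> exp (r / 2 * t)" using Y(2)[of i] False mult_right_mono[of "cmod (Y i)" "r / 2" t] by simp
          qed (use False r nonneg in auto)
          also have "\<dots> = 4 / r * (exp (r / 4 * t + r / 2 * t + - r * t) * f t)"
            by (simp only: exp_add ac_simps)
          also have "r / 4 * t + r / 2 * t + - r * t = - (r / 4) * t" by (simp add: field_simps)
          finally show ?thesis .
        qed (simp add: neg)
      qed
    qed auto
    moreover have dq: "(LINT t|lborel. (?f (z + Y i) t - ?f z t) / Y i) = (?L (z + Y i) - ?L z) / Y i" for i
    proof -
      have "Re (z + Y i) > 0" using Y(2)[of i] abs_Re_le_cmod[of "Y i"] r by (simp add: r_def)
      then show ?thesis using intf[of z] intf[of "z + Y i"] r
        by (subst Bochner_Integration.integral_divide_zero) (simp add: r_def Bochner_Integration.integral_diff)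
    qed
    ultimately have "(\<lambda>i. (?L (z + Y i) - ?L z) / Y i) \<longlonglongrightarrow> ?D" by (simp only: dq)
    then show "((\<lambda>h. (?L (z + h) - ?L z) / h) \<circ> X) \<longlonglongrightarrow> ?D"
      unfolding comp_def Y_def by (rule LIMSEQ_offset)
  qed
  then show "?L field_differentiable at z within {z. 0 < Re z}"
    using field_differentiable_at_within field_differentiable_def by blast
qed

text \<open>\<open>G\<close> and the transform of f are holomorphic on the strip 0 < Re z < d + e
  and agree on its real segment, hence throughout. On the line Re z = d this makes \<open>G\<close>
  a Fourier transform of exp(-d * t) * f t, and inversion writes 2 * pi * f t as an integral over
  that line. Moving it to Re z = -d yields the residue, and on the new line exp(t * z) has modulus
  exp(-d * t).\<close>

theorem laplace_inversion_residue_bound: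
  fixes f :: "real \<Rightarrow> real" and G :: "complex \<Rightarrow> complex"
  assumes meas[measurable]: "f \<in> borel_measurable borel"
    and nonneg: "\<And>t. 0 \<le> f t" and neg: "\<And>t. t < 0 \<Longrightarrow> f t = 0"
    and cont: "\<And>t. continuous (at_right t) f"
    and int: "\<And>\<gamma>. 0 < \<gamma> \<Longrightarrow> integrable lborel (\<lambda>t. exp (- \<gamma> * t) * f t)"
    and G: "\<And>\<gamma>. 0 < \<gamma> \<Longrightarrow> G (of_real \<gamma>) = of_real (LINT t|lborel. exp (- \<gamma> * t) * f t)"
    and d: "0 < d" and e: "0 < e"
    and an: "G analytic_on ({z. \<bar>Re z\<bar> < d + e} - {0})"
    and pole: "is_pole G 0" "zorder G 0 = -1"
    and right: "integrable lborel (\<lambda>y. G (Complex d y))"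
    and left: "integrable lborel (\<lambda>y. G (Complex (- d) y))"
    and top: "uniform_limit {-d..d} (\<lambda>y u. G (Complex u y)) (\<lambda>_. 0) at_top"
    and bot: "uniform_limit {-d..d} (\<lambda>y u. G (Complex u y)) (\<lambda>_. 0) at_bot"
  shows "\<bar>f t - Re (residue G 0)\<bar> \<le> exp (- d * t) * (LINT y|lborel. cmod (G (Complex (- d) y)))"
proof -
  define L where "L z = (LINT t|lborel. exp (- z * of_real t) * complex_of_real (f t))" for z
  define S where "S = {z. 0 < Re z \<and> Re z < d + e}"
  have "S = {z. 0 < Re z} \<inter> {z. Re z < d + e}" by (auto simp: S_def)
  then have S: "open S" "connected S"
    by (auto intro!: open_Int open_halfspace_Re_lt open_halfspace_Re_gt convex_connected convex_Int convex_halfspace_Re_lt convex_halfspace_Re_gt)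
  have "L holomorphic_on {z. 0 < Re z}"
    unfolding L_def[abs_def] by (rule holomorphic_laplace[OF meas nonneg neg int])
  then have "L holomorphic_on S" by (rule holomorphic_on_subset) (auto simp: S_def)
  moreover have "G holomorphic_on S"
    using analytic_imp_holomorphic[OF an] by (rule holomorphic_on_subset) (auto simp: S_def)
  ultimately have hol: "(\<lambda>z. G z - L z) holomorphic_on S" by (intro holomorphic_intros)
  have GL: "G z = L z" if z: "z \<in> S" for z
  proof -
    define U where "U = complex_of_real ` {0<..<d + e}"
    have "G z - L z = 0"
    proof (rule analytic_continuation[OF hol S, of U "of_real (d/2)"])
      show "U \<subseteq> S" "complex_of_real (d/2) \<in> S" using d e by (auto simp: U_def S_def)
      show "complex_of_real (d / 2) islimpt U"
        unfolding islimpt_approachable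
      proof (intro allI impI)
        fix q :: real assume q: "0 < q"
        define m where "m = min (q/2) (d/4)"
        have m: "0 < m" "m < q" "m < d / 2" using q d by (auto simp: m_def)
        have "complex_of_real (d/2 + m) \<in> U" unfolding U_def using m d e by (intro imageI) auto
        moreover have "dist (complex_of_real (d/2 + m)) (complex_of_real (d/2)) < q"
          using m by (simp add: dist_norm flip: of_real_diff)
        moreover have "complex_of_real (d/2 + m) \<noteq> complex_of_real (d/2)" using m by (simp only: of_real_eq_iff)
        ultimately show "\<exists>x'\<in>U. x' \<noteq> complex_of_real (d / 2) \<and> dist x' (complex_of_real (d / 2)) < q" by blast
      qed
      fix w assume "w \<in> U"
      then obtain \<gamma> where \<gamma>: "w = of_real \<gamma>" "0 < \<gamma>" by (auto simp: U_def)
      have "exp (- w * of_real t) * complex_of_real (f t) = complex_of_real (exp (- \<gamma> * t) * f t)" for t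
      proof -
        have "- w * of_real t = complex_of_real (- \<gamma> * t)" by (simp add: \<gamma>)
        then have "exp (- w * of_real t) = complex_of_real (exp (- \<gamma> * t))" by (simp only: exp_of_real)
        then show ?thesis by (simp only: of_real_mult)
      qed
      then show "G w - L w = 0" using G[OF \<gamma>(2)] unfolding L_def \<gamma>(1)
        by (simp only: integral_complex_of_real diff_self)
    qed (rule z)
    then show ?thesis by simp
  qed
  define g where "g t = exp (- d * t) * f t" for t
  \<comment> \<open>The minus sign turns the Laplace kernel exp(-z * s) at z = d - \<i> * \<theta>
    into an exponential with phase \<theta> * s, the convention of characteristic functions.\<close>
  define \<phi> where "\<phi> \<theta> = G (Complex d (- \<theta>))" for \<theta>
  have "complex_of_real (2 * pi * g t) = (LINT \<theta>|lborel. iexp (- (\<theta> * t)) * \<phi> \<theta>)"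
  proof (rule fourier_inversion_nonneg)
    show "integrable lborel g" unfolding g_def by (rule int[OF d])
    show "0 \<le> g t" for t using nonneg by (simp add: g_def)
    show "continuous (at_right t) g" unfolding g_def by (intro continuous_intros cont)
    show "integrable lborel \<phi>"
      using lborel_integrable_real_affine[OF right, of "-1" 0] by (simp add: \<phi>_def[abs_def])
    fix \<theta> :: real
    have "\<phi> \<theta> = L (Complex d (- \<theta>))" unfolding \<phi>_def using d e by (intro GL) (simp add: S_def)
    also have "\<dots> = (LINT s|lborel. iexp (\<theta> * s) * complex_of_real (g s))"
      unfolding L_def
    proof (intro Bochner_Integration.integral_cong refl)
      fix s :: real
      have "exp (- Complex d (- \<theta>) * of_real s) = iexp (\<theta> * s) * complex_of_real (exp (- d * s))"
      proof -
        have "- Complex d (- \<theta>) * of_real s = \<i> * of_real (\<theta> * s) + of_real (- d * s)"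
          by (simp add: complex_eq_iff)
        then show ?thesis by (simp only: exp_add exp_of_real)
      qed
      then show "exp (- Complex d (- \<theta>) * of_real s) * complex_of_real (f s) = iexp (\<theta> * s) * complex_of_real (g s)"
        by (simp add: g_def)
    qed
    finally show "\<phi> \<theta> = (LINT s|lborel. iexp (\<theta> * s) * complex_of_real (g s))" .
  qed
  also have "\<dots> = (LINT y|lborel. iexp (y * t) * G (Complex d y))"
  proof -
    define H where "H \<theta> = iexp (- (\<theta> * t)) * \<phi> \<theta>" for \<theta>
    have "(LINT \<theta>|lborel. H \<theta>) = \<bar>-1\<bar> *\<^sub>R (LINT x|lborel. H (0 + (-1) * x))"
      by (rule lborel_integral_real_affine) simp
    moreover have "H (0 + (-1) * x) = iexp (x * t) * G (Complex d x)" for x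
      by (simp add: H_def \<phi>_def)
    ultimately show ?thesis unfolding H_def[symmetric] by (simp only: abs_minus abs_one scaleR_one)
  qed
  finally have "complex_of_real (exp (d * t)) * complex_of_real (2 * pi * g t)
      = (LINT y|lborel. complex_of_real (exp (d * t)) * (iexp (y * t) * G (Complex d y)))"
    by (simp only: integral_mult_right_zero)
  also have "\<dots> = (LINT y|lborel. exp (of_real t * Complex d y) * G (Complex d y))"
  proof (intro Bochner_Integration.integral_cong refl)
    fix y :: real
    have "of_real t * Complex d y = of_real (d * t) + \<i> * of_real (y * t)"
      by (simp add: complex_eq_iff)
    then have "exp (of_real t * Complex d y) = complex_of_real (exp (d * t)) * iexp (y * t)"
      by (simp only: exp_add exp_of_real)
    then show "complex_of_real (exp (d * t)) * (iexp (y * t) * G (Complex d y)) = exp (of_real t * Complex d y) * G (Complex d y)"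
      by (simp only: mult.assoc)
  qed
  also have "complex_of_real (exp (d * t)) * complex_of_real (2 * pi * g t) = complex_of_real (2 * pi * f t)"
    by (simp add: g_def exp_minus)
  finally have I: "complex_of_real (2 * pi * f t) = (LINT y|lborel. exp (of_real t * Complex d y) * G (Complex d y))" .
  let ?I = "LINT y|lborel. exp (of_real t * Complex (- d) y) * G (Complex (- d) y)"
  let ?\<Psi> = "LINT y|lborel. cmod (G (Complex (- d) y))"
  have "complex_of_real (2 * pi * f t) - ?I = 2 * pi * residue G 0"
    unfolding I using contour_shift_simple_pole[OF d e an pole right left top bot] .
  then have "?I = 2 * pi * (of_real (f t) - residue G 0)" by (simp add: algebra_simps)
  then have eq: "cmod ?I = 2 * pi * cmod (of_real (f t) - residue G 0)" by (simp add: norm_mult)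
  have "cmod ?I \<le> (LINT y|lborel. cmod (exp (of_real t * Complex (- d) y) * G (Complex (- d) y)))"
    by (rule integral_norm_bound)
  also have "\<dots> = exp (- d * t) * ?\<Psi>"
    by (simp only: norm_mult integral_mult_right_zero norm_exp_eq_Re) simp
  finally have "2 * pi * cmod (of_real (f t) - residue G 0) \<le> exp (- d * t) * ?\<Psi>" by (simp only: eq)
  moreover have "\<bar>f t - Re (residue G 0)\<bar> \<le> cmod (of_real (f t) - residue G 0)"
    using abs_Re_le_cmod[of "of_real (f t) - residue G 0"] by simp
  moreover have "cmod (of_real (f t) - residue G 0) \<le> 2 * pi * cmod (of_real (f t) - residue G 0)"
    using pi_gt3 by (simp add: mult_le_cancel_right1)
  ultimately show ?thesis by linarith
qed

section \<open>Markov chains and their futures\<close>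

lemma measure_eqI_rectangles:
  assumes M1: "sets M1 = sets (A \<Otimes>\<^sub>M B)" and M2: "sets M2 = sets (A \<Otimes>\<^sub>M B)"
    and fin: "finite_measure M1"
    and eq: "\<And>a b. a \<in> sets A \<Longrightarrow> b \<in> sets B \<Longrightarrow> emeasure M1 (a \<times> b) = emeasure M2 (a \<times> b)"
  shows "M1 = M2"
proof (rule measure_eqI_generator_eq)
  let ?G = "{a \<times> b | a b. a \<in> sets A \<and> b \<in> sets B}"
  show "Int_stable ?G" by (rule Int_stable_pair_measure_generator)
  show "?G \<subseteq> Pow (space A \<times> space B)" by (rule pair_measure_closed)
  show "sets M1 = sigma_sets (space A \<times> space B) ?G" "sets M2 = sigma_sets (space A \<times> space B) ?G"
    using M1 M2 by (simp_all add: sets_pair_measure)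
  show "range (\<lambda>i::nat. space A \<times> space B) \<subseteq> ?G" by auto
  show "emeasure M1 (space A \<times> space B) \<noteq> \<infinity>" for i :: nat
    using fin by (simp add: finite_measure.emeasure_finite)
qed (use eq in auto)

text \<open>For fixed A both sides are finite measures in B: the law of Z under M weighted by the
  event that Y lies in A, and the mixture of the kernel over the law of Y under the same weight.
  They are compared on an intersection-stable generator, so applications only have to treat
  cylinders or rectangles.\<close>

lemma kernel_rectangle_extend:
  assumes M: "prob_space M"
    and Y[measurable]: "Y \<in> measurable M N1" and Z[measurable]: "Z \<in> measurable M N2"
    and K: "K \<in> measurable N1 (subprob_algebra N2)"
    and G: "Int_stable G" "sets N2 = sigma_sets (space N2) G" "space N2 \<in> G"
    and A[measurable]: "A \<in> sets N1"
    and eq: "\<And>B. B \<in> G \<Longrightarrow>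
      (\<integral>\<^sup>+\<omega>. indicator A (Y \<omega>) * indicator B (Z \<omega>) \<partial>M) = (\<integral>\<^sup>+\<omega>. indicator A (Y \<omega>) * emeasure (K (Y \<omega>)) B \<partial>M)"
    and B: "B \<in> sets N2"
  shows "(\<integral>\<^sup>+\<omega>. indicator A (Y \<omega>) * indicator B (Z \<omega>) \<partial>M) = (\<integral>\<^sup>+\<omega>. indicator A (Y \<omega>) * emeasure (K (Y \<omega>)) B \<partial>M)"
proof -
  interpret prob_space M by fact
  define D where "D = density M (\<lambda>\<omega>. indicator A (Y \<omega>))"
  have sD[measurable_cong]: "sets D = sets M" "space D = space M" by (simp_all add: D_def)
  note [measurable] = measurable_emeasure_subprob_algebra
  have ne: "space (distr D N1 Y) \<noteq> {}" using measurable_space[OF Y] not_empty by auto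
  have m1: "emeasure (distr D N2 Z) B = (\<integral>\<^sup>+\<omega>. indicator A (Y \<omega>) * indicator B (Z \<omega>) \<partial>M)" if [measurable]: "B \<in> sets N2" for B
  proof -
    have "emeasure (distr D N2 Z) B = (\<integral>\<^sup>+z. indicator B z \<partial>distr D N2 Z)" by simp
    also have "\<dots> = (\<integral>\<^sup>+\<omega>. indicator B (Z \<omega>) \<partial>D)" by (rule nn_integral_distr) measurable
    also have "\<dots> = (\<integral>\<^sup>+\<omega>. indicator A (Y \<omega>) * indicator B (Z \<omega>) \<partial>M)"
      unfolding D_def by (rule nn_integral_density) measurable
    finally show ?thesis .
  qed
  have m2: "emeasure (distr D N1 Y \<bind> K) B = (\<integral>\<^sup>+\<omega>. indicator A (Y \<omega>) * emeasure (K (Y \<omega>)) B \<partial>M)" if [measurable]: "B \<in> sets N2" for B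
  proof -
    have [measurable]: "(\<lambda>y. emeasure (K y) B) \<in> borel_measurable N1"
      by (rule measurable_compose[OF K]) measurable
    have "emeasure (distr D N1 Y \<bind> K) B = (\<integral>\<^sup>+y. emeasure (K y) B \<partial>distr D N1 Y)"
      using K by (intro emeasure_bind[OF ne _ that]) simp
    also have "\<dots> = (\<integral>\<^sup>+\<omega>. emeasure (K (Y \<omega>)) B \<partial>D)" by (rule nn_integral_distr) measurable
    also have "\<dots> = (\<integral>\<^sup>+\<omega>. indicator A (Y \<omega>) * emeasure (K (Y \<omega>)) B \<partial>M)"
      unfolding D_def by (rule nn_integral_density) measurable
    finally show ?thesis .
  qed
  have Gs: "b \<in> sets N2" if "b \<in> G" for b using that G(2) by auto
  have "distr D N2 Z = distr D N1 Y \<bind> K"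
  proof (rule measure_eqI_generator_eq[OF G(1)])
    show "G \<subseteq> Pow (space N2)" using Gs sets.sets_into_space by blast
    show "sets (distr D N1 Y \<bind> K) = sigma_sets (space N2) G"
      unfolding G(2)[symmetric] by (rule sets_bind) (use ne subprob_measurableD(2)[OF K] in auto)
    show "range (\<lambda>i::nat. space N2) \<subseteq> G" using G(3) by auto
    have "emeasure (distr D N2 Z) (space N2) \<le> (\<integral>\<^sup>+\<omega>. 1 \<partial>M)"
      unfolding m1[OF sets.top] by (intro nn_integral_mono) (auto split: split_indicator)
    then show "emeasure (distr D N2 Z) (space N2) \<noteq> \<infinity>" for i :: nat
      by (auto simp: emeasure_space_1 top_unique)
  qed (use G(2) eq Gs in \<open>auto simp: m1 m2\<close>)
  then show ?thesis using m1[OF B] m2[OF B] by simp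
qed

text \<open>The rectangle identities say that the law of (Y, Z) is the law of Y followed by the
  kernel sending y to the image of K y under the map that pairs with y. Integrating h against both
  descriptions gives the claim.\<close>

lemma nn_integral_disintegration:
  assumes M: "prob_space M"
    and Y[measurable]: "Y \<in> measurable M N1" and Z[measurable]: "Z \<in> measurable M N2"
    and K: "K \<in> measurable N1 (prob_algebra N2)"
    and eq: "\<And>A B. A \<in> sets N1 \<Longrightarrow> B \<in> sets N2 \<Longrightarrow>
      (\<integral>\<^sup>+\<omega>. indicator A (Y \<omega>) * indicator B (Z \<omega>) \<partial>M) = (\<integral>\<^sup>+\<omega>. indicator A (Y \<omega>) * emeasure (K (Y \<omega>)) B \<partial>M)"
    and h[measurable]: "h \<in> borel_measurable (N1 \<Otimes>\<^sub>M N2)"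
  shows "(\<integral>\<^sup>+\<omega>. h (Y \<omega>, Z \<omega>) \<partial>M) = (\<integral>\<^sup>+\<omega>. \<integral>\<^sup>+z. h (Y \<omega>, z) \<partial>K (Y \<omega>) \<partial>M)"
proof -
  interpret prob_space M by fact
  have K'[measurable]: "K \<in> measurable N1 (subprob_algebra N2)" using K by (rule measurable_prob_algebraD)
  have sK: "sets (K y) = sets N2" "space (K y) = space N2" if "y \<in> space N1" for y
    using subprob_measurableD[OF K' that] by auto
  let ?k = "\<lambda>y. distr (K y) (N1 \<Otimes>\<^sub>M N2) (Pair y)"
  have k[measurable]: "?k \<in> measurable N1 (subprob_algebra (N1 \<Otimes>\<^sub>M N2))"
    by (rule measurable_distr2[OF _ K']) simp
  have Pm: "Pair y \<in> measurable (K y) (N1 \<Otimes>\<^sub>M N2)" if "y \<in> space N1" for y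
    using that sK[OF that] by (simp add: measurable_cong_sets[OF sK(1)[OF that] refl])
  have ne: "space (distr M N1 Y) \<noteq> {}" using measurable_space[OF Y] not_empty by auto
  have ki: "(\<integral>\<^sup>+z. h z \<partial>(distr M N1 Y \<bind> ?k)) = (\<integral>\<^sup>+\<omega>. \<integral>\<^sup>+z. h (Y \<omega>, z) \<partial>K (Y \<omega>) \<partial>M)"
    if [measurable]: "h \<in> borel_measurable (N1 \<Otimes>\<^sub>M N2)" for h
  proof -
    have "(\<integral>\<^sup>+z. h z \<partial>(distr M N1 Y \<bind> ?k)) = (\<integral>\<^sup>+y. \<integral>\<^sup>+z. h z \<partial>?k y \<partial>distr M N1 Y)"
      by (rule nn_integral_bind[OF that]) (simp add: k)
    also have "\<dots> = (\<integral>\<^sup>+\<omega>. \<integral>\<^sup>+z. h z \<partial>?k (Y \<omega>) \<partial>M)" by (rule nn_integral_distr) measurable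
    also have "\<dots> = (\<integral>\<^sup>+\<omega>. \<integral>\<^sup>+z. h (Y \<omega>, z) \<partial>K (Y \<omega>) \<partial>M)"
      by (intro nn_integral_cong nn_integral_distr Pm measurable_space[OF Y]) auto
    finally show ?thesis .
  qed
  have law: "distr M (N1 \<Otimes>\<^sub>M N2) (\<lambda>\<omega>. (Y \<omega>, Z \<omega>)) = distr M N1 Y \<bind> ?k"
  proof (rule measure_eqI_rectangles)
    show "sets (distr M N1 Y \<bind> ?k) = sets (N1 \<Otimes>\<^sub>M N2)"
      using ne by (intro sets_bind) auto
    show "finite_measure (distr M (N1 \<Otimes>\<^sub>M N2) (\<lambda>\<omega>. (Y \<omega>, Z \<omega>)))"
      by (intro finite_measure_distr) measurable
    fix a b assume [measurable]: "a \<in> sets N1" "b \<in> sets N2"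
    have "emeasure (distr M (N1 \<Otimes>\<^sub>M N2) (\<lambda>\<omega>. (Y \<omega>, Z \<omega>))) (a \<times> b) = (\<integral>\<^sup>+z. indicator (a \<times> b) z \<partial>distr M (N1 \<Otimes>\<^sub>M N2) (\<lambda>\<omega>. (Y \<omega>, Z \<omega>)))"
      by simp
    also have "\<dots> = (\<integral>\<^sup>+\<omega>. indicator a (Y \<omega>) * indicator b (Z \<omega>) \<partial>M)"
      by (subst nn_integral_distr) (auto simp: indicator_times)
    also have "\<dots> = (\<integral>\<^sup>+\<omega>. indicator a (Y \<omega>) * emeasure (K (Y \<omega>)) b \<partial>M)" by (rule eq) auto
    also have "\<dots> = (\<integral>\<^sup>+\<omega>. \<integral>\<^sup>+z. indicator (a \<times> b) (Y \<omega>, z) \<partial>K (Y \<omega>) \<partial>M)"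
      using measurable_space[OF Y] by (intro nn_integral_cong) (simp add: indicator_times nn_integral_cmult sK)
    also have "\<dots> = (\<integral>\<^sup>+z. indicator (a \<times> b) z \<partial>(distr M N1 Y \<bind> ?k))" by (rule ki[symmetric]) simp
    also have "\<dots> = emeasure (distr M N1 Y \<bind> ?k) (a \<times> b)"
      using ne by (intro nn_integral_indicator) (simp add: sets_bind[where N="N1 \<Otimes>\<^sub>M N2"])
    finally show "emeasure (distr M (N1 \<Otimes>\<^sub>M N2) (\<lambda>\<omega>. (Y \<omega>, Z \<omega>))) (a \<times> b) = emeasure (distr M N1 Y \<bind> ?k) (a \<times> b)" .
  qed simp
  have "(\<integral>\<^sup>+\<omega>. h (Y \<omega>, Z \<omega>) \<partial>M) = (\<integral>\<^sup>+z. h z \<partial>distr M (N1 \<Otimes>\<^sub>M N2) (\<lambda>\<omega>. (Y \<omega>, Z \<omega>)))"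
    by (rule nn_integral_distr[symmetric]) measurable
  then show ?thesis using ki[OF h] by (simp only: law)
qed

text \<open>A cylinder constrains finitely many coordinates, so its indicator is a product over an
  initial segment with factor 1 at the free coordinates. In this shape a path can be integrated out
  one coordinate at a time, starting from the last.\<close>

lemma prod_algebra_indicator_prod:
  fixes E :: "'x measure"
  assumes "A \<in> prod_algebra UNIV (\<lambda>_::nat. E)"
  shows "\<exists>n \<phi>. (\<forall>i. \<phi> i \<in> borel_measurable E) \<and>
    (\<forall>p. (\<forall>i. p i \<in> space E) \<longrightarrow> indicator A p = (\<Prod>i\<le>n. \<phi> i (p i) :: ennreal))"
proof -
  from assms obtain J B where A: "A = prod_emb UNIV (\<lambda>_. E) J (\<Pi>\<^sub>E j\<in>J. B j)" "finite J" "\<And>j. j \<in> J \<Longrightarrow> B j \<in> sets E"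
    by (auto elim!: prod_algebraE)
  \<comment> \<open>0 is inserted so that the maximum exists when no coordinate is
    constrained.\<close>
  define n where "n = Max (insert 0 J)"
  define \<phi> where "\<phi> i = (if i \<in> J then indicator (B i) else (\<lambda>_. 1::ennreal))" for i
  have le: "j \<le> n" if "j \<in> J" for j unfolding n_def using that A(2) by (intro Max_ge) auto
  have "indicator A p = (\<Prod>i\<le>n. \<phi> i (p i))" if p: "\<forall>i. p i \<in> space E" for p
  proof -
    have "(\<Prod>i\<le>n. \<phi> i (p i)) = (\<Prod>i\<in>J. \<phi> i (p i))"
      by (rule prod.mono_neutral_right) (auto simp: \<phi>_def dest: le)
    also have "\<dots> = indicator A p"
    proof (cases "p \<in> A")
      case True
      then show ?thesis by (auto simp: A(1) prod_emb_def \<phi>_def PiE_iff intro!: prod.neutral)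
    next
      case False
      then obtain j where "j \<in> J" "p j \<notin> B j" using p by (auto simp: A(1) prod_emb_def PiE_iff)
      then have "(\<Prod>i\<in>J. \<phi> i (p i)) = 0" using A(2) by (intro prod_zero) (auto simp: \<phi>_def intro!: bexI[of _ j])
      then show ?thesis using False by simp
    qed
    finally show ?thesis by simp
  qed
  moreover have "\<phi> i \<in> borel_measurable E" for i using A(3) by (auto simp: \<phi>_def)
  ultimately show ?thesis by blast
qed

section \<open>The law of the chain as a kernel in its starting point\<close>

context
  fixes E :: "'x measure" and P :: "'x \<Rightarrow> 'x measure"
  assumes P: "P \<in> measurable E (prob_algebra E)"
begin

lemma kernel_subprob[measurable]: "P \<in> measurable E (subprob_algebra E)"
  using P by (rule measurable_prob_algebraD)

lemma nn_integral_kernel_measurable[measurable]: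
  "\<phi> \<in> borel_measurable E \<Longrightarrow> (\<lambda>x. \<integral>\<^sup>+y. \<phi> y \<partial>P x) \<in> borel_measurable E"
  by (rule measurable_compose[OF kernel_subprob nn_integral_measurable_subprob_algebra])

text \<open>Reduces the Ionescu-Tulcea limit to a composition of n step kernels. The start
  \<open>\<lambda>_. undefined\<close> is the only path over the empty index set.\<close>

lemma chain_law_finite_horizon:
  assumes x: "x \<in> space E" and f[measurable]: "f \<in> borel_measurable (\<Pi>\<^sub>M j\<in>{0..<n}. E)"
  shows "(\<integral>\<^sup>+p. f (restrict p {0..<n}) \<partial>chain_law E P x)
    = (\<integral>\<^sup>+p. f p \<partial>Ionescu_Tulcea.C (chain_step E P x) (\<lambda>_. E) 0 n (\<lambda>_. undefined))"
proof -
  interpret IT: Ionescu_Tulcea "chain_step E P x" "\<lambda>_. E"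
    using P x by (rule Ionescu_Tulcea_chain_step)
  have u: "(\<lambda>_. undefined) \<in> space (\<Pi>\<^sub>M j\<in>{0..<0::nat}. E)" by (simp add: space_PiM)
  note sC = IT.sets_C[OF u, of n, simplified]
  have up: "IT.up_to {0..<n} = n"
    unfolding IT.up_to_def by (rule Least_equality) (auto simp: not_le[symmetric])
  have "(\<integral>\<^sup>+p. f (restrict p {0..<n}) \<partial>chain_law E P x) = (\<integral>\<^sup>+p. f p \<partial>distr IT.PF.lim (\<Pi>\<^sub>M j\<in>{0..<n}. E) (\<lambda>p. restrict p {0..<n}))"
    unfolding chain_law_def
    by (subst nn_integral_distr) (auto intro!: measurable_restrict_subset simp: measurable_cong_sets[OF IT.PF.sets_lim refl])
  also have "\<dots> = (\<integral>\<^sup>+p. f p \<partial>IT.CI {0..<n})" by (simp add: IT.distr_lim)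
  also have "\<dots> = (\<integral>\<^sup>+p. f (restrict p {0..<n}) \<partial>IT.C 0 n (\<lambda>_. undefined))"
    unfolding IT.CI_def up
    by (subst nn_integral_distr) (auto intro!: measurable_restrict_subset simp: measurable_cong_sets[OF sC refl])
  also have "\<dots> = (\<integral>\<^sup>+p. f p \<partial>IT.C 0 n (\<lambda>_. undefined))"
    using sets_eq_imp_space_eq[OF sC] by (intro nn_integral_cong) (auto simp: space_PiM PiE_restrict)
  finally show ?thesis .
qed

lemma chain_law_start:
  assumes x: "x \<in> space E" and \<phi>[measurable]: "\<phi> \<in> borel_measurable E"
  shows "(\<integral>\<^sup>+p. \<phi> (p 0) \<partial>chain_law E P x) = \<phi> x"
proof -
  interpret IT: Ionescu_Tulcea "chain_step E P x" "\<lambda>_. E"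
    using P x by (rule Ionescu_Tulcea_chain_step)
  have u: "(\<lambda>_. undefined) \<in> space (\<Pi>\<^sub>M j\<in>{0..<0::nat}. E)" by (simp add: space_PiM)
  have [measurable]: "(\<lambda>p. \<phi> (p 0)) \<in> borel_measurable (\<Pi>\<^sub>M j\<in>{0..<Suc 0}. E)"
    by measurable
  have "(\<integral>\<^sup>+p. \<phi> (p 0) \<partial>chain_law E P x) = (\<integral>\<^sup>+p. \<phi> (p 0) \<partial>IT.C 0 (Suc 0) (\<lambda>_. undefined))"
    using chain_law_finite_horizon[OF x, of "\<lambda>p. \<phi> (p 0)" "Suc 0"] by simp
  also have "IT.C 0 (Suc 0) (\<lambda>_. undefined) = IT.eP 0 (\<lambda>_. undefined)"
    using u IT.measurable_eP[of 0] by (simp add: bind_return)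
  also have "(\<integral>\<^sup>+p. \<phi> (p 0) \<partial>\<dots>) = (\<integral>\<^sup>+y. \<phi> y \<partial>return E x)"
    using u by (subst IT.nn_integral_eP) (auto simp: chain_step_def)
  also have "\<dots> = \<phi> x" using x by (simp add: nn_integral_return)
  finally show ?thesis .
qed

lemma chain_law_step:
  assumes x: "x \<in> space E" and g[measurable]: "g \<in> borel_measurable (\<Pi>\<^sub>M j\<in>{..n}. E)"
    and \<phi>[measurable]: "\<phi> \<in> borel_measurable E"
  shows "(\<integral>\<^sup>+p. g (restrict p {..n}) * \<phi> (p (Suc n)) \<partial>chain_law E P x)
    = (\<integral>\<^sup>+p. g (restrict p {..n}) * (\<integral>\<^sup>+y. \<phi> y \<partial>P (p n)) \<partial>chain_law E P x)"
proof -
  interpret IT: Ionescu_Tulcea "chain_step E P x" "\<lambda>_. E"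
    using P x by (rule Ionescu_Tulcea_chain_step)
  have u: "(\<lambda>_. undefined) \<in> space (\<Pi>\<^sub>M j\<in>{0..<0::nat}. E)" by (simp add: space_PiM)
  have I: "{..n} = {0..<Suc n}" by auto
  let ?C = "IT.C 0 (Suc n) (\<lambda>_. undefined)"
  have sC: "sets ?C = sets (\<Pi>\<^sub>M j\<in>{0..<Suc n}. E)" using IT.sets_C[OF u, of "Suc n"] by simp
  have spC: "space ?C = space (\<Pi>\<^sub>M j\<in>{0..<Suc n}. E)" using sets_eq_imp_space_eq[OF sC] .
  have rm[measurable]: "(\<lambda>p. restrict p {..n}) \<in> measurable (\<Pi>\<^sub>M j\<in>{0..<Suc (Suc n)}. E) (\<Pi>\<^sub>M j\<in>{..n}. E)"
    by (rule measurable_restrict_subset) auto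
  have f1[measurable]: "(\<lambda>p. g (restrict p {..n}) * \<phi> (p (Suc n))) \<in> borel_measurable (\<Pi>\<^sub>M j\<in>{0..<Suc (Suc n)}. E)"
    by measurable
  have f2[measurable]: "(\<lambda>p. g (restrict p {..n}) * (\<integral>\<^sup>+y. \<phi> y \<partial>P (p n))) \<in> borel_measurable (\<Pi>\<^sub>M j\<in>{0..<Suc n}. E)"
    unfolding I[symmetric] by (measurable; simp)
  have eP: "IT.eP (Suc n) \<in> measurable ?C (subprob_algebra (\<Pi>\<^sub>M j\<in>{0..<Suc (Suc n)}. E))"
    unfolding measurable_cong_sets[OF sC refl] by (rule IT.measurable_eP)
  have rr: "{0..<Suc n} \<inter> {..n} = {..n}" "{0..<Suc (Suc n)} \<inter> {..n} = {..n}" by auto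
  have "(\<integral>\<^sup>+p. g (restrict p {..n}) * \<phi> (p (Suc n)) \<partial>chain_law E P x) = (\<integral>\<^sup>+p. g (restrict p {..n}) * \<phi> (p (Suc n)) \<partial>IT.C 0 (Suc (Suc n)) (\<lambda>_. undefined))"
    using chain_law_finite_horizon[OF x f1] by (simp add: rr del: IT.C.simps)
  also have "IT.C 0 (Suc (Suc n)) (\<lambda>_. undefined) = ?C \<bind> IT.eP (Suc n)" by simp
  also have "(\<integral>\<^sup>+p. g (restrict p {..n}) * \<phi> (p (Suc n)) \<partial>(?C \<bind> IT.eP (Suc n)))
      = (\<integral>\<^sup>+p. \<integral>\<^sup>+q. g (restrict q {..n}) * \<phi> (q (Suc n)) \<partial>IT.eP (Suc n) p \<partial>?C)"
    by (rule nn_integral_bind[OF f1 eP])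
  also have "\<dots> = (\<integral>\<^sup>+p. g (restrict p {..n}) * (\<integral>\<^sup>+y. \<phi> y \<partial>P (p n)) \<partial>?C)"
  proof (rule nn_integral_cong)
    fix p assume "p \<in> space ?C"
    then have p: "p \<in> space (\<Pi>\<^sub>M j\<in>{0..<Suc n}. E)" by (simp only: spC)
    then have pn: "p n \<in> space E" by (auto simp: space_PiM PiE_iff)
    have "restrict (p(Suc n := y)) {..n} = restrict p {..n}" for y by (auto simp: restrict_def fun_eq_iff)
    then have "(\<integral>\<^sup>+q. g (restrict q {..n}) * \<phi> (q (Suc n)) \<partial>IT.eP (Suc n) p) = (\<integral>\<^sup>+y. g (restrict p {..n}) * \<phi> y \<partial>P (p n))"
      using p by (subst IT.nn_integral_eP[OF p f1]) (simp add: chain_step_def)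
    also have "\<dots> = g (restrict p {..n}) * (\<integral>\<^sup>+y. \<phi> y \<partial>P (p n))"
      using subprob_measurableD(2)[OF kernel_subprob pn] \<phi>
      by (intro nn_integral_cmult) (simp add: measurable_cong_sets[where M="P (p n)" and M'=E])
    finally show "(\<integral>\<^sup>+q. g (restrict q {..n}) * \<phi> (q (Suc n)) \<partial>IT.eP (Suc n) p) = g (restrict p {..n}) * (\<integral>\<^sup>+y. \<phi> y \<partial>P (p n))" .
  qed
  also have "\<dots> = (\<integral>\<^sup>+p. g (restrict p {..n}) * (\<integral>\<^sup>+y. \<phi> y \<partial>P (p n)) \<partial>chain_law E P x)"
    using chain_law_finite_horizon[OF x f2] by (simp add: rr del: IT.C.simps)
  finally show ?thesis .
qed

text \<open>The Markov step integrates the last coordinate out and stores its conditional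
  expectation in the factor of coordinate n. Expressing the result as an updated family of factors
  preserves the shape, so inductions over arbitrary factors close.\<close>

lemma chain_law_prod_Suc:
  assumes x: "x \<in> space E" and \<phi>[measurable]: "\<And>i. \<phi> i \<in> borel_measurable E"
  shows "(\<integral>\<^sup>+p. (\<Prod>i\<le>Suc n. \<phi> i (p i)) \<partial>chain_law E P x)
    = (\<integral>\<^sup>+p. (\<Prod>i\<le>n. (\<phi>(n := \<lambda>y. \<phi> n y * (\<integral>\<^sup>+z. \<phi> (Suc n) z \<partial>P y))) i (p i)) \<partial>chain_law E P x)"
proof -
  let ?g = "\<lambda>p. \<Prod>i\<le>n. \<phi> i (p i)"
  have "(\<integral>\<^sup>+p. (\<Prod>i\<le>Suc n. \<phi> i (p i)) \<partial>chain_law E P x) = (\<integral>\<^sup>+p. ?g (restrict p {..n}) * \<phi> (Suc n) (p (Suc n)) \<partial>chain_law E P x)"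
    by (intro nn_integral_cong) (simp add: atMost_Suc mult.commute)
  also have "\<dots> = (\<integral>\<^sup>+p. ?g (restrict p {..n}) * (\<integral>\<^sup>+y. \<phi> (Suc n) y \<partial>P (p n)) \<partial>chain_law E P x)"
    by (rule chain_law_step[OF x]) measurable
  also have "\<dots> = (\<integral>\<^sup>+p. (\<Prod>i\<le>n. (\<phi>(n := \<lambda>y. \<phi> n y * (\<integral>\<^sup>+z. \<phi> (Suc n) z \<partial>P y))) i (p i)) \<partial>chain_law E P x)"
    by (intro nn_integral_cong) (simp add: lessThan_Suc_atMost[symmetric] ac_simps)
  finally show ?thesis .
qed

lemma chain_law_prod_measurable:
  assumes "\<And>i. \<phi> i \<in> borel_measurable E"
  shows "(\<lambda>x. \<integral>\<^sup>+p. (\<Prod>i\<le>n. \<phi> i (p i)) \<partial>chain_law E P x) \<in> borel_measurable E"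
  using assms
proof (induction n arbitrary: \<phi>)
  case 0
  then show ?case by (subst measurable_cong[of _ _ "\<phi> 0"]) (auto simp: chain_law_start)
next
  case (Suc n)
  note [measurable] = Suc.prems
  show ?case
    by (subst measurable_cong[OF chain_law_prod_Suc]) (auto intro!: Suc.IH Suc.prems)
qed

text \<open>Measurability in the starting point has to be checked on cylinders only, where
  \<open>chain_law_prod_measurable\<close> peels off coordinates until a measurable function of the
  start remains.\<close>

lemma chain_law_measurable: "chain_law E P \<in> measurable E (prob_algebra (path_space E))"
proof (rule measurable_prob_algebra_generated)
  show "sets (path_space E) = sigma_sets (\<Pi>\<^sub>E i\<in>UNIV. space E) (prod_algebra UNIV (\<lambda>_. E))"
    unfolding path_space_def by (rule sets_PiM)
  show "Int_stable (prod_algebra UNIV (\<lambda>_. E))" by (rule Int_stable_prod_algebra)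
  show "prod_algebra UNIV (\<lambda>_. E) \<subseteq> Pow (\<Pi>\<^sub>E i\<in>UNIV. space E)" by (rule prod_algebra_sets_into_space)
  fix A assume "A \<in> prod_algebra UNIV (\<lambda>_::nat. E)"
  from prod_algebra_indicator_prod[OF this] obtain n \<phi> where \<phi>: "\<And>i. \<phi> i \<in> borel_measurable E"
    and ind: "\<And>p. (\<And>i. p i \<in> space E) \<Longrightarrow> indicator A p = (\<Prod>i\<le>n. \<phi> i (p i) :: ennreal)" by metis
  have "emeasure (chain_law E P x) A = (\<integral>\<^sup>+p. (\<Prod>i\<le>n. \<phi> i (p i)) \<partial>chain_law E P x)" if x: "x \<in> space E" for x
  proof -
    have sets: "sets (chain_law E P x) = sets (path_space E)" using sets_chain_law[OF P x] .
    have "A \<in> sets (path_space E)"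
      using \<open>A \<in> prod_algebra UNIV _\<close> unfolding path_space_def sets_PiM by auto
    then have "emeasure (chain_law E P x) A = (\<integral>\<^sup>+p. indicator A p \<partial>chain_law E P x)" by (simp add: sets)
    also have "\<dots> = (\<integral>\<^sup>+p. (\<Prod>i\<le>n. \<phi> i (p i)) \<partial>chain_law E P x)"
      using sets_eq_imp_space_eq[OF sets] by (intro nn_integral_cong ind) (auto simp: path_space_def space_PiM)
    finally show ?thesis .
  qed
  then show "(\<lambda>x. emeasure (chain_law E P x) A) \<in> borel_measurable E"
    by (subst measurable_cong) (auto intro: chain_law_prod_measurable \<phi>)
qed (simp_all add: prob_space_chain_law[OF P] sets_chain_law[OF P])

end

text \<open>The starting cell is dropped: two lines that separate after generation k share
  \<open>X \<omega> k\<close>, and what evolves independently given its value begins at generation k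
  + 1.\<close>

definition future_law :: "'x measure \<Rightarrow> ('x \<Rightarrow> 'x measure) \<Rightarrow> 'x \<Rightarrow> (nat \<Rightarrow> 'x) measure" where
  "future_law E P x = distr (chain_law E P x) (path_space E) (\<lambda>p n. p (Suc n))"

lemma measurable_path_component:
  assumes "f \<in> measurable M (path_space E)"
  shows "(\<lambda>\<omega>. f \<omega> n) \<in> measurable M E"
  using measurable_compose[OF assms, of "\<lambda>p. p n" E] unfolding path_space_def by simp

lemma measurable_pathI:
  assumes "\<And>n. (\<lambda>\<omega>. f \<omega> n) \<in> measurable M E"
  shows "f \<in> measurable M (path_space E)"
proof -
  have "(\<lambda>\<omega>. \<lambda>i\<in>UNIV. f \<omega> i) \<in> measurable M (path_space E)"
    unfolding path_space_def by (rule measurable_restrict) (rule assms)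
  then show ?thesis by (simp add: restrict_UNIV)
qed

lemma measurable_path_restrict:
  assumes "f \<in> measurable M (path_space E)"
  shows "(\<lambda>\<omega>. restrict (f \<omega>) J) \<in> measurable M (\<Pi>\<^sub>M j\<in>J. E)"
  by (rule measurable_restrict) (rule measurable_path_component[OF assms])

lemma measurable_path_shift:
  assumes "f \<in> measurable M (path_space E)"
  shows "(\<lambda>\<omega> n. f \<omega> (c n)) \<in> measurable M (path_space E)"
  by (rule measurable_pathI) (rule measurable_path_component[OF assms])

lemma future_law_measurable:
  assumes "P \<in> measurable E (prob_algebra E)"
  shows "future_law E P \<in> measurable E (prob_algebra (path_space E))"
  unfolding future_law_def
  by (rule measurable_distr_prob_space2[OF chain_law_measurable[OF assms]])
     (simp add: measurable_path_shift split_beta')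

section \<open>The Markov property of X with its whole past and whole future\<close>

context markov_independence
begin

lemma kernel: "P \<in> measurable E (prob_algebra E)"
  using markov by (simp add: stationary_markov_def)

lemma measurable_X[measurable]: "(\<lambda>\<omega>. X \<omega> n) \<in> measurable M E"
  using X_measurable by (rule measurable_path_component)

lemma measurable_Xk[measurable]: "(\<lambda>\<omega>. Xk k \<omega> n) \<in> measurable M E"
  using Xk_measurable by (rule measurable_path_component)

lemma X_space: "\<omega> \<in> space M \<Longrightarrow> X \<omega> n \<in> space E"
  using measurable_space[OF measurable_X] .

lemma subalgebra_sigma_gen:
  assumes [measurable]: "Y \<in> measurable M N"
  shows "finite_measure_subalgebra M (sigma_gen M N Y)"
proof
  show "subalgebra M (sigma_gen M N Y)"
    using assms unfolding subalgebra_def sigma_gen_def measurable_iff_sets by simp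
qed

text \<open>Tested against events of the past, the conditional probabilities of the hypothesis give
  the identity for rectangles, and disintegration along the kernel that sends a past y to
  \<open>P (y n)\<close> extends it to nonnegative functions.\<close>

lemma markov_step:
  assumes g[measurable]: "g \<in> borel_measurable (\<Pi>\<^sub>M j\<in>{..n}. E)" and \<phi>[measurable]: "\<phi> \<in> borel_measurable E"
  shows "(\<integral>\<^sup>+\<omega>. g (restrict (X \<omega>) {..n}) * \<phi> (X \<omega> (Suc n)) \<partial>M)
       = (\<integral>\<^sup>+\<omega>. g (restrict (X \<omega>) {..n}) * (\<integral>\<^sup>+y. \<phi> y \<partial>P (X \<omega> n)) \<partial>M)"
proof -
  let ?N = "\<Pi>\<^sub>M j\<in>{..n}. E" and ?Y = "\<lambda>\<omega>. restrict (X \<omega>) {..n}"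
  have Y[measurable]: "?Y \<in> measurable M ?N" using X_measurable by (rule measurable_path_restrict)
  let ?F = "sigma_gen M ?N ?Y"
  interpret F: finite_measure_subalgebra M ?F by (rule subalgebra_sigma_gen) measurable
  have pn: "(\<lambda>y. y n) \<in> measurable ?N E" by measurable
  have K: "(\<lambda>y. P (y n)) \<in> measurable ?N (prob_algebra E)"
    using measurable_compose[OF pn kernel] by simp
  have "(\<integral>\<^sup>+\<omega>. (\<lambda>(y, z). g y * \<phi> z) (?Y \<omega>, X \<omega> (Suc n)) \<partial>M) = (\<integral>\<^sup>+\<omega>. \<integral>\<^sup>+z. (\<lambda>(y, z). g y * \<phi> z) (?Y \<omega>, z) \<partial>P (?Y \<omega> n) \<partial>M)"
  proof (rule nn_integral_disintegration[OF prob_space_axioms Y measurable_X K])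
    fix A B assume [measurable]: "A \<in> sets ?N" "B \<in> sets E"
    have AF: "?Y -` A \<inter> space M \<in> sets ?F" unfolding sigma_gen_def by (rule in_vimage_algebra) measurable
    have Am: "?Y -` A \<inter> space M \<in> sets M" by measurable
    have mPm: "(\<lambda>\<omega>. measure (P (X \<omega> n)) B) \<in> borel_measurable M"
      by (rule measurable_compose[OF measurable_X measurable_compose[OF kernel_subprob[OF kernel] measurable_measure_subprob_algebra]]) fact
    have mP: "measure (P (X \<omega> n)) B \<le> 1" "measure (P (X \<omega> n)) B = emeasure (P (X \<omega> n)) B" if "\<omega> \<in> space M" for \<omega>
    proof -
      interpret P: prob_space "P (X \<omega> n)"
        using measurable_space[OF kernel X_space[OF that]] by (simp add: space_prob_algebra)
      show "measure (P (X \<omega> n)) B \<le> 1" "measure (P (X \<omega> n)) B = emeasure (P (X \<omega> n)) B"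
        by (auto simp: P.emeasure_eq_measure)
    qed
    let ?B = "indicator {\<omega> \<in> space M. X \<omega> (Suc n) \<in> B} :: 'w \<Rightarrow> real"
    have iB: "integrable M ?B" by (rule integrable_const_bound[where B=1]) (auto simp: indicator_def)
    have iP: "integrable M (\<lambda>\<omega>. indicator (?Y -` A \<inter> space M) \<omega> * measure (P (X \<omega> n)) B)"
    proof (rule integrable_const_bound[where B=1])
      show "AE \<omega> in M. norm (indicator (?Y -` A \<inter> space M) \<omega> * measure (P (X \<omega> n)) B) \<le> 1"
        by (rule AE_I2) (simp add: mP(1) indicator_def)
      show "(\<lambda>\<omega>. indicator (?Y -` A \<inter> space M) \<omega> * measure (P (X \<omega> n)) B) \<in> borel_measurable M"
        by (intro borel_measurable_times borel_measurable_indicator Am mPm)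
    qed
    let ?A = "indicator (?Y -` A \<inter> space M) :: 'w \<Rightarrow> real"
    have i1: "(\<integral>\<omega>. ?A \<omega> * ?B \<omega> \<partial>M) = (\<integral>\<omega>. ?A \<omega> * real_cond_exp M ?F ?B \<omega> \<partial>M)"
      using F.real_cond_exp_intA[OF iB AF] by (simp add: set_lebesgue_integral_def)
    have i2: "(\<integral>\<omega>. ?A \<omega> * real_cond_exp M ?F ?B \<omega> \<partial>M) = (\<integral>\<omega>. ?A \<omega> * measure (P (X \<omega> n)) B \<partial>M)"
    proof (rule integral_cong_AE)
      have "AE \<omega> in M. real_cond_exp M ?F ?B \<omega> = measure (P (X \<omega> n)) B"
        using markov \<open>B \<in> sets E\<close> unfolding stationary_markov_def cond_pr_def by blast
      then show "AE \<omega> in M. ?A \<omega> * real_cond_exp M ?F ?B \<omega> = ?A \<omega> * measure (P (X \<omega> n)) B"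
        by (rule AE_mp) (auto intro: AE_I2)
      show "(\<lambda>\<omega>. ?A \<omega> * real_cond_exp M ?F ?B \<omega>) \<in> borel_measurable M"
        by (intro borel_measurable_times borel_measurable_cond_exp2 borel_measurable_indicator Am)
      show "(\<lambda>\<omega>. ?A \<omega> * measure (P (X \<omega> n)) B) \<in> borel_measurable M"
        by (intro borel_measurable_times borel_measurable_indicator Am mPm)
    qed
    have "(\<integral>\<^sup>+\<omega>. indicator A (?Y \<omega>) * indicator B (X \<omega> (Suc n)) \<partial>M) = (\<integral>\<^sup>+\<omega>. ennreal (?A \<omega> * ?B \<omega>) \<partial>M)"
      by (intro nn_integral_cong) (auto split: split_indicator)
    also have "\<dots> = ennreal (\<integral>\<omega>. ?A \<omega> * ?B \<omega> \<partial>M)"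
      using Am iB by (intro nn_integral_eq_integral integrable_mult_indicator[where 'b=real, unfolded real_scaleR_def] AE_I2) auto
    also have "\<dots> = ennreal (\<integral>\<omega>. ?A \<omega> * measure (P (X \<omega> n)) B \<partial>M)"
      by (simp only: i1 i2)
    also have "\<dots> = (\<integral>\<^sup>+\<omega>. ennreal (?A \<omega> * measure (P (X \<omega> n)) B) \<partial>M)"
      by (rule nn_integral_eq_integral[symmetric, OF iP]) auto
    also have "\<dots> = (\<integral>\<^sup>+\<omega>. indicator A (?Y \<omega>) * emeasure (P (?Y \<omega> n)) B \<partial>M)"
      by (intro nn_integral_cong) (simp add: mP(2) indicator_def)
    finally show "(\<integral>\<^sup>+\<omega>. indicator A (?Y \<omega>) * indicator B (X \<omega> (Suc n)) \<partial>M) = (\<integral>\<^sup>+\<omega>. indicator A (?Y \<omega>) * emeasure (P (?Y \<omega> n)) B \<partial>M)" .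
  qed measurable
  also have "\<dots> = (\<integral>\<^sup>+\<omega>. g (?Y \<omega>) * (\<integral>\<^sup>+y. \<phi> y \<partial>P (X \<omega> n)) \<partial>M)"
  proof (rule nn_integral_cong)
    fix \<omega> assume "\<omega> \<in> space M"
    note sets = subprob_measurableD(2)[OF kernel_subprob[OF kernel] X_space[OF this, of n]]
    have "\<phi> \<in> borel_measurable (P (X \<omega> n))" by (subst measurable_cong_sets[OF sets refl]) (rule \<phi>)
    then show "(\<integral>\<^sup>+z. (\<lambda>(y, z). g y * \<phi> z) (?Y \<omega>, z) \<partial>P (?Y \<omega> n)) = g (?Y \<omega>) * (\<integral>\<^sup>+y. \<phi> y \<partial>P (X \<omega> n))"
      by (simp add: nn_integral_cmult)
  qed
  finally show ?thesis by simp
qed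

text \<open>\<open>markov_step\<close> for X and \<open>chain_law_prod_Suc\<close> for the chain
  remove the last factor in the same way, so both sides obey the same recursion in n.\<close>

lemma markov_prod:
  assumes g[measurable]: "g \<in> borel_measurable (\<Pi>\<^sub>M j\<in>{..k}. E)" and "\<And>i. \<phi> i \<in> borel_measurable E"
  shows "(\<integral>\<^sup>+\<omega>. g (restrict (X \<omega>) {..k}) * (\<Prod>i\<le>n. \<phi> i (X \<omega> (k + i))) \<partial>M)
       = (\<integral>\<^sup>+\<omega>. g (restrict (X \<omega>) {..k}) * (\<integral>\<^sup>+p. (\<Prod>i\<le>n. \<phi> i (p i)) \<partial>chain_law E P (X \<omega> k)) \<partial>M)"
  using assms(2)
proof (induction n arbitrary: \<phi>)
  case 0
  then show ?case by (intro nn_integral_cong) (simp add: chain_law_start[OF kernel X_space])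
next
  case (Suc n)
  note [measurable] = Suc.prems
  let ?\<psi> = "\<phi>(n := \<lambda>y. \<phi> n y * (\<integral>\<^sup>+z. \<phi> (Suc n) z \<partial>P y))"
  have \<psi>: "?\<psi> i \<in> borel_measurable E" for i
    using nn_integral_kernel_measurable[OF kernel Suc.prems, of "Suc n"] by auto
  have prod_upd: "(\<Prod>i\<le>n. (f(n := \<lambda>y. f n y * c y)) i (w i)) = (\<Prod>i\<le>n. f i (w i)) * c (w n)"
    for f :: "nat \<Rightarrow> 'x \<Rightarrow> ennreal" and c :: "'x \<Rightarrow> ennreal" and w :: "nat \<Rightarrow> 'x"
    by (simp add: lessThan_Suc_atMost[symmetric] ac_simps)
  \<comment> \<open>The past together with the factors already passed is regarded as a function of
    the path up to time k + n, which is the form \<open>markov_step\<close> needs.\<close>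
  define G where "G y = g (restrict y {..k}) * (\<Prod>i\<le>n. \<phi> i (y (k + i)))" for y
  have [measurable]: "(\<lambda>y. restrict y {..k}) \<in> measurable (\<Pi>\<^sub>M j\<in>{..k+n}. E) (\<Pi>\<^sub>M j\<in>{..k}. E)"
    by (rule measurable_restrict_subset) auto
  have [measurable]: "(\<lambda>y. \<phi> i (y (k + i))) \<in> borel_measurable (\<Pi>\<^sub>M j\<in>{..k+n}. E)" if "i \<le> n" for i
  proof -
    have "(\<lambda>y. y (k + i)) \<in> measurable (\<Pi>\<^sub>M j\<in>{..k+n}. E) E"
      using that by (intro measurable_component_singleton) auto
    from measurable_compose[OF this Suc.prems] show ?thesis .
  qed
  have G: "G \<in> borel_measurable (\<Pi>\<^sub>M j\<in>{..k+n}. E)" unfolding G_def by measurable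
  have Gr: "G (restrict (X \<omega>) {..k + n}) = g (restrict (X \<omega>) {..k}) * (\<Prod>i\<le>n. \<phi> i (X \<omega> (k + i)))" for \<omega>
    by (auto simp: G_def Int_absorb1 intro!: arg_cong2[where f=times] prod.cong)
  have "(\<integral>\<^sup>+\<omega>. g (restrict (X \<omega>) {..k}) * (\<Prod>i\<le>Suc n. \<phi> i (X \<omega> (k + i))) \<partial>M)
      = (\<integral>\<^sup>+\<omega>. G (restrict (X \<omega>) {..k + n}) * \<phi> (Suc n) (X \<omega> (Suc (k + n))) \<partial>M)"
    by (intro nn_integral_cong) (simp add: Gr atMost_Suc ac_simps)
  also have "\<dots> = (\<integral>\<^sup>+\<omega>. G (restrict (X \<omega>) {..k + n}) * (\<integral>\<^sup>+z. \<phi> (Suc n) z \<partial>P (X \<omega> (k + n))) \<partial>M)"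
    by (rule markov_step[OF G]) measurable
  also have "\<dots> = (\<integral>\<^sup>+\<omega>. g (restrict (X \<omega>) {..k}) * (\<Prod>i\<le>n. ?\<psi> i (X \<omega> (k + i))) \<partial>M)"
  proof (rule nn_integral_cong)
    fix \<omega>
    note u = prod_upd[of \<phi> "\<lambda>y. \<integral>\<^sup>+z. \<phi> (Suc n) z \<partial>P y" "\<lambda>i. X \<omega> (k + i)"]
    show "G (restrict (X \<omega>) {..k + n}) * (\<integral>\<^sup>+z. \<phi> (Suc n) z \<partial>P (X \<omega> (k + n))) = g (restrict (X \<omega>) {..k}) * (\<Prod>i\<le>n. ?\<psi> i (X \<omega> (k + i)))"
      unfolding u Gr by (simp only: mult.assoc)
  qed
  also have "\<dots> = (\<integral>\<^sup>+\<omega>. g (restrict (X \<omega>) {..k}) * (\<integral>\<^sup>+p. (\<Prod>i\<le>n. ?\<psi> i (p i)) \<partial>chain_law E P (X \<omega> k)) \<partial>M)"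
    by (rule Suc.IH[OF \<psi>])
  also have "\<dots> = (\<integral>\<^sup>+\<omega>. g (restrict (X \<omega>) {..k}) * (\<integral>\<^sup>+p. (\<Prod>i\<le>Suc n. \<phi> i (p i)) \<partial>chain_law E P (X \<omega> k)) \<partial>M)"
    using chain_law_prod_Suc[OF kernel X_space, where \<phi>=\<phi> and n=n] Suc.prems by (intro nn_integral_cong) simp
  finally show ?case .
qed

text \<open>The future includes generation k itself because the chain law has its starting point as
  coordinate 0; passing to \<open>future_law\<close> shifts this coordinate away.\<close>

lemma markov_property:
  assumes h[measurable]: "h \<in> borel_measurable ((\<Pi>\<^sub>M j\<in>{..k}. E) \<Otimes>\<^sub>M path_space E)"
  shows "(\<integral>\<^sup>+\<omega>. h (restrict (X \<omega>) {..k}, \<lambda>n. X \<omega> (k + n)) \<partial>M)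
       = (\<integral>\<^sup>+\<omega>. \<integral>\<^sup>+p. h (restrict (X \<omega>) {..k}, p) \<partial>chain_law E P (X \<omega> k) \<partial>M)"
proof -
  let ?N = "\<Pi>\<^sub>M j\<in>{..k}. E" and ?Y = "\<lambda>\<omega>. restrict (X \<omega>) {..k}" and ?Z = "\<lambda>\<omega> n. X \<omega> (k + n)"
  have Y[measurable]: "?Y \<in> measurable M ?N" using X_measurable by (rule measurable_path_restrict)
  have Z[measurable]: "?Z \<in> measurable M (path_space E)" using X_measurable by (rule measurable_path_shift)
  have pk: "(\<lambda>y. y k) \<in> measurable ?N E" by measurable
  have K: "(\<lambda>y. chain_law E P (y k)) \<in> measurable ?N (prob_algebra (path_space E))"
    using measurable_compose[OF pk chain_law_measurable[OF kernel]] by simp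
  have "(\<integral>\<^sup>+\<omega>. h (?Y \<omega>, ?Z \<omega>) \<partial>M) = (\<integral>\<^sup>+\<omega>. \<integral>\<^sup>+p. h (?Y \<omega>, p) \<partial>chain_law E P (?Y \<omega> k) \<partial>M)"
  proof (rule nn_integral_disintegration[OF prob_space_axioms Y Z K _ h])
    fix A B assume A: "A \<in> sets ?N" and B: "B \<in> sets (path_space E)"
    show "(\<integral>\<^sup>+\<omega>. indicator A (?Y \<omega>) * indicator B (?Z \<omega>) \<partial>M) = (\<integral>\<^sup>+\<omega>. indicator A (?Y \<omega>) * emeasure (chain_law E P (?Y \<omega> k)) B \<partial>M)"
    proof (rule kernel_rectangle_extend[OF prob_space_axioms Y Z measurable_prob_algebraD[OF K] Int_stable_prod_algebra _ _ A _ B])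
      show "sets (path_space E) = sigma_sets (space (path_space E)) (prod_algebra UNIV (\<lambda>_. E))"
        by (simp add: path_space_def sets_PiM space_PiM)
      show "space (path_space E) \<in> prod_algebra UNIV (\<lambda>_. E)"
        by (simp add: path_space_def space_PiM space_in_prod_algebra)
      fix B assume B: "B \<in> prod_algebra UNIV (\<lambda>_::nat. E)"
      from prod_algebra_indicator_prod[OF this] obtain n \<phi> where \<phi>: "\<And>i. \<phi> i \<in> borel_measurable E"
        and ind: "\<And>p. (\<And>i. p i \<in> space E) \<Longrightarrow> indicator B p = (\<Prod>i\<le>n. \<phi> i (p i) :: ennreal)" by metis
      have Bs: "B \<in> sets (path_space E)" using B unfolding path_space_def sets_PiM by auto
      have "(\<integral>\<^sup>+\<omega>. indicator A (?Y \<omega>) * indicator B (?Z \<omega>) \<partial>M) = (\<integral>\<^sup>+\<omega>. indicator A (?Y \<omega>) * (\<Prod>i\<le>n. \<phi> i (X \<omega> (k + i))) \<partial>M)"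
        using X_space by (intro nn_integral_cong) (simp add: ind)
      also have "\<dots> = (\<integral>\<^sup>+\<omega>. indicator A (?Y \<omega>) * (\<integral>\<^sup>+p. (\<Prod>i\<le>n. \<phi> i (p i)) \<partial>chain_law E P (X \<omega> k)) \<partial>M)"
        by (rule markov_prod) (use A \<phi> in auto)
      also have "\<dots> = (\<integral>\<^sup>+\<omega>. indicator A (?Y \<omega>) * emeasure (chain_law E P (?Y \<omega> k)) B \<partial>M)"
      proof (intro nn_integral_cong arg_cong2[where f=times] refl)
        fix \<omega> assume "\<omega> \<in> space M"
        note sets = sets_chain_law[OF kernel X_space[OF this, of k]]
        have "emeasure (chain_law E P (X \<omega> k)) B = (\<integral>\<^sup>+p. indicator B p \<partial>chain_law E P (X \<omega> k))"
          using Bs by (simp add: sets)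
        also have "\<dots> = (\<integral>\<^sup>+p. (\<Prod>i\<le>n. \<phi> i (p i)) \<partial>chain_law E P (X \<omega> k))"
          using sets_eq_imp_space_eq[OF sets] by (intro nn_integral_cong ind) (auto simp: path_space_def space_PiM)
        finally show "(\<integral>\<^sup>+p. (\<Prod>i\<le>n. \<phi> i (p i)) \<partial>chain_law E P (X \<omega> k)) = emeasure (chain_law E P (?Y \<omega> k)) B" by simp
      qed
      finally show "(\<integral>\<^sup>+\<omega>. indicator A (?Y \<omega>) * indicator B (?Z \<omega>) \<partial>M) = (\<integral>\<^sup>+\<omega>. indicator A (?Y \<omega>) * emeasure (chain_law E P (?Y \<omega> k)) B \<partial>M)" .
    qed
  qed
  then show ?thesis by simp
qed

end

section \<open>Joint conditional independence of two lines of descent\<close>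

text \<open>These lines follow first children except for child i after generation k. For different i
  any two of them separate exactly there, which supplies the infinite family used in
  \<open>pair_positive\<close>.\<close>

definition branch_line :: "nat \<Rightarrow> nat \<Rightarrow> nat \<Rightarrow> nat list" where
  "branch_line k i n = (if n \<le> k then replicate n 1 else replicate k 1 @ i # replicate (n - Suc k) 1)"

lemma descent_line_branch_line: "1 \<le> i \<Longrightarrow> descent_line (branch_line k i)"
  unfolding descent_line_def
proof safe
  assume i: "1 \<le> i"
  show "branch_line k i 0 = []" by (simp add: branch_line_def)
  fix n
  consider "n < k" | "n = k" | "k < n" by linarith
  then show "\<exists>j\<ge>1. branch_line k i (Suc n) = branch_line k i n @ [j]"
  proof cases
    case 1 then show ?thesis by (auto simp: branch_line_def replicate_append_same intro!: exI[of _ 1])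
  next
    case 2 then show ?thesis using i by (auto simp: branch_line_def)
  next
    case 3
    then have "Suc n - Suc k = Suc (n - Suc k)" by simp
    with 3 show ?thesis by (auto simp: branch_line_def replicate_append_same intro!: exI[of _ 1])
  qed
qed

section \<open>Symmetry and positivity for pairs of separating lines\<close>

context markov_independence
begin

lemma measurable_T[measurable]: "(\<lambda>\<omega>. T \<omega> v) \<in> measurable M E"
  using measurable_compose[OF T_measurable, of "\<lambda>p. p v" E] by simp

lemma measurable_T_line[measurable]: "(\<lambda>\<omega> n. T \<omega> (v n)) \<in> measurable M (path_space E)"
  by (rule measurable_pathI) measurable

lemma bounded_integrable:
  fixes f :: "'w \<Rightarrow> real"
  assumes "f \<in> borel_measurable M" "\<And>\<omega>. \<omega> \<in> space M \<Longrightarrow> \<bar>f \<omega>\<bar> \<le> B"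
  shows "integrable M f"
  using assms by (intro integrable_const_bound[where B=B]) (auto intro!: AE_I2)

lemma integral_pair_lines:
  assumes v: "descent_line v" "descent_line w" "\<And>n. n \<le> k \<Longrightarrow> v n = w n" "v (Suc k) \<noteq> w (Suc k)"
    and H: "H \<in> borel_measurable (path_space E \<Otimes>\<^sub>M path_space E)"
  shows "(\<integral>\<omega>. H (\<lambda>n. T \<omega> (v n), \<lambda>n. T \<omega> (w n)) \<partial>M) = (\<integral>\<omega>. (H (X \<omega>, Xk k \<omega>) :: real) \<partial>M)"
proof -
  note [measurable] = X_measurable Xk_measurable H
  have "(\<integral>\<omega>. H (\<lambda>n. T \<omega> (v n), \<lambda>n. T \<omega> (w n)) \<partial>M) = (\<integral>p. H p \<partial>distr M (path_space E \<Otimes>\<^sub>M path_space E) (\<lambda>\<omega>. (\<lambda>n. T \<omega> (v n), \<lambda>n. T \<omega> (w n))))"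
    by (rule integral_distr[symmetric]) measurable
  also have "\<dots> = (\<integral>\<omega>. H (X \<omega>, Xk k \<omega>) \<partial>M)"
    using pair_law[OF v(1,2), of k] v(3,4) by (simp add: integral_distr)
  finally show ?thesis .
qed

lemma integral_line:
  assumes v: "descent_line v" and H: "H \<in> borel_measurable (path_space E)"
  shows "(\<integral>\<omega>. H (\<lambda>n. T \<omega> (v n)) \<partial>M) = (\<integral>\<omega>. (H (X \<omega>) :: real) \<partial>M)"
  using integral_distr[OF measurable_T_line H, of v] integral_distr[OF X_measurable H] line_law[OF v] by simp

lemma integral_Xk:
  assumes H: "H \<in> borel_measurable (path_space E)"
  shows "(\<integral>\<omega>. H (Xk k \<omega>) \<partial>M) = (\<integral>\<omega>. (H (X \<omega>) :: real) \<partial>M)"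
  using integral_distr[OF Xk_measurable H, of k] integral_distr[OF X_measurable H] Xk_law by simp

lemma branch_lines:
  assumes "i \<noteq> j"
  shows "\<And>n. n \<le> k \<Longrightarrow> branch_line k i n = branch_line k j n" "branch_line k i (Suc k) \<noteq> branch_line k j (Suc k)"
  using assms by (auto simp: branch_line_def)

text \<open>The pair law applies to the same two lines in either order, so \<open>(X, Xk k)\<close>
  is exchangeable.\<close>

lemma pair_symmetric:
  assumes [measurable]: "z \<in> borel_measurable (path_space E)" "z' \<in> borel_measurable (path_space E)"
  shows "(\<integral>\<omega>. z (X \<omega>) * z' (Xk k \<omega>) \<partial>M) = (\<integral>\<omega>. (z' (X \<omega>) * z (Xk k \<omega>) :: real) \<partial>M)"
proof -
  let ?H = "\<lambda>(p, q). z p * z' q" and ?H' = "\<lambda>(p, q). z' p * z q"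
  have "(\<integral>\<omega>. z (X \<omega>) * z' (Xk k \<omega>) \<partial>M) = (\<integral>\<omega>. ?H (\<lambda>n. T \<omega> (branch_line k 1 n), \<lambda>n. T \<omega> (branch_line k 2 n)) \<partial>M)"
    using integral_pair_lines[OF descent_line_branch_line descent_line_branch_line branch_lines, of 1 2 k ?H] by simp
  also have "\<dots> = (\<integral>\<omega>. ?H' (\<lambda>n. T \<omega> (branch_line k 2 n), \<lambda>n. T \<omega> (branch_line k 1 n)) \<partial>M)"
    by (simp add: mult.commute)
  also have "\<dots> = (\<integral>\<omega>. z' (X \<omega>) * z (Xk k \<omega>) \<partial>M)"
    using integral_pair_lines[OF descent_line_branch_line descent_line_branch_line branch_lines, of 2 1 k ?H'] by simp
  finally show ?thesis .
qed

text \<open>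
  Only pairwise conditional independence of the past and the two futures is assumed. Positivity of
  the covariance of exchangeable copies, available because every cell carries infinitely many
  labelled descendants, upgrades it to joint conditional independence.
\<close>

lemma pair_positive:
  assumes [measurable]: "z \<in> borel_measurable (path_space E)"
    and bnd: "\<And>p. p \<in> space (path_space E) \<Longrightarrow> \<bar>z p\<bar> \<le> B"
  shows "0 \<le> (\<integral>\<omega>. (z (X \<omega>) * z (Xk k \<omega>) :: real) \<partial>M)"
proof (rule ccontr)
  define c where "c = (\<integral>\<omega>. z (X \<omega>) * z (Xk k \<omega>) \<partial>M)"
  define v where "v = (\<integral>\<omega>. (z (X \<omega>))\<^sup>2 \<partial>M)"
  define Z where "Z i \<omega> = z (\<lambda>n. T \<omega> (branch_line k (Suc i) n))" for i \<omega>
  assume "\<not> 0 \<le> (\<integral>\<omega>. z (X \<omega>) * z (Xk k \<omega>) \<partial>M)"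
  then have c: "c < 0" by (simp add: c_def)
  have [measurable]: "Z i \<in> borel_measurable M" for i unfolding Z_def by measurable
  have Zb: "\<bar>Z i \<omega>\<bar> \<le> B" if "\<omega> \<in> space M" for i \<omega>
    unfolding Z_def using measurable_space[OF measurable_T_line that] by (rule bnd)
  have B: "0 \<le> B" using Zb[of _ 0] not_empty abs_ge_zero order_trans by blast
  have intZ: "integrable M (\<lambda>\<omega>. Z i \<omega> * Z j \<omega>)" for i j
    by (rule bounded_integrable[where B="B * B"]) (use Zb B in \<open>auto simp: abs_mult intro!: mult_mono\<close>)
  have ZZ: "(\<integral>\<omega>. Z i \<omega> * Z j \<omega> \<partial>M) = (if i = j then v else c)" for i j
  proof (cases "i = j")
    case True
    then show ?thesis
      using integral_line[OF descent_line_branch_line, of "Suc i" "\<lambda>p. (z p)\<^sup>2" k]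
      by (simp add: Z_def v_def power2_eq_square)
  next
    case False
    then show ?thesis
      using integral_pair_lines[OF descent_line_branch_line descent_line_branch_line branch_lines, of "Suc i" "Suc j" k "\<lambda>(p, q). z p * z q"]
      by (simp add: Z_def c_def)
  qed
  \<comment> \<open>The second moment of a sum of n + 1 copies is (n + 1) * (v + n * c). Its
    nonnegativity for all n rules out a negative c.\<close>
  have key: "0 \<le> v + real n * c" if n: "0 < n" for n :: nat
  proof -
    have "0 \<le> (\<integral>\<omega>. (\<Sum>i\<le>n. Z i \<omega>)\<^sup>2 \<partial>M)" by (rule integral_nonneg_AE) auto
    also have "\<dots> = (\<integral>\<omega>. (\<Sum>i\<le>n. \<Sum>j\<le>n. Z i \<omega> * Z j \<omega>) \<partial>M)"
      by (simp add: power2_eq_square sum_product)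
    also have "\<dots> = (\<Sum>i\<le>n. \<Sum>j\<le>n. (\<integral>\<omega>. Z i \<omega> * Z j \<omega> \<partial>M))"
      by (simp add: Bochner_Integration.integral_sum intZ)
    also have "\<dots> = (\<Sum>i\<le>n. \<Sum>j\<le>n. (if i = j then v - c else 0) + c)"
      by (intro sum.cong refl) (auto simp: ZZ)
    also have "\<dots> = (\<Sum>i\<le>n. (v - c) + real (Suc n) * c)"
      by (intro sum.cong refl) (simp add: sum.distrib)
    also have "\<dots> = real (Suc n) * (v + real n * c)" by (simp add: algebra_simps)
    finally show ?thesis by (simp add: zero_le_mult_iff)
  qed
  obtain n :: nat where n: "v / - c < real n" using reals_Archimedean2 by blast
  have "v / - c < real (Suc n)" using n by simp
  then have "v + real (Suc n) * c < 0" using c by (simp add: divide_simps algebra_simps split: if_splits)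
  then show False using key[of "Suc n"] by simp
qed

lemma future_law_measure_measurable[measurable]:
  assumes "G \<in> sets (path_space E)"
  shows "(\<lambda>x. measure (future_law E P x) G) \<in> borel_measurable E"
  by (rule measurable_compose[OF measurable_prob_algebraD[OF future_law_measurable[OF kernel]]])
     (rule measurable_measure_subprob_algebra[OF assms])

lemma prob_space_future_law: "x \<in> space E \<Longrightarrow> prob_space (future_law E P x)"
  and sets_future_law: "x \<in> space E \<Longrightarrow> sets (future_law E P x) = sets (path_space E)"
  using measurable_space[OF future_law_measurable[OF kernel]] by (auto simp: space_prob_algebra)

text \<open>Real integrals of bounded functions are used because differences of such terms are
  formed in \<open>futures_given_past_rectangle\<close>.\<close>

lemma future_given_past:
  assumes u[measurable]: "u \<in> borel_measurable (\<Pi>\<^sub>M j\<in>{..k}. E)" and "\<And>y. 0 \<le> u y" "\<And>y. u y \<le> 1"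
    and G[measurable]: "G \<in> sets (path_space E)"
  shows "(\<integral>\<omega>. u (restrict (X \<omega>) {..k}) * indicator G (\<lambda>n. X \<omega> (Suc k + n)) \<partial>M)
       = (\<integral>\<omega>. u (restrict (X \<omega>) {..k}) * measure (future_law E P (X \<omega> k)) G \<partial>M)"
proof -
  let ?Y = "\<lambda>\<omega>. restrict (X \<omega>) {..k}"
  have [measurable]: "?Y \<in> measurable M (\<Pi>\<^sub>M j\<in>{..k}. E)" using X_measurable by (rule measurable_path_restrict)
  have [measurable]: "(\<lambda>\<omega> n. X \<omega> (Suc (k + n))) \<in> measurable M (path_space E)"
    using X_measurable by (rule measurable_path_shift)
  have sh[measurable]: "(\<lambda>p n. p (Suc n)) \<in> measurable (path_space E) (path_space E)"
    by (rule measurable_path_shift) measurable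
  have i: "indicator G (\<lambda>n. X \<omega> (Suc k + n)) = (indicator G (\<lambda>n. X \<omega> (k + Suc n)) :: real)" for \<omega>
    by simp
  have "ennreal (\<integral>\<omega>. u (?Y \<omega>) * indicator G (\<lambda>n. X \<omega> (Suc k + n)) \<partial>M) = (\<integral>\<^sup>+\<omega>. ennreal (u (?Y \<omega>) * indicator G (\<lambda>n. X \<omega> (Suc k + n))) \<partial>M)"
    by (intro nn_integral_eq_integral[symmetric] bounded_integrable[where B=1]) (use assms(2,3) in \<open>auto split: split_indicator\<close>)
  also have "\<dots> = (\<integral>\<^sup>+\<omega>. (\<lambda>(y, p). ennreal (u y) * indicator G (\<lambda>n. p (Suc n))) (?Y \<omega>, \<lambda>n. X \<omega> (k + n)) \<partial>M)"
    by (intro nn_integral_cong) (auto split: split_indicator)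
  also have "\<dots> = (\<integral>\<^sup>+\<omega>. \<integral>\<^sup>+p. (\<lambda>(y, p). ennreal (u y) * indicator G (\<lambda>n. p (Suc n))) (?Y \<omega>, p) \<partial>chain_law E P (X \<omega> k) \<partial>M)"
    by (rule markov_property) measurable
  also have "\<dots> = (\<integral>\<^sup>+\<omega>. ennreal (u (?Y \<omega>) * measure (future_law E P (X \<omega> k)) G) \<partial>M)"
  proof (rule nn_integral_cong)
    fix \<omega> assume \<omega>: "\<omega> \<in> space M"
    note x = X_space[OF \<omega>, of k]
    note sets = sets_chain_law[OF kernel x]
    interpret F: prob_space "future_law E P (X \<omega> k)" by (rule prob_space_future_law[OF x])
    have sh': "(\<lambda>p n. p (Suc n)) \<in> measurable (chain_law E P (X \<omega> k)) (path_space E)"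
      by (subst measurable_cong_sets[OF sets refl]) (rule sh)
    have ind: "(\<lambda>p. indicator G (\<lambda>n. p (Suc n)) :: ennreal) \<in> borel_measurable (chain_law E P (X \<omega> k))"
      by (rule measurable_compose[OF sh']) simp
    have "(\<integral>\<^sup>+p. ennreal (u (?Y \<omega>)) * indicator G (\<lambda>n. p (Suc n)) \<partial>chain_law E P (X \<omega> k))
        = ennreal (u (?Y \<omega>)) * (\<integral>\<^sup>+p. indicator G (\<lambda>n. p (Suc n)) \<partial>chain_law E P (X \<omega> k))"
      by (rule nn_integral_cmult[OF ind])
    also have "(\<integral>\<^sup>+p. indicator G (\<lambda>n. p (Suc n)) \<partial>chain_law E P (X \<omega> k)) = (\<integral>\<^sup>+p. indicator G p \<partial>future_law E P (X \<omega> k))"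
      unfolding future_law_def by (rule nn_integral_distr[symmetric, OF sh']) simp
    also have "\<dots> = emeasure (future_law E P (X \<omega> k)) G" by (simp add: sets_future_law[OF x])
    also have "\<dots> = ennreal (measure (future_law E P (X \<omega> k)) G)" by (rule F.emeasure_eq_measure)
    finally show "(\<integral>\<^sup>+p. (\<lambda>(y, p). ennreal (u y) * indicator G (\<lambda>n. p (Suc n))) (?Y \<omega>, p) \<partial>chain_law E P (X \<omega> k))
        = ennreal (u (?Y \<omega>) * measure (future_law E P (X \<omega> k)) G)"
      using assms(2) by (simp only: prod.case ennreal_mult measure_nonneg)
  qed
  also have "\<dots> = ennreal (\<integral>\<omega>. u (?Y \<omega>) * measure (future_law E P (X \<omega> k)) G \<partial>M)"
  proof (intro nn_integral_eq_integral bounded_integrable[where B=1])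
    fix \<omega> assume \<omega>: "\<omega> \<in> space M"
    interpret F: prob_space "future_law E P (X \<omega> k)" by (rule prob_space_future_law[OF X_space[OF \<omega>]])
    show "\<bar>u (?Y \<omega>) * measure (future_law E P (X \<omega> k)) G\<bar> \<le> 1"
      using assms(2,3) by (simp add: abs_mult mult_le_one)
  qed (use assms(2) in \<open>auto intro!: borel_measurable_times measurable_compose[OF measurable_X future_law_measure_measurable[OF G]]\<close>)
  finally show ?thesis
    using assms(2) by (subst (asm) ennreal_inj) (auto intro!: integral_nonneg_AE AE_I2)
qed

text \<open>\<open>Xk k\<close> has the law of X and almost surely the same past up to generation k,
  so its future given that past follows the same kernel.\<close>

lemma future_Xk_given_past:
  assumes u[measurable]: "u \<in> borel_measurable (\<Pi>\<^sub>M j\<in>{..k}. E)" and "\<And>y. 0 \<le> u y" "\<And>y. u y \<le> 1"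
    and G[measurable]: "G \<in> sets (path_space E)"
  shows "(\<integral>\<omega>. u (restrict (X \<omega>) {..k}) * indicator G (\<lambda>n. Xk k \<omega> (Suc k + n)) \<partial>M)
       = (\<integral>\<omega>. u (restrict (X \<omega>) {..k}) * measure (future_law E P (X \<omega> k)) G \<partial>M)"
proof -
  let ?h = "\<lambda>p. u (restrict p {..k}) * indicator G (\<lambda>n. p (Suc k + n)) :: real"
  have [measurable]: "(\<lambda>p. restrict p {..k}) \<in> measurable (path_space E) (\<Pi>\<^sub>M j\<in>{..k}. E)"
    by (rule measurable_path_restrict) measurable
  have [measurable]: "(\<lambda>p n. p (Suc (k + n))) \<in> measurable (path_space E) (path_space E)"
    by (rule measurable_path_shift) measurable
  have h[measurable]: "?h \<in> borel_measurable (path_space E)" by simp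
  have eq: "AE \<omega> in M. u (restrict (X \<omega>) {..k}) * indicator G (\<lambda>n. Xk k \<omega> (Suc k + n)) = ?h (Xk k \<omega>)"
    using Xk_eq[of k]
  proof eventually_elim
    case (elim \<omega>)
    then have "restrict (Xk k \<omega>) {..k} = restrict (X \<omega>) {..k}" by (auto simp: restrict_def)
    then show ?case by (simp only:)
  qed
  have [measurable]: "(\<lambda>\<omega>. restrict (X \<omega>) {..k}) \<in> measurable M (\<Pi>\<^sub>M j\<in>{..k}. E)"
    using X_measurable by (rule measurable_path_restrict)
  have [measurable]: "(\<lambda>\<omega> n. Xk k \<omega> (Suc (k + n))) \<in> measurable M (path_space E)"
    using Xk_measurable by (rule measurable_path_shift)
  have "(\<integral>\<omega>. u (restrict (X \<omega>) {..k}) * indicator G (\<lambda>n. Xk k \<omega> (Suc k + n)) \<partial>M) = (\<integral>\<omega>. ?h (Xk k \<omega>) \<partial>M)"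
    by (rule integral_cong_AE[OF _ _ eq]) (simp_all add: measurable_compose[OF Xk_measurable h])
  also have "\<dots> = (\<integral>\<omega>. ?h (X \<omega>) \<partial>M)" by (rule integral_Xk[OF h])
  finally show ?thesis using future_given_past[OF assms] by simp
qed

lemma integral_cond_pr:
  assumes Y: "Y \<in> measurable M N" and Q: "{\<omega> \<in> space M. Q \<omega>} \<in> sets M"
  shows "(\<integral>\<omega>. cond_pr M (sigma_gen M N Y) Q \<omega> \<partial>M) = prob {\<omega> \<in> space M. Q \<omega>}"
    "cond_pr M (sigma_gen M N Y) Q \<in> borel_measurable M"
proof -
  interpret F: finite_measure_subalgebra M "sigma_gen M N Y" by (rule subalgebra_sigma_gen[OF Y])
  have "integrable M (indicator {\<omega> \<in> space M. Q \<omega>} :: _ \<Rightarrow> real)"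
    using Q by (intro bounded_integrable[where B=1]) (auto split: split_indicator)
  from F.real_cond_exp_int(2)[OF this] Q
  show "(\<integral>\<omega>. cond_pr M (sigma_gen M N Y) Q \<omega> \<partial>M) = prob {\<omega> \<in> space M. Q \<omega>}"
    by (simp add: cond_pr_def Int_absorb2 subset_eq)
  show "cond_pr M (sigma_gen M N Y) Q \<in> borel_measurable M"
    unfolding cond_pr_def by (rule borel_measurable_cond_exp2)
qed

lemma cond_pr_eqI:
  assumes Y[measurable]: "Y \<in> measurable M N" and Q[measurable]: "{\<omega> \<in> space M. Q \<omega>} \<in> sets M"
    and r[measurable]: "r \<in> borel_measurable N" and rb: "\<And>\<omega>. \<omega> \<in> space M \<Longrightarrow> \<bar>r (Y \<omega>)\<bar> \<le> 1"
    and eq: "\<And>A. A \<in> sets N \<Longrightarrow> (\<integral>\<omega>. indicator A (Y \<omega>) * indicator {\<omega> \<in> space M. Q \<omega>} \<omega> \<partial>M) = (\<integral>\<omega>. indicator A (Y \<omega>) * (r (Y \<omega>) :: real) \<partial>M)"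
  shows "AE \<omega> in M. cond_pr M (sigma_gen M N Y) Q \<omega> = r (Y \<omega>)"
proof -
  interpret F: finite_measure_subalgebra M "sigma_gen M N Y" by (rule subalgebra_sigma_gen[OF Y])
  have YF: "Y \<in> measurable (sigma_gen M N Y) N"
    unfolding sigma_gen_def using measurable_space[OF Y] by (intro measurable_vimage_algebra1) auto
  show ?thesis
    unfolding cond_pr_def
  proof (rule F.real_cond_exp_charact)
    show "integrable M (indicator {\<omega> \<in> space M. Q \<omega>} :: _ \<Rightarrow> real)"
      by (intro bounded_integrable[where B=1]) (auto split: split_indicator)
    show "integrable M (\<lambda>\<omega>. r (Y \<omega>))" by (intro bounded_integrable[where B=1] rb) auto
    show "(\<lambda>\<omega>. r (Y \<omega>)) \<in> borel_measurable (sigma_gen M N Y)" by (rule measurable_compose[OF YF r])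
    fix B assume "B \<in> sets (sigma_gen M N Y)"
    then obtain A where A: "A \<in> sets N" "B = Y -` A \<inter> space M"
      unfolding sigma_gen_def using sets_vimage_algebra2[of Y "space M" N] measurable_space[OF Y] by auto
    have "(\<integral>\<omega>\<in>B. f \<omega> \<partial>M) = (\<integral>\<omega>. indicator A (Y \<omega>) * f \<omega> \<partial>M)" for f :: "_ \<Rightarrow> real"
      unfolding set_lebesgue_integral_def A(2) by (intro Bochner_Integration.integral_cong) (auto split: split_indicator)
    then show "(\<integral>\<omega>\<in>B. indicator {\<omega> \<in> space M. Q \<omega>} \<omega> \<partial>M) = (\<integral>\<omega>\<in>B. r (Y \<omega>) \<partial>M)"
      using eq[OF A(1)] by simp
  qed
qed

text \<open>The assumed conditional independence enters only here. It conditions on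
  \<open>X \<omega> k\<close> alone, so after integration it yields the product formula on the whole
  space, with no event of earlier generations inserted.\<close>

lemma futures_uncorrelated:
  assumes G[measurable]: "G \<in> sets (path_space E)" and H[measurable]: "H \<in> sets (path_space E)"
  shows "(\<integral>\<omega>. indicator G (\<lambda>n. X \<omega> (Suc k + n)) * indicator H (\<lambda>n. Xk k \<omega> (Suc k + n)) \<partial>M)
       = (\<integral>\<omega>. measure (future_law E P (X \<omega> k)) G * measure (future_law E P (X \<omega> k)) H \<partial>M)"
proof -
  let ?F = "sigma_gen M E (\<lambda>\<omega>. X \<omega> k)" and ?R = "\<Pi>\<^sub>M n\<in>{Suc k..}. E"
  let ?r = "\<lambda>G x. measure (future_law E P x) G"
  have sh[measurable]: "(\<lambda>q n. q (Suc k + n)) \<in> measurable ?R (path_space E)"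
    by (rule measurable_pathI) (rule measurable_component_singleton, simp)
  \<comment> \<open>The hypothesis speaks of paths restricted to generations after k;
    \<open>V\<close> transports events about the reindexed future to that index set.\<close>
  define V where "V G = (\<lambda>q n. q (Suc k + n)) -` G \<inter> space ?R" for G :: "(nat \<Rightarrow> 'x) set"
  have V[measurable]: "V G \<in> sets ?R" if "G \<in> sets (path_space E)" for G
    unfolding V_def using that by (rule measurable_sets[OF sh])
  have [measurable]: "(\<lambda>\<omega>. restrict (X \<omega>) {Suc k..}) \<in> measurable M ?R"
    "(\<lambda>\<omega>. restrict (Xk k \<omega>) {Suc k..}) \<in> measurable M ?R"
    using X_measurable Xk_measurable by (auto intro: measurable_path_restrict)
  have VX: "restrict f {Suc k..} \<in> V G \<longleftrightarrow> (\<lambda>n. f (Suc k + n)) \<in> G" if "\<And>n. f n \<in> space E" for f G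
    using that by (auto simp: V_def space_PiM)
  have Xksp: "Xk k \<omega> n \<in> space E" if "\<omega> \<in> space M" for \<omega> n
    using measurable_space[OF measurable_Xk that] .
  have pk: "(\<lambda>y. y k) \<in> measurable (\<Pi>\<^sub>M j\<in>{..k}. E) E" by measurable
  have rb: "\<bar>?r G x\<bar> \<le> 1" "0 \<le> ?r G x" if "x \<in> space E" for G x
    using prob_space.prob_le_1[OF prob_space_future_law[OF that]] by auto
  have ind: "(\<lambda>y. indicator A (y k) :: real) \<in> borel_measurable (\<Pi>\<^sub>M j\<in>{..k}. E)" if "A \<in> sets E" for A
    using that by (intro measurable_compose[OF pk]) simp
  have 1: "AE \<omega> in M. cond_pr M ?F (\<lambda>\<omega>. restrict (X \<omega>) {Suc k..} \<in> V G) \<omega> = ?r G (X \<omega> k)"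
  proof (rule cond_pr_eqI[OF measurable_X _ future_law_measure_measurable[OF G] rb(1)[OF X_space]])
    show "{\<omega> \<in> space M. restrict (X \<omega>) {Suc k..} \<in> V G} \<in> sets M" using V[OF G] by measurable
    fix A assume A: "A \<in> sets E"
    have "(\<integral>\<omega>. indicator A (X \<omega> k) * indicator {\<omega> \<in> space M. restrict (X \<omega>) {Suc k..} \<in> V G} \<omega> \<partial>M)
       = (\<integral>\<omega>. indicator A (restrict (X \<omega>) {..k} k) * indicator G (\<lambda>n. X \<omega> (Suc k + n)) \<partial>M)"
      by (intro Bochner_Integration.integral_cong) (auto simp: VX X_space split: split_indicator)
    also have "\<dots> = (\<integral>\<omega>. indicator A (restrict (X \<omega>) {..k} k) * ?r G (X \<omega> k) \<partial>M)"
      by (rule future_given_past[OF ind[OF A] _ _ G]) auto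
    finally show "(\<integral>\<omega>. indicator A (X \<omega> k) * indicator {\<omega> \<in> space M. restrict (X \<omega>) {Suc k..} \<in> V G} \<omega> \<partial>M)
        = (\<integral>\<omega>. indicator A (X \<omega> k) * ?r G (X \<omega> k) \<partial>M)" by simp
  qed
  have 2: "AE \<omega> in M. cond_pr M ?F (\<lambda>\<omega>. restrict (Xk k \<omega>) {Suc k..} \<in> V H) \<omega> = ?r H (X \<omega> k)"
  proof (rule cond_pr_eqI[OF measurable_X _ future_law_measure_measurable[OF H] rb(1)[OF X_space]])
    show "{\<omega> \<in> space M. restrict (Xk k \<omega>) {Suc k..} \<in> V H} \<in> sets M" using V[OF H] by measurable
    fix A assume A: "A \<in> sets E"
    have "(\<integral>\<omega>. indicator A (X \<omega> k) * indicator {\<omega> \<in> space M. restrict (Xk k \<omega>) {Suc k..} \<in> V H} \<omega> \<partial>M)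
       = (\<integral>\<omega>. indicator A (restrict (X \<omega>) {..k} k) * indicator H (\<lambda>n. Xk k \<omega> (Suc k + n)) \<partial>M)"
      by (intro Bochner_Integration.integral_cong) (auto simp: VX Xksp split: split_indicator)
    also have "\<dots> = (\<integral>\<omega>. indicator A (restrict (X \<omega>) {..k} k) * ?r H (X \<omega> k) \<partial>M)"
      by (rule future_Xk_given_past[OF ind[OF A] _ _ H]) auto
    finally show "(\<integral>\<omega>. indicator A (X \<omega> k) * indicator {\<omega> \<in> space M. restrict (Xk k \<omega>) {Suc k..} \<in> V H} \<omega> \<partial>M)
        = (\<integral>\<omega>. indicator A (X \<omega> k) * ?r H (X \<omega> k) \<partial>M)" by simp
  qed
  let ?Q = "\<lambda>\<omega>. restrict (Xk k \<omega>) {Suc k..} \<in> V H \<and> restrict (X \<omega>) {Suc k..} \<in> V G"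
  have Q: "{\<omega> \<in> space M. ?Q \<omega>} \<in> sets M" using V[OF H] V[OF G] by measurable
  have 3: "AE \<omega> in M. cond_pr M ?F ?Q \<omega> = cond_pr M ?F (\<lambda>\<omega>. restrict (Xk k \<omega>) {Suc k..} \<in> V H) \<omega> * cond_pr M ?F (\<lambda>\<omega>. restrict (X \<omega>) {Suc k..} \<in> V G) \<omega>"
    using cond_indep[of k] V[OF H] V[OF G] unfolding cond_indep_var_def by blast
  have "(\<integral>\<omega>. indicator G (\<lambda>n. X \<omega> (Suc k + n)) * indicator H (\<lambda>n. Xk k \<omega> (Suc k + n)) \<partial>M) = (\<integral>\<omega>. (indicator {\<omega> \<in> space M. ?Q \<omega>} \<omega> :: real) \<partial>M)"
    by (intro Bochner_Integration.integral_cong) (auto simp: VX X_space Xksp split: split_indicator)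
  also have "\<dots> = prob {\<omega> \<in> space M. ?Q \<omega>}" using Q by simp
  also have "\<dots> = (\<integral>\<omega>. cond_pr M ?F ?Q \<omega> \<partial>M)" using integral_cond_pr(1)[OF measurable_X Q] by simp
  also have "\<dots> = (\<integral>\<omega>. ?r G (X \<omega> k) * ?r H (X \<omega> k) \<partial>M)"
  proof (rule integral_cong_AE)
    show "cond_pr M ?F ?Q \<in> borel_measurable M" by (rule integral_cond_pr(2)[OF measurable_X Q])
    show "(\<lambda>\<omega>. ?r G (X \<omega> k) * ?r H (X \<omega> k)) \<in> borel_measurable M"
      by (intro borel_measurable_times measurable_compose[OF measurable_X future_law_measure_measurable] G H)
    show "AE \<omega> in M. cond_pr M ?F ?Q \<omega> = ?r G (X \<omega> k) * ?r H (X \<omega> k)"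
      using 1 2 3 by eventually_elim (simp only: mult.commute)
  qed
  finally show ?thesis .
qed

text \<open>Let z be the indicator of the past event F times a centred indicator of a future event.
  The mixed second moment \<open>D\<close> of z along the two lines equals the defect
  \<open>J\<close> of the claimed formula. The defects for F and its complement add up to 0 by
  \<open>futures_uncorrelated\<close>; for G = H both are nonnegative by
  \<open>pair_positive\<close>, so they vanish. Positivity for the sum of the terms belonging to G
  and H then settles the mixed case.\<close>

lemma futures_given_past_rectangle:
  assumes F[measurable]: "F \<in> sets (\<Pi>\<^sub>M j\<in>{..k}. E)"
    and G[measurable]: "G \<in> sets (path_space E)" and H[measurable]: "H \<in> sets (path_space E)"
  shows "(\<integral>\<omega>. indicator F (restrict (X \<omega>) {..k}) * (indicator G (\<lambda>n. X \<omega> (Suc k + n)) * indicator H (\<lambda>n. Xk k \<omega> (Suc k + n))) \<partial>M)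
       = (\<integral>\<omega>. indicator F (restrict (X \<omega>) {..k}) * (measure (future_law E P (X \<omega> k)) G * measure (future_law E P (X \<omega> k)) H) \<partial>M)"
proof -
  let ?N = "\<Pi>\<^sub>M j\<in>{..k}. E"
  \<comment> \<open>The cut at 1 changes nothing on \<open>space E\<close> and makes the bounds hold
    at every point, so they need no membership conditions.\<close>
  define q where "q G x = min 1 (measure (future_law E P x) G)" for G x
  define z where "z F G p = indicator F (restrict p {..k}) * (indicator G (\<lambda>n. p (Suc k + n)) - q G (p k))" for F G p
  define D where "D F G H = (\<integral>\<omega>. z F G (X \<omega>) * z F H (Xk k \<omega>) \<partial>M)" for F G H
  define J where "J F G H = (\<integral>\<omega>. indicator F (restrict (X \<omega>) {..k}) * (indicator G (\<lambda>n. X \<omega> (Suc k + n)) * indicator H (\<lambda>n. Xk k \<omega> (Suc k + n))) \<partial>M)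
      - (\<integral>\<omega>. indicator F (restrict (X \<omega>) {..k}) * (q G (X \<omega> k) * q H (X \<omega> k)) \<partial>M)" for F G H
  have qm[measurable]: "q G \<in> borel_measurable E" if "G \<in> sets (path_space E)" for G
    unfolding q_def using future_law_measure_measurable[OF that] by simp
  have q01: "0 \<le> q G x" "q G x \<le> 1" for G x by (auto simp: q_def)
  have qe: "measure (future_law E P x) G = q G x" if "x \<in> space E" for x G
    using prob_space.prob_le_1[OF prob_space_future_law[OF that]] by (simp add: q_def)
  have [measurable]: "(\<lambda>p. restrict p {..k}) \<in> measurable (path_space E) ?N"
    by (rule measurable_path_restrict) measurable
  have [measurable]: "(\<lambda>p n. p (Suc (k + n))) \<in> measurable (path_space E) (path_space E)"
    by (rule measurable_path_shift) measurable
  have mk: "(\<lambda>p. p k) \<in> measurable (path_space E) E"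
    by (rule measurable_path_component) measurable
  have mkN: "(\<lambda>y. y k) \<in> measurable ?N E" by measurable
  have zm: "z F G \<in> borel_measurable (path_space E)" if [measurable]: "F \<in> sets ?N" "G \<in> sets (path_space E)" for F G
  proof -
    have [measurable]: "(\<lambda>p. q G (p k)) \<in> borel_measurable (path_space E)"
      by (rule measurable_compose[OF mk qm[OF that(2)]])
    show ?thesis unfolding z_def add_Suc by measurable
  qed
  have zb: "\<bar>z F G p\<bar> \<le> 1" for F G p
    using q01[of G "p k"] by (auto simp: z_def split: split_indicator)
  have mY[measurable]: "(\<lambda>\<omega>. restrict (X \<omega>) {..k}) \<in> measurable M ?N" using X_measurable by (rule measurable_path_restrict)
  have mA[measurable]: "(\<lambda>\<omega> n. X \<omega> (Suc (k + n))) \<in> measurable M (path_space E)" using X_measurable by (rule measurable_path_shift)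
  have mB[measurable]: "(\<lambda>\<omega> n. Xk k \<omega> (Suc (k + n))) \<in> measurable M (path_space E)" using Xk_measurable by (rule measurable_path_shift)
  have mq[measurable]: "(\<lambda>\<omega>. q G (X \<omega> k)) \<in> borel_measurable M" if "G \<in> sets (path_space E)" for G
    using that by (rule measurable_compose[OF measurable_X qm])
  have zint: "integrable M (\<lambda>\<omega>. z F G (X \<omega>) * z F' H (Xk k \<omega>))"
    if "F \<in> sets ?N" "F' \<in> sets ?N" "G \<in> sets (path_space E)" "H \<in> sets (path_space E)" for F F' G H
    by (rule bounded_integrable[where B=1])
       (use zb that in \<open>auto simp: abs_mult intro!: mult_le_one borel_measurable_times measurable_compose[OF X_measurable zm] measurable_compose[OF Xk_measurable zm]\<close>)
  have pull: "(\<integral>\<omega>. indicator F (restrict (X \<omega>) {..k}) * q H (X \<omega> k) * indicator G (\<lambda>n. X \<omega> (Suc k + n)) \<partial>M)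
        = (\<integral>\<omega>. indicator F (restrict (X \<omega>) {..k}) * (q G (X \<omega> k) * q H (X \<omega> k)) \<partial>M)" (is ?t1)
    "(\<integral>\<omega>. indicator F (restrict (X \<omega>) {..k}) * q H (X \<omega> k) * indicator G (\<lambda>n. Xk k \<omega> (Suc k + n)) \<partial>M)
        = (\<integral>\<omega>. indicator F (restrict (X \<omega>) {..k}) * (q G (X \<omega> k) * q H (X \<omega> k)) \<partial>M)" (is ?t2)
    if [measurable]: "F \<in> sets ?N" and G: "G \<in> sets (path_space E)" and H: "H \<in> sets (path_space E)" for F G H
  proof -
    let ?u = "\<lambda>y. indicator F y * q H (y k)"
    have [measurable]: "(\<lambda>y. q H (y k)) \<in> borel_measurable ?N"
      by (rule measurable_compose[OF mkN qm[OF H]])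
    have u: "?u \<in> borel_measurable ?N" "\<And>y. 0 \<le> ?u y" "\<And>y. ?u y \<le> 1"
      using q01 by (auto intro: mult_le_one)
    have e: "(\<integral>\<omega>. ?u (restrict (X \<omega>) {..k}) * measure (future_law E P (X \<omega> k)) G \<partial>M)
       = (\<integral>\<omega>. indicator F (restrict (X \<omega>) {..k}) * (q G (X \<omega> k) * q H (X \<omega> k)) \<partial>M)"
      by (intro Bochner_Integration.integral_cong) (auto simp: qe X_space)
    show ?t1 using future_given_past[OF u G] unfolding e by simp
    show ?t2 using future_Xk_given_past[OF u G] unfolding e by simp
  qed
  \<comment> \<open>In the expanded product each mixed term reduces to the product term by the
    Markov property of a single line, which leaves joint minus product. The squared indicator of F
    is the indicator itself.\<close>
  have DJ: "D F G H = J F G H" if [measurable]: "F \<in> sets ?N" and G[measurable]: "G \<in> sets (path_space E)" and H[measurable]: "H \<in> sets (path_space E)" for F G H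
  proof -
    let ?F = "\<lambda>\<omega>. indicator F (restrict (X \<omega>) {..k}) :: real" and ?A = "\<lambda>\<omega>. indicator G (\<lambda>n. X \<omega> (Suc k + n)) :: real"
      and ?B = "\<lambda>\<omega>. indicator H (\<lambda>n. Xk k \<omega> (Suc k + n)) :: real"
    let ?g = "\<lambda>\<omega>. q G (X \<omega> k)" and ?h = "\<lambda>\<omega>. q H (X \<omega> k)"
    have [measurable]: "?F \<in> borel_measurable M" "?A \<in> borel_measurable M" "?B \<in> borel_measurable M" by auto
    have int1: "integrable M (\<lambda>\<omega>. ?F \<omega> * (?A \<omega> * ?B \<omega>))"
      by (rule bounded_integrable[where B=1], measurable) (simp split: split_indicator)
    have int2: "integrable M (\<lambda>\<omega>. ?F \<omega> * ?h \<omega> * ?A \<omega>)"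
      by (rule bounded_integrable[where B=1], measurable) (simp add: q01 split: split_indicator)
    have int3: "integrable M (\<lambda>\<omega>. ?F \<omega> * ?g \<omega> * ?B \<omega>)"
      by (rule bounded_integrable[where B=1], measurable) (simp add: q01 split: split_indicator)
    have int4: "integrable M (\<lambda>\<omega>. ?F \<omega> * (?g \<omega> * ?h \<omega>))"
      by (rule bounded_integrable[where B=1], measurable) (simp add: q01 abs_mult mult_le_one split: split_indicator)
    note int = int1 int2 int3 int4
    have "D F G H = (\<integral>\<omega>. ?F \<omega> * (?A \<omega> * ?B \<omega>) - ?F \<omega> * ?h \<omega> * ?A \<omega> - ?F \<omega> * ?g \<omega> * ?B \<omega> + ?F \<omega> * (?g \<omega> * ?h \<omega>) \<partial>M)"
      unfolding D_def
    proof (rule integral_cong_AE)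
      show "AE \<omega> in M. z F G (X \<omega>) * z F H (Xk k \<omega>) = ?F \<omega> * (?A \<omega> * ?B \<omega>) - ?F \<omega> * ?h \<omega> * ?A \<omega> - ?F \<omega> * ?g \<omega> * ?B \<omega> + ?F \<omega> * (?g \<omega> * ?h \<omega>)"
        using Xk_eq[of k]
      proof eventually_elim
        case (elim \<omega>)
        then have "restrict (Xk k \<omega>) {..k} = restrict (X \<omega>) {..k}" by (auto simp: restrict_def)
        moreover have "?F \<omega> * ?F \<omega> = ?F \<omega>" by (simp split: split_indicator)
        ultimately show ?case
          using elim unfolding z_def by (simp add: algebra_simps) (auto split: split_indicator)
      qed
    qed (use zint[OF that(1) that(1) G H] int in \<open>auto intro: borel_measurable_integrable\<close>)
    also have "\<dots> = (\<integral>\<omega>. ?F \<omega> * (?A \<omega> * ?B \<omega>) \<partial>M) - (\<integral>\<omega>. ?F \<omega> * ?h \<omega> * ?A \<omega> \<partial>M) - (\<integral>\<omega>. ?F \<omega> * ?g \<omega> * ?B \<omega> \<partial>M) + (\<integral>\<omega>. ?F \<omega> * (?g \<omega> * ?h \<omega>) \<partial>M)"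
      using int by (simp only: Bochner_Integration.integral_add Bochner_Integration.integral_diff Bochner_Integration.integrable_add Bochner_Integration.integrable_diff)
    also have "\<dots> = J F G H"
      using pull(1)[OF that(1) G H] pull(2)[OF that(1) H G] unfolding J_def by (simp add: mult.commute)
    finally show ?thesis .
  qed
  \<comment> \<open>Over F and its complement together the past event disappears, and what remains
    is \<open>futures_uncorrelated\<close>.\<close>
  have J_compl: "J F G H + J (space ?N - F) G H = 0"
    if [measurable]: "F \<in> sets ?N" "G \<in> sets (path_space E)" "H \<in> sets (path_space E)" for F G H
  proof -
    have split: "(\<integral>\<omega>. indicator F (restrict (X \<omega>) {..k}) * f \<omega> \<partial>M) + (\<integral>\<omega>. indicator (space ?N - F) (restrict (X \<omega>) {..k}) * f \<omega> \<partial>M) = (\<integral>\<omega>. f \<omega> \<partial>M)"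
      if [measurable]: "f \<in> borel_measurable M" and fb: "\<And>\<omega>. \<bar>f \<omega>\<bar> \<le> 1" for f :: "_ \<Rightarrow> real"
    proof -
      have "integrable M (\<lambda>\<omega>. indicator F' (restrict (X \<omega>) {..k}) * f \<omega>)" if [measurable]: "F' \<in> sets ?N" for F'
        by (rule bounded_integrable[where B=1]) (use fb in \<open>auto split: split_indicator\<close>)
      then have "(\<integral>\<omega>. indicator F (restrict (X \<omega>) {..k}) * f \<omega> \<partial>M) + (\<integral>\<omega>. indicator (space ?N - F) (restrict (X \<omega>) {..k}) * f \<omega> \<partial>M)
        = (\<integral>\<omega>. indicator F (restrict (X \<omega>) {..k}) * f \<omega> + indicator (space ?N - F) (restrict (X \<omega>) {..k}) * f \<omega> \<partial>M)"
        by (intro Bochner_Integration.integral_add[symmetric]) auto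
      also have "\<dots> = (\<integral>\<omega>. f \<omega> \<partial>M)"
        using measurable_space[OF mY] by (intro Bochner_Integration.integral_cong) (auto split: split_indicator)
      finally show ?thesis .
    qed
    have "(\<integral>\<omega>. indicator G (\<lambda>n. X \<omega> (Suc k + n)) * indicator H (\<lambda>n. Xk k \<omega> (Suc k + n)) \<partial>M) = (\<integral>\<omega>. q G (X \<omega> k) * q H (X \<omega> k) \<partial>M)"
      using futures_uncorrelated[of G H k] by (simp add: qe X_space cong: Bochner_Integration.integral_cong)
    moreover have "\<bar>q G x * q H x\<bar> \<le> 1" for x using q01 by (simp add: abs_mult mult_le_one)
    moreover have "\<bar>indicator G a * indicator H b :: real\<bar> \<le> 1" for a b by (simp split: split_indicator)
    ultimately show ?thesis
      using split[of "\<lambda>\<omega>. indicator G (\<lambda>n. X \<omega> (Suc k + n)) * indicator H (\<lambda>n. Xk k \<omega> (Suc k + n))"]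
        split[of "\<lambda>\<omega>. q G (X \<omega> k) * q H (X \<omega> k)"] unfolding J_def by simp
  qed
  have D_compl: "D F G H + D (space ?N - F) G H = 0"
    if "F \<in> sets ?N" "G \<in> sets (path_space E)" "H \<in> sets (path_space E)" for F G H
    using J_compl[OF that] DJ[OF that] DJ[of "space ?N - F" G H] that by auto
  have D_nonneg: "0 \<le> D F G G" if "F \<in> sets ?N" "G \<in> sets (path_space E)" for F G
    unfolding D_def by (rule pair_positive[OF zm[OF that] zb])
  have D0: "D F G G = 0" if "F \<in> sets ?N" "G \<in> sets (path_space E)" for F G
    using D_nonneg[OF that] D_nonneg[of "space ?N - F" G] D_compl[OF that that(2)] that by auto
  have D_sym: "D F G H = D F H G"
    if "F \<in> sets ?N" "G \<in> sets (path_space E)" "H \<in> sets (path_space E)" for F G H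
    unfolding D_def by (rule pair_symmetric) (use zm that in auto)
  \<comment> \<open>Polarisation: with both diagonal terms equal to 0, positivity for the sum leaves
    twice the mixed term.\<close>
  have D_pos: "0 \<le> D F G H" if "F \<in> sets ?N" "G \<in> sets (path_space E)" "H \<in> sets (path_space E)" for F G H
  proof -
    let ?z = "\<lambda>p. z F G p + z F H p"
    have "0 \<le> (\<integral>\<omega>. ?z (X \<omega>) * ?z (Xk k \<omega>) \<partial>M)"
    proof (rule pair_positive[where B=2])
      show "?z \<in> borel_measurable (path_space E)" using zm that by auto
      show "\<bar>?z p\<bar> \<le> 2" for p using zb[of F G p] zb[of F H p] by linarith
    qed
    also have "\<dots> = D F G G + D F G H + (D F H G + D F H H)"
      unfolding D_def using that by (simp add: distrib_left distrib_right zint Bochner_Integration.integral_add)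
    finally show ?thesis using D0 D_sym that by simp
  qed
  have "D F G H = 0"
    using D_pos[OF F G H] D_pos[of "space ?N - F" G H] D_compl[OF F G H] by auto
  then have "J F G H = 0" using DJ[OF F G H] by simp
  then show ?thesis unfolding J_def by (simp add: qe X_space cong: Bochner_Integration.integral_cong)
qed

lemma pair_future_kernel:
  "(\<lambda>x. future_law E P x \<Otimes>\<^sub>M future_law E P x) \<in> measurable E (prob_algebra (path_space E \<Otimes>\<^sub>M path_space E))"
proof (rule measurable_prob_algebraI)
  fix x assume x: "x \<in> space E"
  interpret p: prob_space "future_law E P x" by (rule prob_space_future_law[OF x])
  interpret pp: pair_prob_space "future_law E P x" "future_law E P x" ..
  show "prob_space (future_law E P x \<Otimes>\<^sub>M future_law E P x)" by (rule pp.prob_space_axioms)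
next
  note K = measurable_prob_algebraD[OF future_law_measurable[OF kernel]]
  show "(\<lambda>x. future_law E P x \<Otimes>\<^sub>M future_law E P x) \<in> measurable E (subprob_algebra (path_space E \<Otimes>\<^sub>M path_space E))"
    by (rule measurable_pair_measure[OF K K])
qed

text \<open>From here on the two lines can be treated as two independent draws from
  \<open>future_law\<close> after their common past.\<close>

theorem joint_futures_given_past:
  assumes h[measurable]: "h \<in> borel_measurable ((\<Pi>\<^sub>M j\<in>{..k}. E) \<Otimes>\<^sub>M (path_space E \<Otimes>\<^sub>M path_space E))"
  shows "(\<integral>\<^sup>+\<omega>. h (restrict (X \<omega>) {..k}, (\<lambda>n. X \<omega> (Suc k + n), \<lambda>n. Xk k \<omega> (Suc k + n))) \<partial>M)
       = (\<integral>\<^sup>+\<omega>. \<integral>\<^sup>+z. h (restrict (X \<omega>) {..k}, z) \<partial>(future_law E P (X \<omega> k) \<Otimes>\<^sub>M future_law E P (X \<omega> k)) \<partial>M)"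
proof -
  let ?N = "\<Pi>\<^sub>M j\<in>{..k}. E" and ?Q = "path_space E \<Otimes>\<^sub>M path_space E"
  let ?Y = "\<lambda>\<omega>. restrict (X \<omega>) {..k}" and ?Z = "\<lambda>\<omega>. (\<lambda>n. X \<omega> (Suc k + n), \<lambda>n. Xk k \<omega> (Suc k + n))"
  let ?f = "\<lambda>x. future_law E P x \<Otimes>\<^sub>M future_law E P x"
  have Y[measurable]: "?Y \<in> measurable M ?N" using X_measurable by (rule measurable_path_restrict)
  have mA: "(\<lambda>\<omega> n. X \<omega> (Suc k + n)) \<in> measurable M (path_space E)" using X_measurable by (rule measurable_path_shift)
  have mB: "(\<lambda>\<omega> n. Xk k \<omega> (Suc k + n)) \<in> measurable M (path_space E)" using Xk_measurable by (rule measurable_path_shift)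
  have Z: "?Z \<in> measurable M ?Q" using mA mB by (rule measurable_Pair)
  have mkN: "(\<lambda>y. y k) \<in> measurable ?N E" by measurable
  have K: "(\<lambda>y. ?f (y k)) \<in> measurable ?N (prob_algebra ?Q)"
    by (rule measurable_compose[OF mkN pair_future_kernel])
  have "(\<integral>\<^sup>+\<omega>. h (?Y \<omega>, ?Z \<omega>) \<partial>M) = (\<integral>\<^sup>+\<omega>. \<integral>\<^sup>+z. h (?Y \<omega>, z) \<partial>?f (?Y \<omega> k) \<partial>M)"
  proof (rule nn_integral_disintegration[OF prob_space_axioms Y Z K _ h])
    fix A B assume A: "A \<in> sets ?N" and B: "B \<in> sets ?Q"
    let ?G = "{a \<times> b | a b. a \<in> sets (path_space E) \<and> b \<in> sets (path_space E)}"
    show "(\<integral>\<^sup>+\<omega>. indicator A (?Y \<omega>) * indicator B (?Z \<omega>) \<partial>M) = (\<integral>\<^sup>+\<omega>. indicator A (?Y \<omega>) * emeasure (?f (?Y \<omega> k)) B \<partial>M)"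
    proof (rule kernel_rectangle_extend[OF prob_space_axioms Y Z measurable_prob_algebraD[OF K] Int_stable_pair_measure_generator _ _ A _ B])
      show "sets ?Q = sigma_sets (space ?Q) ?G" by (simp add: sets_pair_measure space_pair_measure)
      show "space ?Q \<in> ?G" by (auto simp: space_pair_measure)
      fix B assume "B \<in> ?G"
      then obtain G H where B: "B = G \<times> H" and G: "G \<in> sets (path_space E)" and H: "H \<in> sets (path_space E)" by auto
      let ?r = "\<lambda>G \<omega>. measure (future_law E P (X \<omega> k)) G"
      have rm: "?r G \<in> borel_measurable M" if "G \<in> sets (path_space E)" for G
        using that by (rule measurable_compose[OF measurable_X future_law_measure_measurable])
      have r01: "0 \<le> ?r G \<omega>" "?r G \<omega> \<le> 1" if "\<omega> \<in> space M" for \<omega> G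
        using prob_space.prob_le_1[OF prob_space_future_law[OF X_space[OF that]]] by auto
      have iA: "(\<lambda>\<omega>. indicator A (?Y \<omega>) :: real) \<in> borel_measurable M"
        by (rule measurable_compose[OF Y]) (use A in simp)
      have i1: "(\<lambda>\<omega>. indicator G (\<lambda>n. X \<omega> (Suc k + n)) :: real) \<in> borel_measurable M"
        by (rule measurable_compose[OF mA]) (use G in simp)
      have i2: "(\<lambda>\<omega>. indicator H (\<lambda>n. Xk k \<omega> (Suc k + n)) :: real) \<in> borel_measurable M"
        by (rule measurable_compose[OF mB]) (use H in simp)
      have "(\<integral>\<^sup>+\<omega>. indicator A (?Y \<omega>) * indicator B (?Z \<omega>) \<partial>M)
         = (\<integral>\<^sup>+\<omega>. ennreal (indicator A (?Y \<omega>) * (indicator G (\<lambda>n. X \<omega> (Suc k + n)) * indicator H (\<lambda>n. Xk k \<omega> (Suc k + n)))) \<partial>M)"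
        by (intro nn_integral_cong) (simp add: B split: split_indicator)
      also have "\<dots> = ennreal (\<integral>\<omega>. indicator A (?Y \<omega>) * (indicator G (\<lambda>n. X \<omega> (Suc k + n)) * indicator H (\<lambda>n. Xk k \<omega> (Suc k + n))) \<partial>M)"
      proof (intro nn_integral_eq_integral bounded_integrable[where B=1] borel_measurable_times iA i1 i2)
        show "\<bar>indicator A (?Y \<omega>) * (indicator G (\<lambda>n. X \<omega> (Suc k + n)) * indicator H (\<lambda>n. Xk k \<omega> (Suc k + n)))\<bar> \<le> (1::real)" for \<omega>
          by (simp split: split_indicator)
      qed simp
      also have "\<dots> = ennreal (\<integral>\<omega>. indicator A (?Y \<omega>) * (?r G \<omega> * ?r H \<omega>) \<partial>M)"
        by (simp only: futures_given_past_rectangle[OF A G H])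
      also have "\<dots> = (\<integral>\<^sup>+\<omega>. ennreal (indicator A (?Y \<omega>) * (?r G \<omega> * ?r H \<omega>)) \<partial>M)"
      proof (intro nn_integral_eq_integral[symmetric] bounded_integrable[where B=1] borel_measurable_times iA rm G H)
        fix \<omega> assume \<omega>: "\<omega> \<in> space M"
        show "\<bar>indicator A (?Y \<omega>) * (?r G \<omega> * ?r H \<omega>)\<bar> \<le> 1"
          using r01[OF \<omega>] by (simp add: abs_mult mult_le_one split: split_indicator)
      qed simp
      also have "\<dots> = (\<integral>\<^sup>+\<omega>. indicator A (?Y \<omega>) * emeasure (?f (?Y \<omega> k)) B \<partial>M)"
      proof (rule nn_integral_cong)
        fix \<omega> assume \<omega>: "\<omega> \<in> space M"
        note x = X_space[OF \<omega>, of k]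
        interpret p: prob_space "future_law E P (X \<omega> k)" by (rule prob_space_future_law[OF x])
        have "emeasure (?f (X \<omega> k)) B = emeasure (future_law E P (X \<omega> k)) G * emeasure (future_law E P (X \<omega> k)) H"
          unfolding B by (rule p.emeasure_pair_measure_Times) (simp_all add: sets_future_law[OF x] G H)
        also have "\<dots> = ennreal (?r G \<omega> * ?r H \<omega>)" by (simp add: p.emeasure_eq_measure ennreal_mult)
        finally show "ennreal (indicator A (?Y \<omega>) * (?r G \<omega> * ?r H \<omega>)) = indicator A (?Y \<omega>) * emeasure (?f (?Y \<omega> k)) B"
          by (simp split: split_indicator)
      qed
      finally show "(\<integral>\<^sup>+\<omega>. indicator A (?Y \<omega>) * indicator B (?Z \<omega>) \<partial>M) = (\<integral>\<^sup>+\<omega>. indicator A (?Y \<omega>) * emeasure (?f (?Y \<omega> k)) B \<partial>M)" .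
    qed
  qed
  then show ?thesis by simp
qed

end

section \<open>Sums over pairs of labels\<close>

text \<open>Sums over labels are integrals for counting measure on a countable type, so Tonelli's
  theorem exchanges them with one another and with expectations without any summability
  condition.\<close>

abbreviation nsum :: "('i::countable \<Rightarrow> ennreal) \<Rightarrow> ennreal" where
  "nsum f \<equiv> (\<integral>\<^sup>+i. f i \<partial>count_space UNIV)"

lemma nsum_swap:
  fixes f :: "'i::countable \<Rightarrow> 'j::countable \<Rightarrow> ennreal"
  shows "nsum (\<lambda>i. nsum (f i)) = nsum (\<lambda>j. nsum (\<lambda>i. f i j))"
  by (rule nn_integral_count_space_nn_integral) auto

lemma nsum_prod:
  fixes f :: "'i::countable \<times> 'j::countable \<Rightarrow> ennreal"
  shows "nsum f = nsum (\<lambda>i. nsum (\<lambda>j. f (i, j)))"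
  by (rule nn_integral_fst_count_space[symmetric])

lemma nsum_cmult: "nsum (\<lambda>i. c * f i) = c * nsum f" for f :: "'i::countable \<Rightarrow> ennreal"
  by (rule nn_integral_cmult) simp

lemma nsum_multc: "nsum (\<lambda>i. f i * c) = nsum f * c" for f :: "'i::countable \<Rightarrow> ennreal"
  by (rule nn_integral_multc) simp

lemma nsum_add: "nsum (\<lambda>i. f i + g i) = nsum f + nsum g" for f :: "'i::countable \<Rightarrow> ennreal"
  by (rule nn_integral_add) auto

lemma nsum_list:
  fixes h :: "nat list \<Rightarrow> ennreal"
  shows "nsum h = h [] + nsum (\<lambda>i. nsum (\<lambda>x. h (i # x)))"
proof -
  have "nsum h = nsum (\<lambda>x. h x * indicator {[]} x + h x * indicator (- {[]}) x)"
    by (intro nn_integral_cong) (auto split: split_indicator)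
  also have "\<dots> = nsum (\<lambda>x. h x * indicator {[]} x) + nsum (\<lambda>x. h x * indicator (- {[]}) x)"
    by (rule nsum_add)
  also have "nsum (\<lambda>x. h x * indicator {[]} x) = h []"
    by simp
  also have "nsum (\<lambda>x. h x * indicator (- {[]}) x) = (\<integral>\<^sup>+x. h x \<partial>count_space (- {[]}))"
    by (rule nn_integral_count_space_indicator[symmetric]) simp
  also have "\<dots> = nsum (\<lambda>z. h (case_prod (#) z))"
    by (rule nn_integral_bij_count_space[symmetric]) (auto simp: bij_betw_def inj_on_def image_def neq_Nil_conv)
  also have "\<dots> = nsum (\<lambda>i. nsum (\<lambda>x. h (i # x)))" by (simp add: nsum_prod)
  finally show ?thesis .
qed

text \<open>The lists of length n have total weight equal to the n-th power of the total weight of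
  one letter. With \<open>child_prob\<close> as weight this turns a sum over labels into a sum over
  generations with factor \<kappa>1 to the power n.\<close>

lemma nsum_list_weight:
  fixes r :: "nat \<Rightarrow> ennreal" and \<phi> :: "nat \<Rightarrow> ennreal"
  shows "nsum (\<lambda>x. prod_list (map r x) * \<phi> (length x)) = (\<Sum>n. nsum r ^ n * \<phi> n)"
proof -
  have c: "nsum (\<lambda>x. prod_list (map r x) * indicator {n} (length x)) = nsum r ^ n" for n
  proof (induction n)
    case 0
    have "nsum (\<lambda>i. nsum (\<lambda>x. prod_list (map r (i # x)) * indicator {0} (length (i # x)))) = 0"
      by simp
    then show ?case by (subst nsum_list) simp
  next
    case (Suc n)
    have "nsum (\<lambda>x. prod_list (map r x) * indicator {Suc n} (length x))
        = nsum (\<lambda>i. nsum (\<lambda>x. r i * (prod_list (map r x) * indicator {n} (length x))))"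
      by (subst nsum_list) (auto intro!: nn_integral_cong simp: mult.assoc split: split_indicator)
    also have "\<dots> = nsum r * nsum r ^ n" by (simp add: nsum_cmult nsum_multc Suc.IH)
    finally show ?case by simp
  qed
  have "nsum (\<lambda>x. prod_list (map r x) * \<phi> (length x))
      = nsum (\<lambda>x. nsum (\<lambda>n. prod_list (map r x) * indicator {n} (length x) * \<phi> n))"
  proof (rule nn_integral_cong)
    fix x :: "nat list"
    have "nsum (\<lambda>n. prod_list (map r x) * indicator {n} (length x) * \<phi> n) = nsum (\<lambda>n. (prod_list (map r x) * \<phi> n) * indicator {length x} n)"
      by (intro nn_integral_cong) (auto split: split_indicator)
    also have "\<dots> = prod_list (map r x) * \<phi> (length x)" by simp
    finally show "prod_list (map r x) * \<phi> (length x) = nsum (\<lambda>n. prod_list (map r x) * indicator {n} (length x) * \<phi> n)" by simp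
  qed
  also have "\<dots> = nsum (\<lambda>n. nsum (\<lambda>x. prod_list (map r x) * indicator {n} (length x) * \<phi> n))" by (rule nsum_swap)
  also have "\<dots> = nsum (\<lambda>n. nsum r ^ n * \<phi> n)" by (simp add: nsum_multc c)
  finally show ?thesis by (simp add: nn_integral_count_space_nat)
qed

text \<open>The longest common prefix u cuts a pair uniquely into u and two tails that are empty or
  begin differently; the four summands are the cases of empty and nonempty tails. Equal first
  letters are coded as zero terms so that every sum runs over a whole type.\<close>

lemma nsum_pairs_split:
  fixes g :: "nat list \<Rightarrow> nat list \<Rightarrow> ennreal"
  shows "nsum (\<lambda>v. nsum (\<lambda>w. g v w)) = nsum (\<lambda>u. g u u
    + nsum (\<lambda>i. nsum (\<lambda>x. g (u @ i # x) u)) + nsum (\<lambda>j. nsum (\<lambda>y. g u (u @ j # y)))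
    + nsum (\<lambda>i. nsum (\<lambda>j. nsum (\<lambda>x. nsum (\<lambda>y. (if i = j then 0 else g (u @ i # x) (u @ j # y)))))))"
proof -
  define Z where "Z = {(u :: nat list, x :: nat list, y :: nat list). x = [] \<or> y = [] \<or> hd x \<noteq> hd y}"
  define F where "F = (\<lambda>(u :: nat list, x, y). (u @ x, u @ y))"
  \<comment> \<open>If the prefixes had different lengths, the longer one would make both tails of
    the shorter begin with the same letter.\<close>
  have inj: "u = u' \<and> x = x' \<and> y = y'" if "(u, x, y) \<in> Z" "(u', x', y') \<in> Z" "u @ x = u' @ x'" "u @ y = u' @ y'" for u x y u' x' y'
    using that
  proof (induction u arbitrary: u')
    case Nil
    show ?case
    proof (cases u')
      case (Cons a u'')
      then have "x = a # (u'' @ x')" "y = a # (u'' @ y')" using Nil.prems by auto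
      then show ?thesis using Nil.prems(1) by (simp add: Z_def)
    qed (use Nil in auto)
  next
    case (Cons a u)
    show ?case
    proof (cases u')
      case Nil
      then have "x' = a # (u @ x)" "y' = a # (u @ y)" using Cons.prems by auto
      then show ?thesis using Cons.prems(2) by (simp add: Z_def)
    next
      case (Cons b u'')
      then show ?thesis using Cons.prems Cons.IH[of u''] by (auto simp: Z_def)
    qed
  qed
  have "bij_betw F Z UNIV"
    unfolding bij_betw_def
  proof
    show "inj_on F Z"
      by (rule inj_onI) (use inj in \<open>auto simp: F_def\<close>)
    show "F ` Z = UNIV"
    proof (rule set_eqI, simp, safe)
      fix v w :: "nat list"
      obtain ps xs ys where "v = ps @ xs" "w = ps @ ys" "xs = [] \<or> ys = [] \<or> hd xs \<noteq> hd ys"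
        using longest_common_prefix[of v w] by blast
      then show "(v, w) \<in> F ` Z" by (intro image_eqI[of _ _ "(ps, xs, ys)"]) (auto simp: F_def Z_def)
    qed
  qed
  then have "nsum (\<lambda>p. g (fst p) (snd p)) = (\<integral>\<^sup>+z. g (fst (F z)) (snd (F z)) \<partial>count_space Z)"
    by (rule nn_integral_bij_count_space[symmetric])
  also have "\<dots> = nsum (\<lambda>z. g (fst (F z)) (snd (F z)) * indicator Z z)"
    by (rule nn_integral_count_space_indicator) simp
  also have "\<dots> = nsum (\<lambda>u. nsum (\<lambda>x. nsum (\<lambda>y. g (u @ x) (u @ y) * indicator Z (u, x, y))))"
    by (simp add: nsum_prod F_def)
  also have "\<dots> = nsum (\<lambda>u. g u u + nsum (\<lambda>i. nsum (\<lambda>x. g (u @ i # x) u)) + nsum (\<lambda>j. nsum (\<lambda>y. g u (u @ j # y)))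
    + nsum (\<lambda>i. nsum (\<lambda>j. nsum (\<lambda>x. nsum (\<lambda>y. (if i = j then 0 else g (u @ i # x) (u @ j # y)))))))"
  proof (rule nn_integral_cong)
    fix u
    let ?h = "\<lambda>x y. g (u @ x) (u @ y) * indicator Z (u, x, y)"
    have "nsum (\<lambda>x. nsum (?h x)) = nsum (?h []) + nsum (\<lambda>i. nsum (\<lambda>x. nsum (?h (i # x))))" by (rule nsum_list)
    also have "nsum (?h []) = g u u + nsum (\<lambda>j. nsum (\<lambda>y. g u (u @ j # y)))"
      by (subst nsum_list) (simp add: Z_def)
    also have "nsum (\<lambda>i. nsum (\<lambda>x. nsum (?h (i # x)))) = nsum (\<lambda>i. nsum (\<lambda>x. g (u @ i # x) u + nsum (\<lambda>j. nsum (\<lambda>y. if i = j then 0 else g (u @ i # x) (u @ j # y)))))"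
    proof (intro nn_integral_cong)
      fix i x
      have "nsum (?h (i # x)) = ?h (i # x) [] + nsum (\<lambda>j. nsum (\<lambda>y. ?h (i # x) (j # y)))" by (rule nsum_list)
      also have "?h (i # x) [] = g (u @ i # x) u" by (simp add: Z_def)
      also have "nsum (\<lambda>j. nsum (\<lambda>y. ?h (i # x) (j # y))) = nsum (\<lambda>j. nsum (\<lambda>y. if i = j then 0 else g (u @ i # x) (u @ j # y)))"
        by (intro nn_integral_cong) (simp add: Z_def)
      finally show "nsum (?h (i # x)) = g (u @ i # x) u + nsum (\<lambda>j. nsum (\<lambda>y. if i = j then 0 else g (u @ i # x) (u @ j # y)))" .
    qed
    also have "\<dots> = nsum (\<lambda>i. nsum (\<lambda>x. g (u @ i # x) u)) + nsum (\<lambda>i. nsum (\<lambda>x. nsum (\<lambda>j. nsum (\<lambda>y. if i = j then 0 else g (u @ i # x) (u @ j # y)))))"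
      by (simp add: nsum_add)
    also have "nsum (\<lambda>i. nsum (\<lambda>x. nsum (\<lambda>j. nsum (\<lambda>y. if i = j then 0 else g (u @ i # x) (u @ j # y)))))
      = nsum (\<lambda>i. nsum (\<lambda>j. nsum (\<lambda>x. nsum (\<lambda>y. if i = j then 0 else g (u @ i # x) (u @ j # y)))))"
      by (intro nn_integral_cong nsum_swap)
    finally show "nsum (\<lambda>x. nsum (?h x)) = g u u + nsum (\<lambda>i. nsum (\<lambda>x. g (u @ i # x) u)) + nsum (\<lambda>j. nsum (\<lambda>y. g u (u @ j # y)))
    + nsum (\<lambda>i. nsum (\<lambda>j. nsum (\<lambda>x. nsum (\<lambda>y. (if i = j then 0 else g (u @ i # x) (u @ j # y))))))"
      by (simp add: ac_simps)
  qed
  finally show ?thesis by (simp add: nsum_prod)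
qed

section \<open>Factorisation of expectations over the cells of two lines\<close>

lemma (in prob_space) indep_var_nn_integral_mult:
  assumes "indep_var S A N B" and \<phi>[measurable]: "\<phi> \<in> borel_measurable S" and \<psi>[measurable]: "\<psi> \<in> borel_measurable N"
  shows "(\<integral>\<^sup>+\<omega>. \<phi> (A \<omega>) * \<psi> (B \<omega>) \<partial>M) = (\<integral>\<^sup>+\<omega>. \<phi> (A \<omega>) \<partial>M) * (\<integral>\<^sup>+\<omega>. \<psi> (B \<omega>) \<partial>M)"
proof -
  from assms(1)[unfolded indep_var_distribution_eq]
  have [measurable]: "A \<in> measurable M S" "B \<in> measurable M N"
    and eq: "distr M S A \<Otimes>\<^sub>M distr M N B = distr M (S \<Otimes>\<^sub>M N) (\<lambda>x. (A x, B x))" by auto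
  interpret D: prob_space "distr M N B" by (rule prob_space_distr) simp
  have "(\<integral>\<^sup>+\<omega>. \<phi> (A \<omega>) * \<psi> (B \<omega>) \<partial>M) = (\<integral>\<^sup>+z. \<phi> (fst z) * \<psi> (snd z) \<partial>distr M (S \<Otimes>\<^sub>M N) (\<lambda>x. (A x, B x)))"
    by (subst nn_integral_distr) auto
  also have "\<dots> = (\<integral>\<^sup>+a. \<integral>\<^sup>+b. \<phi> a * \<psi> b \<partial>distr M N B \<partial>distr M S A)"
    unfolding eq[symmetric] by (subst D.nn_integral_fst[symmetric]) auto
  also have "\<dots> = (\<integral>\<^sup>+\<omega>. \<phi> (A \<omega>) \<partial>M) * (\<integral>\<^sup>+\<omega>. \<psi> (B \<omega>) \<partial>M)"
    by (simp add: nn_integral_cmult nn_integral_multc nn_integral_distr)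
  finally show ?thesis .
qed

context markov_independence
begin

lemma kappa_law:
  fixes a :: "nat \<Rightarrow> ennreal"
  shows "(\<integral>\<^sup>+\<omega>. a (\<kappa> (X \<omega> n)) \<partial>M) = (\<integral>\<^sup>+\<omega>. a (\<kappa> (X \<omega> 0)) \<partial>M)"
    and "(\<integral>\<^sup>+\<omega>. a (\<kappa> (Xk k \<omega> n)) \<partial>M) = (\<integral>\<^sup>+\<omega>. a (\<kappa> (X \<omega> 0)) \<partial>M)"
proof -
  have [measurable]: "(\<lambda>\<omega>. \<kappa> (X \<omega> n)) \<in> measurable M (count_space UNIV)" for n
    by (rule measurable_compose[OF measurable_X kappa_measurable])
  have am: "a \<in> borel_measurable (count_space UNIV)" by simp
  have d: "(\<integral>\<^sup>+\<omega>. a (\<kappa> (X \<omega> n)) \<partial>M) = (\<integral>\<^sup>+j. a j \<partial>distr M (count_space UNIV) (\<lambda>\<omega>. \<kappa> (X \<omega> n)))" for n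
    by (subst nn_integral_distr) auto
  show 1: "(\<integral>\<^sup>+\<omega>. a (\<kappa> (X \<omega> n)) \<partial>M) = (\<integral>\<^sup>+\<omega>. a (\<kappa> (X \<omega> 0)) \<partial>M)"
    unfolding d[of n] d[of 0] kappa_ident[of n] ..
  have m: "(\<lambda>p. a (\<kappa> (p n))) \<in> borel_measurable (path_space E)"
  proof -
    have "(\<lambda>p. p n) \<in> measurable (path_space E) E" by (rule measurable_path_component) measurable
    from measurable_compose[OF this measurable_compose[OF kappa_measurable am]] show ?thesis .
  qed
  have "(\<integral>\<^sup>+\<omega>. a (\<kappa> (Xk k \<omega> n)) \<partial>M) = (\<integral>\<^sup>+p. a (\<kappa> (p n)) \<partial>distr M (path_space E) (Xk k))"
    by (subst nn_integral_distr[OF Xk_measurable]) (simp_all add: m)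
  also have "\<dots> = (\<integral>\<^sup>+\<omega>. a (\<kappa> (X \<omega> n)) \<partial>M)"
    unfolding Xk_law by (subst nn_integral_distr[OF X_measurable]) (simp_all add: m)
  finally show "(\<integral>\<^sup>+\<omega>. a (\<kappa> (Xk k \<omega> n)) \<partial>M) = (\<integral>\<^sup>+\<omega>. a (\<kappa> (X \<omega> 0)) \<partial>M)" using 1 by simp
qed

text \<open>Two independences are combined: the offspring numbers are independent of all lifetimes,
  and they are independent among themselves. All have the law of
  \<open>\<kappa> (X \<omega> 0)\<close>, so the factors no longer refer to the cells.\<close>

lemma pair_expectation:
  fixes a :: "bool \<times> nat \<Rightarrow> nat \<Rightarrow> ennreal"
  assumes J: "finite J" "J \<subseteq> pair_cells k" and \<psi>: "\<psi> \<in> borel_measurable (\<Pi>\<^sub>M c\<in>pair_cells k. borel)"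
  shows "(\<integral>\<^sup>+\<omega>. (\<Prod>c\<in>J. a c (\<kappa> (pair_param X (Xk k) c \<omega>))) * \<psi> (\<lambda>c\<in>pair_cells k. \<xi> (pair_param X (Xk k) c \<omega>)) \<partial>M)
    = (\<Prod>c\<in>J. \<integral>\<^sup>+\<omega>. a c (\<kappa> (X \<omega> 0)) \<partial>M) * (\<integral>\<^sup>+\<omega>. \<psi> (\<lambda>c\<in>pair_cells k. \<xi> (pair_param X (Xk k) c \<omega>)) \<partial>M)"
proof -
  let ?K = "\<lambda>\<omega>. \<lambda>c\<in>pair_cells k. real (\<kappa> (pair_param X (Xk k) c \<omega>))"
  \<comment> \<open>\<open>pair_kappa_indep_lifetimes\<close> treats the offspring numbers as reals;
    rounding down recovers the integers.\<close>
  define \<phi> where "\<phi> q = (\<Prod>c\<in>J. a c (nat \<lfloor>q c :: real\<rfloor>))" for q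
  have fl: "(\<lambda>r::real. nat \<lfloor>r\<rfloor>) \<in> measurable borel (count_space UNIV)"
    by (rule measurable_compose[OF measurable_real_floor]) simp
  have \<phi>: "\<phi> \<in> borel_measurable (\<Pi>\<^sub>M c\<in>pair_cells k. borel)"
    unfolding \<phi>_def
  proof (rule borel_measurable_prod_ennreal)
    fix c assume "c \<in> J"
    then have "(\<lambda>q. q c) \<in> measurable (\<Pi>\<^sub>M c\<in>pair_cells k. borel) borel"
      using J(2) by (intro measurable_component_singleton) auto
    from measurable_compose[OF this measurable_compose[OF fl, of "a c" borel]]
    show "(\<lambda>q. a c (nat \<lfloor>q c :: real\<rfloor>)) \<in> borel_measurable (\<Pi>\<^sub>M c\<in>pair_cells k. borel)" by simp
  qed
  have \<phi>K: "\<phi> (?K \<omega>) = (\<Prod>c\<in>J. a c (\<kappa> (pair_param X (Xk k) c \<omega>)))" for \<omega>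
    unfolding \<phi>_def using J(2) by (intro prod.cong) auto
  have "(\<integral>\<^sup>+\<omega>. (\<Prod>c\<in>J. a c (\<kappa> (pair_param X (Xk k) c \<omega>))) \<partial>M) = (\<Prod>c\<in>J. \<integral>\<^sup>+\<omega>. a c (\<kappa> (pair_param X (Xk k) c \<omega>)) \<partial>M)"
  proof (rule indep_vars_nn_integral[OF J(1)])
    show "indep_vars (\<lambda>_. borel) (\<lambda>c \<omega>. a c (\<kappa> (pair_param X (Xk k) c \<omega>))) J"
      by (rule indep_vars_compose2[OF indep_vars_subset[OF pair_kappa_indep J(2)]]) simp
  qed simp
  also have "\<dots> = (\<Prod>c\<in>J. \<integral>\<^sup>+\<omega>. a c (\<kappa> (X \<omega> 0)) \<partial>M)"
  proof (rule prod.cong[OF refl])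
    fix c
    show "(\<integral>\<^sup>+\<omega>. a c (\<kappa> (pair_param X (Xk k) c \<omega>)) \<partial>M) = (\<integral>\<^sup>+\<omega>. a c (\<kappa> (X \<omega> 0)) \<partial>M)"
      using kappa_law(1)[of "a c" "snd c"] kappa_law(2)[of "a c" k "snd c"]
      by (cases "fst c") (simp_all only: pair_param_def if_True if_False)
  qed
  finally have "(\<integral>\<^sup>+\<omega>. \<phi> (?K \<omega>) \<partial>M) = (\<Prod>c\<in>J. \<integral>\<^sup>+\<omega>. a c (\<kappa> (X \<omega> 0)) \<partial>M)" by (simp only: \<phi>K)
  with indep_var_nn_integral_mult[OF pair_kappa_indep_lifetimes[of k] \<phi> \<psi>] show ?thesis
    by (simp only: \<phi>K)
qed

end

text \<open>The four groups of factors are the ancestors before the branching generation k, the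
  branching cell, the ancestors after it, and the dividing cell at the end of the label.\<close>

lemma prod_split_at:
  fixes f :: "nat \<Rightarrow> 'a::comm_monoid_mult"
  shows "(\<Prod>l\<le>Suc (k + m). f l) = (\<Prod>l<k. f l) * f k * (\<Prod>l<m. f (Suc (k + l))) * f (Suc (k + m))"
proof (induction m)
  case 0
  then show ?case by (simp flip: lessThan_Suc_atMost)
next
  case (Suc m)
  then show ?case by (simp add: ac_simps)
qed

lemma prod_tail_split:
  fixes f :: "nat \<Rightarrow> 'a::comm_monoid_mult"
  shows "(\<Prod>l\<in>{k<..Suc (k + m)}. f l) = (\<Prod>l<m. f (Suc (k + l))) * f (Suc (k + m))"
proof (induction m)
  case 0
  have "{k<..Suc k} = {Suc k}" by auto
  then show ?case by simp
next
  case (Suc m)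
  have "{k<..Suc (k + Suc m)} = insert (Suc (Suc (k + m))) {k<..Suc (k + m)}" by auto
  then show ?case using Suc by (simp add: ac_simps)
qed

lemma prod_list_nth: "(\<Prod>l<length x. h (x ! l)) = prod_list (map h x)" for h :: "'b \<Rightarrow> 'a::comm_monoid_mult"
  by (simp add: prod.list_conv_set_nth atLeast0LessThan)

text \<open>A proper ancestor of v contributes the indicator that the next cell on the way to v is
  among its j children; the cell v itself contributes j - 1, the cells gained when it
  divides.\<close>

definition split_factor :: "nat list \<Rightarrow> nat \<Rightarrow> nat \<Rightarrow> ennreal" where
  "split_factor v l j = (if l < length v then (if 1 \<le> v ! l \<and> v ! l \<le> j then 1 else 0) else of_nat (j - 1))"

text \<open>The number of cells gained by time \<open>t\<close> through the division of the cell \<open>v\<close> whose ancestral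
  parameters are \<open>p\<close>; it is \<open>0\<close> if the cell does not exist.\<close>

definition path_gain :: "('x \<Rightarrow> real) \<Rightarrow> ('x \<Rightarrow> nat) \<Rightarrow> nat list \<Rightarrow> real \<Rightarrow> (nat \<Rightarrow> 'x) \<Rightarrow> ennreal" where
  "path_gain \<xi> \<kappa> v t p = (\<Prod>l\<le>length v. split_factor v l (\<kappa> (p l))) * indicator {..t} (lifetime_sum \<xi> p (length v))"

text \<open>Extends a label to an infinite line of descent, to which the hypotheses on laws apply.
  Entries up to \<open>length v\<close> are the ancestors of v and v itself; the ones appended
  afterwards do not influence the gain.\<close>

definition label_line :: "nat list \<Rightarrow> nat \<Rightarrow> nat list" where
  "label_line v n = take n v @ replicate (n - length v) 1"

definition cell_gain :: "('x \<Rightarrow> real) \<Rightarrow> ('x \<Rightarrow> nat) \<Rightarrow> (nat list \<Rightarrow> 'x) \<Rightarrow> nat list \<Rightarrow> real \<Rightarrow> ennreal" where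
  "cell_gain \<xi> \<kappa> T v t = path_gain \<xi> \<kappa> v t (\<lambda>n. T (label_line v n))"

lemma descent_line_label_line:
  assumes "\<forall>i\<in>set v. 1 \<le> i"
  shows "descent_line (label_line v)"
  unfolding descent_line_def
proof safe
  show "label_line v 0 = []" by (simp add: label_line_def)
  fix n
  show "\<exists>i\<ge>1. label_line v (Suc n) = label_line v n @ [i]"
  proof (cases "n < length v")
    case True
    then show ?thesis using assms by (auto simp: label_line_def take_Suc_conv_app_nth intro!: exI[of _ "v ! n"])
  next
    case False
    then have "Suc n - length v = Suc (n - length v)" by simp
    with False show ?thesis by (auto simp: label_line_def replicate_append_same intro!: exI[of _ 1])
  qed
qed

lemma label_line_split:
  shows "n \<le> length u \<Longrightarrow> label_line (u @ i # x) n = label_line (u @ j # y) n"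
    and "i \<noteq> j \<Longrightarrow> label_line (u @ i # x) (Suc (length u)) \<noteq> label_line (u @ j # y) (Suc (length u))"
    and "n \<le> length u \<Longrightarrow> label_line (u @ z) n = label_line u n"
  by (auto simp: label_line_def)

lemma path_gain_cong:
  assumes "\<And>n. n \<le> length v \<Longrightarrow> p n = q n"
  shows "path_gain \<xi> \<kappa> v t p = path_gain \<xi> \<kappa> v t q"
  unfolding path_gain_def lifetime_sum_def using assms by (auto intro!: arg_cong2[where f=times] prod.cong arg_cong[where f="indicator _"] sum.cong)

text \<open>A label containing 0 lies on no line of descent. Its gain vanishes, so sums may range
  over all lists although the law hypotheses cover only valid labels.\<close>

lemma path_gain_invalid:
  assumes "\<not> (\<forall>i\<in>set v. 1 \<le> i)"
  shows "path_gain \<xi> \<kappa> v t p = 0"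
proof -
  obtain l where l: "l < length v" "\<not> 1 \<le> v ! l" using assms by (auto simp: in_set_conv_nth)
  then have "(\<Prod>l\<le>length v. split_factor v l (\<kappa> (p l))) = 0"
    by (intro prod_zero) (auto simp: split_factor_def intro!: bexI[of _ l])
  then show ?thesis by (simp add: path_gain_def)
qed

context markov_independence
begin

lemma measurable_lifetime_sum:
  assumes "f \<in> measurable N (path_space E)"
  shows "(\<lambda>\<omega>. lifetime_sum \<xi> (f \<omega>) n) \<in> borel_measurable N"
  unfolding lifetime_sum_def
  by (rule borel_measurable_sum) (rule measurable_compose[OF measurable_path_component[OF assms] xi_measurable])

lemma measurable_lifetime_indicator:
  assumes "f \<in> measurable N (path_space E)"
  shows "(\<lambda>\<omega>. indicator {..t} (lifetime_sum \<xi> (f \<omega>) n) :: ennreal) \<in> borel_measurable N"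
  by (rule measurable_compose[OF measurable_lifetime_sum[OF assms]]) simp

lemma measurable_path_gain: "path_gain \<xi> \<kappa> v t \<in> borel_measurable (path_space E)"
proof -
  have id: "(\<lambda>p. p) \<in> measurable (path_space E) (path_space E)" by simp
  have "(\<lambda>p. split_factor v l (\<kappa> (p l))) \<in> borel_measurable (path_space E)" for l
    by (rule measurable_compose[OF measurable_path_component[OF id] measurable_compose[OF kappa_measurable]]) simp
  then show ?thesis unfolding path_gain_def
    by (intro borel_measurable_times_ennreal borel_measurable_prod_ennreal measurable_lifetime_indicator id)
qed

lemma measurable_cell_gain[measurable]: "(\<lambda>\<omega>. cell_gain \<xi> \<kappa> (T \<omega>) v t) \<in> borel_measurable M"
  unfolding cell_gain_def by (rule measurable_compose[OF measurable_T_line measurable_path_gain])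

lemma nn_integral_line:
  assumes v: "descent_line v" and H: "H \<in> borel_measurable (path_space E)"
  shows "(\<integral>\<^sup>+\<omega>. H (\<lambda>n. T \<omega> (v n)) \<partial>M) = (\<integral>\<^sup>+\<omega>. H (X \<omega>) \<partial>M)"
proof -
  have "(\<integral>\<^sup>+\<omega>. H (\<lambda>n. T \<omega> (v n)) \<partial>M) = (\<integral>\<^sup>+p. H p \<partial>distr M (path_space E) (\<lambda>\<omega> n. T \<omega> (v n)))"
    by (subst nn_integral_distr[OF measurable_T_line]) (simp_all add: H)
  also have "\<dots> = (\<integral>\<^sup>+\<omega>. H (X \<omega>) \<partial>M)"
    unfolding line_law[OF v] by (subst nn_integral_distr[OF X_measurable]) (simp_all add: H)
  finally show ?thesis .
qed

lemma nn_integral_pair_lines: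
  assumes v: "descent_line v" "descent_line w" "\<And>n. n \<le> k \<Longrightarrow> v n = w n" "v (Suc k) \<noteq> w (Suc k)"
    and H: "H \<in> borel_measurable (path_space E)" and H': "H' \<in> borel_measurable (path_space E)"
  shows "(\<integral>\<^sup>+\<omega>. H (\<lambda>n. T \<omega> (v n)) * H' (\<lambda>n. T \<omega> (w n)) \<partial>M) = (\<integral>\<^sup>+\<omega>. H (X \<omega>) * H' (Xk k \<omega>) \<partial>M)"
proof -
  note [measurable] = H H' X_measurable Xk_measurable
  let ?D = "distr M (path_space E \<Otimes>\<^sub>M path_space E)"
  have "(\<integral>\<^sup>+\<omega>. H (\<lambda>n. T \<omega> (v n)) * H' (\<lambda>n. T \<omega> (w n)) \<partial>M)
      = (\<integral>\<^sup>+p. H (fst p) * H' (snd p) \<partial>?D (\<lambda>\<omega>. (\<lambda>n. T \<omega> (v n), \<lambda>n. T \<omega> (w n))))"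
    by (subst nn_integral_distr) auto
  also have "?D (\<lambda>\<omega>. (\<lambda>n. T \<omega> (v n), \<lambda>n. T \<omega> (w n))) = ?D (\<lambda>\<omega>. (X \<omega>, Xk k \<omega>))"
    by (rule pair_law[where k=k]) (use v in auto)
  also have "(\<integral>\<^sup>+p. H (fst p) * H' (snd p) \<partial>?D (\<lambda>\<omega>. (X \<omega>, Xk k \<omega>))) = (\<integral>\<^sup>+\<omega>. H (X \<omega>) * H' (Xk k \<omega>) \<partial>M)"
    by (subst nn_integral_distr) auto
  finally show ?thesis .
qed

text \<open>A single line is treated as the first line of a pair that separates after generation 0,
  using only the cells marked \<open>False\<close>.\<close>

lemma line_expectation:
  fixes a :: "nat \<Rightarrow> nat \<Rightarrow> ennreal"
  shows "(\<integral>\<^sup>+\<omega>. (\<Prod>l\<le>N. a l (\<kappa> (X \<omega> l))) * (indicator {..s} (lifetime_sum \<xi> (X \<omega>) m) * indicator {..t} (lifetime_sum \<xi> (X \<omega>) n)) \<partial>M)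
    = (\<Prod>l\<le>N. \<integral>\<^sup>+\<omega>. a l (\<kappa> (X \<omega> 0)) \<partial>M)
      * (\<integral>\<^sup>+\<omega>. indicator {..s} (lifetime_sum \<xi> (X \<omega>) m) * indicator {..t} (lifetime_sum \<xi> (X \<omega>) n) \<partial>M)"
proof -
  let ?J = "Pair False ` {..N}"
  let ?\<psi> = "\<lambda>q. indicator {..s} (\<Sum>j\<le>m. q (False, j)) * indicator {..t} (\<Sum>j\<le>n. q (False, j)) :: ennreal"
  have J: "finite ?J" "?J \<subseteq> pair_cells 0" by (auto simp: pair_cells_def)
  have c: "(\<lambda>q. q (False, j)) \<in> borel_measurable (\<Pi>\<^sub>M c\<in>pair_cells 0. borel)" for j
    by (rule measurable_component_singleton) (simp add: pair_cells_def)
  have \<psi>: "?\<psi> \<in> borel_measurable (\<Pi>\<^sub>M c\<in>pair_cells 0. borel)"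
    by (intro borel_measurable_times_ennreal measurable_compose[OF borel_measurable_sum[OF c]]) auto
  have "\<And>j. (False, j) \<in> pair_cells 0" by (simp add: pair_cells_def)
  with pair_expectation[OF J \<psi>, of "\<lambda>c. a (snd c)"] show ?thesis
    by (simp add: prod.reindex inj_on_def pair_param_def lifetime_sum_def)
qed

text \<open>Up to generation k both lines run through the same cells, so the two factors of such a
  cell involve one offspring number and must stay in one integral. After k the cells are distinct
  and contribute separate factors.\<close>

lemma pair_line_expectation:
  fixes a b :: "nat \<Rightarrow> nat \<Rightarrow> ennreal"
  assumes k: "k \<le> m" "k \<le> n"
  shows "(\<integral>\<^sup>+\<omega>. ((\<Prod>l\<le>m. a l (\<kappa> (X \<omega> l))) * indicator {..s} (lifetime_sum \<xi> (X \<omega>) m))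
        * ((\<Prod>l\<le>n. b l (\<kappa> (Xk k \<omega> l))) * indicator {..t} (lifetime_sum \<xi> (Xk k \<omega>) n)) \<partial>M)
    = (\<Prod>l\<le>m. \<integral>\<^sup>+\<omega>. (if l \<le> k then a l (\<kappa> (X \<omega> 0)) * b l (\<kappa> (X \<omega> 0)) else a l (\<kappa> (X \<omega> 0))) \<partial>M)
      * (\<Prod>l\<in>{k<..n}. \<integral>\<^sup>+\<omega>. b l (\<kappa> (X \<omega> 0)) \<partial>M)
      * (\<integral>\<^sup>+\<omega>. indicator {..s} (lifetime_sum \<xi> (X \<omega>) m) * indicator {..t} (lifetime_sum \<xi> (Xk k \<omega>) n) \<partial>M)"
proof -
  let ?J1 = "Pair False ` {..m}" and ?J2 = "Pair True ` {k<..n}"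
  define c where "c = (\<lambda>(d, l) j. if d then b l j else if l \<le> k then a l j * b l j else a l j)"
  have cT: "c (True, l) = b l" for l by (simp add: c_def fun_eq_iff)
  \<comment> \<open>The lifetimes of the second line up to k are read off the first line, because
    \<open>pair_cells\<close> lists the common cells once.\<close>
  let ?\<psi> = "\<lambda>q. indicator {..s} (\<Sum>j\<le>m. q (False, j)) * indicator {..t} ((\<Sum>j\<le>k. q (False, j)) + (\<Sum>j\<in>{k<..n}. q (True, j))) :: ennreal"
  have J: "finite (?J1 \<union> ?J2)" "?J1 \<union> ?J2 \<subseteq> pair_cells k" by (auto simp: pair_cells_def)
  have comp: "(\<lambda>q. q d) \<in> borel_measurable (\<Pi>\<^sub>M c\<in>pair_cells k. borel)" if "d \<in> pair_cells k" for d
    using that by (rule measurable_component_singleton)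
  have \<psi>: "?\<psi> \<in> borel_measurable (\<Pi>\<^sub>M c\<in>pair_cells k. borel)"
  proof (intro borel_measurable_times_ennreal)
    have "(\<lambda>q. \<Sum>j\<le>m. q (False, j) :: real) \<in> borel_measurable (\<Pi>\<^sub>M c\<in>pair_cells k. borel)"
      by (intro borel_measurable_sum comp) (simp add: pair_cells_def)
    then show "(\<lambda>q. indicator {..s} (\<Sum>j\<le>m. q (False, j)) :: ennreal) \<in> borel_measurable (\<Pi>\<^sub>M c\<in>pair_cells k. borel)"
      by (rule measurable_compose) simp
    have "(\<lambda>q. (\<Sum>j\<le>k. q (False, j)) + (\<Sum>j\<in>{k<..n}. q (True, j)) :: real) \<in> borel_measurable (\<Pi>\<^sub>M c\<in>pair_cells k. borel)"
      by (intro borel_measurable_add borel_measurable_sum comp) (simp_all add: pair_cells_def)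
    then show "(\<lambda>q. indicator {..t} ((\<Sum>j\<le>k. q (False, j)) + (\<Sum>j\<in>{k<..n}. q (True, j))) :: ennreal) \<in> borel_measurable (\<Pi>\<^sub>M c\<in>pair_cells k. borel)"
      by (rule measurable_compose) simp
  qed
  have pcF: "\<And>j. (False, j) \<in> pair_cells k" and pcT: "\<And>j. j \<in> {k<..n} \<Longrightarrow> (True, j) \<in> pair_cells k" by (simp_all add: pair_cells_def)
  have prodJ: "(\<Prod>d\<in>?J1 \<union> ?J2. f d) = (\<Prod>l\<le>m. f (False, l)) * (\<Prod>l\<in>{k<..n}. f (True, l))" for f :: "_ \<Rightarrow> ennreal"
    by (subst prod.union_disjoint) (auto simp: prod.reindex inj_on_def)
  let ?q = "\<lambda>\<omega>. \<lambda>c\<in>pair_cells k. \<xi> (pair_param X (Xk k) c \<omega>)"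
  have nk: "{..n} = {..k} \<union> {k<..n}" using k by auto
  have mk: "{..m} = {..k} \<union> {k<..m}" using k by auto
  have agree: "AE \<omega> in M. ?\<psi> (?q \<omega>) = indicator {..s} (lifetime_sum \<xi> (X \<omega>) m) * indicator {..t} (lifetime_sum \<xi> (Xk k \<omega>) n)"
    using Xk_eq[of k]
  proof eventually_elim
    case (elim \<omega>)
    have "lifetime_sum \<xi> (Xk k \<omega>) n = (\<Sum>j\<le>k. \<xi> (Xk k \<omega> j)) + (\<Sum>j\<in>{k<..n}. \<xi> (Xk k \<omega> j))"
      unfolding lifetime_sum_def nk by (rule sum.union_disjoint) auto
    also have "(\<Sum>j\<le>k. \<xi> (Xk k \<omega> j)) = (\<Sum>j\<le>k. \<xi> (X \<omega> j))" using elim by (intro sum.cong) auto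
    also have "(\<Sum>j\<in>{k<..n}. \<xi> (Xk k \<omega> j)) = (\<Sum>j\<in>{k<..n}. ?q \<omega> (True, j))"
      using pcT by (intro sum.cong) (auto simp: pair_param_def)
    also have "(\<Sum>j\<le>k. \<xi> (X \<omega> j)) = (\<Sum>j\<le>k. ?q \<omega> (False, j))"
      using pcF by (intro sum.cong) (auto simp: pair_param_def)
    finally have "lifetime_sum \<xi> (Xk k \<omega>) n = (\<Sum>j\<le>k. ?q \<omega> (False, j)) + (\<Sum>j\<in>{k<..n}. ?q \<omega> (True, j))" .
    moreover have "lifetime_sum \<xi> (X \<omega>) m = (\<Sum>j\<le>m. ?q \<omega> (False, j))"
      unfolding lifetime_sum_def using pcF by (intro sum.cong) (auto simp: pair_param_def)
    ultimately show ?case by (simp only:)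
  qed
  have prods: "AE \<omega> in M. (\<Prod>l\<le>m. a l (\<kappa> (X \<omega> l))) * (\<Prod>l\<le>n. b l (\<kappa> (Xk k \<omega> l))) = (\<Prod>d\<in>?J1 \<union> ?J2. c d (\<kappa> (pair_param X (Xk k) d \<omega>)))"
    using Xk_eq[of k]
  proof eventually_elim
    case (elim \<omega>)
    have "(\<Prod>l\<le>n. b l (\<kappa> (Xk k \<omega> l))) = (\<Prod>l\<le>k. b l (\<kappa> (Xk k \<omega> l))) * (\<Prod>l\<in>{k<..n}. b l (\<kappa> (Xk k \<omega> l)))"
      unfolding nk by (rule prod.union_disjoint) auto
    also have "(\<Prod>l\<le>k. b l (\<kappa> (Xk k \<omega> l))) = (\<Prod>l\<le>k. b l (\<kappa> (X \<omega> l)))" using elim by (intro prod.cong) auto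
    finally have 1: "(\<Prod>l\<le>n. b l (\<kappa> (Xk k \<omega> l))) = (\<Prod>l\<le>k. b l (\<kappa> (X \<omega> l))) * (\<Prod>l\<in>{k<..n}. b l (\<kappa> (Xk k \<omega> l)))" .
    have 2: "(\<Prod>l\<le>m. a l (\<kappa> (X \<omega> l))) = (\<Prod>l\<le>k. a l (\<kappa> (X \<omega> l))) * (\<Prod>l\<in>{k<..m}. a l (\<kappa> (X \<omega> l)))"
      unfolding mk by (rule prod.union_disjoint) auto
    have 3: "(\<Prod>l\<le>m. c (False, l) (\<kappa> (X \<omega> l))) = (\<Prod>l\<le>k. a l (\<kappa> (X \<omega> l)) * b l (\<kappa> (X \<omega> l))) * (\<Prod>l\<in>{k<..m}. a l (\<kappa> (X \<omega> l)))"
      unfolding mk by (subst prod.union_disjoint) (auto simp: c_def intro!: arg_cong2[where f=times] prod.cong)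
    have 4: "(\<Prod>d\<in>?J1 \<union> ?J2. c d (\<kappa> (pair_param X (Xk k) d \<omega>)))
        = (\<Prod>l\<le>m. c (False, l) (\<kappa> (X \<omega> l))) * (\<Prod>l\<in>{k<..n}. b l (\<kappa> (Xk k \<omega> l)))"
      by (simp only: prodJ pair_param_def fst_conv snd_conv if_True if_False cT)
    show ?case unfolding 4 3 1 2 prod.distrib by (simp only: ac_simps)
  qed
  have "(\<integral>\<^sup>+\<omega>. ((\<Prod>l\<le>m. a l (\<kappa> (X \<omega> l))) * indicator {..s} (lifetime_sum \<xi> (X \<omega>) m))
        * ((\<Prod>l\<le>n. b l (\<kappa> (Xk k \<omega> l))) * indicator {..t} (lifetime_sum \<xi> (Xk k \<omega>) n)) \<partial>M)
     = (\<integral>\<^sup>+\<omega>. (\<Prod>d\<in>?J1 \<union> ?J2. c d (\<kappa> (pair_param X (Xk k) d \<omega>))) * ?\<psi> (?q \<omega>) \<partial>M)"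
  proof (rule nn_integral_cong_AE)
    have four: "(x * y) * (z * w) = (x * z) * (y * w)" for x y z w :: ennreal by (simp only: ac_simps)
    show "AE \<omega> in M. ((\<Prod>l\<le>m. a l (\<kappa> (X \<omega> l))) * indicator {..s} (lifetime_sum \<xi> (X \<omega>) m))
        * ((\<Prod>l\<le>n. b l (\<kappa> (Xk k \<omega> l))) * indicator {..t} (lifetime_sum \<xi> (Xk k \<omega>) n))
      = (\<Prod>d\<in>?J1 \<union> ?J2. c d (\<kappa> (pair_param X (Xk k) d \<omega>))) * ?\<psi> (?q \<omega>)"
      using agree prods
    proof eventually_elim
      case (elim \<omega>)
      show ?case by (rule trans[OF four]) (simp only: elim)
    qed
  qed
  also have "\<dots> = (\<Prod>d\<in>?J1 \<union> ?J2. \<integral>\<^sup>+\<omega>. c d (\<kappa> (X \<omega> 0)) \<partial>M) * (\<integral>\<^sup>+\<omega>. ?\<psi> (?q \<omega>) \<partial>M)"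
    by (rule pair_expectation[OF J \<psi>])
  also have "(\<integral>\<^sup>+\<omega>. ?\<psi> (?q \<omega>) \<partial>M) = (\<integral>\<^sup>+\<omega>. indicator {..s} (lifetime_sum \<xi> (X \<omega>) m) * indicator {..t} (lifetime_sum \<xi> (Xk k \<omega>) n) \<partial>M)"
    using agree by (rule nn_integral_cong_AE)
  also have "(\<Prod>d\<in>?J1 \<union> ?J2. \<integral>\<^sup>+\<omega>. c d (\<kappa> (X \<omega> 0)) \<partial>M)
     = (\<Prod>l\<le>m. \<integral>\<^sup>+\<omega>. (if l \<le> k then a l (\<kappa> (X \<omega> 0)) * b l (\<kappa> (X \<omega> 0)) else a l (\<kappa> (X \<omega> 0))) \<partial>M)
      * (\<Prod>l\<in>{k<..n}. \<integral>\<^sup>+\<omega>. b l (\<kappa> (X \<omega> 0)) \<partial>M)"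
    unfolding prodJ by (simp add: c_def)
  finally show ?thesis .
qed

end

section \<open>Moments of the number of cells gained\<close>

lemma prod_mult_initial:
  fixes f g :: "nat \<Rightarrow> 'a::comm_monoid_mult"
  assumes "k \<le> n"
  shows "(\<Prod>l\<le>k. f l) * (\<Prod>l\<le>n. g l) = (\<Prod>l\<le>n. if l \<le> k then f l * g l else g l)"
proof -
  have n: "{..n} = {..k} \<union> {k<..n}" using assms by auto
  have "(\<Prod>l\<le>n. if l \<le> k then f l * g l else g l) = (\<Prod>l\<le>k. f l * g l) * (\<Prod>l\<in>{k<..n}. g l)"
    unfolding n by (subst prod.union_disjoint) (auto intro!: arg_cong2[where f=times] prod.cong)
  also have "(\<Prod>l\<le>k. f l * g l) * (\<Prod>l\<in>{k<..n}. g l) = (\<Prod>l\<le>k. f l) * ((\<Prod>l\<le>k. g l) * (\<Prod>l\<in>{k<..n}. g l))"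
    by (simp only: prod.distrib mult.assoc)
  also have "(\<Prod>l\<le>k. g l) * (\<Prod>l\<in>{k<..n}. g l) = (\<Prod>l\<le>n. g l)"
    unfolding n by (rule prod.union_disjoint[symmetric]) auto
  finally show ?thesis by simp
qed

lemma split_factor_append:
  "l < length u \<Longrightarrow> split_factor (u @ z) l = split_factor u l"
  "l < length u \<Longrightarrow> split_factor u l j * split_factor u l j = split_factor u l j"
  "split_factor (u @ i # x) (length u) j = (if 1 \<le> i \<and> i \<le> j then 1 else 0)"
  "split_factor (u @ i # x) (Suc (length u + l)) j = split_factor x l j"
  "split_factor u (length u) j = of_nat (j - 1)"
  by (auto simp: split_factor_def nth_append fun_eq_iff)

context markov_independence
begin

definition child_prob :: "nat \<Rightarrow> ennreal" where
  "child_prob i = (\<integral>\<^sup>+\<omega>. (if 1 \<le> i \<and> i \<le> \<kappa> (X \<omega> 0) then 1 else 0) \<partial>M)"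

abbreviation "label_prob v \<equiv> prod_list (map child_prob v)"
abbreviation "mean_gain \<equiv> (\<integral>\<^sup>+\<omega>. of_nat (\<kappa> (X \<omega> 0) - 1) \<partial>M)"

definition line_prob :: "nat \<Rightarrow> real \<Rightarrow> nat \<Rightarrow> real \<Rightarrow> ennreal" where
  "line_prob m s n t = (\<integral>\<^sup>+\<omega>. indicator {..s} (lifetime_sum \<xi> (X \<omega>) m) * indicator {..t} (lifetime_sum \<xi> (X \<omega>) n) \<partial>M)"

definition split_prob :: "nat \<Rightarrow> nat \<Rightarrow> nat \<Rightarrow> real \<Rightarrow> real \<Rightarrow> ennreal" where
  "split_prob k m n s t = (\<integral>\<^sup>+\<omega>. indicator {..s} (lifetime_sum \<xi> (X \<omega>) m) * indicator {..t} (lifetime_sum \<xi> (Xk k \<omega>) n) \<partial>M)"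

lemma measurable_kappa[measurable]: "(\<lambda>\<omega>. \<kappa> (X \<omega> n)) \<in> measurable M (count_space UNIV)"
  by (rule measurable_compose[OF measurable_X kappa_measurable])

lemma label_prob_invalid: "\<not> (\<forall>i\<in>set v. 1 \<le> i) \<Longrightarrow> label_prob v = 0"
  by (induction v) (auto simp: child_prob_def not_less_eq_eq)

lemma split_factor_integral:
  "l < length v \<Longrightarrow> (\<integral>\<^sup>+\<omega>. split_factor v l (\<kappa> (X \<omega> 0)) \<partial>M) = child_prob (v ! l)"
  by (simp add: split_factor_def child_prob_def)

lemma label_prob_prod: "(\<Prod>l<length v. \<integral>\<^sup>+\<omega>. split_factor v l (\<kappa> (X \<omega> 0)) \<partial>M) = label_prob v"
  using prod_list_nth[of child_prob v] by (simp add: split_factor_integral)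

text \<open>Along proper ancestors the factors are indicators and hence idempotent; only the factor
  of the dividing cell is really squared.\<close>

lemma cell_gain_diagonal:
  "(\<integral>\<^sup>+\<omega>. cell_gain \<xi> \<kappa> (T \<omega>) u s * cell_gain \<xi> \<kappa> (T \<omega>) u t \<partial>M)
    = label_prob u * (\<integral>\<^sup>+\<omega>. of_nat (\<kappa> (X \<omega> 0) - 1) * of_nat (\<kappa> (X \<omega> 0) - 1) \<partial>M) * line_prob (length u) s (length u) t"
proof (cases "\<forall>i\<in>set u. 1 \<le> i")
  case True
  let ?k = "length u"
  have "(\<integral>\<^sup>+\<omega>. cell_gain \<xi> \<kappa> (T \<omega>) u s * cell_gain \<xi> \<kappa> (T \<omega>) u t \<partial>M) = (\<integral>\<^sup>+\<omega>. path_gain \<xi> \<kappa> u s (X \<omega>) * path_gain \<xi> \<kappa> u t (X \<omega>) \<partial>M)"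
    unfolding cell_gain_def
    by (rule nn_integral_line[OF descent_line_label_line[OF True]]) (intro borel_measurable_times_ennreal measurable_path_gain)
  also have "\<dots> = (\<integral>\<^sup>+\<omega>. (\<Prod>l\<le>?k. split_factor u l (\<kappa> (X \<omega> l)) * split_factor u l (\<kappa> (X \<omega> l)))
      * (indicator {..s} (lifetime_sum \<xi> (X \<omega>) ?k) * indicator {..t} (lifetime_sum \<xi> (X \<omega>) ?k)) \<partial>M)"
    by (intro nn_integral_cong) (simp only: path_gain_def prod.distrib ac_simps)
  also have "\<dots> = (\<Prod>l\<le>?k. \<integral>\<^sup>+\<omega>. split_factor u l (\<kappa> (X \<omega> 0)) * split_factor u l (\<kappa> (X \<omega> 0)) \<partial>M) * line_prob ?k s ?k t"
    unfolding line_prob_def by (rule line_expectation)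
  also have "(\<Prod>l\<le>?k. \<integral>\<^sup>+\<omega>. split_factor u l (\<kappa> (X \<omega> 0)) * split_factor u l (\<kappa> (X \<omega> 0)) \<partial>M)
      = label_prob u * (\<integral>\<^sup>+\<omega>. of_nat (\<kappa> (X \<omega> 0) - 1) * of_nat (\<kappa> (X \<omega> 0) - 1) \<partial>M)"
    unfolding lessThan_Suc_atMost[symmetric] prod.lessThan_Suc label_prob_prod[symmetric]
    by (intro arg_cong2[where f=times] prod.cong) (simp_all add: split_factor_append)
  finally show ?thesis .
next
  case False
  then show ?thesis by (simp add: cell_gain_def path_gain_invalid label_prob_invalid[OF False])
qed

lemma cell_gain_mean:
  "(\<integral>\<^sup>+\<omega>. cell_gain \<xi> \<kappa> (T \<omega>) u t \<partial>M) = label_prob u * mean_gain * line_prob (length u) t (length u) t"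
proof (cases "\<forall>i\<in>set u. 1 \<le> i")
  case True
  let ?k = "length u"
  have "(\<integral>\<^sup>+\<omega>. cell_gain \<xi> \<kappa> (T \<omega>) u t \<partial>M) = (\<integral>\<^sup>+\<omega>. path_gain \<xi> \<kappa> u t (X \<omega>) \<partial>M)"
    unfolding cell_gain_def
    by (rule nn_integral_line[OF descent_line_label_line[OF True]]) (rule measurable_path_gain)
  also have "\<dots> = (\<integral>\<^sup>+\<omega>. (\<Prod>l\<le>?k. split_factor u l (\<kappa> (X \<omega> l)))
      * (indicator {..t} (lifetime_sum \<xi> (X \<omega>) ?k) * indicator {..t} (lifetime_sum \<xi> (X \<omega>) ?k)) \<partial>M)"
    by (intro nn_integral_cong) (simp add: path_gain_def split: split_indicator)
  also have "\<dots> = (\<Prod>l\<le>?k. \<integral>\<^sup>+\<omega>. split_factor u l (\<kappa> (X \<omega> 0)) \<partial>M) * line_prob ?k t ?k t"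
    unfolding line_prob_def by (rule line_expectation)
  also have "(\<Prod>l\<le>?k. \<integral>\<^sup>+\<omega>. split_factor u l (\<kappa> (X \<omega> 0)) \<partial>M) = label_prob u * mean_gain"
    unfolding lessThan_Suc_atMost[symmetric] prod.lessThan_Suc label_prob_prod by (simp add: split_factor_append)
  finally show ?thesis .
next
  case False
  then show ?thesis by (simp add: cell_gain_def path_gain_invalid label_prob_invalid[OF False])
qed

text \<open>The gain from the division of u and the existence of its child j involve the same
  offspring number, so they stay in one integral; all other generations factor.\<close>

lemma cell_gain_ancestor:
  "(\<integral>\<^sup>+\<omega>. cell_gain \<xi> \<kappa> (T \<omega>) u s * cell_gain \<xi> \<kappa> (T \<omega>) (u @ j # y) t \<partial>M)
    = label_prob u * ((\<integral>\<^sup>+\<omega>. of_nat (\<kappa> (X \<omega> 0) - 1) * (if 1 \<le> j \<and> j \<le> \<kappa> (X \<omega> 0) then 1 else 0) \<partial>M)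
      * (label_prob y * (mean_gain * line_prob (length u) s (Suc (length u + length y)) t)))"
proof (cases "\<forall>i\<in>set (u @ j # y). 1 \<le> i")
  case True
  let ?k = "length u" let ?w = "u @ j # y" let ?n = "Suc (length u + length y)"
  have lw: "length ?w = ?n" by simp
  have u: "cell_gain \<xi> \<kappa> (T \<omega>) u s = path_gain \<xi> \<kappa> u s (\<lambda>n. T \<omega> (label_line ?w n))" for \<omega>
    unfolding cell_gain_def by (intro path_gain_cong) (simp add: label_line_split(3))
  have "(\<integral>\<^sup>+\<omega>. cell_gain \<xi> \<kappa> (T \<omega>) u s * cell_gain \<xi> \<kappa> (T \<omega>) ?w t \<partial>M) = (\<integral>\<^sup>+\<omega>. path_gain \<xi> \<kappa> u s (X \<omega>) * path_gain \<xi> \<kappa> ?w t (X \<omega>) \<partial>M)"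
    unfolding u unfolding cell_gain_def
    by (rule nn_integral_line[OF descent_line_label_line[OF True]]) (intro borel_measurable_times_ennreal measurable_path_gain)
  also have "\<dots> = (\<integral>\<^sup>+\<omega>. (\<Prod>l\<le>?n. if l \<le> ?k then split_factor u l (\<kappa> (X \<omega> l)) * split_factor ?w l (\<kappa> (X \<omega> l)) else split_factor ?w l (\<kappa> (X \<omega> l)))
      * (indicator {..s} (lifetime_sum \<xi> (X \<omega>) ?k) * indicator {..t} (lifetime_sum \<xi> (X \<omega>) ?n)) \<partial>M)"
  proof (intro nn_integral_cong)
    fix \<omega>
    have kn: "?k \<le> ?n" by simp
    show "path_gain \<xi> \<kappa> u s (X \<omega>) * path_gain \<xi> \<kappa> ?w t (X \<omega>) = (\<Prod>l\<le>?n. if l \<le> ?k then split_factor u l (\<kappa> (X \<omega> l)) * split_factor ?w l (\<kappa> (X \<omega> l)) else split_factor ?w l (\<kappa> (X \<omega> l)))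
      * (indicator {..s} (lifetime_sum \<xi> (X \<omega>) ?k) * indicator {..t} (lifetime_sum \<xi> (X \<omega>) ?n))"
      unfolding prod_mult_initial[OF kn, symmetric] path_gain_def lw by (simp only: ac_simps)
  qed
  also have "\<dots> = (\<Prod>l\<le>?n. \<integral>\<^sup>+\<omega>. (if l \<le> ?k then split_factor u l (\<kappa> (X \<omega> 0)) * split_factor ?w l (\<kappa> (X \<omega> 0)) else split_factor ?w l (\<kappa> (X \<omega> 0))) \<partial>M) * line_prob ?k s ?n t"
    unfolding line_prob_def by (rule line_expectation[where a="\<lambda>l j'. if l \<le> ?k then split_factor u l j' * split_factor ?w l j' else split_factor ?w l j'"])
  also have "(\<Prod>l\<le>?n. \<integral>\<^sup>+\<omega>. (if l \<le> ?k then split_factor u l (\<kappa> (X \<omega> 0)) * split_factor ?w l (\<kappa> (X \<omega> 0)) else split_factor ?w l (\<kappa> (X \<omega> 0))) \<partial>M)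
     = label_prob u * (\<integral>\<^sup>+\<omega>. of_nat (\<kappa> (X \<omega> 0) - 1) * (if 1 \<le> j \<and> j \<le> \<kappa> (X \<omega> 0) then 1 else 0) \<partial>M) * label_prob y * mean_gain"
  proof -
    have "(\<Prod>l<?k. \<integral>\<^sup>+\<omega>. (if l \<le> ?k then split_factor u l (\<kappa> (X \<omega> 0)) * split_factor ?w l (\<kappa> (X \<omega> 0)) else split_factor ?w l (\<kappa> (X \<omega> 0))) \<partial>M)
       = (\<Prod>l<?k. \<integral>\<^sup>+\<omega>. split_factor u l (\<kappa> (X \<omega> 0)) \<partial>M)"
      by (rule prod.cong) (simp_all add: split_factor_append)
    then show ?thesis unfolding prod_split_at label_prob_prod[symmetric] by (simp add: split_factor_append)
  qed
  finally show ?thesis by (simp only: mult.assoc)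
next
  case False
  then have "\<not> (\<forall>i\<in>set u. 1 \<le> i) \<or> \<not> (\<forall>i\<in>set y. 1 \<le> i) \<or> j = 0"
    by (auto simp: Suc_le_eq)
  then have "label_prob u = 0 \<or> label_prob y = 0 \<or> j = 0"
    using label_prob_invalid by blast
  moreover have "cell_gain \<xi> \<kappa> (T \<omega>) (u @ j # y) t = 0" for \<omega>
    unfolding cell_gain_def by (rule path_gain_invalid[OF False])
  ultimately show ?thesis by (elim disjE) simp_all
qed

text \<open>The existence of the children i and j concerns one offspring number, that of the common
  ancestor. After it the offspring numbers of the two lines contribute independent factors, while
  the lifetimes remain coupled inside \<open>split_prob\<close> through the common past.\<close>

lemma cell_gain_split:
  assumes "i \<noteq> j"
  shows "(\<integral>\<^sup>+\<omega>. cell_gain \<xi> \<kappa> (T \<omega>) (u @ i # x) s * cell_gain \<xi> \<kappa> (T \<omega>) (u @ j # y) t \<partial>M)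
    = label_prob u * ((\<integral>\<^sup>+\<omega>. (if 1 \<le> i \<and> i \<le> \<kappa> (X \<omega> 0) then 1 else 0) * (if 1 \<le> j \<and> j \<le> \<kappa> (X \<omega> 0) then 1 else 0) \<partial>M)
      * (label_prob x * (label_prob y * (mean_gain * (mean_gain
        * split_prob (length u) (Suc (length u + length x)) (Suc (length u + length y)) s t)))))"
proof (cases "(\<forall>i\<in>set (u @ i # x). 1 \<le> i) \<and> (\<forall>i\<in>set (u @ j # y). 1 \<le> i)")
  case True
  let ?k = "length u" let ?v = "u @ i # x" let ?w = "u @ j # y" let ?m = "Suc (length u + length x)" let ?n = "Suc (length u + length y)"
  have lw: "length ?v = ?m" "length ?w = ?n" by simp_all
  have km: "?k \<le> ?m" "?k \<le> ?n" by simp_all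
  have "(\<integral>\<^sup>+\<omega>. cell_gain \<xi> \<kappa> (T \<omega>) ?v s * cell_gain \<xi> \<kappa> (T \<omega>) ?w t \<partial>M) = (\<integral>\<^sup>+\<omega>. path_gain \<xi> \<kappa> ?v s (X \<omega>) * path_gain \<xi> \<kappa> ?w t (Xk ?k \<omega>) \<partial>M)"
    unfolding cell_gain_def
    by (rule nn_integral_pair_lines[OF descent_line_label_line descent_line_label_line])
      (use True label_line_split(1) label_line_split(2)[OF assms] in \<open>auto intro!: measurable_path_gain\<close>)
  also have "\<dots> = (\<Prod>l\<le>?m. \<integral>\<^sup>+\<omega>. (if l \<le> ?k then split_factor ?v l (\<kappa> (X \<omega> 0)) * split_factor ?w l (\<kappa> (X \<omega> 0)) else split_factor ?v l (\<kappa> (X \<omega> 0))) \<partial>M)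
      * (\<Prod>l\<in>{?k<..?n}. \<integral>\<^sup>+\<omega>. split_factor ?w l (\<kappa> (X \<omega> 0)) \<partial>M) * split_prob ?k ?m ?n s t"
    unfolding path_gain_def lw split_prob_def by (rule pair_line_expectation[OF km])
  also have "(\<Prod>l\<le>?m. \<integral>\<^sup>+\<omega>. (if l \<le> ?k then split_factor ?v l (\<kappa> (X \<omega> 0)) * split_factor ?w l (\<kappa> (X \<omega> 0)) else split_factor ?v l (\<kappa> (X \<omega> 0))) \<partial>M)
     = label_prob u * (\<integral>\<^sup>+\<omega>. (if 1 \<le> i \<and> i \<le> \<kappa> (X \<omega> 0) then 1 else 0) * (if 1 \<le> j \<and> j \<le> \<kappa> (X \<omega> 0) then 1 else 0) \<partial>M) * label_prob x * mean_gain"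
  proof -
    have "(\<Prod>l<?k. \<integral>\<^sup>+\<omega>. (if l \<le> ?k then split_factor ?v l (\<kappa> (X \<omega> 0)) * split_factor ?w l (\<kappa> (X \<omega> 0)) else split_factor ?v l (\<kappa> (X \<omega> 0))) \<partial>M)
       = (\<Prod>l<?k. \<integral>\<^sup>+\<omega>. split_factor u l (\<kappa> (X \<omega> 0)) \<partial>M)"
      by (rule prod.cong) (simp_all add: split_factor_append)
    then show ?thesis unfolding prod_split_at label_prob_prod[symmetric] by (simp add: split_factor_append)
  qed
  also have "(\<Prod>l\<in>{?k<..?n}. \<integral>\<^sup>+\<omega>. split_factor ?w l (\<kappa> (X \<omega> 0)) \<partial>M) = label_prob y * mean_gain"
    unfolding prod_tail_split label_prob_prod[symmetric] by (simp add: split_factor_append)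
  finally show ?thesis by (simp only: ac_simps)
next
  case False
  then have "\<not> (\<forall>i\<in>set u. 1 \<le> i) \<or> \<not> (\<forall>i\<in>set x. 1 \<le> i) \<or> \<not> (\<forall>i\<in>set y. 1 \<le> i) \<or> i = 0 \<or> j = 0"
    by (auto simp: Suc_le_eq)
  then have inv: "label_prob u = 0 \<or> label_prob x = 0 \<or> label_prob y = 0 \<or> i = 0 \<or> j = 0"
    using label_prob_invalid by blast
  have "cell_gain \<xi> \<kappa> (T \<omega>) (u @ i # x) s = 0 \<or> cell_gain \<xi> \<kappa> (T \<omega>) (u @ j # y) t = 0" for \<omega>
    using False path_gain_invalid unfolding cell_gain_def by blast
  then have zero: "cell_gain \<xi> \<kappa> (T \<omega>) (u @ i # x) s * cell_gain \<xi> \<kappa> (T \<omega>) (u @ j # y) t = 0" for \<omega>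
    by (metis mult_eq_0_iff)
  show ?thesis unfolding zero using inv by (elim disjE) simp_all
qed

lemma measurable_nsum:
  assumes "\<And>i. f i \<in> borel_measurable N"
  shows "(\<lambda>\<omega>. nsum (\<lambda>i. f i \<omega>)) \<in> borel_measurable N"
proof -
  interpret sigma_finite_measure "count_space (UNIV :: 'i::countable set)"
    by (rule sigma_finite_measure_count_space_countable) simp
  show ?thesis
  proof (rule borel_measurable_nn_integral)
    have "(\<lambda>z. f (fst z) (snd z)) \<in> borel_measurable (count_space UNIV \<Otimes>\<^sub>M N)"
      using assms by (intro measurable_pair_measure_countable1) auto
    from measurable_compose[OF measurable_pair_swap' this]
    show "(\<lambda>(\<omega>, i). f i \<omega>) \<in> borel_measurable (N \<Otimes>\<^sub>M count_space UNIV)"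
      by (simp add: split_beta')
  qed
qed

lemma nn_integral_nsum:
  assumes "\<And>i. f i \<in> borel_measurable N"
  shows "(\<integral>\<^sup>+\<omega>. nsum (\<lambda>i. f i \<omega>) \<partial>N) = nsum (\<lambda>i. \<integral>\<^sup>+\<omega>. f i \<omega> \<partial>N)"
  by (rule nn_integral_count_space_nn_integral) (use assms in auto)

lemma nsum_children: "nsum (\<lambda>i. if 1 \<le> i \<and> i \<le> K then 1 else 0) = of_nat K"
proof -
  have "nsum (\<lambda>i. if 1 \<le> i \<and> i \<le> K then 1 else 0) = nsum (\<lambda>i. indicator {1..K} i)"
    by (intro nn_integral_cong) (auto split: split_indicator)
  also have "\<dots> = of_nat K" by (simp add: nn_integral_indicator emeasure_count_space)
  finally show ?thesis .
qed

text \<open>Counts ordered pairs of distinct children, which is where the second factorial moment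
  \<kappa>2 comes from.\<close>

lemma nsum_children_pairs:
  "nsum (\<lambda>i. nsum (\<lambda>j. if i = j then 0 else (if 1 \<le> i \<and> i \<le> K then 1 else 0) * (if 1 \<le> j \<and> j \<le> K then 1 else 0))) = of_nat K * of_nat (K - 1)"
proof -
  have "nsum (\<lambda>j. if i = j then 0 else (if 1 \<le> i \<and> i \<le> K then 1 else 0) * (if 1 \<le> j \<and> j \<le> K then 1 else 0))
      = (if 1 \<le> i \<and> i \<le> K then 1 else 0) * of_nat (K - 1)" for i
  proof (cases "1 \<le> i \<and> i \<le> K")
    case True
    have "nsum (\<lambda>j. if i = j then 0 else (if 1 \<le> i \<and> i \<le> K then 1 else 0) * (if 1 \<le> j \<and> j \<le> K then 1 else 0)) = nsum (\<lambda>j. indicator ({1..K} - {i}) j)"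
      using True by (intro nn_integral_cong) (auto split: split_indicator)
    also have "\<dots> = of_nat (K - 1)" using True by (simp add: nn_integral_indicator emeasure_count_space card_Diff_singleton)
    finally show ?thesis using True by simp
  next
    case False
    then show ?thesis by (auto intro!: nn_integral_zero' AE_I2)
  qed
  then show ?thesis using nsum_children[of K] by (simp add: nsum_multc)
qed

lemma nsum_child_prob: "nsum child_prob = (\<integral>\<^sup>+\<omega>. of_nat (\<kappa> (X \<omega> 0)) \<partial>M)"
proof -
  have "nsum child_prob = (\<integral>\<^sup>+\<omega>. nsum (\<lambda>i. if 1 \<le> i \<and> i \<le> \<kappa> (X \<omega> 0) then 1 else 0) \<partial>M)"
    unfolding child_prob_def by (rule nn_integral_nsum[symmetric]) measurable
  then show ?thesis by (simp only: nsum_children)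
qed

abbreviation "offspring_mean \<equiv> (\<integral>\<^sup>+\<omega>. of_nat (\<kappa> (X \<omega> 0)) \<partial>M)"
abbreviation "offspring_fact2 \<equiv> (\<integral>\<^sup>+\<omega>. of_nat (\<kappa> (X \<omega> 0)) * of_nat (\<kappa> (X \<omega> 0) - 1) \<partial>M)"

abbreviation total_gain :: "real \<Rightarrow> 'w \<Rightarrow> ennreal" where
  "total_gain t \<omega> \<equiv> nsum (\<lambda>v. cell_gain \<xi> \<kappa> (T \<omega>) v t)"

lemma measurable_total_gain: "total_gain t \<in> borel_measurable M"
  by (rule measurable_nsum) (rule measurable_cell_gain)

lemma total_gain_mean:
  "(\<integral>\<^sup>+\<omega>. total_gain t \<omega> \<partial>M) = (\<Sum>n. offspring_mean ^ n * (mean_gain * line_prob n t n t))"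
proof -
  have "(\<integral>\<^sup>+\<omega>. total_gain t \<omega> \<partial>M) = nsum (\<lambda>v. label_prob v * (mean_gain * line_prob (length v) t (length v) t))"
    by (subst nn_integral_nsum) (auto simp: cell_gain_mean mult.assoc)
  also have "\<dots> = (\<Sum>n. offspring_mean ^ n * (mean_gain * line_prob n t n t))"
    unfolding nsum_list_weight[of child_prob "\<lambda>n. mean_gain * line_prob n t n t"] nsum_child_prob ..
  finally show ?thesis .
qed

text \<open>
  For a pair of labels with last common ancestor of generation \<open>k\<close>, the four terms correspond to
  equal labels, to either label being the ancestor itself, and to two distinct children of it.
\<close>

lemma total_gain_second_moment:
  "(\<integral>\<^sup>+\<omega>. total_gain s \<omega> * total_gain t \<omega> \<partial>M) = (\<Sum>k. offspring_mean ^ k *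
    ((\<integral>\<^sup>+\<omega>. of_nat (\<kappa> (X \<omega> 0) - 1) * of_nat (\<kappa> (X \<omega> 0) - 1) \<partial>M) * line_prob k s k t
     + offspring_fact2 * (\<Sum>n. offspring_mean ^ n * (mean_gain * line_prob k t (Suc (k + n)) s))
     + offspring_fact2 * (\<Sum>n. offspring_mean ^ n * (mean_gain * line_prob k s (Suc (k + n)) t))
     + offspring_fact2 * (\<Sum>m. offspring_mean ^ m * (\<Sum>n. offspring_mean ^ n * (mean_gain * (mean_gain * split_prob k (Suc (k + m)) (Suc (k + n)) s t))))))"
proof -
  let ?c = "\<lambda>v t \<omega>. cell_gain \<xi> \<kappa> (T \<omega>) v t"
  let ?I = "\<lambda>v w. \<integral>\<^sup>+\<omega>. ?c v s \<omega> * ?c w t \<omega> \<partial>M"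
  let ?d = "\<integral>\<^sup>+\<omega>. of_nat (\<kappa> (X \<omega> 0) - 1) * of_nat (\<kappa> (X \<omega> 0) - 1) \<partial>M"
  define kj where "kj j = (\<integral>\<^sup>+\<omega>. of_nat (\<kappa> (X \<omega> 0) - 1) * (if 1 \<le> j \<and> j \<le> \<kappa> (X \<omega> 0) then 1 else 0) \<partial>M)" for j
  define r2 where "r2 i j = (\<integral>\<^sup>+\<omega>. (if i = j then 0 else (if 1 \<le> i \<and> i \<le> \<kappa> (X \<omega> 0) then 1 else 0) * (if 1 \<le> j \<and> j \<le> \<kappa> (X \<omega> 0) then 1 else 0)) \<partial>M)" for i j
  note weight = nsum_list_weight[of child_prob, unfolded nsum_child_prob]
  \<comment> \<open>The ancestor's own gain \<kappa> - 1, summed over its \<kappa> children, leads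
    to the same second factorial moment as pairs of distinct children.\<close>
  have kj: "nsum kj = offspring_fact2"
  proof -
    have "nsum kj = (\<integral>\<^sup>+\<omega>. nsum (\<lambda>j. of_nat (\<kappa> (X \<omega> 0) - 1) * (if 1 \<le> j \<and> j \<le> \<kappa> (X \<omega> 0) then 1 else 0)) \<partial>M)"
      unfolding kj_def by (rule nn_integral_nsum[symmetric]) measurable
    then show ?thesis by (simp only: nsum_cmult nsum_children mult.commute)
  qed
  have r2: "nsum (\<lambda>i. nsum (r2 i)) = offspring_fact2"
  proof -
    let ?f = "\<lambda>i j \<omega>. (if i = j then 0 else (if 1 \<le> i \<and> i \<le> \<kappa> (X \<omega> 0) then 1 else 0) * (if 1 \<le> j \<and> j \<le> \<kappa> (X \<omega> 0) then 1 else 0)) :: ennreal"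
    have f: "?f i j \<in> borel_measurable M" for i j by measurable
    have "nsum (\<lambda>i. nsum (r2 i)) = nsum (\<lambda>i. \<integral>\<^sup>+\<omega>. nsum (\<lambda>j. ?f i j \<omega>) \<partial>M)"
      unfolding r2_def by (intro nn_integral_cong nn_integral_nsum[symmetric] f)
    also have "\<dots> = (\<integral>\<^sup>+\<omega>. nsum (\<lambda>i. nsum (\<lambda>j. ?f i j \<omega>)) \<partial>M)"
      by (intro nn_integral_nsum[symmetric] measurable_nsum f)
    finally show ?thesis by (simp only: nsum_children_pairs)
  qed
  have "(\<integral>\<^sup>+\<omega>. total_gain s \<omega> * total_gain t \<omega> \<partial>M) = (\<integral>\<^sup>+\<omega>. nsum (\<lambda>v. nsum (\<lambda>w. ?c v s \<omega> * ?c w t \<omega>)) \<partial>M)"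
    by (simp only: nsum_cmult nsum_multc)
  also have "\<dots> = nsum (\<lambda>v. \<integral>\<^sup>+\<omega>. nsum (\<lambda>w. ?c v s \<omega> * ?c w t \<omega>) \<partial>M)"
    by (intro nn_integral_nsum measurable_nsum borel_measurable_times_ennreal measurable_cell_gain)
  also have "\<dots> = nsum (\<lambda>v. nsum (\<lambda>w. ?I v w))"
    by (intro nn_integral_cong nn_integral_nsum borel_measurable_times_ennreal measurable_cell_gain)
  also have "\<dots> = nsum (\<lambda>u. ?I u u
    + nsum (\<lambda>i. nsum (\<lambda>x. ?I (u @ i # x) u)) + nsum (\<lambda>j. nsum (\<lambda>y. ?I u (u @ j # y)))
    + nsum (\<lambda>i. nsum (\<lambda>j. nsum (\<lambda>x. nsum (\<lambda>y. (if i = j then 0 else ?I (u @ i # x) (u @ j # y)))))))"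
    by (rule nsum_pairs_split)
  also have "\<dots> = nsum (\<lambda>u. label_prob u * (?d * line_prob (length u) s (length u) t
     + offspring_fact2 * (\<Sum>n. offspring_mean ^ n * (mean_gain * line_prob (length u) t (Suc (length u + n)) s))
     + offspring_fact2 * (\<Sum>n. offspring_mean ^ n * (mean_gain * line_prob (length u) s (Suc (length u + n)) t))
     + offspring_fact2 * (\<Sum>m. offspring_mean ^ m * (\<Sum>n. offspring_mean ^ n * (mean_gain * (mean_gain * split_prob (length u) (Suc (length u + m)) (Suc (length u + n)) s t))))))"
  proof (rule nn_integral_cong)
    fix u :: "nat list"
    let ?k = "length u"
    have t1: "?I u u = label_prob u * (?d * line_prob ?k s ?k t)"
      by (simp only: cell_gain_diagonal mult.assoc)
    have anc: "nsum (\<lambda>j. nsum (\<lambda>y. label_prob u * (kj j * (label_prob y * (mean_gain * line_prob ?k a (Suc (?k + length y)) b)))))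
       = label_prob u * (offspring_fact2 * (\<Sum>n. offspring_mean ^ n * (mean_gain * line_prob ?k a (Suc (?k + n)) b)))" for a b
      by (simp only: nsum_cmult nsum_multc kj weight[of "\<lambda>n. mean_gain * line_prob ?k a (Suc (?k + n)) b"])
    \<comment> \<open>Here the second label is the ancestor, so the times s and t change places in
      comparison with the next term.\<close>
    have t2: "nsum (\<lambda>i. nsum (\<lambda>x. ?I (u @ i # x) u)) = label_prob u * (offspring_fact2 * (\<Sum>n. offspring_mean ^ n * (mean_gain * line_prob ?k t (Suc (?k + n)) s)))"
      unfolding anc[symmetric] by (subst mult.commute) (simp only: cell_gain_ancestor kj_def)
    have t3: "nsum (\<lambda>j. nsum (\<lambda>y. ?I u (u @ j # y))) = label_prob u * (offspring_fact2 * (\<Sum>n. offspring_mean ^ n * (mean_gain * line_prob ?k s (Suc (?k + n)) t)))"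
      unfolding anc[symmetric] by (simp only: cell_gain_ancestor kj_def)
    have "(if i = j then 0 else ?I (u @ i # x) (u @ j # y)) = label_prob u * (r2 i j * (label_prob x * (label_prob y * (mean_gain * (mean_gain
        * split_prob ?k (Suc (?k + length x)) (Suc (?k + length y)) s t)))))" for i j x y
      by (simp add: cell_gain_split r2_def)
    then have t4: "nsum (\<lambda>i. nsum (\<lambda>j. nsum (\<lambda>x. nsum (\<lambda>y. (if i = j then 0 else ?I (u @ i # x) (u @ j # y))))))
       = label_prob u * (offspring_fact2 * (\<Sum>m. offspring_mean ^ m * (\<Sum>n. offspring_mean ^ n * (mean_gain * (mean_gain * split_prob ?k (Suc (?k + m)) (Suc (?k + n)) s t)))))"
      by (simp only: nsum_cmult nsum_multc r2 weight[of "\<lambda>n. mean_gain * (mean_gain * split_prob ?k _ (Suc (?k + n)) s t)"]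
          weight[of "\<lambda>m. (\<Sum>n. offspring_mean ^ n * (mean_gain * (mean_gain * split_prob ?k (Suc (?k + m)) (Suc (?k + n)) s t)))"])
    show "?I u u + nsum (\<lambda>i. nsum (\<lambda>x. ?I (u @ i # x) u)) + nsum (\<lambda>j. nsum (\<lambda>y. ?I u (u @ j # y)))
      + nsum (\<lambda>i. nsum (\<lambda>j. nsum (\<lambda>x. nsum (\<lambda>y. (if i = j then 0 else ?I (u @ i # x) (u @ j # y))))))
      = label_prob u * (?d * line_prob (length u) s (length u) t
     + offspring_fact2 * (\<Sum>n. offspring_mean ^ n * (mean_gain * line_prob (length u) t (Suc (length u + n)) s))
     + offspring_fact2 * (\<Sum>n. offspring_mean ^ n * (mean_gain * line_prob (length u) s (Suc (length u + n)) t))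
     + offspring_fact2 * (\<Sum>m. offspring_mean ^ m * (\<Sum>n. offspring_mean ^ n * (mean_gain * (mean_gain * split_prob (length u) (Suc (length u + m)) (Suc (length u + n)) s t)))))"
      by (simp only: t1 t2 t3 t4 distrib_left)
  qed
  also have "\<dots> = (\<Sum>k. offspring_mean ^ k * (?d * line_prob k s k t
     + offspring_fact2 * (\<Sum>n. offspring_mean ^ n * (mean_gain * line_prob k t (Suc (k + n)) s))
     + offspring_fact2 * (\<Sum>n. offspring_mean ^ n * (mean_gain * line_prob k s (Suc (k + n)) t))
     + offspring_fact2 * (\<Sum>m. offspring_mean ^ m * (\<Sum>n. offspring_mean ^ n * (mean_gain * (mean_gain * split_prob k (Suc (k + m)) (Suc (k + n)) s t))))))"
    by (rule weight)
  finally show ?thesis .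
qed

end

lemma lifetime_sum_shift:
  "lifetime_sum \<xi> p (Suc (k + n)) = lifetime_sum \<xi> p k + lifetime_sum \<xi> (\<lambda>n. p (Suc k + n)) n"
  unfolding lifetime_sum_def by (induction n) (simp_all add: add.assoc)

section \<open>Integrating out the futures after the last common ancestor\<close>

context markov_independence
begin

definition lifetime_cdf :: "nat \<Rightarrow> 'x \<Rightarrow> real \<Rightarrow> ennreal" where
  "lifetime_cdf n x t = emeasure (future_law E P x) {p \<in> space (path_space E). lifetime_sum \<xi> p n \<le> t}"

text \<open>Expected gain, within time t after its birth, from the progeny of one child of a cell
  with parameter x: at n generations below the child there are \<kappa>1 to the power n cells on
  average, each adding \<kappa>1 - 1 when it divides.\<close>

definition growth :: "'x \<Rightarrow> real \<Rightarrow> ennreal" where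
  "growth x t = (\<Sum>n. offspring_mean ^ n * (mean_gain * lifetime_cdf n x t))"

lemma measurable_lifetime_sum_path[measurable]: "(\<lambda>p. lifetime_sum \<xi> p n) \<in> borel_measurable (path_space E)"
  by (rule measurable_lifetime_sum) simp

lemma lifetime_cdf_integral:
  assumes "x \<in> space E"
  shows "(\<integral>\<^sup>+a. indicator {..t} (c + lifetime_sum \<xi> a n) \<partial>future_law E P x) = lifetime_cdf n x (t - c)"
proof -
  have "(\<integral>\<^sup>+a. indicator {..t} (c + lifetime_sum \<xi> a n) \<partial>future_law E P x)
      = (\<integral>\<^sup>+a. indicator {p \<in> space (path_space E). lifetime_sum \<xi> p n \<le> t - c} a \<partial>future_law E P x)"
    using sets_eq_imp_space_eq[OF sets_future_law[OF assms]]
    by (intro nn_integral_cong) (auto split: split_indicator)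
  also have "\<dots> = lifetime_cdf n x (t - c)"
    unfolding lifetime_cdf_def by (rule nn_integral_indicator) (simp add: sets_future_law[OF assms])
  finally show ?thesis .
qed

lemma joint_futures_product:
  fixes k :: nat
  defines "N \<equiv> \<Pi>\<^sub>M j\<in>{..k}. E"
  assumes u[measurable]: "u \<in> borel_measurable N" and f[measurable]: "f \<in> borel_measurable (N \<Otimes>\<^sub>M path_space E)"
    and g[measurable]: "g \<in> borel_measurable (N \<Otimes>\<^sub>M path_space E)"
  shows "(\<integral>\<^sup>+\<omega>. u (restrict (X \<omega>) {..k}) * (f (restrict (X \<omega>) {..k}, \<lambda>n. X \<omega> (Suc k + n)) * g (restrict (X \<omega>) {..k}, \<lambda>n. Xk k \<omega> (Suc k + n))) \<partial>M)
    = (\<integral>\<^sup>+\<omega>. u (restrict (X \<omega>) {..k}) * ((\<integral>\<^sup>+a. f (restrict (X \<omega>) {..k}, a) \<partial>future_law E P (X \<omega> k)) * (\<integral>\<^sup>+b. g (restrict (X \<omega>) {..k}, b) \<partial>future_law E P (X \<omega> k))) \<partial>M)"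
proof -
  define h where "h = (\<lambda>(y, z). u y * (f (y, fst z) * g (y, snd z)))"
  have h: "h \<in> borel_measurable (N \<Otimes>\<^sub>M (path_space E \<Otimes>\<^sub>M path_space E))" unfolding h_def by measurable
  have Y: "(\<lambda>\<omega>. restrict (X \<omega>) {..k}) \<in> measurable M N"
    unfolding N_def using X_measurable by (rule measurable_path_restrict)
  have "(\<integral>\<^sup>+\<omega>. h (restrict (X \<omega>) {..k}, (\<lambda>n. X \<omega> (Suc k + n), \<lambda>n. Xk k \<omega> (Suc k + n))) \<partial>M)
     = (\<integral>\<^sup>+\<omega>. \<integral>\<^sup>+z. h (restrict (X \<omega>) {..k}, z) \<partial>(future_law E P (X \<omega> k) \<Otimes>\<^sub>M future_law E P (X \<omega> k)) \<partial>M)"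
    by (rule joint_futures_given_past) (use h N_def in simp)
  also have "\<dots> = (\<integral>\<^sup>+\<omega>. u (restrict (X \<omega>) {..k}) * ((\<integral>\<^sup>+a. f (restrict (X \<omega>) {..k}, a) \<partial>future_law E P (X \<omega> k)) * (\<integral>\<^sup>+b. g (restrict (X \<omega>) {..k}, b) \<partial>future_law E P (X \<omega> k))) \<partial>M)"
  proof (rule nn_integral_cong)
    fix \<omega> assume \<omega>: "\<omega> \<in> space M"
    let ?y = "restrict (X \<omega>) {..k}" and ?F = "future_law E P (X \<omega> k)"
    note x = X_space[OF \<omega>, of k]
    have y: "?y \<in> space N" using measurable_space[OF Y \<omega>] .
    note sF = sets_future_law[OF x]
    interpret F: prob_space ?F by (rule prob_space_future_law[OF x])
    have m: "(\<lambda>a. \<phi> (?y, a)) \<in> borel_measurable ?F" if "\<phi> \<in> borel_measurable (N \<Otimes>\<^sub>M path_space E)" for \<phi> :: "_ \<Rightarrow> ennreal"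
      by (subst measurable_cong_sets[OF sF refl]) (rule measurable_Pair2[OF that y])
    note fm = m[OF f] and gm = m[OF g]
    have "(\<integral>\<^sup>+z. h (?y, z) \<partial>(?F \<Otimes>\<^sub>M ?F)) = (\<integral>\<^sup>+a. \<integral>\<^sup>+b. h (?y, (a, b)) \<partial>?F \<partial>?F)"
    proof (rule F.nn_integral_fst[symmetric])
      have "(\<lambda>z. u ?y * (f (?y, fst z) * g (?y, snd z))) \<in> borel_measurable (?F \<Otimes>\<^sub>M ?F)"
        by (intro borel_measurable_times_ennreal borel_measurable_const measurable_compose[OF measurable_fst fm] measurable_compose[OF measurable_snd gm])
      then show "(\<lambda>z. h (?y, z)) \<in> borel_measurable (?F \<Otimes>\<^sub>M ?F)" by (simp add: h_def)
    qed
    also have "\<dots> = (\<integral>\<^sup>+a. u ?y * (f (?y, a) * (\<integral>\<^sup>+b. g (?y, b) \<partial>?F)) \<partial>?F)"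
      using gm by (intro nn_integral_cong) (simp add: h_def nn_integral_cmult)
    also have "\<dots> = u ?y * ((\<integral>\<^sup>+a. f (?y, a) \<partial>?F) * (\<integral>\<^sup>+b. g (?y, b) \<partial>?F))"
      using fm by (simp add: nn_integral_cmult nn_integral_multc)
    finally show "(\<integral>\<^sup>+z. h (?y, z) \<partial>(?F \<Otimes>\<^sub>M ?F)) = u ?y * ((\<integral>\<^sup>+a. f (?y, a) \<partial>?F) * (\<integral>\<^sup>+b. g (?y, b) \<partial>?F))" .
  qed
  finally show ?thesis by (simp add: h_def)
qed

lemma measurable_lifetime_sum_restrict:
  "(\<lambda>y. lifetime_sum \<xi> y k) \<in> borel_measurable (\<Pi>\<^sub>M j\<in>{..k}. E)"
  unfolding lifetime_sum_def
proof (rule borel_measurable_sum)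
  fix j assume "j \<in> {..k}"
  then have "(\<lambda>y. y j) \<in> measurable (\<Pi>\<^sub>M j\<in>{..k}. E) E" by (rule measurable_component_singleton)
  from measurable_compose[OF this xi_measurable] show "(\<lambda>y. \<xi> (y j)) \<in> borel_measurable (\<Pi>\<^sub>M j\<in>{..k}. E)" .
qed

lemma lifetime_sum_restrict: "lifetime_sum \<xi> (restrict p {..k}) k = lifetime_sum \<xi> p k"
  by (simp add: lifetime_sum_def)

lemma measurable_lifetime_event:
  "(\<lambda>z. indicator {..t} (lifetime_sum \<xi> (fst z) k + lifetime_sum \<xi> (snd z) n) :: ennreal) \<in> borel_measurable ((\<Pi>\<^sub>M j\<in>{..k}. E) \<Otimes>\<^sub>M path_space E)"
proof -
  have "(\<lambda>z. lifetime_sum \<xi> (fst z) k + lifetime_sum \<xi> (snd z) n) \<in> borel_measurable ((\<Pi>\<^sub>M j\<in>{..k}. E) \<Otimes>\<^sub>M path_space E)"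
    by (intro borel_measurable_add measurable_compose[OF measurable_fst measurable_lifetime_sum_restrict]
        measurable_compose[OF measurable_snd measurable_lifetime_sum_path])
  then show ?thesis by (rule measurable_compose) simp
qed

lemma measurable_lifetime_cdf:
  "(\<lambda>\<omega>. lifetime_cdf n (X \<omega> k) (t - lifetime_sum \<xi> (X \<omega>) k)) \<in> borel_measurable M"
proof -
  let ?N = "\<Pi>\<^sub>M j\<in>{..k}. E"
  have Y: "(\<lambda>\<omega>. restrict (X \<omega>) {..k}) \<in> measurable M ?N"
    using X_measurable by (rule measurable_path_restrict)
  have pk: "(\<lambda>y. y k) \<in> measurable ?N E" by (rule measurable_component_singleton) simp
  have K: "(\<lambda>y. future_law E P (y k)) \<in> measurable ?N (subprob_algebra (path_space E))"
    by (rule measurable_compose[OF pk measurable_prob_algebraD[OF future_law_measurable[OF kernel]]])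
  have "(\<lambda>y. \<integral>\<^sup>+a. indicator {..t} (lifetime_sum \<xi> y k + lifetime_sum \<xi> a n) \<partial>future_law E P (y k)) \<in> borel_measurable ?N"
    by (rule nn_integral_measurable_subprob_algebra2[OF _ K]) (use measurable_lifetime_event[of t k n] in \<open>simp add: split_beta'\<close>)
  from measurable_compose[OF Y this]
  have "(\<lambda>\<omega>. \<integral>\<^sup>+a. indicator {..t} (lifetime_sum \<xi> (X \<omega>) k + lifetime_sum \<xi> a n) \<partial>future_law E P (X \<omega> k)) \<in> borel_measurable M"
    by (simp only: lifetime_sum_restrict restrict_apply' atMost_iff order_refl)
  then show ?thesis
    by (rule measurable_cong[THEN iffD1, rotated]) (rule lifetime_cdf_integral[OF X_space])
qed

lemma measurable_growth_shifted:
  "(\<lambda>\<omega>. growth (X \<omega> k) (t - lifetime_sum \<xi> (X \<omega>) k)) \<in> borel_measurable M"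
  unfolding growth_def
  by (intro borel_measurable_suminf_order borel_measurable_times_ennreal borel_measurable_const measurable_lifetime_cdf)

lemma line_prob_eq:
  "line_prob k s (Suc (k + n)) t = (\<integral>\<^sup>+\<omega>. indicator {..s} (lifetime_sum \<xi> (X \<omega>) k) * lifetime_cdf n (X \<omega> k) (t - lifetime_sum \<xi> (X \<omega>) k) \<partial>M)"
proof -
  have u: "(\<lambda>y. indicator {..s} (lifetime_sum \<xi> y k) :: ennreal) \<in> borel_measurable (\<Pi>\<^sub>M j\<in>{..k}. E)"
    by (rule measurable_compose[OF measurable_lifetime_sum_restrict]) simp
  \<comment> \<open>The constant 1 as factor on the second line lets the statement about two futures
    serve for one.\<close>
  have "line_prob k s (Suc (k + n)) t = (\<integral>\<^sup>+\<omega>. indicator {..s} (lifetime_sum \<xi> (X \<omega>) k) * (indicator {..t} (lifetime_sum \<xi> (X \<omega>) k + lifetime_sum \<xi> (\<lambda>n. X \<omega> (Suc k + n)) n) * 1) \<partial>M)"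
    unfolding line_prob_def lifetime_sum_shift by simp
  also have "\<dots> = (\<integral>\<^sup>+\<omega>. indicator {..s} (lifetime_sum \<xi> (X \<omega>) k) * ((\<integral>\<^sup>+a. indicator {..t} (lifetime_sum \<xi> (X \<omega>) k + lifetime_sum \<xi> a n) \<partial>future_law E P (X \<omega> k)) * (\<integral>\<^sup>+b. 1 \<partial>future_law E P (X \<omega> k))) \<partial>M)"
    using joint_futures_product[OF u measurable_lifetime_event borel_measurable_const, of t n 1]
    by (simp only: fst_conv snd_conv lifetime_sum_restrict)
  also have "\<dots> = (\<integral>\<^sup>+\<omega>. indicator {..s} (lifetime_sum \<xi> (X \<omega>) k) * lifetime_cdf n (X \<omega> k) (t - lifetime_sum \<xi> (X \<omega>) k) \<partial>M)"
    by (intro nn_integral_cong) (simp add: lifetime_cdf_integral X_space prob_space.emeasure_space_1[OF prob_space_future_law])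
  finally show ?thesis .
qed

lemma split_prob_eq:
  "split_prob k (Suc (k + m)) (Suc (k + n)) s t = (\<integral>\<^sup>+\<omega>. lifetime_cdf m (X \<omega> k) (s - lifetime_sum \<xi> (X \<omega>) k) * lifetime_cdf n (X \<omega> k) (t - lifetime_sum \<xi> (X \<omega>) k) \<partial>M)"
proof -
  have "split_prob k (Suc (k + m)) (Suc (k + n)) s t = (\<integral>\<^sup>+\<omega>. 1 * (indicator {..s} (lifetime_sum \<xi> (X \<omega>) k + lifetime_sum \<xi> (\<lambda>n. X \<omega> (Suc k + n)) m)
      * indicator {..t} (lifetime_sum \<xi> (X \<omega>) k + lifetime_sum \<xi> (\<lambda>n. Xk k \<omega> (Suc k + n)) n)) \<partial>M)"
    unfolding split_prob_def
  proof (rule nn_integral_cong_AE)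
    show "AE \<omega> in M. indicator {..s} (lifetime_sum \<xi> (X \<omega>) (Suc (k + m))) * indicator {..t} (lifetime_sum \<xi> (Xk k \<omega>) (Suc (k + n)))
       = (1 :: ennreal) * (indicator {..s} (lifetime_sum \<xi> (X \<omega>) k + lifetime_sum \<xi> (\<lambda>n. X \<omega> (Suc k + n)) m)
      * indicator {..t} (lifetime_sum \<xi> (X \<omega>) k + lifetime_sum \<xi> (\<lambda>n. Xk k \<omega> (Suc k + n)) n))"
      using Xk_eq[of k]
    proof eventually_elim
      case (elim \<omega>)
      then have "lifetime_sum \<xi> (Xk k \<omega>) k = lifetime_sum \<xi> (X \<omega>) k" by (simp add: lifetime_sum_def)
      then show ?case by (simp only: lifetime_sum_shift mult_1)
    qed
  qed
  also have "\<dots> = (\<integral>\<^sup>+\<omega>. 1 * ((\<integral>\<^sup>+a. indicator {..s} (lifetime_sum \<xi> (X \<omega>) k + lifetime_sum \<xi> a m) \<partial>future_law E P (X \<omega> k))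
      * (\<integral>\<^sup>+b. indicator {..t} (lifetime_sum \<xi> (X \<omega>) k + lifetime_sum \<xi> b n) \<partial>future_law E P (X \<omega> k))) \<partial>M)"
    using joint_futures_product[OF borel_measurable_const[where c=1] measurable_lifetime_event[of s k m] measurable_lifetime_event[of t k n]]
    by (simp only: fst_conv snd_conv lifetime_sum_restrict)
  also have "\<dots> = (\<integral>\<^sup>+\<omega>. lifetime_cdf m (X \<omega> k) (s - lifetime_sum \<xi> (X \<omega>) k) * lifetime_cdf n (X \<omega> k) (t - lifetime_sum \<xi> (X \<omega>) k) \<partial>M)"
    by (intro nn_integral_cong) (simp add: lifetime_cdf_integral X_space)
  finally show ?thesis .
qed

lemma line_prob_sum:
  "(\<Sum>n. offspring_mean ^ n * (mean_gain * line_prob k s (Suc (k + n)) t))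
    = (\<integral>\<^sup>+\<omega>. indicator {..s} (lifetime_sum \<xi> (X \<omega>) k) * growth (X \<omega> k) (t - lifetime_sum \<xi> (X \<omega>) k) \<partial>M)"
proof -
  have i: "(\<lambda>\<omega>. indicator {..s} (lifetime_sum \<xi> (X \<omega>) k) :: ennreal) \<in> borel_measurable M"
    by (rule measurable_lifetime_indicator[OF X_measurable])
  note m = borel_measurable_times_ennreal[OF i measurable_lifetime_cdf[of _ k t]]
  have "(\<Sum>n. offspring_mean ^ n * (mean_gain * line_prob k s (Suc (k + n)) t))
     = (\<Sum>n. \<integral>\<^sup>+\<omega>. offspring_mean ^ n * (mean_gain * (indicator {..s} (lifetime_sum \<xi> (X \<omega>) k) * lifetime_cdf n (X \<omega> k) (t - lifetime_sum \<xi> (X \<omega>) k))) \<partial>M)"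
    unfolding line_prob_eq using m by (simp add: nn_integral_cmult)
  also have "\<dots> = (\<integral>\<^sup>+\<omega>. (\<Sum>n. offspring_mean ^ n * (mean_gain * (indicator {..s} (lifetime_sum \<xi> (X \<omega>) k) * lifetime_cdf n (X \<omega> k) (t - lifetime_sum \<xi> (X \<omega>) k)))) \<partial>M)"
    by (rule nn_integral_suminf[symmetric]) (intro borel_measurable_times_ennreal borel_measurable_const m)
  also have "\<dots> = (\<integral>\<^sup>+\<omega>. indicator {..s} (lifetime_sum \<xi> (X \<omega>) k) * growth (X \<omega> k) (t - lifetime_sum \<xi> (X \<omega>) k) \<partial>M)"
    unfolding growth_def ennreal_suminf_cmult[symmetric] by (intro nn_integral_cong suminf_cong) (simp only: ac_simps)
  finally show ?thesis .
qed

text \<open>Independence of the futures given the past turns the double sum over the generations of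
  the two tails into a product of two sums.\<close>

lemma split_prob_sum:
  "(\<Sum>m. offspring_mean ^ m * (\<Sum>n. offspring_mean ^ n * (mean_gain * (mean_gain * split_prob k (Suc (k + m)) (Suc (k + n)) s t))))
    = (\<integral>\<^sup>+\<omega>. growth (X \<omega> k) (s - lifetime_sum \<xi> (X \<omega>) k) * growth (X \<omega> k) (t - lifetime_sum \<xi> (X \<omega>) k) \<partial>M)"
proof -
  let ?c = "\<lambda>n t \<omega>. lifetime_cdf n (X \<omega> k) (t - lifetime_sum \<xi> (X \<omega>) k)"
  note m = measurable_lifetime_cdf[of _ k]
  note I = borel_measurable_times_ennreal borel_measurable_const m borel_measurable_suminf_order
  have "(\<Sum>m. offspring_mean ^ m * (\<Sum>n. offspring_mean ^ n * (mean_gain * (mean_gain * split_prob k (Suc (k + m)) (Suc (k + n)) s t))))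
     = (\<Sum>m. \<Sum>n. \<integral>\<^sup>+\<omega>. (offspring_mean ^ m * (offspring_mean ^ n * (mean_gain * mean_gain))) * (?c m s \<omega> * ?c n t \<omega>) \<partial>M)"
    unfolding ennreal_suminf_cmult[symmetric]
  proof (intro suminf_cong)
    fix m n
    have "(\<integral>\<^sup>+\<omega>. (offspring_mean ^ m * (offspring_mean ^ n * (mean_gain * mean_gain))) * (?c m s \<omega> * ?c n t \<omega>) \<partial>M)
       = (offspring_mean ^ m * (offspring_mean ^ n * (mean_gain * mean_gain))) * split_prob k (Suc (k + m)) (Suc (k + n)) s t"
      unfolding split_prob_eq by (intro nn_integral_cmult I)
    then show "offspring_mean ^ m * (offspring_mean ^ n * (mean_gain * (mean_gain * split_prob k (Suc (k + m)) (Suc (k + n)) s t)))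
       = (\<integral>\<^sup>+\<omega>. (offspring_mean ^ m * (offspring_mean ^ n * (mean_gain * mean_gain))) * (?c m s \<omega> * ?c n t \<omega>) \<partial>M)"
      by (simp only: mult.assoc)
  qed
  also have "\<dots> = (\<Sum>m. \<integral>\<^sup>+\<omega>. (\<Sum>n. (offspring_mean ^ m * (offspring_mean ^ n * (mean_gain * mean_gain))) * (?c m s \<omega> * ?c n t \<omega>)) \<partial>M)"
    by (intro suminf_cong nn_integral_suminf[symmetric] I)
  also have "\<dots> = (\<integral>\<^sup>+\<omega>. (\<Sum>m. \<Sum>n. (offspring_mean ^ m * (offspring_mean ^ n * (mean_gain * mean_gain))) * (?c m s \<omega> * ?c n t \<omega>)) \<partial>M)"
    by (intro nn_integral_suminf[symmetric] I)
  also have "\<dots> = (\<integral>\<^sup>+\<omega>. growth (X \<omega> k) (s - lifetime_sum \<xi> (X \<omega>) k) * growth (X \<omega> k) (t - lifetime_sum \<xi> (X \<omega>) k) \<partial>M)"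
  proof (rule nn_integral_cong)
    fix \<omega>
    have "growth (X \<omega> k) (s - lifetime_sum \<xi> (X \<omega>) k) * growth (X \<omega> k) (t - lifetime_sum \<xi> (X \<omega>) k)
       = (\<Sum>m. \<Sum>n. (offspring_mean ^ m * (mean_gain * ?c m s \<omega>)) * (offspring_mean ^ n * (mean_gain * ?c n t \<omega>)))"
      unfolding growth_def by (simp only: ennreal_suminf_cmult ennreal_suminf_multc)
    also have "\<dots> = (\<Sum>m. \<Sum>n. (offspring_mean ^ m * (offspring_mean ^ n * (mean_gain * mean_gain))) * (?c m s \<omega> * ?c n t \<omega>))"
      by (intro suminf_cong) (simp only: ac_simps)
    finally show "(\<Sum>m. \<Sum>n. (offspring_mean ^ m * (offspring_mean ^ n * (mean_gain * mean_gain))) * (?c m s \<omega> * ?c n t \<omega>))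
       = growth (X \<omega> k) (s - lifetime_sum \<xi> (X \<omega>) k) * growth (X \<omega> k) (t - lifetime_sum \<xi> (X \<omega>) k)" ..
  qed
  finally show ?thesis .
qed

lemma xi_X_nonneg: "\<omega> \<in> space M \<Longrightarrow> 0 \<le> \<xi> (X \<omega> n)"
  using xi_nonneg X_space by blast

lemma lifetime_sum_nonneg: "\<omega> \<in> space M \<Longrightarrow> 0 \<le> lifetime_sum \<xi> (X \<omega>) n"
  unfolding lifetime_sum_def by (intro sum_nonneg xi_X_nonneg)

lemma second_moment:
  "(\<integral>\<^sup>+\<omega>. total_gain s \<omega> * total_gain t \<omega> \<partial>M) = (\<Sum>k. offspring_mean ^ k *
    ((\<integral>\<^sup>+\<omega>. of_nat (\<kappa> (X \<omega> 0) - 1) * of_nat (\<kappa> (X \<omega> 0) - 1) \<partial>M) * line_prob k s k t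
     + offspring_fact2 * (\<integral>\<^sup>+\<omega>. indicator {..t} (lifetime_sum \<xi> (X \<omega>) k) * growth (X \<omega> k) (s - lifetime_sum \<xi> (X \<omega>) k) \<partial>M)
     + offspring_fact2 * (\<integral>\<^sup>+\<omega>. indicator {..s} (lifetime_sum \<xi> (X \<omega>) k) * growth (X \<omega> k) (t - lifetime_sum \<xi> (X \<omega>) k) \<partial>M)
     + offspring_fact2 * (\<integral>\<^sup>+\<omega>. growth (X \<omega> k) (s - lifetime_sum \<xi> (X \<omega>) k) * growth (X \<omega> k) (t - lifetime_sum \<xi> (X \<omega>) k) \<partial>M)))"
  by (simp only: total_gain_second_moment line_prob_sum split_prob_sum)

text \<open>Generation 0 is set aside because \<open>growth\<close> describes only what follows the
  division of a cell. In later generations the initial cell has died whenever its descendant has,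
  lifetimes being nonnegative, so the sum is the case k = 0 of \<open>line_prob_sum\<close>.\<close>

lemma first_moment:
  "(\<integral>\<^sup>+\<omega>. total_gain t \<omega> \<partial>M) = mean_gain * line_prob 0 t 0 t
    + offspring_mean * (\<integral>\<^sup>+\<omega>. indicator {..t} (\<xi> (X \<omega> 0)) * growth (X \<omega> 0) (t - \<xi> (X \<omega> 0)) \<partial>M)"
proof -
  have l: "line_prob (Suc n) t (Suc n) t = line_prob 0 t (Suc (0 + n)) t" for n
    unfolding line_prob_def
  proof (rule nn_integral_cong)
    fix \<omega> assume \<omega>: "\<omega> \<in> space M"
    have "lifetime_sum \<xi> (X \<omega>) 0 \<le> lifetime_sum \<xi> (X \<omega>) (Suc n)"
      unfolding lifetime_sum_def by (intro sum_mono2) (auto simp: xi_X_nonneg[OF \<omega>])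
    then show "indicator {..t} (lifetime_sum \<xi> (X \<omega>) (Suc n)) * indicator {..t} (lifetime_sum \<xi> (X \<omega>) (Suc n))
       = (indicator {..t} (lifetime_sum \<xi> (X \<omega>) 0) * indicator {..t} (lifetime_sum \<xi> (X \<omega>) (Suc (0 + n))) :: ennreal)"
      by (auto split: split_indicator)
  qed
  have "(\<integral>\<^sup>+\<omega>. total_gain t \<omega> \<partial>M) = (\<Sum>n<Suc 0. offspring_mean ^ n * (mean_gain * line_prob n t n t)) + (\<Sum>n. offspring_mean ^ (n + Suc 0) * (mean_gain * line_prob (n + Suc 0) t (n + Suc 0) t))"
    unfolding total_gain_mean by (subst add.commute) (rule suminf_offset[OF summableI])
  also have "(\<Sum>n. offspring_mean ^ (n + Suc 0) * (mean_gain * line_prob (n + Suc 0) t (n + Suc 0) t)) = offspring_mean * (\<Sum>n. offspring_mean ^ n * (mean_gain * line_prob 0 t (Suc (0 + n)) t))"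
    unfolding add_Suc_right add_0_right l power_Suc mult.assoc by (rule ennreal_suminf_cmult)
  also have "(\<Sum>n. offspring_mean ^ n * (mean_gain * line_prob 0 t (Suc (0 + n)) t)) = (\<integral>\<^sup>+\<omega>. indicator {..t} (lifetime_sum \<xi> (X \<omega>) 0) * growth (X \<omega> 0) (t - lifetime_sum \<xi> (X \<omega>) 0) \<partial>M)"
    by (rule line_prob_sum)
  finally show ?thesis by (simp add: lifetime_sum_def)
qed

end

section \<open>The population as one plus the total gain\<close>

lemma birth_time_snoc: "birth_time \<xi> T (v @ [i]) = birth_time \<xi> T v + \<xi> (T v)"
  by (simp add: birth_time_def)

lemma cell_exists_snoc: "cell_exists \<kappa> T (v @ [i]) \<longleftrightarrow> cell_exists \<kappa> T v \<and> 1 \<le> i \<and> i \<le> \<kappa> (T v)"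
  by (auto simp: cell_exists_def less_Suc_eq nth_append)

lemma lifetime_sum_label_line:
  "lifetime_sum \<xi> (\<lambda>n. T (label_line v n)) (length v) = birth_time \<xi> T v + \<xi> (T v)"
proof -
  have "{..length v} = insert (length v) {..<length v}" by auto
  then show ?thesis by (simp add: lifetime_sum_def birth_time_def label_line_def)
qed

text \<open>Translates the product along an ancestral line back into the tree: the indicators
  together say that v exists, and the lifetime sum is the time at which v divides.\<close>

lemma cell_gain_eq:
  "cell_gain \<xi> \<kappa> T v t = (if cell_exists \<kappa> T v \<and> birth_time \<xi> T v + \<xi> (T v) \<le> t then of_nat (\<kappa> (T v) - 1) else 0)"
proof (cases "cell_exists \<kappa> T v")
  case True
  have "(\<Prod>l\<le>length v. split_factor v l (\<kappa> (T (label_line v l)))) = of_nat (\<kappa> (T v) - 1)"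
  proof -
    have "(\<Prod>l<length v. split_factor v l (\<kappa> (T (label_line v l)))) = 1"
      using True by (intro prod.neutral) (auto simp: split_factor_def label_line_def cell_exists_def)
    then show ?thesis by (simp add: split_factor_def label_line_def flip: lessThan_Suc_atMost)
  qed
  then show ?thesis using True by (simp add: cell_gain_def path_gain_def lifetime_sum_label_line)
next
  case False
  then obtain j where j: "j < length v" "\<not> (1 \<le> v ! j \<and> v ! j \<le> \<kappa> (T (take j v)))" by (auto simp: cell_exists_def)
  then have "(\<Prod>l\<le>length v. split_factor v l (\<kappa> (T (label_line v l)))) = 0"
    by (intro prod_zero) (auto simp: split_factor_def label_line_def intro!: bexI[of _ j])
  then show ?thesis using False by (simp add: cell_gain_def path_gain_def)
qed

lemma cell_gain_mono: "s \<le> t \<Longrightarrow> cell_gain \<xi> \<kappa> T v s \<le> cell_gain \<xi> \<kappa> T v t"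
  by (auto simp: cell_gain_eq)

text \<open>Every division by time \<open>t\<close> replaces one living cell by \<open>\<kappa>\<close> new ones.\<close>

lemma num_alive_eq:
  assumes \<xi>: "\<And>v. 0 \<le> \<xi> (T v)" and \<kappa>: "\<And>v. 2 \<le> \<kappa> (T v)" and t: "0 \<le> t"
    and fin: "nsum (\<lambda>v. cell_gain \<xi> \<kappa> T v t) < \<infinity>"
  shows "num_alive \<xi> \<kappa> T t = 1 + nsum (\<lambda>v. cell_gain \<xi> \<kappa> T v t)"
proof -
  define D where "D = {v. cell_exists \<kappa> T v \<and> birth_time \<xi> T v + \<xi> (T v) \<le> t}"
  define B where "B = {v. cell_exists \<kappa> T v \<and> birth_time \<xi> T v \<le> t}"
  \<comment> \<open>Since every division produces at least two cells, each element of
    \<open>D\<close> contributes at least 1; a finite total gain therefore forces \<open>D\<close>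
    to be finite.\<close>
  have ge: "indicator D v \<le> cell_gain \<xi> \<kappa> T v t" for v
  proof (cases "v \<in> D")
    case True
    have "1 \<le> \<kappa> (T v) - 1" using \<kappa>[of v] by simp
    then have "of_nat 1 \<le> (of_nat (\<kappa> (T v) - 1) :: ennreal)" by (simp only: of_nat_le_iff)
    then show ?thesis using True by (simp add: D_def cell_gain_eq)
  qed simp
  have "emeasure (count_space UNIV) D = nsum (indicator D)" by simp
  also have "\<dots> \<le> nsum (\<lambda>v. cell_gain \<xi> \<kappa> T v t)" by (intro nn_integral_mono ge)
  also have "\<dots> < \<infinity>" by (rule fin)
  finally have D: "finite D" by (auto simp: emeasure_count_space split: if_splits)
  \<comment> \<open>A cell born by time t is the initial one or a child of a cell that has divided
    by then. Counting children gives the cells born, and removing those that have divided leaves the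
    living ones.\<close>
  have BD: "B = insert [] ((\<lambda>(v, i). v @ [i]) ` (SIGMA v:D. {1..\<kappa> (T v)}))"
  proof (rule set_eqI)
    fix w :: "nat list"
    show "w \<in> B \<longleftrightarrow> w \<in> insert [] ((\<lambda>(v, i). v @ [i]) ` (SIGMA v:D. {1..\<kappa> (T v)}))"
    proof (cases w rule: rev_cases)
      case Nil
      then show ?thesis using t by (simp add: B_def cell_exists_def birth_time_def)
    next
      case (snoc v i)
      then show ?thesis by (auto simp: B_def D_def cell_exists_snoc birth_time_snoc)
    qed
  qed
  have sub: "D \<subseteq> B" using \<xi> by (auto simp: D_def B_def intro: order_trans[rotated])
  have finB: "finite B" unfolding BD using D by (intro finite.insertI finite_imageI finite_SigmaI) auto
  have "card ((\<lambda>(v, i). v @ [i]) ` (SIGMA v:D. {1..\<kappa> (T v)})) = card (SIGMA v:D. {1..\<kappa> (T v)})"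
    by (rule card_image) (auto simp: inj_on_def)
  also have "\<dots> = (\<Sum>v\<in>D. \<kappa> (T v))" using D by simp
  finally have cB: "card B = Suc (\<Sum>v\<in>D. \<kappa> (T v))"
    unfolding BD using D by (subst card_insert_disjoint) auto
  have "(\<Sum>v\<in>D. \<kappa> (T v)) = (\<Sum>v\<in>D. (\<kappa> (T v) - 1) + 1)"
  proof (rule sum.cong)
    show "\<kappa> (T v) = \<kappa> (T v) - 1 + 1" for v using \<kappa>[of v] by simp
  qed simp
  also have "\<dots> = (\<Sum>v\<in>D. \<kappa> (T v) - 1) + card D" by (subst sum.distrib) simp
  finally have cBD: "card (B - D) = 1 + (\<Sum>v\<in>D. \<kappa> (T v) - 1)"
    using card_Diff_subset[OF D sub] cB by simp
  have "{v. cell_exists \<kappa> T v \<and> birth_time \<xi> T v \<le> t \<and> t < birth_time \<xi> T v + \<xi> (T v)} = B - D"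
    by (auto simp: B_def D_def)
  then have "num_alive \<xi> \<kappa> T t = of_nat (card (B - D))"
    using finB by (simp add: num_alive_def emeasure_count_space_finite)
  also have "\<dots> = 1 + (\<Sum>v\<in>D. of_nat (\<kappa> (T v) - 1))" by (simp only: cBD of_nat_add of_nat_sum of_nat_1)
  also have "(\<Sum>v\<in>D. of_nat (\<kappa> (T v) - 1)) = (\<Sum>v\<in>D. cell_gain \<xi> \<kappa> T v t)"
    by (intro sum.cong refl) (simp add: D_def cell_gain_eq)
  also have "\<dots> = nsum (\<lambda>v. cell_gain \<xi> \<kappa> T v t)"
    by (rule nn_integral_count_space'[OF D, symmetric]) (auto simp: D_def cell_gain_eq)
  finally show ?thesis .
qed

section \<open>Convergence from the asymptotics of the covariances\<close>

text \<open>Between neighbouring grid points at distance h, monotonicity of exp(\<nu> * t) * g t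
  confines g t up to factors exp(\<nu> * h) and exp(-\<nu> * h). These tend to 1 as the mesh
  shrinks, so limits along all meshes 1/(j + 1) are enough.\<close>

lemma tendsto_of_monotone_grids:
  fixes g :: "real \<Rightarrow> real"
  assumes \<nu>: "0 < \<nu>" and nonneg: "\<And>t. 0 \<le> t \<Longrightarrow> 0 \<le> g t"
    and mono: "\<And>s t. 0 \<le> s \<Longrightarrow> s \<le> t \<Longrightarrow> exp (\<nu> * s) * g s \<le> exp (\<nu> * t) * g t"
    and grid: "\<And>j::nat. (\<lambda>n. g (real n / real (Suc j))) \<longlonglongrightarrow> w"
  shows "(g \<longlongrightarrow> w) at_top"
proof (rule tendstoI)
  fix e :: real assume e: "0 < e"
  have w: "0 \<le> w" by (rule LIMSEQ_le_const[OF grid[of 0]]) (auto intro!: exI[of _ 0] nonneg)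
  have h0: "(\<lambda>j. 1 / real (Suc j)) \<longlonglongrightarrow> 0" using LIMSEQ_Suc[OF lim_1_over_n] by simp
  \<comment> \<open>The mesh is chosen first: its factors must keep w + e/2 below w + e and w - e/2
    above w - e.\<close>
  have "(\<lambda>j. exp (\<nu> * (1 / real (Suc j))) * (w + e/2)) \<longlonglongrightarrow> exp (\<nu> * 0) * (w + e/2)"
    by (intro tendsto_intros h0)
  then have "eventually (\<lambda>j. exp (\<nu> * (1 / real (Suc j))) * (w + e/2) < w + e) sequentially"
    using e by (auto dest: order_tendstoD(2)[where a="w + e"])
  moreover have "(\<lambda>j. exp (- (\<nu> * (1 / real (Suc j)))) * (w - e/2)) \<longlonglongrightarrow> exp (- (\<nu> * 0)) * (w - e/2)"
    by (intro tendsto_intros h0)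
  then have "eventually (\<lambda>j. w - e < exp (- (\<nu> * (1 / real (Suc j)))) * (w - e/2)) sequentially"
    using e by (auto dest: order_tendstoD(1)[where a="w - e"])
  ultimately have "eventually (\<lambda>j. exp (\<nu> * (1 / real (Suc j))) * (w + e/2) < w + e \<and> w - e < exp (- (\<nu> * (1 / real (Suc j)))) * (w - e/2)) sequentially"
    by eventually_elim simp
  then obtain j where j: "exp (\<nu> * (1 / real (Suc j))) * (w + e/2) < w + e" "w - e < exp (- (\<nu> * (1 / real (Suc j)))) * (w - e/2)"
    by (auto simp: eventually_sequentially)
  define h where "h = 1 / real (Suc j)"
  have h: "0 < h" by (simp add: h_def)
  have "eventually (\<lambda>n. dist (g (real n * h)) w < e/2) sequentially"
    using tendstoD[OF grid[of j], of "e/2"] e by (simp add: h_def)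
  then obtain N where N: "\<And>n. N \<le> n \<Longrightarrow> \<bar>g (real n * h) - w\<bar> < e/2"
    by (auto simp: eventually_sequentially dist_real_def)
  show "eventually (\<lambda>t. dist (g t) w < e) at_top"
    using eventually_ge_at_top[of "real N * h"]
  proof eventually_elim
    case (elim t)
    have t: "0 \<le> t" using elim h order_trans[of 0 "real N * h" t] by simp
    define n where "n = nat \<lfloor>t / h\<rfloor>"
    have fl: "real n = of_int \<lfloor>t / h\<rfloor>" unfolding n_def using t h by simp
    have n1: "real n * h \<le> t"
    proof -
      have "real n \<le> t / h" by (simp add: fl)
      then show ?thesis using h by (simp only: pos_le_divide_eq)
    qed
    have n2: "t \<le> real (Suc n) * h"
    proof -
      have "t / h \<le> real (Suc n)" unfolding of_nat_Suc fl using real_of_int_floor_add_one_ge[of "t / h"] by linarith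
      then show ?thesis using h by (simp only: pos_divide_le_eq)
    qed
    have Nn: "N \<le> n" unfolding n_def using elim h by (intro le_nat_floor) (simp only: pos_le_divide_eq)
    have a: "\<bar>g (real n * h) - w\<bar> < e/2" "\<bar>g (real (Suc n) * h) - w\<bar> < e/2" using N[OF Nn] N[of "Suc n"] Nn by auto
    have up: "g t \<le> exp (\<nu> * h) * g (real (Suc n) * h)"
    proof -
      have "exp (\<nu> * t) * g t \<le> exp (\<nu> * (real (Suc n) * h)) * g (real (Suc n) * h)" by (rule mono[OF t n2])
      also have "\<dots> \<le> exp (\<nu> * (t + h)) * g (real (Suc n) * h)"
      proof (intro mult_right_mono nonneg)
        have "real (Suc n) * h \<le> t + h" using n1 by (simp add: algebra_simps)
        then have "\<nu> * (real (Suc n) * h) \<le> \<nu> * (t + h)" using \<nu> by (intro mult_left_mono) auto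
        then show "exp (\<nu> * (real (Suc n) * h)) \<le> exp (\<nu> * (t + h))" by simp
      qed (use h in simp)
      also have "\<dots> = exp (\<nu> * t) * (exp (\<nu> * h) * g (real (Suc n) * h))" by (simp add: distrib_left exp_add)
      finally show ?thesis by simp
    qed
    have lo: "exp (- (\<nu> * h)) * g (real n * h) \<le> g t"
    proof -
      have "exp (\<nu> * t) * (exp (- (\<nu> * h)) * g (real n * h)) = exp (\<nu> * (t - h)) * g (real n * h)"
        by (simp add: right_diff_distrib exp_diff exp_minus divide_inverse)
      also have "\<dots> \<le> exp (\<nu> * (real n * h)) * g (real n * h)"
      proof (intro mult_right_mono nonneg)
        have "t - h \<le> real n * h" using n2 by (simp add: algebra_simps)
        then have "\<nu> * (t - h) \<le> \<nu> * (real n * h)" using \<nu> by (intro mult_left_mono) auto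
        then show "exp (\<nu> * (t - h)) \<le> exp (\<nu> * (real n * h))" by simp
      qed (use h in simp)
      also have "\<dots> \<le> exp (\<nu> * t) * g t" using n1 h by (intro mono) auto
      finally show ?thesis by simp
    qed
    have "g t \<le> exp (\<nu> * h) * (w + e/2)" using up a(2) by (smt (verit) mult_left_mono exp_ge_zero)
    moreover have "exp (- (\<nu> * h)) * (w - e/2) \<le> g t" using lo a(1) by (smt (verit) mult_left_mono exp_ge_zero)
    ultimately show ?case using j unfolding h_def[symmetric] dist_real_def by linarith
  qed
qed

context prob_space
begin

text \<open>Takes the place of a Borel-Cantelli argument, once for the increments along integer
  times and once for the squared distances to the limit on finer grids.\<close>

lemma AE_summable_of_integral_bound:
  fixes f :: "nat \<Rightarrow> 'a \<Rightarrow> real"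
  assumes f: "\<And>n. integrable M (f n)" "\<And>n \<omega>. 0 \<le> f n \<omega>"
    and b: "\<And>n. (\<integral>\<omega>. f n \<omega> \<partial>M) \<le> b n" "summable b"
  shows "AE \<omega> in M. summable (\<lambda>n. f n \<omega>)"
proof -
  have [measurable]: "f n \<in> borel_measurable M" for n using f(1) by auto
  have b0: "0 \<le> b n" for n by (rule order_trans[OF integral_nonneg_AE b(1)]) (simp add: f(2))
  have "(\<integral>\<^sup>+\<omega>. (\<Sum>n. ennreal (f n \<omega>)) \<partial>M) = (\<Sum>n. \<integral>\<^sup>+\<omega>. ennreal (f n \<omega>) \<partial>M)"
    by (rule nn_integral_suminf) simp
  also have "\<dots> = (\<Sum>n. ennreal (\<integral>\<omega>. f n \<omega> \<partial>M))"
    using f by (intro suminf_cong nn_integral_eq_integral) auto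
  also have "\<dots> \<le> (\<Sum>n. ennreal (b n))" using b(1) by (intro suminf_le ennreal_leI) auto
  also have "\<dots> = ennreal (\<Sum>n. b n)" using b0 b(2) by (rule suminf_ennreal2)
  also have "\<dots> < \<infinity>" by simp
  finally have "AE \<omega> in M. (\<Sum>n. ennreal (f n \<omega>)) \<noteq> \<infinity>"
    by (intro nn_integral_PInf_AE) auto
  then show ?thesis
    by eventually_elim (use f(2) in \<open>auto intro!: summable_suminf_not_top\<close>)
qed

lemma integrable_power2_diff:
  fixes U V :: "'a \<Rightarrow> real"
  assumes [measurable]: "U \<in> borel_measurable M" "V \<in> borel_measurable M"
    and "integrable M (\<lambda>\<omega>. (U \<omega>)\<^sup>2)" "integrable M (\<lambda>\<omega>. (V \<omega>)\<^sup>2)"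
  shows "integrable M (\<lambda>\<omega>. (U \<omega> - V \<omega>)\<^sup>2)"
proof (rule Bochner_Integration.integrable_bound)
  show "integrable M (\<lambda>\<omega>. 2 * (U \<omega>)\<^sup>2 + 2 * (V \<omega>)\<^sup>2)" using assms by simp
  have "(u - v)\<^sup>2 \<le> 2 * u\<^sup>2 + 2 * v\<^sup>2" for u v :: real
    using zero_le_power2[of "u + v"] by (simp add: power2_eq_square algebra_simps)
  then show "AE \<omega> in M. norm ((U \<omega> - V \<omega>)\<^sup>2) \<le> norm (2 * (U \<omega>)\<^sup>2 + 2 * (V \<omega>)\<^sup>2)" by simp
qed simp

text \<open>All second moments and mixed moments approach the same L, so L cancels in the expansion
  of the squared distance and G is Cauchy at an exponential rate. The limit W is built pointwise
  along the integers, Fatou's lemma carries the rate over to W, and the rate makes squared distances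
  summable on every grid.\<close>

lemma quadratic_mean_limit:
  fixes G :: "real \<Rightarrow> 'a \<Rightarrow> real"
  assumes meas[measurable]: "\<And>t. G t \<in> borel_measurable M" and nonneg: "\<And>t \<omega>. 0 \<le> G t \<omega>"
    and sq: "\<And>t. 0 \<le> t \<Longrightarrow> integrable M (\<lambda>\<omega>. (G t \<omega>)\<^sup>2)"
    and cov: "\<And>s t. 0 \<le> s \<Longrightarrow> 0 \<le> t \<Longrightarrow> \<bar>(\<integral>\<omega>. G s \<omega> * G t \<omega> \<partial>M) - L\<bar> \<le> K * exp (- \<eta> * min s t)"
    and \<eta>: "0 < \<eta>" and \<nu>: "0 < \<nu>"
    and mono: "AE \<omega> in M. \<forall>s t. 0 \<le> s \<longrightarrow> s \<le> t \<longrightarrow> exp (\<nu> * s) * G s \<omega> \<le> exp (\<nu> * t) * G t \<omega>"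
  obtains W where "W \<in> borel_measurable M" "\<And>\<omega>. 0 \<le> W \<omega>" "integrable M (\<lambda>\<omega>. (W \<omega>)\<^sup>2)"
    "\<And>t. 0 \<le> t \<Longrightarrow> (\<integral>\<omega>. (G t \<omega> - W \<omega>)\<^sup>2 \<partial>M) \<le> 4 * K * exp (- \<eta> * t)"
    "(\<integral>\<omega>. (W \<omega>)\<^sup>2 \<partial>M) = L" "((\<lambda>t. \<integral>\<omega>. G t \<omega> \<partial>M) \<longlongrightarrow> (\<integral>\<omega>. W \<omega> \<partial>M)) at_top"
    "AE \<omega> in M. ((\<lambda>t. G t \<omega>) \<longlongrightarrow> W \<omega>) at_top"
proof -
  have K: "0 \<le> K"
    using cov[of 0 0] by (simp add: order_trans[OF abs_ge_zero])
  have intprod: "integrable M (\<lambda>\<omega>. U \<omega> * V \<omega>)"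
    if [measurable]: "U \<in> borel_measurable M" "V \<in> borel_measurable M"
      and "integrable M (\<lambda>\<omega>. (U \<omega>)\<^sup>2)" "integrable M (\<lambda>\<omega>. (V \<omega>)\<^sup>2)" for U V :: "'a \<Rightarrow> real"
  proof (rule Bochner_Integration.integrable_bound)
    show "integrable M (\<lambda>\<omega>. (U \<omega>)\<^sup>2 + (V \<omega>)\<^sup>2)" using that by simp
    show "AE \<omega> in M. norm (U \<omega> * V \<omega>) \<le> norm ((U \<omega>)\<^sup>2 + (V \<omega>)\<^sup>2)"
    proof (rule AE_I2)
      fix \<omega>
      have "2 * (\<bar>U \<omega>\<bar> * \<bar>V \<omega>\<bar>) \<le> (U \<omega>)\<^sup>2 + (V \<omega>)\<^sup>2"
        using sum_squares_bound[of "\<bar>U \<omega>\<bar>" "\<bar>V \<omega>\<bar>"] by simp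
      moreover have "0 \<le> \<bar>U \<omega>\<bar> * \<bar>V \<omega>\<bar>" by simp
      ultimately show "norm (U \<omega> * V \<omega>) \<le> norm ((U \<omega>)\<^sup>2 + (V \<omega>)\<^sup>2)"
        unfolding real_norm_def abs_mult by linarith
    qed
  qed simp
  \<comment> \<open>The two squares and the doubled mixed term contribute errors with coefficients
    1, 1 and 2, whence the constant 4; the error at the earlier time s is the largest.\<close>
  have GG: "(\<integral>\<omega>. (G s \<omega> - G t \<omega>)\<^sup>2 \<partial>M) \<le> 4 * K * exp (- \<eta> * s)" if st: "0 \<le> s" "s \<le> t" for s t
  proof -
    have t: "0 \<le> t" using st by simp
    note ip = intprod[OF meas meas sq[OF st(1)] sq[OF t]]
    have "(\<integral>\<omega>. (G s \<omega> - G t \<omega>)\<^sup>2 \<partial>M) = (\<integral>\<omega>. G s \<omega> * G s \<omega> + G t \<omega> * G t \<omega> - 2 * (G s \<omega> * G t \<omega>) \<partial>M)"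
      by (simp add: power2_eq_square algebra_simps)
    also have "\<dots> = (\<integral>\<omega>. G s \<omega> * G s \<omega> \<partial>M) + (\<integral>\<omega>. G t \<omega> * G t \<omega> \<partial>M) - 2 * (\<integral>\<omega>. G s \<omega> * G t \<omega> \<partial>M)"
      using ip sq[OF st(1)] sq[OF t] by (simp add: power2_eq_square)
    also have "\<dots> \<le> (L + K * exp (- \<eta> * s)) + (L + K * exp (- \<eta> * t)) - 2 * (L - K * exp (- \<eta> * s))"
      using cov[OF st(1) st(1)] cov[OF t t] cov[OF st(1) t] st by (simp add: abs_le_iff min_def)
    also have "\<dots> \<le> 4 * K * exp (- \<eta> * s)"
    proof -
      have "K * exp (- \<eta> * t) \<le> K * exp (- \<eta> * s)"
        using K \<eta> st by (intro mult_left_mono) auto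
      moreover have "L + x + (L + y) - 2 * (L - x) \<le> 4 * x" if "y \<le> x" for x y using that by simp
      ultimately show ?thesis by (simp only: mult.assoc)
    qed
    finally show ?thesis .
  qed
  \<comment> \<open>Half the exponent: bounding \<bar>D\<bar> by D squared over q^n plus q^n, the
    first term has integral at most 4 * K * q^(2 * n) / q^n, so both terms are of order q^n.\<close>
  define q where "q = exp (- \<eta> / 2)"
  have q: "0 < q" "q < 1" using \<eta> by (auto simp: q_def)
  have qn: "q ^ n * q ^ n = exp (- \<eta> * real n)" for n
    by (simp add: q_def flip: exp_of_nat_mult exp_add)
  have "AE \<omega> in M. summable (\<lambda>n. \<bar>G (real (Suc n)) \<omega> - G (real n) \<omega>\<bar>)"
  proof (rule AE_summable_of_integral_bound[where b="\<lambda>n. (4 * K + 1) * q ^ n"])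
    fix n
    let ?D = "\<lambda>\<omega>. G (real n) \<omega> - G (real (Suc n)) \<omega>"
    have iD: "integrable M (\<lambda>\<omega>. (?D \<omega>)\<^sup>2)" by (intro integrable_power2_diff sq meas) auto
    have pt: "\<bar>G (real (Suc n)) \<omega> - G (real n) \<omega>\<bar> \<le> (?D \<omega>)\<^sup>2 / q ^ n + q ^ n" for \<omega>
    proof -
      have "2 * (\<bar>?D \<omega>\<bar> * q ^ n) \<le> \<bar>?D \<omega>\<bar>\<^sup>2 + (q ^ n)\<^sup>2" using sum_squares_bound[of "\<bar>?D \<omega>\<bar>" "q ^ n"] by simp
      moreover have "0 \<le> \<bar>?D \<omega>\<bar> * q ^ n" using q by simp
      ultimately have "\<bar>?D \<omega>\<bar> * q ^ n \<le> (?D \<omega>)\<^sup>2 + q ^ n * q ^ n" unfolding power2_abs power2_eq_square[of "q ^ n"] by linarith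
      then show ?thesis using q by (simp add: field_simps abs_minus_commute)
    qed
    have ib: "integrable M (\<lambda>\<omega>. (?D \<omega>)\<^sup>2 / q ^ n + q ^ n)" using iD by simp
    show i: "integrable M (\<lambda>\<omega>. \<bar>G (real (Suc n)) \<omega> - G (real n) \<omega>\<bar>)"
    proof (rule Bochner_Integration.integrable_bound[OF ib])
      show "AE \<omega> in M. norm \<bar>G (real (Suc n)) \<omega> - G (real n) \<omega>\<bar> \<le> norm ((?D \<omega>)\<^sup>2 / q ^ n + q ^ n)"
        unfolding real_norm_def abs_idempotent by (intro AE_I2 order_trans[OF pt abs_ge_self])
    qed simp
    have "(\<integral>\<omega>. \<bar>G (real (Suc n)) \<omega> - G (real n) \<omega>\<bar> \<partial>M) \<le> (\<integral>\<omega>. (?D \<omega>)\<^sup>2 / q ^ n + q ^ n \<partial>M)"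
      by (rule integral_mono[OF i ib pt])
    also have "\<dots> = (\<integral>\<omega>. (?D \<omega>)\<^sup>2 \<partial>M) / q ^ n + q ^ n" using iD by (simp add: prob_space)
    also have "\<dots> \<le> 4 * K * (q ^ n * q ^ n) / q ^ n + q ^ n"
      using GG[of "real n" "real (Suc n)"] q by (intro add_right_mono divide_right_mono) (simp_all only: qn, auto)
    also have "\<dots> = (4 * K + 1) * q ^ n" using q by (simp add: field_simps)
    finally show "(\<integral>\<omega>. \<bar>G (real (Suc n)) \<omega> - G (real n) \<omega>\<bar> \<partial>M) \<le> (4 * K + 1) * q ^ n" .
  qed (use q in \<open>auto intro!: summable_mult summable_geometric\<close>)
  then have conv: "AE \<omega> in M. convergent (\<lambda>n. G (real n) \<omega>)"
  proof eventually_elim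
    case (elim \<omega>)
    then have "summable (\<lambda>n. G (real (Suc n)) \<omega> - G (real n) \<omega>)" by (rule summable_rabs_cancel)
    then have "convergent (\<lambda>n. G (real n) \<omega> - G (real 0) \<omega>)"
      unfolding summable_iff_convergent sum_lessThan_telescope[of "\<lambda>n. G (real n) \<omega>"] by simp
    then have "convergent (\<lambda>n. (G (real n) \<omega> - G (real 0) \<omega>) + G (real 0) \<omega>)"
      by (intro convergent_add convergent_const)
    then show ?case by simp
  qed
  \<comment> \<open>Where the sequence does not converge \<open>lim\<close> is an unspecified value;
    the maximum makes W nonnegative everywhere and alters nothing on the convergence set.\<close>
  define W where "W \<omega> = max 0 (lim (\<lambda>n. G (real n) \<omega>))" for \<omega>
  have Wm[measurable]: "W \<in> borel_measurable M" unfolding W_def by measurable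
  have W0: "0 \<le> W \<omega>" for \<omega> by (simp add: W_def)
  have lim: "AE \<omega> in M. (\<lambda>n. G (real n) \<omega>) \<longlonglongrightarrow> W \<omega>"
    using conv
  proof eventually_elim
    case (elim \<omega>)
    then have l: "(\<lambda>n. G (real n) \<omega>) \<longlonglongrightarrow> lim (\<lambda>n. G (real n) \<omega>)" by (simp add: convergent_LIMSEQ_iff)
    moreover have "0 \<le> lim (\<lambda>n. G (real n) \<omega>)" by (rule LIMSEQ_le_const[OF l]) (auto intro: nonneg)
    ultimately show ?case by (simp add: W_def)
  qed
  \<comment> \<open>Fatou's lemma along integer times turns the Cauchy estimate into an estimate
    against W, from which the square integrability of W follows too.\<close>
  have nnW: "(\<integral>\<^sup>+\<omega>. ennreal ((G t \<omega> - W \<omega>)\<^sup>2) \<partial>M) \<le> ennreal (4 * K * exp (- \<eta> * t))" if t: "0 \<le> t" for t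
  proof -
    have "(\<integral>\<^sup>+\<omega>. ennreal ((G t \<omega> - W \<omega>)\<^sup>2) \<partial>M) = (\<integral>\<^sup>+\<omega>. liminf (\<lambda>n. ennreal ((G t \<omega> - G (real n) \<omega>)\<^sup>2)) \<partial>M)"
    proof (rule nn_integral_cong_AE)
      show "AE \<omega> in M. ennreal ((G t \<omega> - W \<omega>)\<^sup>2) = liminf (\<lambda>n. ennreal ((G t \<omega> - G (real n) \<omega>)\<^sup>2))"
        using lim
      proof eventually_elim
        case (elim \<omega>)
        then have "(\<lambda>n. (G t \<omega> - G (real n) \<omega>)\<^sup>2) \<longlonglongrightarrow> (G t \<omega> - W \<omega>)\<^sup>2"
          by (intro tendsto_intros)
        from tendsto_ennrealI[OF this] show ?case by (rule lim_imp_Liminf[OF sequentially_bot, symmetric])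
      qed
    qed
    also have "\<dots> \<le> liminf (\<lambda>n. \<integral>\<^sup>+\<omega>. ennreal ((G t \<omega> - G (real n) \<omega>)\<^sup>2) \<partial>M)"
      by (rule nn_integral_liminf) simp
    also have "\<dots> \<le> ennreal (4 * K * exp (- \<eta> * t))"
    proof (rule Liminf_le)
      obtain N where N: "t \<le> real N" using real_arch_simple by blast
      show "\<forall>\<^sub>F n in sequentially. (\<integral>\<^sup>+\<omega>. ennreal ((G t \<omega> - G (real n) \<omega>)\<^sup>2) \<partial>M) \<le> ennreal (4 * K * exp (- \<eta> * t))"
      proof (rule eventually_sequentiallyI[of N])
        fix n assume "N \<le> n"
        then have tn: "t \<le> real n" using N by simp
        have "(\<integral>\<^sup>+\<omega>. ennreal ((G t \<omega> - G (real n) \<omega>)\<^sup>2) \<partial>M) = ennreal (\<integral>\<omega>. (G t \<omega> - G (real n) \<omega>)\<^sup>2 \<partial>M)"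
          by (intro nn_integral_eq_integral integrable_power2_diff sq meas) (use t in auto)
        also have "\<dots> \<le> ennreal (4 * K * exp (- \<eta> * t))" by (intro ennreal_leI GG t tn)
        finally show "(\<integral>\<^sup>+\<omega>. ennreal ((G t \<omega> - G (real n) \<omega>)\<^sup>2) \<partial>M) \<le> ennreal (4 * K * exp (- \<eta> * t))" .
      qed
    qed simp
    finally show ?thesis .
  qed
  have intGW: "integrable M (\<lambda>\<omega>. (G t \<omega> - W \<omega>)\<^sup>2)" if "0 \<le> t" for t
    using nnW[OF that] by (intro integrableI_nonneg) (auto intro: le_less_trans)
  have GW: "(\<integral>\<omega>. (G t \<omega> - W \<omega>)\<^sup>2 \<partial>M) \<le> 4 * K * exp (- \<eta> * t)" if "0 \<le> t" for t
    using nnW[OF that] K by (subst (asm) nn_integral_eq_integral[OF intGW[OF that]]) auto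
  have intW: "integrable M (\<lambda>\<omega>. (W \<omega>)\<^sup>2)"
    using integrable_power2_diff[OF meas[of 0] _ sq[of 0] intGW[of 0]] by simp
  \<comment> \<open>The square root of the error exp(-\<eta> * t), as the weight that balances the
    two terms in \<open>amgm\<close>.\<close>
  define \<theta> where "\<theta> t = exp (- \<eta> / 2 * t)" for t
  have \<theta>: "0 < \<theta> t" "\<theta> t * \<theta> t = exp (- \<eta> * t)" for t by (simp_all add: \<theta>_def flip: exp_add)
  have \<theta>0: "(\<theta> \<longlongrightarrow> 0) at_top" unfolding \<theta>_def using \<eta> by real_asymp
  have amgm: "\<bar>x\<bar> * y \<le> x\<^sup>2 / \<theta> t + \<theta> t * y\<^sup>2" if "0 \<le> y" for x y t
  proof -
    have "2 * (\<bar>x\<bar> * (\<theta> t * y)) \<le> \<bar>x\<bar>\<^sup>2 + (\<theta> t * y)\<^sup>2" using sum_squares_bound[of "\<bar>x\<bar>" "\<theta> t * y"] by simp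
    moreover have "0 \<le> \<bar>x\<bar> * (\<theta> t * y)" using that \<theta>(1)[of t] by simp
    ultimately have "\<bar>x\<bar> * (\<theta> t * y) \<le> x\<^sup>2 + (\<theta> t * y)\<^sup>2" by simp
    moreover have "(x\<^sup>2 / \<theta> t + \<theta> t * y\<^sup>2) * \<theta> t = x\<^sup>2 + (\<theta> t * y)\<^sup>2"
      using \<theta>(1)[of t] by (simp add: distrib_right power2_eq_square)
    ultimately have "(\<bar>x\<bar> * y) * \<theta> t \<le> (x\<^sup>2 / \<theta> t + \<theta> t * y\<^sup>2) * \<theta> t"
      by (simp only: ac_simps)
    then show ?thesis using \<theta>(1)[of t] by (simp only: mult_le_cancel_right_pos)
  qed
  \<comment> \<open>Used with Y = 1 for the convergence of the means and with Y = 2 * W for that of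
    the second moments.\<close>
  have small: "(\<integral>\<omega>. \<bar>G t \<omega> - W \<omega>\<bar> * Y \<omega> \<partial>M) \<le> (4 * K + (\<integral>\<omega>. (Y \<omega>)\<^sup>2 \<partial>M)) * \<theta> t"
    "integrable M (\<lambda>\<omega>. \<bar>G t \<omega> - W \<omega>\<bar> * Y \<omega>)"
    if t: "0 \<le> t" and [measurable]: "Y \<in> borel_measurable M" and iY: "integrable M (\<lambda>\<omega>. (Y \<omega>)\<^sup>2)" and Y0: "\<And>\<omega>. 0 \<le> Y \<omega>" for t Y
  proof -
    have ib: "integrable M (\<lambda>\<omega>. (G t \<omega> - W \<omega>)\<^sup>2 / \<theta> t + \<theta> t * (Y \<omega>)\<^sup>2)" using intGW[OF t] iY by simp
    show i: "integrable M (\<lambda>\<omega>. \<bar>G t \<omega> - W \<omega>\<bar> * Y \<omega>)"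
      using intprod[of "\<lambda>\<omega>. \<bar>G t \<omega> - W \<omega>\<bar>" Y] intGW[OF t] iY by simp
    have "(\<integral>\<omega>. \<bar>G t \<omega> - W \<omega>\<bar> * Y \<omega> \<partial>M) \<le> (\<integral>\<omega>. (G t \<omega> - W \<omega>)\<^sup>2 / \<theta> t + \<theta> t * (Y \<omega>)\<^sup>2 \<partial>M)"
      by (rule integral_mono[OF i ib]) (rule amgm[OF Y0])
    also have "\<dots> = (\<integral>\<omega>. (G t \<omega> - W \<omega>)\<^sup>2 \<partial>M) / \<theta> t + \<theta> t * (\<integral>\<omega>. (Y \<omega>)\<^sup>2 \<partial>M)" using intGW[OF t] iY by simp
    also have "\<dots> \<le> 4 * K * (\<theta> t * \<theta> t) / \<theta> t + \<theta> t * (\<integral>\<omega>. (Y \<omega>)\<^sup>2 \<partial>M)"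
      unfolding \<theta>(2) using GW[OF t] \<theta>(1)[of t] by (intro add_right_mono divide_right_mono) auto
    also have "\<dots> = (4 * K + (\<integral>\<omega>. (Y \<omega>)\<^sup>2 \<partial>M)) * \<theta> t" using \<theta>(1)[of t] by (simp add: algebra_simps)
    finally show "(\<integral>\<omega>. \<bar>G t \<omega> - W \<omega>\<bar> * Y \<omega> \<partial>M) \<le> (4 * K + (\<integral>\<omega>. (Y \<omega>)\<^sup>2 \<partial>M)) * \<theta> t" .
  qed
  have int1: "integrable M U" if "U \<in> borel_measurable M" "integrable M (\<lambda>\<omega>. (U \<omega>)\<^sup>2)" for U :: "'a \<Rightarrow> real"
    using intprod[OF that(1) _ that(2), of "\<lambda>_. 1"] by simp
  have mean: "((\<lambda>t. \<integral>\<omega>. G t \<omega> \<partial>M) \<longlongrightarrow> (\<integral>\<omega>. W \<omega> \<partial>M)) at_top"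
  proof (rule Lim_null[THEN iffD2], rule Lim_null_comparison)
    show "((\<lambda>t. (4 * K + 1) * \<theta> t) \<longlongrightarrow> 0) at_top" using tendsto_mult_left[OF \<theta>0, of "4 * K + 1"] by simp
    show "\<forall>\<^sub>F t in at_top. norm ((\<integral>\<omega>. G t \<omega> \<partial>M) - (\<integral>\<omega>. W \<omega> \<partial>M)) \<le> (4 * K + 1) * \<theta> t"
      using eventually_ge_at_top[of 0]
    proof eventually_elim
      case (elim t)
      have "(\<integral>\<omega>. G t \<omega> \<partial>M) - (\<integral>\<omega>. W \<omega> \<partial>M) = (\<integral>\<omega>. G t \<omega> - W \<omega> \<partial>M)"
        using int1[OF meas sq[OF elim]] int1[OF Wm intW] by simp
      also have "norm \<dots> \<le> (\<integral>\<omega>. \<bar>G t \<omega> - W \<omega>\<bar> \<partial>M)" using integral_norm_bound[of M "\<lambda>\<omega>. G t \<omega> - W \<omega>"] by simp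
      also have "\<dots> \<le> (4 * K + 1) * \<theta> t" using small(1)[OF elim, of "\<lambda>_. 1"] by (simp add: prob_space)
      finally show ?case .
    qed
  qed
  have WL: "(\<integral>\<omega>. (W \<omega>)\<^sup>2 \<partial>M) = L"
  proof -
    have "((\<lambda>t. \<integral>\<omega>. (G t \<omega>)\<^sup>2 \<partial>M) \<longlongrightarrow> (\<integral>\<omega>. (W \<omega>)\<^sup>2 \<partial>M)) at_top"
    proof (rule Lim_null[THEN iffD2], rule Lim_null_comparison)
      let ?c = "4 * K + (\<integral>\<omega>. (2 * W \<omega>)\<^sup>2 \<partial>M)"
      have "((\<lambda>t. ?c * \<theta> t + 4 * K * (\<theta> t * \<theta> t)) \<longlongrightarrow> ?c * 0 + 4 * K * (0 * 0)) at_top"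
        by (intro tendsto_intros \<theta>0)
      then show "((\<lambda>t. ?c * \<theta> t + 4 * K * (\<theta> t * \<theta> t)) \<longlongrightarrow> 0) at_top" by simp
      show "\<forall>\<^sub>F t in at_top. norm ((\<integral>\<omega>. (G t \<omega>)\<^sup>2 \<partial>M) - (\<integral>\<omega>. (W \<omega>)\<^sup>2 \<partial>M)) \<le> ?c * \<theta> t + 4 * K * (\<theta> t * \<theta> t)"
        using eventually_ge_at_top[of 0]
      proof eventually_elim
        case (elim t)
        have i2: "integrable M (\<lambda>\<omega>. (2 * W \<omega>)\<^sup>2)" using intW by (simp add: power_mult_distrib)
        note s = small[OF elim _ i2]
        have "(\<integral>\<omega>. (G t \<omega>)\<^sup>2 \<partial>M) - (\<integral>\<omega>. (W \<omega>)\<^sup>2 \<partial>M) = (\<integral>\<omega>. (G t \<omega>)\<^sup>2 - (W \<omega>)\<^sup>2 \<partial>M)"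
          using sq[OF elim] intW by simp
        also have "norm \<dots> \<le> (\<integral>\<omega>. \<bar>(G t \<omega>)\<^sup>2 - (W \<omega>)\<^sup>2\<bar> \<partial>M)" using integral_norm_bound[of M "\<lambda>\<omega>. (G t \<omega>)\<^sup>2 - (W \<omega>)\<^sup>2"] by simp
        also have "\<dots> \<le> (\<integral>\<omega>. \<bar>G t \<omega> - W \<omega>\<bar> * (2 * W \<omega>) + (G t \<omega> - W \<omega>)\<^sup>2 \<partial>M)"
        proof (rule integral_mono)
          show "integrable M (\<lambda>\<omega>. \<bar>(G t \<omega>)\<^sup>2 - (W \<omega>)\<^sup>2\<bar>)" using sq[OF elim] intW by simp
          show "integrable M (\<lambda>\<omega>. \<bar>G t \<omega> - W \<omega>\<bar> * (2 * W \<omega>) + (G t \<omega> - W \<omega>)\<^sup>2)"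
            using s(2) intGW[OF elim] W0 by (intro Bochner_Integration.integrable_add) auto
          fix \<omega>
          have "(G t \<omega>)\<^sup>2 - (W \<omega>)\<^sup>2 = (G t \<omega> - W \<omega>) * (2 * W \<omega>) + (G t \<omega> - W \<omega>)\<^sup>2"
            by (simp add: power2_eq_square algebra_simps)
          also have "\<bar>\<dots>\<bar> \<le> \<bar>(G t \<omega> - W \<omega>) * (2 * W \<omega>)\<bar> + \<bar>(G t \<omega> - W \<omega>)\<^sup>2\<bar>" by (rule abs_triangle_ineq)
          also have "\<dots> = \<bar>G t \<omega> - W \<omega>\<bar> * (2 * W \<omega>) + (G t \<omega> - W \<omega>)\<^sup>2" using W0[of \<omega>] by (simp add: abs_mult)
          finally show "\<bar>(G t \<omega>)\<^sup>2 - (W \<omega>)\<^sup>2\<bar> \<le> \<bar>G t \<omega> - W \<omega>\<bar> * (2 * W \<omega>) + (G t \<omega> - W \<omega>)\<^sup>2" .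
        qed
        also have "\<dots> = (\<integral>\<omega>. \<bar>G t \<omega> - W \<omega>\<bar> * (2 * W \<omega>) \<partial>M) + (\<integral>\<omega>. (G t \<omega> - W \<omega>)\<^sup>2 \<partial>M)"
          using s(2) intGW[OF elim] W0 by (intro Bochner_Integration.integral_add) auto
        also have "\<dots> \<le> ?c * \<theta> t + 4 * K * (\<theta> t * \<theta> t)"
          unfolding \<theta>(2) using s(1) GW[OF elim] W0 by (intro add_mono) auto
        finally show ?case .
      qed
    qed
    moreover have "((\<lambda>t. \<integral>\<omega>. (G t \<omega>)\<^sup>2 \<partial>M) \<longlongrightarrow> L) at_top"
    proof (rule Lim_null[THEN iffD2], rule Lim_null_comparison)
      show "((\<lambda>t. K * (\<theta> t * \<theta> t)) \<longlongrightarrow> 0) at_top"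
        using tendsto_mult_left[OF tendsto_mult[OF \<theta>0 \<theta>0], of K] by simp
      show "\<forall>\<^sub>F t in at_top. norm ((\<integral>\<omega>. (G t \<omega>)\<^sup>2 \<partial>M) - L) \<le> K * (\<theta> t * \<theta> t)"
        using eventually_ge_at_top[of 0] 
      proof eventually_elim
        case (elim t)
        show ?case using cov[OF elim elim] by (simp add: \<theta>(2) power2_eq_square)
      qed
    qed
    ultimately show ?thesis using tendsto_unique trivial_limit_at_top_linorder by blast
  qed
  \<comment> \<open>On each grid the squared distances to W have geometrically decreasing integrals;
    the meshes are countably many, so one null set serves them all.\<close>
  have "AE \<omega> in M. \<forall>j. (\<lambda>n. G (real n / real (Suc j)) \<omega>) \<longlonglongrightarrow> W \<omega>"
    unfolding AE_all_countable
  proof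
    fix j :: nat
    define r where "r = exp (- \<eta> / real (Suc j))"
    have r: "0 < r" "r < 1" using \<eta> by (auto simp: r_def divide_neg_pos)
    have "AE \<omega> in M. summable (\<lambda>n. (G (real n / real (Suc j)) \<omega> - W \<omega>)\<^sup>2)"
    proof (rule AE_summable_of_integral_bound[where b="\<lambda>n. 4 * K * r ^ n"])
      show "(\<integral>\<omega>. (G (real n / real (Suc j)) \<omega> - W \<omega>)\<^sup>2 \<partial>M) \<le> 4 * K * r ^ n" for n
        using GW[of "real n / real (Suc j)"] by (simp add: r_def mult.commute flip: exp_of_nat_mult)
    qed (use r intGW in \<open>auto intro!: summable_mult summable_geometric\<close>)
    then show "AE \<omega> in M. (\<lambda>n. G (real n / real (Suc j)) \<omega>) \<longlonglongrightarrow> W \<omega>"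
    proof eventually_elim
      case (elim \<omega>)
      then have "(\<lambda>n. (G (real n / real (Suc j)) \<omega> - W \<omega>)\<^sup>2) \<longlonglongrightarrow> 0" by (rule summable_LIMSEQ_zero)
      then have "(\<lambda>n. sqrt ((G (real n / real (Suc j)) \<omega> - W \<omega>)\<^sup>2)) \<longlonglongrightarrow> sqrt 0" by (rule tendsto_real_sqrt)
      then have "(\<lambda>n. G (real n / real (Suc j)) \<omega> - W \<omega>) \<longlonglongrightarrow> 0" by (simp add: tendsto_rabs_zero_iff)
      then show ?case by (simp add: LIM_zero_iff)
    qed
  qed
  with mono have "AE \<omega> in M. ((\<lambda>t. G t \<omega>) \<longlongrightarrow> W \<omega>) at_top"
  proof eventually_elim
    case (elim \<omega>)
    show ?case by (rule tendsto_of_monotone_grids[OF \<nu>]) (use elim nonneg in auto)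
  qed
  with that[OF Wm W0 intW GW WL mean] show ?thesis by blast
qed

end

section \<open>Offspring constants and the function f0 as a renewal sum\<close>

context markov_independence
begin

abbreviation "\<kappa>1 \<equiv> kappa_mean M \<kappa> X"
abbreviation "\<kappa>2 \<equiv> kappa_fact2 M \<kappa> X"

lemma kappa_X_ge_2: "\<omega> \<in> space M \<Longrightarrow> 2 \<le> \<kappa> (X \<omega> n)"
  using kappa_ge_2 X_space by blast

lemma integrable_kappa_bounded:
  assumes "\<And>j. 2 \<le> j \<Longrightarrow> \<bar>c j\<bar> \<le> (real j)\<^sup>2"
  shows "integrable M (\<lambda>\<omega>. c (\<kappa> (X \<omega> n)) :: real)"
proof (rule Bochner_Integration.integrable_bound[OF kappa_square_integrable[of n]])
  show "(\<lambda>\<omega>. c (\<kappa> (X \<omega> n))) \<in> borel_measurable M" by (rule measurable_compose[OF measurable_kappa]) simp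
  show "AE \<omega> in M. norm (c (\<kappa> (X \<omega> n))) \<le> norm ((real (\<kappa> (X \<omega> n)))\<^sup>2)"
    using assms kappa_X_ge_2 by (intro AE_I2) simp
qed

lemma kappa_le_square: "2 \<le> j \<Longrightarrow> real j \<le> (real j)\<^sup>2"
  by (simp add: power2_eq_square)

lemma integrable_kappa: "integrable M (\<lambda>\<omega>. real (\<kappa> (X \<omega> n)))"
  by (rule integrable_kappa_bounded) (simp only: abs_of_nat kappa_le_square)

lemma kappa_mean_ge_2: "2 \<le> \<kappa>1"
proof -
  have "(\<integral>\<omega>. 2 \<partial>M) \<le> (\<integral>\<omega>. real (\<kappa> (X \<omega> 0)) \<partial>M)"
    using kappa_X_ge_2 by (intro integral_mono integrable_kappa) auto
  then show ?thesis by (simp add: kappa_mean_def prob_space)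
qed

lemma offspring_mean_eq: "offspring_mean = ennreal \<kappa>1"
proof -
  have "offspring_mean = (\<integral>\<^sup>+\<omega>. ennreal (real (\<kappa> (X \<omega> 0))) \<partial>M)" by (simp add: ennreal_of_nat_eq_real_of_nat)
  also have "\<dots> = ennreal \<kappa>1"
    unfolding kappa_mean_def by (rule nn_integral_eq_integral[OF integrable_kappa]) simp
  finally show ?thesis .
qed

lemma mean_gain_eq: "mean_gain = ennreal (\<kappa>1 - 1)"
proof -
  note i = integrable_kappa[of 0]
  have "mean_gain = (\<integral>\<^sup>+\<omega>. ennreal (real (\<kappa> (X \<omega> 0)) - 1) \<partial>M)"
  proof (intro nn_integral_cong)
    fix \<omega> assume "\<omega> \<in> space M"
    then have "1 \<le> \<kappa> (X \<omega> 0)" using kappa_X_ge_2[of \<omega> 0] by simp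
    then show "of_nat (\<kappa> (X \<omega> 0) - 1) = ennreal (real (\<kappa> (X \<omega> 0)) - 1)"
      by (simp add: ennreal_of_nat_eq_real_of_nat of_nat_diff)
  qed
  also have "\<dots> = ennreal (\<integral>\<omega>. real (\<kappa> (X \<omega> 0)) - 1 \<partial>M)"
  proof (rule nn_integral_eq_integral)
    show "AE \<omega> in M. 0 \<le> real (\<kappa> (X \<omega> 0)) - 1"
    proof (rule AE_I2)
      fix \<omega> assume "\<omega> \<in> space M"
      then show "0 \<le> real (\<kappa> (X \<omega> 0)) - 1" using kappa_X_ge_2[of \<omega> 0] by simp
    qed
  qed (use i in simp)
  also have "(\<integral>\<omega>. real (\<kappa> (X \<omega> 0)) - 1 \<partial>M) = \<kappa>1 - 1" using i by (simp add: kappa_mean_def prob_space)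
  finally show ?thesis .
qed

lemma offspring_fact2_eq: "offspring_fact2 = ennreal \<kappa>2"
proof -
  have "offspring_fact2 = (\<integral>\<^sup>+\<omega>. of_nat (\<kappa> (X \<omega> 1)) * of_nat (\<kappa> (X \<omega> 1) - 1) \<partial>M)"
    using kappa_law(1)[of "\<lambda>j. of_nat j * of_nat (j - 1)" 1] by simp
  also have "\<dots> = (\<integral>\<^sup>+\<omega>. ennreal (real (\<kappa> (X \<omega> 1)) * (real (\<kappa> (X \<omega> 1)) - 1)) \<partial>M)"
  proof (intro nn_integral_cong)
    fix \<omega> assume "\<omega> \<in> space M"
    then have "1 \<le> \<kappa> (X \<omega> 1)" using kappa_X_ge_2[of \<omega> 1] by simp
    then show "of_nat (\<kappa> (X \<omega> 1)) * of_nat (\<kappa> (X \<omega> 1) - 1) = ennreal (real (\<kappa> (X \<omega> 1)) * (real (\<kappa> (X \<omega> 1)) - 1))"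
      by (simp add: ennreal_of_nat_eq_real_of_nat of_nat_diff flip: ennreal_mult)
  qed
  also have "\<dots> = ennreal \<kappa>2"
    unfolding kappa_fact2_def
  proof (rule nn_integral_eq_integral)
    show "integrable M (\<lambda>\<omega>. real (\<kappa> (X \<omega> 1)) * (real (\<kappa> (X \<omega> 1)) - 1))"
      by (rule integrable_kappa_bounded) (simp add: abs_mult power2_eq_square)
    show "AE \<omega> in M. 0 \<le> real (\<kappa> (X \<omega> 1)) * (real (\<kappa> (X \<omega> 1)) - 1)"
    proof (rule AE_I2)
      fix \<omega> assume "\<omega> \<in> space M"
      then show "0 \<le> real (\<kappa> (X \<omega> 1)) * (real (\<kappa> (X \<omega> 1)) - 1)" using kappa_X_ge_2[of \<omega> 1] by simp
    qed
  qed
  finally show ?thesis .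
qed

lemma kappa_fact2_nonneg: "0 \<le> \<kappa>2"
  unfolding kappa_fact2_def
proof (rule integral_nonneg_AE, rule AE_I2)
  fix \<omega> assume "\<omega> \<in> space M"
  then show "0 \<le> real (\<kappa> (X \<omega> 1)) * (real (\<kappa> (X \<omega> 1)) - 1)" using kappa_X_ge_2[of \<omega> 1] by simp
qed

text \<open>Lets the terms with equal labels be absorbed with the same constant \<kappa>2 as all
  other pairs.\<close>

lemma squared_gain_le: "(\<integral>\<^sup>+\<omega>. of_nat (\<kappa> (X \<omega> 0) - 1) * of_nat (\<kappa> (X \<omega> 0) - 1) \<partial>M) \<le> offspring_fact2"
  by (intro nn_integral_mono mult_right_mono) auto

text \<open>A distribution function: that of the total lifetime of generations 1 to n + 1, the tail
  of the line after its starting cell.\<close>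

definition tail_prob :: "nat \<Rightarrow> 'x \<Rightarrow> real \<Rightarrow> real" where
  "tail_prob n x t = \<P>(p in chain_law E P x. lifetime_sum \<xi> p (Suc n) - lifetime_sum \<xi> p 0 \<le> t)"

lemma lifetime_sum_Suc_diff: "lifetime_sum \<xi> p (Suc n) - lifetime_sum \<xi> p 0 = lifetime_sum \<xi> (\<lambda>n. p (Suc n)) n"
  using lifetime_sum_shift[of \<xi> p 0 n] by simp

context
  fixes x assumes x: "x \<in> space E"
begin

lemma prob_space_chain: "prob_space (chain_law E P x)"
  by (rule prob_space_chain_law[OF kernel x])

lemma sets_chain: "sets (chain_law E P x) = sets (path_space E)"
  by (rule sets_chain_law[OF kernel x])

lemma space_chain: "space (chain_law E P x) = space (path_space E)"
  by (rule sets_eq_imp_space_eq[OF sets_chain])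

lemma space_chainD: "p \<in> space (chain_law E P x) \<Longrightarrow> p n \<in> space E"
  by (auto simp: space_chain path_space_def space_PiM)

lemma measurable_chain_sum: "(\<lambda>p. lifetime_sum \<xi> p n) \<in> borel_measurable (chain_law E P x)"
  by (subst measurable_cong_sets[OF sets_chain refl]) (rule measurable_lifetime_sum_path)

lemma lifetime_cdf_eq: "lifetime_cdf n x t = ennreal (tail_prob n x t)"
proof -
  interpret C: prob_space "chain_law E P x" by (rule prob_space_chain)
  have sh: "(\<lambda>p n. p (Suc n)) \<in> measurable (chain_law E P x) (path_space E)"
    by (subst measurable_cong_sets[OF sets_chain refl], rule measurable_path_shift) simp
  have "lifetime_cdf n x t = emeasure (chain_law E P x) ((\<lambda>p n. p (Suc n)) -` {p \<in> space (path_space E). lifetime_sum \<xi> p n \<le> t} \<inter> space (chain_law E P x))"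
    unfolding lifetime_cdf_def future_law_def by (rule emeasure_distr[OF sh]) measurable
  also have "(\<lambda>p n. p (Suc n)) -` {p \<in> space (path_space E). lifetime_sum \<xi> p n \<le> t} \<inter> space (chain_law E P x)
      = {p \<in> space (chain_law E P x). lifetime_sum \<xi> p (Suc n) - lifetime_sum \<xi> p 0 \<le> t}"
    using measurable_space[OF sh] by (auto simp: lifetime_sum_Suc_diff)
  finally show ?thesis by (simp add: tail_prob_def C.emeasure_eq_measure)
qed

lemma tail_prob_cdf: "tail_prob n x = cdf (distr (chain_law E P x) borel (\<lambda>p. lifetime_sum \<xi> p (Suc n) - lifetime_sum \<xi> p 0))"
proof
  fix t
  have m: "(\<lambda>p. lifetime_sum \<xi> p (Suc n) - lifetime_sum \<xi> p 0) \<in> borel_measurable (chain_law E P x)"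
    by (intro borel_measurable_diff measurable_chain_sum)
  show "tail_prob n x t = cdf (distr (chain_law E P x) borel (\<lambda>p. lifetime_sum \<xi> p (Suc n) - lifetime_sum \<xi> p 0)) t"
    unfolding cdf_def2 tail_prob_def by (subst measure_distr[OF m]) (auto intro!: arg_cong[where f="measure _"])
qed

lemma tail_prob_nonneg: "0 \<le> tail_prob n x t"
  by (simp add: tail_prob_def)

lemma tail_prob_mono: "s \<le> t \<Longrightarrow> tail_prob n x s \<le> tail_prob n x t"
proof -
  interpret C: prob_space "chain_law E P x" by (rule prob_space_chain)
  assume "s \<le> t"
  moreover have m: "(\<lambda>p. lifetime_sum \<xi> p (Suc n) - lifetime_sum \<xi> p 0) \<in> borel_measurable (chain_law E P x)"
    by (intro borel_measurable_diff measurable_chain_sum)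
  then have "{p \<in> space (chain_law E P x). lifetime_sum \<xi> p (Suc n) - lifetime_sum \<xi> p 0 \<le> t} \<in> C.events" by measurable
  ultimately show ?thesis unfolding tail_prob_def by (intro C.finite_measure_mono) auto
qed

lemma tail_prob_right_continuous: "continuous (at_right t) (tail_prob n x)"
proof -
  interpret C: prob_space "chain_law E P x" by (rule prob_space_chain)
  have m: "(\<lambda>p. lifetime_sum \<xi> p (Suc n) - lifetime_sum \<xi> p 0) \<in> borel_measurable (chain_law E P x)"
    by (intro borel_measurable_diff measurable_chain_sum)
  interpret F: finite_borel_measure "distr (chain_law E P x) borel (\<lambda>p. lifetime_sum \<xi> p (Suc n) - lifetime_sum \<xi> p 0)"
    unfolding finite_borel_measure_def finite_borel_measure_axioms_def using C.finite_measure_distr[OF m] by simp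
  show ?thesis unfolding tail_prob_cdf by (rule F.cdf_is_right_cont)
qed

lemma tail_prob_neg: "t < 0 \<Longrightarrow> tail_prob n x t = 0"
proof -
  assume t: "t < 0"
  have "{p \<in> space (chain_law E P x). lifetime_sum \<xi> p (Suc n) - lifetime_sum \<xi> p 0 \<le> t} = {}"
  proof -
    have "0 \<le> lifetime_sum \<xi> (\<lambda>n. p (Suc n)) n" if "p \<in> space (chain_law E P x)" for p
      unfolding lifetime_sum_def using space_chainD[OF that] by (intro sum_nonneg xi_nonneg)
    then show ?thesis using t by (fastforce simp: lifetime_sum_Suc_diff)
  qed
  then show ?thesis unfolding tail_prob_def by (simp only: measure_empty)
qed

text \<open>As \<nu> is the infimum of admissible rates for each starting point, some rate below
  \<gamma>' makes the weighted transforms summable; the exponential Markov inequality then bounds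
  all distribution functions at once, with a constant that does not depend on t.\<close>

lemma tail_prob_exponential_bound:
  assumes "\<nu> < \<gamma>'"
  obtains \<gamma> K where "\<gamma> < \<gamma>'" "summable (\<lambda>n. \<kappa>1 ^ n * tail_prob n x t)"
    "\<And>t. summable (\<lambda>n. \<kappa>1 ^ n * tail_prob n x t)" "0 \<le> K" "\<And>t. (\<Sum>n. \<kappa>1 ^ n * tail_prob n x t) \<le> K * exp (\<gamma> * t)"
proof -
  interpret C: prob_space "chain_law E P x" by (rule prob_space_chain)
  have \<kappa>1: "0 \<le> \<kappa>1" using kappa_mean_ge_2 by simp
  let ?I = "\<lambda>\<gamma> n. \<integral>\<^sup>+p. ennreal (exp (- \<gamma> * lifetime_sum \<xi> p (Suc n))) \<partial>chain_law E P x"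
  let ?S = "{\<gamma>. \<gamma> > 0 \<and> (\<Sum>n. ennreal (\<kappa>1 ^ n) * ?I \<gamma> n) < \<infinity>}"
  have "Inf (ereal ` ?S) < ereal \<gamma>'"
    using nu_start[OF x] assms by (metis less_ereal.simps(1))
  then obtain \<gamma> where \<gamma>: "\<gamma> < \<gamma>'" "\<gamma> > 0" and fin: "(\<Sum>n. ennreal (\<kappa>1 ^ n) * ?I \<gamma> n) < \<infinity>"
    by (auto simp: Inf_less_iff)
  \<comment> \<open>The transforms in \<open>nu_start\<close> include the lifetime of the starting
    cell, which \<open>tail_prob\<close> excludes; under the chain law it is the constant \<xi>
    x.\<close>
  have start: "AE p in chain_law E P x. \<xi> (p 0) = \<xi> x"
  proof -
    have [measurable]: "\<xi> \<in> borel_measurable E" by (rule xi_measurable)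
    have "(\<integral>\<^sup>+p. (\<lambda>y. indicator {\<xi> x} (\<xi> y)) (p 0) \<partial>chain_law E P x) = 1"
      using x by (subst chain_law_start[OF kernel x]) auto
    moreover have m: "{p \<in> space (chain_law E P x). \<xi> (p 0) = \<xi> x} \<in> sets (chain_law E P x)"
    proof -
      have "(\<lambda>p. \<xi> (p 0)) \<in> borel_measurable (chain_law E P x)"
        using measurable_chain_sum[of 0] by (simp add: lifetime_sum_def)
      then show ?thesis by measurable
    qed
    moreover have "(\<integral>\<^sup>+p. (\<lambda>y. indicator {\<xi> x} (\<xi> y)) (p 0) \<partial>chain_law E P x) = (\<integral>\<^sup>+p. indicator {p \<in> space (chain_law E P x). \<xi> (p 0) = \<xi> x} p \<partial>chain_law E P x)"
      by (intro nn_integral_cong) (auto split: split_indicator)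
    ultimately have "emeasure (chain_law E P x) {p \<in> space (chain_law E P x). \<xi> (p 0) = \<xi> x} = 1" by simp
    then have "C.prob {p \<in> space (chain_law E P x). \<xi> (p 0) = \<xi> x} = 1" by (simp add: C.emeasure_eq_measure)
    then show ?thesis using C.AE_in_set_eq_1[OF m] by auto
  qed
  \<comment> \<open>On the event the total lifetime is at most t + \<xi> x, so the exponential of
    \<gamma> times the difference is at least 1 there. The factor depending on t then separates from
    the one depending on n.\<close>
  have bound: "ennreal (\<kappa>1 ^ n * tail_prob n x t) \<le> ennreal (exp (\<gamma> * (t + \<xi> x))) * (ennreal (\<kappa>1 ^ n) * ?I \<gamma> n)" for n t
  proof -
    have m: "(\<lambda>p. lifetime_sum \<xi> p (Suc n) - lifetime_sum \<xi> p 0) \<in> borel_measurable (chain_law E P x)"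
      by (intro borel_measurable_diff measurable_chain_sum)
    let ?A = "{p \<in> space (chain_law E P x). lifetime_sum \<xi> p (Suc n) - lifetime_sum \<xi> p 0 \<le> t}"
    have A: "?A \<in> sets (chain_law E P x)" using m by measurable
    have "ennreal (tail_prob n x t) = (\<integral>\<^sup>+p. indicator ?A p \<partial>chain_law E P x)"
      using A by (simp add: tail_prob_def C.emeasure_eq_measure)
    also have "\<dots> \<le> (\<integral>\<^sup>+p. ennreal (exp (\<gamma> * (t + \<xi> x))) * ennreal (exp (- \<gamma> * lifetime_sum \<xi> p (Suc n))) \<partial>chain_law E P x)"
    proof (rule nn_integral_mono_AE)
      show "AE p in chain_law E P x. indicator ?A p \<le> ennreal (exp (\<gamma> * (t + \<xi> x))) * ennreal (exp (- \<gamma> * lifetime_sum \<xi> p (Suc n)))"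
        using start
      proof eventually_elim
        case (elim p)
        show ?case
        proof (cases "p \<in> ?A")
          case True
          then have "0 \<le> t + \<xi> x - lifetime_sum \<xi> p (Suc n)" using elim by (simp add: lifetime_sum_def)
          then have "0 \<le> \<gamma> * (t + \<xi> x - lifetime_sum \<xi> p (Suc n))" using \<gamma>(2) by simp
          then have "1 \<le> exp (\<gamma> * (t + \<xi> x - lifetime_sum \<xi> p (Suc n)))" by simp
          also have "\<dots> = exp (\<gamma> * (t + \<xi> x)) * exp (- \<gamma> * lifetime_sum \<xi> p (Suc n))"
            by (simp add: algebra_simps flip: exp_add)
          finally show ?thesis using True by (simp add: ennreal_mult[symmetric] flip: ennreal_1)
        qed simp
      qed
    qed
    also have "\<dots> = ennreal (exp (\<gamma> * (t + \<xi> x))) * ?I \<gamma> n"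
      by (intro nn_integral_cmult) (use measurable_chain_sum[of "Suc n"] in measurable)
    finally have "ennreal (\<kappa>1 ^ n) * ennreal (tail_prob n x t) \<le> ennreal (\<kappa>1 ^ n) * (ennreal (exp (\<gamma> * (t + \<xi> x))) * ?I \<gamma> n)"
      by (rule mult_left_mono) simp
    then show ?thesis using \<kappa>1 by (simp add: ennreal_mult tail_prob_nonneg ac_simps)
  qed
  obtain K' where K': "(\<Sum>n. ennreal (\<kappa>1 ^ n) * ?I \<gamma> n) = ennreal K'" "0 \<le> K'"
    using fin by (cases "(\<Sum>n. ennreal (\<kappa>1 ^ n) * ?I \<gamma> n)") auto
  have total: "(\<Sum>n. ennreal (\<kappa>1 ^ n * tail_prob n x t)) \<le> ennreal (K' * exp (\<gamma> * \<xi> x) * exp (\<gamma> * t))" for t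
  proof -
    have "(\<Sum>n. ennreal (\<kappa>1 ^ n * tail_prob n x t)) \<le> (\<Sum>n. ennreal (exp (\<gamma> * (t + \<xi> x))) * (ennreal (\<kappa>1 ^ n) * ?I \<gamma> n))"
      by (intro suminf_le bound) auto
    also have "\<dots> = ennreal (K' * exp (\<gamma> * \<xi> x) * exp (\<gamma> * t))"
      unfolding ennreal_suminf_cmult K'(1) using K'(2) by (simp add: distrib_left exp_add ac_simps flip: ennreal_mult)
    finally show ?thesis .
  qed
  have nn: "0 \<le> \<kappa>1 ^ n * tail_prob n x t" for n t using \<kappa>1 by (simp add: tail_prob_nonneg)
  have summ: "summable (\<lambda>n. \<kappa>1 ^ n * tail_prob n x t)" for t
    using total[of t] nn by (intro summable_suminf_not_top) (auto simp: top_unique)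
  show ?thesis
  proof (rule that[OF \<gamma>(1) summ summ])
    show "0 \<le> K' * exp (\<gamma> * \<xi> x)" using K' by simp
    show "(\<Sum>n. \<kappa>1 ^ n * tail_prob n x t) \<le> K' * exp (\<gamma> * \<xi> x) * exp (\<gamma> * t)" for t
      using total[of t] nn K' by (simp add: suminf_ennreal2[OF nn summ])
  qed
qed

lemma summable_tail_prob: "summable (\<lambda>n. \<kappa>1 ^ n * tail_prob n x t)"
proof -
  have "\<nu> < \<nu> + 1" by simp
  then show ?thesis by (rule tail_prob_exponential_bound) auto
qed

definition "renewal t = (\<Sum>n. \<kappa>1 ^ n * tail_prob n x t)"

lemma renewal_nonneg: "0 \<le> renewal t"
  unfolding renewal_def using kappa_mean_ge_2 by (intro suminf_nonneg summable_tail_prob) (simp add: tail_prob_nonneg)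

lemma renewal_neg: "t < 0 \<Longrightarrow> renewal t = 0"
  by (simp add: renewal_def tail_prob_neg)

lemma renewal_mono: "mono renewal"
  unfolding renewal_def using kappa_mean_ge_2
  by (intro monoI suminf_le summable_tail_prob mult_left_mono tail_prob_mono) auto

text \<open>Tannery's theorem: for s below t + 1 the terms are dominated by those at t + 1, since
  distribution functions increase.\<close>

lemma renewal_right_continuous: "continuous (at_right t) renewal"
proof -
  have "((\<lambda>s. \<Sum>n. \<kappa>1 ^ n * tail_prob n x s) \<longlongrightarrow> (\<Sum>n. \<kappa>1 ^ n * tail_prob n x t)) (at_right t)"
  proof (rule tannerys_theorem[THEN conjunct2, THEN conjunct2])
    show "((\<lambda>s. \<kappa>1 ^ n * tail_prob n x s) \<longlongrightarrow> \<kappa>1 ^ n * tail_prob n x t) (at_right t)" for n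
      using tail_prob_right_continuous[of t n] by (intro tendsto_mult_left) (simp add: continuous_within)
    show "summable (\<lambda>n. \<kappa>1 ^ n * tail_prob n x (t + 1))" by (rule summable_tail_prob)
    have "eventually (\<lambda>s. s < t + 1) (at_right t)"
      by (auto simp: eventually_at_right_field intro!: exI[of _ "t + 1"])
    from eventually_prodI[OF eventually_True this, of at_top]
    show "\<forall>\<^sub>F (n, s) in at_top \<times>\<^sub>F at_right t. norm (\<kappa>1 ^ n * tail_prob n x s) \<le> \<kappa>1 ^ n * tail_prob n x (t + 1)"
    proof eventually_elim
      case (elim z)
      then show ?case using kappa_mean_ge_2
        by (auto simp: split_beta' abs_mult tail_prob_nonneg intro!: mult_left_mono tail_prob_mono)
    qed
  qed simp
  then show ?thesis by (simp add: continuous_within renewal_def[abs_def])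
qed

lemma f0_eq: "f0 E \<xi> P \<kappa>1 \<nu> x t = (\<kappa>1 - 1) * exp (- \<nu> * t) * renewal t"
  by (simp add: f0_def renewal_def tail_prob_def)

lemma f0_nonneg: "0 \<le> f0 E \<xi> P \<kappa>1 \<nu> x t"
  unfolding f0_eq using kappa_mean_ge_2 renewal_nonneg[of t] by simp

lemma f0_neg: "t < 0 \<Longrightarrow> f0 E \<xi> P \<kappa>1 \<nu> x t = 0"
  by (simp add: f0_eq renewal_neg)

lemma f0_right_continuous: "continuous (at_right t) (f0 E \<xi> P \<kappa>1 \<nu> x)"
  unfolding f0_eq[abs_def] by (intro continuous_intros renewal_right_continuous)

lemma f0_measurable: "f0 E \<xi> P \<kappa>1 \<nu> x \<in> borel_measurable borel"
  unfolding f0_eq[abs_def] using borel_measurable_mono[OF renewal_mono] by measurable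

text \<open>The renewal sum grows at some rate below \<nu> + \<gamma>, and f0 carries the factor
  exp(-\<nu> * t); the positive number \<open>u\<close> is the decay that is left.\<close>

lemma f0_laplace_integrable:
  assumes "0 < \<gamma>"
  shows "integrable lborel (\<lambda>t. exp (- \<gamma> * t) * f0 E \<xi> P \<kappa>1 \<nu> x t)"
proof -
  have "\<nu> < \<nu> + \<gamma>" using assms by simp
  then obtain \<gamma>' K where \<gamma>': "\<gamma>' < \<nu> + \<gamma>" and K: "0 \<le> K" "\<And>t. renewal t \<le> K * exp (\<gamma>' * t)"
    unfolding renewal_def by (rule tail_prob_exponential_bound) auto
  define u where "u = \<nu> + \<gamma> - \<gamma>'"
  have u: "0 < u" using \<gamma>' by (simp add: u_def)
  have [measurable]: "f0 E \<xi> P \<kappa>1 \<nu> x \<in> borel_measurable borel" by (rule f0_measurable)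
  have "integrable lborel (\<lambda>t. (\<kappa>1 - 1) * K * (indicator {0<..} t * exp (- (t * u))))"
    using integrable_I0i_exp_mscale[OF u] unfolding set_integrable_def by (intro integrable_mult_right) simp
  then show ?thesis
  proof (rule Bochner_Integration.integrable_bound)
    show "AE t in lborel. norm (exp (- \<gamma> * t) * f0 E \<xi> P \<kappa>1 \<nu> x t) \<le> norm ((\<kappa>1 - 1) * K * (indicator {0<..} t * exp (- (t * u))))"
      using AE_lborel_singleton[of 0]
    proof eventually_elim
      case (elim t)
      show ?case
      proof (cases "t < 0")
        case False
        then have t: "0 < t" using elim by simp
        have "exp (- \<gamma> * t) * f0 E \<xi> P \<kappa>1 \<nu> x t = (\<kappa>1 - 1) * (exp (- (\<nu> + \<gamma>) * t) * renewal t)"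
        proof -
          have "exp (- (\<nu> + \<gamma>) * t) = exp (- \<gamma> * t) * exp (- \<nu> * t)" by (simp add: algebra_simps flip: exp_add)
          then show ?thesis by (simp add: f0_eq)
        qed
        also have "\<dots> \<le> (\<kappa>1 - 1) * (exp (- (\<nu> + \<gamma>) * t) * (K * exp (\<gamma>' * t)))"
          using kappa_mean_ge_2 K by (intro mult_left_mono) auto
        also have "\<dots> = (\<kappa>1 - 1) * K * exp (- (t * u))"
          by (simp add: u_def algebra_simps flip: exp_add)
        finally show ?thesis using t f0_nonneg[of t] K kappa_mean_ge_2 by (simp add: abs_mult)
      qed (simp add: f0_neg)
    qed
  qed simp
qed

text \<open>Leads from the extended series of the moment computation to the real function whose
  asymptotics Laplace inversion provides.\<close>

lemma growth_eq: "growth x t = ennreal (exp (\<nu> * t) * f0 E \<xi> P \<kappa>1 \<nu> x t)"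
proof -
  have \<kappa>1: "0 \<le> \<kappa>1" "0 \<le> \<kappa>1 - 1" using kappa_mean_ge_2 by auto
  have "growth x t = (\<Sum>n. ennreal ((\<kappa>1 - 1) * (\<kappa>1 ^ n * tail_prob n x t)))"
    unfolding growth_def lifetime_cdf_eq offspring_mean_eq mean_gain_eq
    using \<kappa>1 by (intro suminf_cong) (simp add: ennreal_mult ennreal_power tail_prob_nonneg ac_simps)
  also have "\<dots> = ennreal (\<Sum>n. (\<kappa>1 - 1) * (\<kappa>1 ^ n * tail_prob n x t))"
    using \<kappa>1 by (intro suminf_ennreal2 summable_mult summable_tail_prob) (simp add: tail_prob_nonneg)
  also have "(\<Sum>n. (\<kappa>1 - 1) * (\<kappa>1 ^ n * tail_prob n x t)) = (\<kappa>1 - 1) * renewal t"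
    unfolding renewal_def by (rule suminf_mult[OF summable_tail_prob])
  also have "\<dots> = exp (\<nu> * t) * f0 E \<xi> P \<kappa>1 \<nu> x t"
    by (simp add: f0_eq exp_minus)
  finally show ?thesis .
qed

end

end

section \<open>The limit of the normalised population\<close>

text \<open>Expands a * b around c squared with two linear terms and one quadratic term. In the
  quadratic term one factor q is given up, as q is at most 1, so that the whole error stays linear
  in q.\<close>

lemma abs_mult_diff_square_le:
  fixes a b c q w :: real
  assumes "\<bar>a - c\<bar> \<le> q * w" "\<bar>b - c\<bar> \<le> q * w" "0 \<le> c" "0 \<le> w" "0 \<le> q" "q \<le> 1"
  shows "\<bar>a * b - c\<^sup>2\<bar> \<le> 2 * q * (c * w + w\<^sup>2)"
proof -
  have "q * w \<le> w" using assms mult_right_mono[of q 1 w] by simp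
  then have 1: "\<bar>a - c\<bar> * \<bar>b - c\<bar> \<le> (q * w) * w" using assms by (intro mult_mono) auto
  have 2: "c * \<bar>a - c\<bar> \<le> c * (q * w)" "c * \<bar>b - c\<bar> \<le> c * (q * w)"
    using assms by (auto intro!: mult_left_mono)
  have "a * b - c\<^sup>2 = (a - c) * (b - c) + c * (a - c) + c * (b - c)"
    by (simp add: power2_eq_square algebra_simps)
  then have "\<bar>a * b - c\<^sup>2\<bar> \<le> \<bar>a - c\<bar> * \<bar>b - c\<bar> + c * \<bar>a - c\<bar> + c * \<bar>b - c\<bar>"
    using abs_triangle_ineq[of "(a - c) * (b - c) + c * (a - c)" "c * (b - c)"]
      abs_triangle_ineq[of "(a - c) * (b - c)" "c * (a - c)"] assms(3) by (simp add: abs_mult)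
  also have "\<dots> \<le> (q * w) * w + c * (q * w) + c * (q * w)" using 1 2 by linarith
  also have "\<dots> \<le> 2 * q * (c * w + w\<^sup>2)"
    using assms mult_nonneg_nonneg[of q "w * w"] by (simp add: power2_eq_square algebra_simps)
  finally show ?thesis .
qed

text \<open>\<open>ennreal\<close> sends negative numbers to 0, which preserves both inequalities
  whatever the signs of u and v.\<close>

lemma ennreal_le_add_of_abs_diff_le:
  assumes "\<bar>u - v\<bar> \<le> w"
  shows "ennreal u \<le> ennreal v + ennreal w" "ennreal v \<le> ennreal u + ennreal w"
proof -
  have "ennreal u \<le> ennreal (v + w)" "ennreal v \<le> ennreal (u + w)"
    using assms by (auto intro!: ennreal_leI)
  moreover have "ennreal (v + w) \<le> ennreal v + ennreal w" "ennreal (u + w) \<le> ennreal u + ennreal w"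
    by (auto simp: ennreal_plus_if add_increasing2 ennreal_leI)
  ultimately show "ennreal u \<le> ennreal v + ennreal w" "ennreal v \<le> ennreal u + ennreal w"
    by (meson order_trans)+
qed

locale branching_analyticity =
  markov_independence M E \<xi> \<kappa> X T Xk P \<nu> + analyticity E \<xi> P "kappa_mean M \<kappa> X" \<nu> F \<delta> \<epsilon>
  for M :: "'w measure" and E :: "'x measure" and \<xi> \<kappa> X T Xk P \<nu> F \<delta> \<epsilon>
begin

abbreviation "f \<equiv> f0 E \<xi> P \<kappa>1 \<nu>"
abbreviation "C \<equiv> C0 F"
abbreviation "\<Psi> \<equiv> Psi0 F \<delta>"

lemma nu_pos: "0 < \<nu>"
  using delta_pos delta_less by simp

lemma f0_residue_bound:
  assumes x: "x \<in> space E"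
  shows "\<bar>f x t - C x\<bar> \<le> exp (- \<delta> * t) * \<Psi> x"
  unfolding C0_def Psi0_def
proof (rule laplace_inversion_residue_bound[OF f0_measurable[OF x] f0_nonneg[OF x] f0_neg[OF x] f0_right_continuous[OF x] f0_laplace_integrable[OF x]
      _ delta_pos eps_pos analytic[OF x] _ _ integrable_right[OF x] integrable_left[OF x] decay_top[OF x] decay_bot[OF x]])
  show "is_pole (F x) 0" "zorder (F x) 0 = - 1" using simple_pole[OF x] by auto
  fix \<gamma> :: real assume "0 < \<gamma>"
  then have "F x (of_real \<gamma>) = of_real (laplace (f x) \<gamma>)" by (rule extends_laplace[OF x])
  also have "laplace (f x) \<gamma> = (LINT t|lborel. exp (- \<gamma> * t) * f x t)"
    unfolding laplace_def set_lebesgue_integral_def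
    by (intro Bochner_Integration.integral_cong) (auto simp: f0_neg[OF x] split: split_indicator)
  finally show "F x (of_real \<gamma>) = of_real (LINT t|lborel. exp (- \<gamma> * t) * f x t)" .
qed

text \<open>The sign and the measurability of \<open>C\<close> are inherited from f along integer
  times.\<close>

lemma f0_tendsto_C:
  assumes x: "x \<in> space E"
  shows "(\<lambda>n. f x (real n)) \<longlonglongrightarrow> C x"
proof (rule Lim_null[THEN iffD2], rule Lim_null_comparison)
  have "((\<lambda>t. exp (- \<delta> * t)) \<longlongrightarrow> 0) at_top" using delta_pos by real_asymp
  from filterlim_compose[OF this filterlim_real_sequentially]
  show "(\<lambda>n. exp (- \<delta> * real n) * \<Psi> x) \<longlonglongrightarrow> 0" using tendsto_mult_right[of _ 0 _ "\<Psi> x"] by fastforce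
  show "\<forall>\<^sub>F n in sequentially. norm (f x (real n) - C x) \<le> exp (- \<delta> * real n) * \<Psi> x"
    using f0_residue_bound[OF x] by simp
qed

lemma C_nonneg: "x \<in> space E \<Longrightarrow> 0 \<le> C x"
  by (rule LIMSEQ_le_const[OF f0_tendsto_C]) (auto intro!: exI[of _ 0] f0_nonneg)

lemma Psi_nonneg: "0 \<le> \<Psi> x"
  unfolding Psi0_def by (rule integral_nonneg_AE) simp

lemma measurable_f0: "(\<lambda>x. f x t) \<in> borel_measurable E"
proof -
  have "(\<lambda>x. lifetime_cdf n x t) \<in> borel_measurable E" for n
    unfolding lifetime_cdf_def
    by (rule measurable_compose[OF measurable_prob_algebraD[OF future_law_measurable[OF kernel]] measurable_emeasure_subprob_algebra]) measurable
  then have g: "(\<lambda>x. growth x t) \<in> borel_measurable E"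
    unfolding growth_def by (intro borel_measurable_suminf_order borel_measurable_times_ennreal borel_measurable_const)
  have "(\<lambda>x. exp (- \<nu> * t) * enn2real (growth x t)) \<in> borel_measurable E" using g by measurable
  then show ?thesis
  proof (rule measurable_cong[THEN iffD1, rotated])
    fix x assume x: "x \<in> space E"
    show "exp (- \<nu> * t) * enn2real (growth x t) = f x t"
      by (simp add: growth_eq[OF x] f0_nonneg[OF x] exp_minus)
  qed
qed

lemma measurable_C: "C \<in> borel_measurable E"
  by (rule borel_measurable_LIMSEQ_real[OF f0_tendsto_C measurable_f0])

text \<open>The smallest admissible error constant: unlike \<open>\<Psi>\<close>, its measurability in \<open>x\<close> is immediate.\<close>

definition err :: "'x \<Rightarrow> real" where
  "err x = (SUP t\<in>\<rat>. exp (\<delta> * t) * \<bar>f x t - C x\<bar>)"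

lemma err_upper: "x \<in> space E \<Longrightarrow> exp (\<delta> * t) * \<bar>f x t - C x\<bar> \<le> \<Psi> x"
proof -
  assume "x \<in> space E"
  then have "exp (\<delta> * t) * \<bar>f x t - C x\<bar> \<le> exp (\<delta> * t) * (exp (- \<delta> * t) * \<Psi> x)"
    by (intro mult_left_mono f0_residue_bound) auto
  also have "\<dots> = \<Psi> x" by (simp add: exp_minus)
  finally show ?thesis .
qed

lemma err_bdd: "x \<in> space E \<Longrightarrow> bdd_above ((\<lambda>t. exp (\<delta> * t) * \<bar>f x t - C x\<bar>) ` \<rat>)"
  by (rule bdd_aboveI2) (rule err_upper)

lemma err_le_Psi: "x \<in> space E \<Longrightarrow> err x \<le> \<Psi> x"
  unfolding err_def by (rule cSUP_least) (auto intro: err_upper)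

lemma measurable_err: "err \<in> borel_measurable E"
  unfolding err_def
proof (rule borel_measurable_cSUP)
  fix t show "(\<lambda>x. exp (\<delta> * t) * \<bar>f x t - C x\<bar>) \<in> borel_measurable E"
    using measurable_f0[of t] measurable_C by measurable
qed (simp_all add: countable_rat err_bdd)

text \<open>The supremum defining \<open>err\<close> runs over rational times to keep it countable;
  right continuity of f extends the bound to all real times.\<close>

lemma err_bound:
  assumes x: "x \<in> space E"
  shows "\<bar>f x t - C x\<bar> \<le> exp (- \<delta> * t) * err x"
proof -
  let ?g = "\<lambda>t. exp (\<delta> * t) * \<bar>f x t - C x\<bar>"
  have "?g t \<le> err x"
  proof (rule ccontr)
    assume "\<not> ?g t \<le> err x"
    then have lt: "err x < ?g t" by simp
    have "continuous (at_right t) ?g" by (intro continuous_intros f0_right_continuous[OF x])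
    then have "(?g \<longlongrightarrow> ?g t) (at_right t)" by (simp add: continuous_within)
    then have "eventually (\<lambda>s. err x < ?g s) (at_right t)" using lt by (rule order_tendstoD)
    then obtain b where b: "t < b" "\<And>s. t < s \<Longrightarrow> s < b \<Longrightarrow> err x < ?g s"
      unfolding eventually_at_right_field by blast
    obtain s where s: "s \<in> \<rat>" "t < s" "s < b" using Rats_dense_in_real[OF b(1)] by blast
    have "?g s \<le> err x" unfolding err_def by (rule cSUP_upper[OF s(1) err_bdd[OF x]])
    with b(2)[OF s(2,3)] show False by simp
  qed
  then have le: "exp (- \<delta> * t) * ?g t \<le> exp (- \<delta> * t) * err x" by (rule mult_left_mono) simp
  have "exp (- \<delta> * t) * exp (\<delta> * t) = 1" by (simp flip: exp_add)
  then have "exp (- \<delta> * t) * ?g t = \<bar>f x t - C x\<bar>" by (simp only: mult.assoc[symmetric] mult_1)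
  with le show ?thesis by (simp only:)
qed

lemma err_nonneg: "x \<in> space E \<Longrightarrow> 0 \<le> err x"
  using err_bound[of x 0] by (simp add: order_trans[OF abs_ge_zero])

lemma f0_le:
  assumes x: "x \<in> space E" and t: "0 \<le> t"
  shows "f x t \<le> C x + err x"
proof -
  have "exp (- \<delta> * t) * err x \<le> 1 * err x"
    using t delta_pos err_nonneg[OF x] by (intro mult_right_mono) auto
  with err_bound[OF x, of t] show ?thesis by simp
qed

abbreviation S :: "'w \<Rightarrow> nat \<Rightarrow> real" where "S \<omega> k \<equiv> lifetime_sum \<xi> (X \<omega>) k"

text \<open>\<delta> is the rate at which f approaches C, and \<nu> - \<delta> is the part of the
  decay exp(-\<nu> * s) that \<open>exp_split\<close> keeps; \<eta> is a rate available in every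
  error term.\<close>

definition \<eta> :: real where "\<eta> = min \<delta> (\<nu> - \<delta>)"

lemma eta_pos: "0 < \<eta>"
  using delta_pos delta_less by (simp add: \<eta>_def)

lemma exp_eta_ge:
  assumes "0 \<le> m" "m \<le> s"
  shows "exp (- \<delta> * s) \<le> exp (- \<eta> * m)" "exp (- (\<nu> - \<delta>) * s) \<le> exp (- \<eta> * m)"
proof -
  have "\<eta> * m \<le> \<delta> * s" using assms delta_pos eta_pos by (intro mult_mono) (auto simp: \<eta>_def)
  then show "exp (- \<delta> * s) \<le> exp (- \<eta> * m)" by simp
  have "\<eta> * m \<le> (\<nu> - \<delta>) * s" using assms delta_less eta_pos by (intro mult_mono) (auto simp: \<eta>_def)
  then have "- (\<nu> - \<delta>) * s \<le> - \<eta> * m" by (simp only: mult_minus_left neg_le_iff_le)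
  then show "exp (- (\<nu> - \<delta>) * s) \<le> exp (- \<eta> * m)" by (simp only: exp_le_cancel_iff)
qed

section \<open>Pointwise bounds for the terms of the second moment\<close>

context
  fixes S s t :: real and y :: 'x
  assumes y: "y \<in> space E" and S: "0 \<le> S" and st: "0 \<le> s" "0 \<le> t"
begin

text \<open>At time u the error is exp(-\<delta> * (u - S)) * err y. Its part exp(-\<delta> * u) is
  at most exp(-\<eta> * min s t), and exp(\<delta> * S) is absorbed by exp(-2 * \<nu> * S). This
  produces the two weights of the second summability hypothesis, with \<open>err\<close> in place of
  \<Psi>.\<close>

lemma main_term_bound:
  "\<bar>exp (- 2 * \<nu> * S) * (f y (s - S) * f y (t - S)) - (C y)\<^sup>2 * exp (- 2 * \<nu> * S)\<bar>
    \<le> 2 * exp (- \<eta> * min s t) * (C y * err y * exp (- (2 * \<nu> - \<delta>) * S) + (err y)\<^sup>2 * exp (- 2 * (\<nu> - \<delta>) * S))"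
proof -
  let ?q = "exp (- \<eta> * min s t)" and ?e = "exp (\<delta> * S)"
  have q: "0 < ?q" "?q \<le> 1" using eta_pos st by auto
  have b: "\<bar>f y (u - S) - C y\<bar> \<le> ?q * (?e * err y)" if u: "min s t \<le> u" for u
  proof -
    have "\<bar>f y (u - S) - C y\<bar> \<le> exp (- \<delta> * (u - S)) * err y" by (rule err_bound[OF y])
    also have "exp (- \<delta> * (u - S)) = exp (- \<delta> * u) * ?e" by (simp only: exp_add[symmetric], rule arg_cong[where f = exp], simp add: algebra_simps)
    also have "\<dots> * err y \<le> (?q * ?e) * err y"
      using exp_eta_ge(1)[of "min s t" u] st u err_nonneg[OF y] by (intro mult_right_mono) auto
    finally show ?thesis by (simp only: mult.assoc)
  qed
  let ?a = "f y (s - S)" and ?b = "f y (t - S)" and ?w = "?e * err y"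
  have w: "0 \<le> ?w" using err_nonneg[OF y] by simp
  have "\<bar>?a * ?b - (C y)\<^sup>2\<bar> \<le> 2 * ?q * (C y * ?w + ?w\<^sup>2)"
    using st by (intro abs_mult_diff_square_le b C_nonneg[OF y] w q less_imp_le[OF q(1)]) auto
  then have "exp (- 2 * \<nu> * S) * \<bar>?a * ?b - (C y)\<^sup>2\<bar> \<le> exp (- 2 * \<nu> * S) * (2 * ?q * (C y * ?w + ?w\<^sup>2))"
    by (rule mult_left_mono) simp
  also have "\<dots> = 2 * ?q * (C y * err y * (exp (- 2 * \<nu> * S) * ?e) + (err y)\<^sup>2 * (exp (- 2 * \<nu> * S) * (?e * ?e)))"
    by (simp only: power2_eq_square ring_distribs ac_simps)
  also have "exp (- 2 * \<nu> * S) * ?e = exp (- (2 * \<nu> - \<delta>) * S)" by (simp only: exp_add[symmetric], rule arg_cong[where f = exp], simp add: algebra_simps)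
  also have "exp (- 2 * \<nu> * S) * (?e * ?e) = exp (- 2 * (\<nu> - \<delta>) * S)" by (simp only: exp_add[symmetric], rule arg_cong[where f = exp], simp add: algebra_simps)
  finally have "exp (- 2 * \<nu> * S) * \<bar>?a * ?b - (C y)\<^sup>2\<bar>
    \<le> 2 * ?q * (C y * err y * exp (- (2 * \<nu> - \<delta>) * S) + (err y)\<^sup>2 * exp (- 2 * (\<nu> - \<delta>) * S))" .
  moreover have "exp (- 2 * \<nu> * S) * (?a * ?b) - (C y)\<^sup>2 * exp (- 2 * \<nu> * S) = exp (- 2 * \<nu> * S) * (?a * ?b - (C y)\<^sup>2)"
    by (simp only: right_diff_distrib mult.commute[of "(C y)\<^sup>2"])
  ultimately show ?thesis by (simp only: abs_mult abs_exp_cancel)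
qed

text \<open>The exponent \<nu> is split into \<nu> - \<delta> and \<delta>. The first part decays at
  rate \<eta>; in the second, s is replaced by the smaller S, which leaves a weight for the sum over
  generations.\<close>

lemma exp_split: "S \<le> s \<Longrightarrow> exp (- \<nu> * s) \<le> exp (- \<eta> * min s t) * exp (- \<delta> * S)"
proof -
  assume Ss: "S \<le> s"
  have "exp (- \<nu> * s) = exp (- (\<nu> - \<delta>) * s) * exp (- \<delta> * s)" by (simp only: exp_add[symmetric], rule arg_cong[where f = exp], simp add: algebra_simps)
  also have "\<dots> \<le> exp (- \<eta> * min s t) * exp (- \<delta> * S)"
    using exp_eta_ge(2)[of "min s t" s] st Ss delta_pos by (intro mult_mono) auto
  finally show ?thesis .
qed

lemma exp_nu_delta: "exp (- \<delta> * S) * exp (- \<nu> * S) = exp (- (\<nu> + \<delta>) * S)"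
  by (simp only: exp_add[symmetric], rule arg_cong[where f = exp], simp add: algebra_simps)

text \<open>The ancestor has divided by time s, so \<open>exp_split\<close> applies to exp(-\<nu> *
  s). The factor exp(-\<nu> * S) that remains from the descendant completes the weight of the third
  summability hypothesis.\<close>

lemma ancestor_term_bound:
  assumes Ss: "S \<le> s"
  shows "exp (- \<nu> * (s + t)) * (exp (\<nu> * (t - S)) * f y (t - S)) \<le> exp (- \<eta> * min s t) * ((C y + err y) * exp (- (\<nu> + \<delta>) * S))"
proof -
  have "exp (- \<nu> * (s + t)) * exp (\<nu> * (t - S)) = exp (- \<nu> * s) * exp (- \<nu> * S)"
    by (simp only: exp_add[symmetric], rule arg_cong[where f = exp], simp add: algebra_simps)
  then have "exp (- \<nu> * (s + t)) * (exp (\<nu> * (t - S)) * f y (t - S)) = exp (- \<nu> * s) * (exp (- \<nu> * S) * f y (t - S))"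
    by (simp only: mult.assoc[symmetric])
  also have "\<dots> \<le> (exp (- \<eta> * min s t) * exp (- \<delta> * S)) * (exp (- \<nu> * S) * (C y + err y))"
  proof (intro mult_mono exp_split Ss)
    \<comment> \<open>Before time S there is no growth; \<open>f0_le\<close> covers the times from S
      on.\<close>
    show "f y (t - S) \<le> C y + err y"
      using f0_le[OF y, of "t - S"] f0_neg[OF y, of "t - S"] C_nonneg[OF y] err_nonneg[OF y] by (cases "t < S") auto
  qed (use f0_nonneg[OF y] in auto)
  also have "\<dots> = exp (- \<eta> * min s t) * ((C y + err y) * (exp (- \<delta> * S) * exp (- \<nu> * S)))" by (simp only: ac_simps)
  finally show ?thesis by (simp only: exp_nu_delta)
qed

lemma diagonal_term_bound:
  assumes Ss: "S \<le> s" "S \<le> t"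
  shows "exp (- \<nu> * (s + t)) \<le> exp (- \<eta> * min s t) * exp (- (\<nu> + \<delta>) * S)"
proof -
  have "exp (- \<nu> * (s + t)) = exp (- \<nu> * s) * exp (- \<nu> * t)" by (simp only: exp_add[symmetric], rule arg_cong[where f = exp], simp add: algebra_simps)
  also have "\<dots> \<le> (exp (- \<eta> * min s t) * exp (- \<delta> * S)) * exp (- \<nu> * S)"
    using Ss nu_pos by (intro mult_mono exp_split) auto
  also have "\<dots> = exp (- \<eta> * min s t) * exp (- (\<nu> + \<delta>) * S)" by (simp only: mult.assoc exp_nu_delta)
  finally show ?thesis .
qed

end

text \<open>The bound holds for u > t as well, where f vanishes, because \<open>err_bound\<close> is
  valid at negative times.\<close>

lemma mean_term_bound:
  assumes y: "y \<in> space E"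
  shows "\<bar>exp (- \<nu> * t) * (exp (\<nu> * (t - u)) * f y (t - u)) - exp (- \<nu> * u) * C y\<bar> \<le> exp (- \<delta> * t) * (exp (- (\<nu> - \<delta>) * u) * err y)"
proof -
  have "exp (- \<nu> * t) * exp (\<nu> * (t - u)) = exp (- \<nu> * u)"
    by (simp only: exp_add[symmetric], rule arg_cong[where f = exp], simp add: algebra_simps)
  then have "exp (- \<nu> * t) * (exp (\<nu> * (t - u)) * f y (t - u)) = exp (- \<nu> * u) * f y (t - u)"
    by (simp only: mult.assoc[symmetric])
  then have "\<bar>exp (- \<nu> * t) * (exp (\<nu> * (t - u)) * f y (t - u)) - exp (- \<nu> * u) * C y\<bar> = exp (- \<nu> * u) * \<bar>f y (t - u) - C y\<bar>"
    by (simp only: right_diff_distrib[symmetric] abs_mult abs_exp_cancel)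
  also have "\<dots> \<le> exp (- \<nu> * u) * (exp (- \<delta> * (t - u)) * err y)" by (intro mult_left_mono err_bound[OF y]) simp
  also have "\<dots> = exp (- \<delta> * t) * (exp (- (\<nu> - \<delta>) * u) * err y)"
  proof -
    have "exp (- \<nu> * u) * exp (- \<delta> * (t - u)) = exp (- \<delta> * t) * exp (- (\<nu> - \<delta>) * u)"
      by (simp only: exp_add[symmetric], rule arg_cong[where f = exp], simp add: algebra_simps)
    then show ?thesis by (simp only: mult.assoc[symmetric])
  qed
  finally show ?thesis .
qed

section \<open>Integrated bounds for the first two moments\<close>

definition main_integral :: "nat \<Rightarrow> ennreal" where
  "main_integral k = (\<integral>\<^sup>+\<omega>. ennreal ((C (X \<omega> k))\<^sup>2 * exp (- 2 * \<nu> * S \<omega> k)) \<partial>M)"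

definition error_integral :: "nat \<Rightarrow> ennreal" where
  "error_integral k = (\<integral>\<^sup>+\<omega>. ennreal (C (X \<omega> k) * err (X \<omega> k) * exp (- (2 * \<nu> - \<delta>) * S \<omega> k)
     + (err (X \<omega> k))\<^sup>2 * exp (- 2 * (\<nu> - \<delta>) * S \<omega> k)) \<partial>M)"

definition ancestor_integral :: "nat \<Rightarrow> ennreal" where
  "ancestor_integral k = (\<integral>\<^sup>+\<omega>. ennreal ((C (X \<omega> k) + err (X \<omega> k)) * exp (- (\<nu> + \<delta>) * S \<omega> k)) \<partial>M)"

definition diagonal_integral :: "nat \<Rightarrow> ennreal" where
  "diagonal_integral k = (\<integral>\<^sup>+\<omega>. ennreal (exp (- (\<nu> + \<delta>) * S \<omega> k)) \<partial>M)"

lemma measurable_S[measurable]: "(\<lambda>\<omega>. S \<omega> k) \<in> borel_measurable M"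
  using X_measurable by (rule measurable_lifetime_sum)

lemma measurable_C_X[measurable]: "(\<lambda>\<omega>. C (X \<omega> k)) \<in> borel_measurable M"
  by (rule measurable_compose[OF measurable_X measurable_C])

lemma measurable_err_X[measurable]: "(\<lambda>\<omega>. err (X \<omega> k)) \<in> borel_measurable M"
  by (rule measurable_compose[OF measurable_X measurable_err])

lemma scaled_growth_product:
  assumes "\<omega> \<in> space M"
  shows "ennreal (exp (- \<nu> * (s + t))) * (growth (X \<omega> k) (s - S \<omega> k) * growth (X \<omega> k) (t - S \<omega> k))
    = ennreal (exp (- 2 * \<nu> * S \<omega> k) * (f (X \<omega> k) (s - S \<omega> k) * f (X \<omega> k) (t - S \<omega> k)))"
proof -
  let ?y = "X \<omega> k" and ?S = "S \<omega> k"
  have e: "exp (- \<nu> * (s + t)) * (exp (\<nu> * (s - ?S)) * exp (\<nu> * (t - ?S))) = exp (- 2 * \<nu> * ?S)"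
    by (simp only: exp_add[symmetric], rule arg_cong[where f = exp], simp add: algebra_simps)
  have n: "0 \<le> f ?y u" for u by (rule f0_nonneg[OF X_space[OF assms]])
  have "ennreal (exp (- \<nu> * (s + t))) * (growth ?y (s - ?S) * growth ?y (t - ?S))
      = ennreal (exp (- \<nu> * (s + t)) * ((exp (\<nu> * (s - ?S)) * f ?y (s - ?S)) * (exp (\<nu> * (t - ?S)) * f ?y (t - ?S))))"
    unfolding growth_eq[OF X_space[OF assms]] using n by (simp only: ennreal_mult mult_nonneg_nonneg exp_ge_zero)
  also have "exp (- \<nu> * (s + t)) * ((exp (\<nu> * (s - ?S)) * f ?y (s - ?S)) * (exp (\<nu> * (t - ?S)) * f ?y (t - ?S)))
      = (exp (- \<nu> * (s + t)) * (exp (\<nu> * (s - ?S)) * exp (\<nu> * (t - ?S)))) * (f ?y (s - ?S) * f ?y (t - ?S))"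
    by (simp only: ac_simps)
  finally show ?thesis by (simp only: e)
qed

text \<open>Finiteness of these integrals is not known here, so the difference is controlled by two
  inequalities with an added error; they become an absolute value once everything is finite.\<close>

lemma main_integral_bounds:
  assumes st: "0 \<le> s" "0 \<le> t"
  shows "ennreal (exp (- \<nu> * (s + t))) * (\<integral>\<^sup>+\<omega>. growth (X \<omega> k) (s - S \<omega> k) * growth (X \<omega> k) (t - S \<omega> k) \<partial>M)
      \<le> main_integral k + ennreal (exp (- \<eta> * min s t)) * (2 * error_integral k)" (is "?N * ?I \<le> _ + ?q * _")
    and "main_integral k
      \<le> ennreal (exp (- \<nu> * (s + t))) * (\<integral>\<^sup>+\<omega>. growth (X \<omega> k) (s - S \<omega> k) * growth (X \<omega> k) (t - S \<omega> k) \<partial>M)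
        + ennreal (exp (- \<eta> * min s t)) * (2 * error_integral k)"
proof -
  let ?u = "\<lambda>\<omega>. ennreal (exp (- \<nu> * (s + t))) * (growth (X \<omega> k) (s - S \<omega> k) * growth (X \<omega> k) (t - S \<omega> k))"
  let ?v = "\<lambda>\<omega>. ennreal ((C (X \<omega> k))\<^sup>2 * exp (- 2 * \<nu> * S \<omega> k))"
  let ?w = "\<lambda>\<omega>. ennreal (C (X \<omega> k) * err (X \<omega> k) * exp (- (2 * \<nu> - \<delta>) * S \<omega> k)
     + (err (X \<omega> k))\<^sup>2 * exp (- 2 * (\<nu> - \<delta>) * S \<omega> k))"
  have meas: "(\<lambda>\<omega>. growth (X \<omega> k) (s - S \<omega> k) * growth (X \<omega> k) (t - S \<omega> k)) \<in> borel_measurable M"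
    by (intro borel_measurable_times_ennreal measurable_growth_shifted)
  have I: "?N * ?I = (\<integral>\<^sup>+\<omega>. ?u \<omega> \<partial>M)" by (rule nn_integral_cmult[symmetric, OF meas])
  have mu: "?u \<in> borel_measurable M" by (intro borel_measurable_times_ennreal meas borel_measurable_const)
  have mw: "?w \<in> borel_measurable M" by measurable
  have mw2: "(\<lambda>\<omega>. ?q * (2 * ?w \<omega>)) \<in> borel_measurable M" by (intro borel_measurable_times_ennreal mw borel_measurable_const)
  have W: "?q * (2 * error_integral k) = (\<integral>\<^sup>+\<omega>. ?q * (2 * ?w \<omega>) \<partial>M)"
    unfolding error_integral_def by (subst nn_integral_cmult, intro borel_measurable_times_ennreal mw borel_measurable_const, subst nn_integral_cmult[OF mw], rule refl)
  have b: "?u \<omega> \<le> ?v \<omega> + ?q * (2 * ?w \<omega>)" "?v \<omega> \<le> ?u \<omega> + ?q * (2 * ?w \<omega>)" if \<omega>: "\<omega> \<in> space M" for \<omega>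
  proof -
    note n = C_nonneg[OF X_space[OF \<omega>]] err_nonneg[OF X_space[OF \<omega>]]
    have "?q * (2 * ?w \<omega>) = ennreal (2 * exp (- \<eta> * min s t) * (C (X \<omega> k) * err (X \<omega> k) * exp (- (2 * \<nu> - \<delta>) * S \<omega> k)
     + (err (X \<omega> k))\<^sup>2 * exp (- 2 * (\<nu> - \<delta>) * S \<omega> k)))"
      using n by (simp add: ennreal_mult ac_simps del: ennreal_plus)
    with ennreal_le_add_of_abs_diff_le[OF main_term_bound[OF X_space[OF \<omega>, of k] lifetime_sum_nonneg[OF \<omega>, of k] st]]
    show "?u \<omega> \<le> ?v \<omega> + ?q * (2 * ?w \<omega>)" "?v \<omega> \<le> ?u \<omega> + ?q * (2 * ?w \<omega>)"
      unfolding scaled_growth_product[OF \<omega>] by simp_all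
  qed
  have "(\<integral>\<^sup>+\<omega>. ?u \<omega> \<partial>M) \<le> (\<integral>\<^sup>+\<omega>. ?v \<omega> + ?q * (2 * ?w \<omega>) \<partial>M)" by (intro nn_integral_mono b)
  also have "\<dots> = (\<integral>\<^sup>+\<omega>. ?v \<omega> \<partial>M) + (\<integral>\<^sup>+\<omega>. ?q * (2 * ?w \<omega>) \<partial>M)" by (intro nn_integral_add mw2) measurable
  finally show "?N * ?I \<le> main_integral k + ?q * (2 * error_integral k)" by (simp only: I W main_integral_def)
  have "(\<integral>\<^sup>+\<omega>. ?v \<omega> \<partial>M) \<le> (\<integral>\<^sup>+\<omega>. ?u \<omega> + ?q * (2 * ?w \<omega>) \<partial>M)" by (intro nn_integral_mono b)
  also have "\<dots> = (\<integral>\<^sup>+\<omega>. ?u \<omega> \<partial>M) + (\<integral>\<^sup>+\<omega>. ?q * (2 * ?w \<omega>) \<partial>M)" by (intro nn_integral_add mw2 mu)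
  finally show "main_integral k \<le> ?N * ?I + ?q * (2 * error_integral k)" by (simp only: I W main_integral_def)
qed

lemma ancestor_integral_bound:
  assumes st: "0 \<le> s" "0 \<le> t"
  shows "ennreal (exp (- \<nu> * (s + t))) * (\<integral>\<^sup>+\<omega>. indicator {..s} (S \<omega> k) * growth (X \<omega> k) (t - S \<omega> k) \<partial>M)
    \<le> ennreal (exp (- \<eta> * min s t)) * ancestor_integral k"
proof -
  have meas: "(\<lambda>\<omega>. indicator {..s} (S \<omega> k) * growth (X \<omega> k) (t - S \<omega> k)) \<in> borel_measurable M"
    by (intro borel_measurable_times_ennreal measurable_growth_shifted) measurable
  have "(\<integral>\<^sup>+\<omega>. ennreal (exp (- \<nu> * (s + t))) * (indicator {..s} (S \<omega> k) * growth (X \<omega> k) (t - S \<omega> k)) \<partial>M)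
      \<le> (\<integral>\<^sup>+\<omega>. ennreal (exp (- \<eta> * min s t)) * ennreal ((C (X \<omega> k) + err (X \<omega> k)) * exp (- (\<nu> + \<delta>) * S \<omega> k)) \<partial>M)"
  proof (rule nn_integral_mono)
    fix \<omega> assume \<omega>: "\<omega> \<in> space M"
    note y = X_space[OF \<omega>, of k]
    show "ennreal (exp (- \<nu> * (s + t))) * (indicator {..s} (S \<omega> k) * growth (X \<omega> k) (t - S \<omega> k))
      \<le> ennreal (exp (- \<eta> * min s t)) * ennreal ((C (X \<omega> k) + err (X \<omega> k)) * exp (- (\<nu> + \<delta>) * S \<omega> k))"
    proof (cases "S \<omega> k \<le> s")
      case True
      from ennreal_leI[OF ancestor_term_bound[OF y lifetime_sum_nonneg[OF \<omega>, of k] st True]]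
      show ?thesis using True f0_nonneg[OF y] C_nonneg[OF y] err_nonneg[OF y]
        by (simp add: growth_eq[OF y] ennreal_mult)
    qed simp
  qed
  also have "\<dots> = ennreal (exp (- \<eta> * min s t)) * ancestor_integral k"
    unfolding ancestor_integral_def by (rule nn_integral_cmult) measurable
  finally show ?thesis by (simp only: nn_integral_cmult[OF meas])
qed

lemma diagonal_integral_bound:
  assumes st: "0 \<le> s" "0 \<le> t"
  shows "ennreal (exp (- \<nu> * (s + t))) * line_prob k s k t \<le> ennreal (exp (- \<eta> * min s t)) * diagonal_integral k"
proof -
  have "(\<integral>\<^sup>+\<omega>. ennreal (exp (- \<nu> * (s + t))) * (indicator {..s} (S \<omega> k) * indicator {..t} (S \<omega> k)) \<partial>M)
      \<le> (\<integral>\<^sup>+\<omega>. ennreal (exp (- \<eta> * min s t)) * ennreal (exp (- (\<nu> + \<delta>) * S \<omega> k)) \<partial>M)"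
  proof (rule nn_integral_mono)
    fix \<omega> assume \<omega>: "\<omega> \<in> space M"
    show "ennreal (exp (- \<nu> * (s + t))) * (indicator {..s} (S \<omega> k) * indicator {..t} (S \<omega> k))
      \<le> ennreal (exp (- \<eta> * min s t)) * ennreal (exp (- (\<nu> + \<delta>) * S \<omega> k))"
    proof (cases "S \<omega> k \<le> s \<and> S \<omega> k \<le> t")
      case True
      from ennreal_leI[OF diagonal_term_bound[OF X_space[OF \<omega>, of k] lifetime_sum_nonneg[OF \<omega>, of k] st True[THEN conjunct1] True[THEN conjunct2]]]
      show ?thesis using True by (simp add: ennreal_mult)
    qed auto
  qed
  also have "\<dots> = ennreal (exp (- \<eta> * min s t)) * diagonal_integral k"
    unfolding diagonal_integral_def by (rule nn_integral_cmult) measurable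
  also have "(\<integral>\<^sup>+\<omega>. ennreal (exp (- \<nu> * (s + t))) * (indicator {..s} (S \<omega> k) * indicator {..t} (S \<omega> k)) \<partial>M)
      = ennreal (exp (- \<nu> * (s + t))) * line_prob k s k t"
    unfolding line_prob_def by (rule nn_integral_cmult) measurable
  finally show ?thesis .
qed

definition main_sum :: ennreal where
  "main_sum = (\<Sum>k. offspring_mean ^ k * main_integral k)"

text \<open>The 2 before \<open>ancestor_integral\<close> accounts for either label being the
  ancestor, the 2 before \<open>error_integral\<close> comes from
  \<open>main_term_bound\<close>.\<close>

definition remainder_sum :: ennreal where
  "remainder_sum = (\<Sum>k. offspring_mean ^ k * (diagonal_integral k + 2 * ancestor_integral k + 2 * error_integral k))"

text \<open>The constants of all pair types are at most \<kappa>2 and every error carries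
  exp(-\<eta> * min s t), so the contributions of each generation combine into one remainder that
  does not depend on s and t.\<close>

lemma second_moment_bounds:
  assumes st: "0 \<le> s" "0 \<le> t"
  shows "ennreal (exp (- \<nu> * (s + t))) * (\<integral>\<^sup>+\<omega>. total_gain s \<omega> * total_gain t \<omega> \<partial>M)
      \<le> offspring_fact2 * main_sum + offspring_fact2 * (ennreal (exp (- \<eta> * min s t)) * remainder_sum)" (is "?N * ?M \<le> _ + _ * (?q * _)")
    and "offspring_fact2 * main_sum
      \<le> ennreal (exp (- \<nu> * (s + t))) * (\<integral>\<^sup>+\<omega>. total_gain s \<omega> * total_gain t \<omega> \<partial>M)
        + offspring_fact2 * (ennreal (exp (- \<eta> * min s t)) * remainder_sum)"
proof -
  let ?c = "\<integral>\<^sup>+\<omega>. of_nat (\<kappa> (X \<omega> 0) - 1) * of_nat (\<kappa> (X \<omega> 0) - 1) \<partial>M"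
  let ?a = "\<lambda>k. \<integral>\<^sup>+\<omega>. indicator {..t} (S \<omega> k) * growth (X \<omega> k) (s - S \<omega> k) \<partial>M"
  let ?b = "\<lambda>k. \<integral>\<^sup>+\<omega>. indicator {..s} (S \<omega> k) * growth (X \<omega> k) (t - S \<omega> k) \<partial>M"
  let ?g = "\<lambda>k. \<integral>\<^sup>+\<omega>. growth (X \<omega> k) (s - S \<omega> k) * growth (X \<omega> k) (t - S \<omega> k) \<partial>M"
  let ?r = "\<lambda>k. diagonal_integral k + 2 * ancestor_integral k + 2 * error_integral k"
  have NM: "?N * ?M = (\<Sum>k. offspring_mean ^ k * (?N * (?c * line_prob k s k t + offspring_fact2 * ?a k + offspring_fact2 * ?b k + offspring_fact2 * ?g k)))"
    unfolding second_moment ennreal_suminf_cmult[symmetric] by (simp only: ac_simps)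
  have p: "offspring_fact2 * main_sum + offspring_fact2 * (?q * remainder_sum)
      = (\<Sum>k. offspring_mean ^ k * (offspring_fact2 * (main_integral k + ?q * ?r k)))"
    unfolding main_sum_def remainder_sum_def ennreal_suminf_cmult[symmetric]
    by (subst suminf_add[OF summableI summableI]) (simp only: distrib_left ac_simps)
  note e1 = diagonal_integral_bound[OF st] ancestor_integral_bound[OF st] main_integral_bounds[OF st]
  \<comment> \<open>The ancestor bound with s and t exchanged; their sum and minimum are
    symmetric.\<close>
  have e2: "?N * ?a k \<le> ?q * ancestor_integral k" for k
    using ancestor_integral_bound[OF st(2,1), of k] by (simp only: add.commute min.commute)
  have up: "?N * (?c * line_prob k s k t + offspring_fact2 * ?a k + offspring_fact2 * ?b k + offspring_fact2 * ?g k)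
      \<le> offspring_fact2 * (main_integral k + ?q * ?r k)" for k
  proof -
    have "?N * (?c * line_prob k s k t + offspring_fact2 * ?a k + offspring_fact2 * ?b k + offspring_fact2 * ?g k)
       = ?c * (?N * line_prob k s k t) + offspring_fact2 * (?N * ?a k) + offspring_fact2 * (?N * ?b k) + offspring_fact2 * (?N * ?g k)"
      by (simp only: distrib_left ac_simps)
    also have "\<dots> \<le> offspring_fact2 * (?q * diagonal_integral k) + offspring_fact2 * (?q * ancestor_integral k)
        + offspring_fact2 * (?q * ancestor_integral k) + offspring_fact2 * (main_integral k + ?q * (2 * error_integral k))"
      by (intro add_mono mult_mono squared_gain_le e1 e2 order_refl zero_le)
    also have "\<dots> = offspring_fact2 * (main_integral k + ?q * ?r k)"
      by (simp only: distrib_left ac_simps mult_2)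
    finally show ?thesis .
  qed
  show "?N * ?M \<le> offspring_fact2 * main_sum + offspring_fact2 * (?q * remainder_sum)"
    unfolding NM p by (intro suminf_le summableI mult_left_mono up zero_le)
  have "offspring_fact2 * main_sum = (\<Sum>k. offspring_mean ^ k * (offspring_fact2 * main_integral k))"
    unfolding main_sum_def ennreal_suminf_cmult[symmetric] by (simp only: ac_simps)
  also have "\<dots> \<le> (\<Sum>k. offspring_mean ^ k * (?N * (?c * line_prob k s k t + offspring_fact2 * ?a k + offspring_fact2 * ?b k + offspring_fact2 * ?g k))
       + offspring_mean ^ k * (offspring_fact2 * (?q * ?r k)))"
  proof (intro suminf_le summableI)
    fix k
    \<comment> \<open>For the lower bound only the growth product is compared with the main term;
      the other three terms are nonnegative and may be added afterwards.\<close>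
    have "offspring_fact2 * main_integral k \<le> offspring_fact2 * (?N * ?g k + ?q * (2 * error_integral k))"
      by (intro mult_left_mono e1 zero_le)
    also have "\<dots> = ?N * (offspring_fact2 * ?g k) + offspring_fact2 * (?q * (2 * error_integral k))"
      by (simp only: distrib_left ac_simps)
    also have "\<dots> \<le> ?N * (?c * line_prob k s k t + offspring_fact2 * ?a k + offspring_fact2 * ?b k + offspring_fact2 * ?g k)
       + offspring_fact2 * (?q * ?r k)"
      by (intro add_mono mult_left_mono) auto
    finally show "offspring_mean ^ k * (offspring_fact2 * main_integral k) \<le> offspring_mean ^ k * (?N * (?c * line_prob k s k t + offspring_fact2 * ?a k + offspring_fact2 * ?b k + offspring_fact2 * ?g k))
       + offspring_mean ^ k * (offspring_fact2 * (?q * ?r k))"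
      unfolding distrib_left[symmetric] by (rule mult_left_mono) simp
  qed
  also have "\<dots> = ?N * ?M + (\<Sum>k. offspring_mean ^ k * (offspring_fact2 * (?q * ?r k)))"
    unfolding NM by (rule suminf_add[symmetric, OF summableI summableI])
  also have "(\<Sum>k. offspring_mean ^ k * (offspring_fact2 * (?q * ?r k))) = offspring_fact2 * (?q * remainder_sum)"
    unfolding remainder_sum_def ennreal_suminf_cmult[symmetric] by (simp only: ac_simps)
  finally show "offspring_fact2 * main_sum \<le> ?N * ?M + offspring_fact2 * (?q * remainder_sum)" .
qed

text \<open>The division of the initial cell contributes at most \<open>mean_gain\<close>, which
  exp(-\<nu> * t) makes negligible. All other gains come from the progeny of its children, hence the
  factor \<open>offspring_mean\<close> and a growth that starts at time \<xi> (X \<omega>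
  0).\<close>

lemma first_moment_bounds:
  assumes t: "0 \<le> t"
  defines "I \<equiv> (\<integral>\<^sup>+\<omega>. ennreal (exp (- \<nu> * \<xi> (X \<omega> 0)) * C (X \<omega> 0)) \<partial>M)"
    and "J \<equiv> (\<integral>\<^sup>+\<omega>. ennreal (exp (- (\<nu> - \<delta>) * \<xi> (X \<omega> 0)) * err (X \<omega> 0)) \<partial>M)"
  shows "ennreal (exp (- \<nu> * t)) * (\<integral>\<^sup>+\<omega>. total_gain t \<omega> \<partial>M)
      \<le> offspring_mean * I + (ennreal (exp (- \<nu> * t)) * mean_gain + ennreal (exp (- \<delta> * t)) * (offspring_mean * J))" (is ?A)
    and "offspring_mean * I \<le> ennreal (exp (- \<nu> * t)) * (\<integral>\<^sup>+\<omega>. total_gain t \<omega> \<partial>M)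
        + (ennreal (exp (- \<nu> * t)) * mean_gain + ennreal (exp (- \<delta> * t)) * (offspring_mean * J))" (is ?B)
proof -
  let ?N = "ennreal (exp (- \<nu> * t))" and ?d = "ennreal (exp (- \<delta> * t))"
  have m\<xi>[measurable]: "(\<lambda>\<omega>. \<xi> (X \<omega> 0)) \<in> borel_measurable M" by (rule measurable_compose[OF measurable_X xi_measurable])
  let ?u = "\<lambda>\<omega>. ?N * (indicator {..t} (\<xi> (X \<omega> 0)) * growth (X \<omega> 0) (t - \<xi> (X \<omega> 0)))"
  let ?v = "\<lambda>\<omega>. ennreal (exp (- \<nu> * \<xi> (X \<omega> 0)) * C (X \<omega> 0))"
  let ?w = "\<lambda>\<omega>. ?d * ennreal (exp (- (\<nu> - \<delta>) * \<xi> (X \<omega> 0)) * err (X \<omega> 0))"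
  let ?g = "\<integral>\<^sup>+\<omega>. indicator {..t} (\<xi> (X \<omega> 0)) * growth (X \<omega> 0) (t - \<xi> (X \<omega> 0)) \<partial>M"
  have gm: "(\<lambda>\<omega>. growth (X \<omega> 0) (t - \<xi> (X \<omega> 0))) \<in> borel_measurable M"
    using measurable_growth_shifted[of 0 t] by (simp add: lifetime_sum_def)
  have meas: "(\<lambda>\<omega>. indicator {..t} (\<xi> (X \<omega> 0)) * growth (X \<omega> 0) (t - \<xi> (X \<omega> 0))) \<in> borel_measurable M"
    by (intro borel_measurable_times_ennreal gm) measurable
  have mu: "?u \<in> borel_measurable M" by (intro borel_measurable_times_ennreal meas borel_measurable_const)
  have mv: "?v \<in> borel_measurable M" by measurable
  have mw: "?w \<in> borel_measurable M" by measurable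
  have b: "?u \<omega> \<le> ?v \<omega> + ?w \<omega>" "?v \<omega> \<le> ?u \<omega> + ?w \<omega>" if \<omega>: "\<omega> \<in> space M" for \<omega>
  proof -
    note y = X_space[OF \<omega>, of 0]
    \<comment> \<open>The indicator is redundant since growth vanishes at negative times.\<close>
    have "indicator {..t} (\<xi> (X \<omega> 0)) * growth (X \<omega> 0) (t - \<xi> (X \<omega> 0)) = growth (X \<omega> 0) (t - \<xi> (X \<omega> 0))"
      using f0_neg[OF y, of "t - \<xi> (X \<omega> 0)"] by (auto simp: growth_eq[OF y] split: split_indicator)
    then have "?u \<omega> = ennreal (exp (- \<nu> * t) * (exp (\<nu> * (t - \<xi> (X \<omega> 0))) * f (X \<omega> 0) (t - \<xi> (X \<omega> 0))))"
      using f0_nonneg[OF y] by (simp add: growth_eq[OF y] ennreal_mult)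
    moreover have "?w \<omega> = ennreal (exp (- \<delta> * t) * (exp (- (\<nu> - \<delta>) * \<xi> (X \<omega> 0)) * err (X \<omega> 0)))"
      using err_nonneg[OF y] by (simp add: ennreal_mult)
    ultimately show "?u \<omega> \<le> ?v \<omega> + ?w \<omega>" "?v \<omega> \<le> ?u \<omega> + ?w \<omega>"
      using ennreal_le_add_of_abs_diff_le[OF mean_term_bound[OF y, of t "\<xi> (X \<omega> 0)"]] by (simp_all only:)
  qed
  have u: "(\<integral>\<^sup>+\<omega>. ?u \<omega> \<partial>M) = ?N * ?g" by (rule nn_integral_cmult[OF meas])
  have w: "(\<integral>\<^sup>+\<omega>. ?w \<omega> \<partial>M) = ?d * J" unfolding J_def by (rule nn_integral_cmult) measurable
  have "?N * ?g \<le> (\<integral>\<^sup>+\<omega>. ?v \<omega> + ?w \<omega> \<partial>M)" unfolding u[symmetric] by (intro nn_integral_mono b)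
  also have "\<dots> = I + ?d * J" unfolding w[symmetric] I_def by (rule nn_integral_add[OF mv mw])
  finally have up: "?N * ?g \<le> I + ?d * J" .
  have "I \<le> (\<integral>\<^sup>+\<omega>. ?u \<omega> + ?w \<omega> \<partial>M)" unfolding I_def by (intro nn_integral_mono b)
  also have "\<dots> = ?N * ?g + ?d * J" unfolding w[symmetric] u[symmetric] by (rule nn_integral_add[OF mu mw])
  finally have lo: "I \<le> ?N * ?g + ?d * J" .
  have "line_prob 0 t 0 t \<le> (\<integral>\<^sup>+\<omega>. 1 \<partial>M)"
    unfolding line_prob_def by (intro nn_integral_mono) (auto split: split_indicator)
  then have l: "line_prob 0 t 0 t \<le> 1" by (simp add: emeasure_space_1)
  have FM: "?N * (\<integral>\<^sup>+\<omega>. total_gain t \<omega> \<partial>M) = ?N * (mean_gain * line_prob 0 t 0 t) + offspring_mean * (?N * ?g)"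
    unfolding first_moment by (simp only: distrib_left ac_simps)
  have "\<dots> \<le> ?N * (mean_gain * 1) + offspring_mean * (I + ?d * J)"
    by (intro add_mono mult_left_mono l up zero_le)
  also have "\<dots> = offspring_mean * I + (?N * mean_gain + ?d * (offspring_mean * J))"
    by (simp only: distrib_left ac_simps mult_1_right mult_1)
  finally show ?A unfolding FM .
  have "offspring_mean * I \<le> offspring_mean * (?N * ?g + ?d * J)" by (intro mult_left_mono lo zero_le)
  also have "\<dots> = offspring_mean * (?N * ?g) + ?d * (offspring_mean * J)" by (simp only: distrib_left ac_simps)
  also have "\<dots> \<le> (?N * (mean_gain * line_prob 0 t 0 t) + offspring_mean * (?N * ?g)) + (?N * mean_gain + ?d * (offspring_mean * J))"
    by (intro add_mono add_increasing zero_le order_refl)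
  finally show ?B unfolding FM .
qed

lemma measurable_num_alive: "(\<lambda>\<omega>. num_alive \<xi> \<kappa> (T \<omega>) t) \<in> borel_measurable M"
proof -
  have [measurable]: "(\<lambda>\<omega>. \<xi> (T \<omega> v)) \<in> borel_measurable M" for v
    by (rule measurable_compose[OF _ xi_measurable]) measurable
  have [measurable]: "(\<lambda>\<omega>. \<kappa> (T \<omega> v)) \<in> measurable M (count_space UNIV)" for v
    by (rule measurable_compose[OF _ kappa_measurable]) measurable
  let ?A = "\<lambda>\<omega>. {v. cell_exists \<kappa> (T \<omega>) v \<and> birth_time \<xi> (T \<omega>) v \<le> t \<and> t < birth_time \<xi> (T \<omega>) v + \<xi> (T \<omega> v)}"
  have "(\<lambda>\<omega>. nsum (\<lambda>v. indicator (?A \<omega>) v)) \<in> borel_measurable M"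
  proof (rule measurable_nsum)
    fix v
    have "Measurable.pred M (\<lambda>\<omega>. v \<in> ?A \<omega>)"
      unfolding cell_exists_def birth_time_def mem_Collect_eq by measurable
    then have "(\<lambda>\<omega>. if v \<in> ?A \<omega> then 1 else 0 :: ennreal) \<in> borel_measurable M" by measurable
    then show "(\<lambda>\<omega>. indicator (?A \<omega>) v :: ennreal) \<in> borel_measurable M"
      by (simp only: indicator_def of_bool_def)
  qed
  then show ?thesis unfolding num_alive_def by simp
qed

text \<open>A finite second moment makes the gain finite almost surely at each integer time;
  monotonicity in time then gives a single null set for all t.\<close>

lemma AE_total_gain_finite:
  assumes "offspring_fact2 * main_sum < \<infinity>" "offspring_fact2 * remainder_sum < \<infinity>"
  shows "AE \<omega> in M. \<forall>t. total_gain t \<omega> < \<infinity>"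
proof -
  have "AE \<omega> in M. total_gain (real n) \<omega> \<noteq> \<infinity>" for n
  proof -
    have "ennreal (exp (- \<nu> * (real n + real n))) * (\<integral>\<^sup>+\<omega>. total_gain (real n) \<omega> * total_gain (real n) \<omega> \<partial>M)
        \<le> offspring_fact2 * main_sum + offspring_fact2 * (ennreal (exp (- \<eta> * min (real n) (real n))) * remainder_sum)"
      by (rule second_moment_bounds) auto
    also have "\<dots> = offspring_fact2 * main_sum + ennreal (exp (- \<eta> * min (real n) (real n))) * (offspring_fact2 * remainder_sum)"
      by (simp only: ac_simps)
    also have "\<dots> < \<infinity>" using assms by (simp add: ennreal_mult_less_top)
    finally have "(\<integral>\<^sup>+\<omega>. total_gain (real n) \<omega> * total_gain (real n) \<omega> \<partial>M) \<noteq> \<infinity>"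
      by (auto simp: ennreal_mult_less_top)
    then have "AE \<omega> in M. total_gain (real n) \<omega> * total_gain (real n) \<omega> \<noteq> \<infinity>"
      by (intro nn_integral_PInf_AE borel_measurable_times_ennreal measurable_total_gain)
    then show ?thesis by (rule AE_mp) (auto simp: ennreal_mult_eq_top_iff)
  qed
  then have "AE \<omega> in M. \<forall>n. total_gain (real n) \<omega> \<noteq> \<infinity>" by (simp add: AE_all_countable)
  then show ?thesis
  proof (rule AE_mp, intro AE_I2 impI allI)
    fix \<omega> t assume fin: "\<forall>n. total_gain (real n) \<omega> \<noteq> \<infinity>"
    obtain n where "t \<le> real n" using real_arch_simple by blast
    then have "total_gain t \<omega> \<le> total_gain (real n) \<omega>" by (intro nn_integral_mono cell_gain_mono)
    also have "\<dots> < \<infinity>" using fin by (simp add: less_top)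
    finally show "total_gain t \<omega> < \<infinity>" .
  qed
qed

lemma num_alive_total_gain:
  assumes \<omega>: "\<omega> \<in> space M" and "0 \<le> t" "total_gain t \<omega> < \<infinity>"
  shows "num_alive \<xi> \<kappa> (T \<omega>) t = 1 + total_gain t \<omega>"
proof (rule num_alive_eq)
  have "T \<omega> v \<in> space E" for v
    using measurable_space[OF T_measurable \<omega>] by (auto simp: space_PiM)
  then show "0 \<le> \<xi> (T \<omega> v)" "2 \<le> \<kappa> (T \<omega> v)" for v
    using xi_nonneg kappa_ge_2 by auto
qed (use assms in auto)

text \<open>Positive weights and a finite total force each integral to be finite, so it can be read
  as a Bochner integral and the series as a real one.\<close>

lemma suminf_weighted_integral:
  assumes g: "\<And>k. g k \<in> borel_measurable M" and nn: "\<And>k \<omega>. \<omega> \<in> space M \<Longrightarrow> 0 \<le> g k \<omega>"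
    and fin: "(\<Sum>k. ennreal (\<kappa>1 ^ k) * (\<integral>\<^sup>+\<omega>. ennreal (g k \<omega>) \<partial>M)) < \<infinity>"
  shows "enn2real (\<Sum>k. ennreal (\<kappa>1 ^ k) * (\<integral>\<^sup>+\<omega>. ennreal (g k \<omega>) \<partial>M)) = (\<Sum>k. \<kappa>1 ^ k * (\<integral>\<omega>. g k \<omega> \<partial>M))"
proof -
  have \<kappa>1: "0 < \<kappa>1 ^ k" for k using kappa_mean_ge_2 by simp
  have k: "(\<integral>\<^sup>+\<omega>. ennreal (g k \<omega>) \<partial>M) = ennreal (\<integral>\<omega>. g k \<omega> \<partial>M)" for k
  proof (rule nn_integral_eq_integral)
    have n0: "ennreal (\<kappa>1 ^ k) \<noteq> 0" using \<kappa>1[of k] by (simp only: ennreal_eq_0_iff not_le)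
    have "ennreal (\<kappa>1 ^ k) * (\<integral>\<^sup>+\<omega>. ennreal (g k \<omega>) \<partial>M) \<noteq> \<infinity>"
      using ennreal_suminf_lessD[OF fin] by (simp add: less_top)
    then have "(\<integral>\<^sup>+\<omega>. ennreal (g k \<omega>) \<partial>M) < \<infinity>"
      by (auto simp: ennreal_mult_eq_top_iff less_top n0)
    then show "integrable M (g k)" using g nn by (intro integrableI_nonneg) auto
  qed (use nn in auto)
  have nn': "0 \<le> \<kappa>1 ^ k * (\<integral>\<omega>. g k \<omega> \<partial>M)" for k
    using \<kappa>1[of k] nn by (intro mult_nonneg_nonneg integral_nonneg_AE AE_I2) auto
  have eq: "(\<Sum>k. ennreal (\<kappa>1 ^ k) * (\<integral>\<^sup>+\<omega>. ennreal (g k \<omega>) \<partial>M)) = (\<Sum>k. ennreal (\<kappa>1 ^ k * (\<integral>\<omega>. g k \<omega> \<partial>M)))"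
    unfolding k using \<kappa>1 by (simp add: ennreal_mult' less_imp_le)
  then have "summable (\<lambda>k. \<kappa>1 ^ k * (\<integral>\<omega>. g k \<omega> \<partial>M))"
    using fin nn' by (intro summable_suminf_not_top) (auto simp: less_top)
  then show ?thesis
    unfolding eq using nn' by (simp add: suminf_ennreal2 suminf_nonneg)
qed

text \<open>W is the limit of the normalised gain, and its second moment is the common limit of the
  mixed moments. The initial cell adds only exp(-\<nu> * t), which disappears in both modes of
  convergence.\<close>

lemma normalized_population_limit:
  assumes hyp1: "(\<integral>\<^sup>+\<omega>. ennreal (exp (- \<nu> * \<xi> (X \<omega> 0)) * C (X \<omega> 0)) \<partial>M)
       + (\<integral>\<^sup>+\<omega>. ennreal (exp (- (\<nu> - \<delta>) * \<xi> (X \<omega> 0)) * \<Psi> (X \<omega> 0)) \<partial>M)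
       + (\<Sum>k. ennreal (\<kappa>1 ^ k) *
            (\<integral>\<^sup>+\<omega>. ennreal ((C (X \<omega> k))\<^sup>2 * exp (- 2 * \<nu> * S \<omega> k)) \<partial>M)) < \<infinity>"
    and hyp2: "(\<Sum>k. ennreal (\<kappa>1 ^ k) *
            (\<integral>\<^sup>+\<omega>. ennreal (C (X \<omega> k) * \<Psi> (X \<omega> k) * exp (- (2 * \<nu> - \<delta>) * S \<omega> k)
                         + (\<Psi> (X \<omega> k))\<^sup>2 * exp (- 2 * (\<nu> - \<delta>) * S \<omega> k)) \<partial>M)) < \<infinity>"
    and hyp3: "(\<Sum>k. ennreal (\<kappa>1 ^ k) *
            (\<integral>\<^sup>+\<omega>. ennreal ((C (X \<omega> k) + \<Psi> (X \<omega> k) + real k) * exp (- (\<nu> + \<delta>) * S \<omega> k)) \<partial>M)) < \<infinity>"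
  shows "\<exists>W.
       W \<in> borel_measurable M \<and> integrable M (\<lambda>\<omega>. (W \<omega>)\<^sup>2) \<and>
       tends_in_quadratic_mean M (\<lambda>t \<omega>. ennreal (exp (- \<nu> * t)) * num_alive \<xi> \<kappa> (T \<omega>) t) W \<and>
       (\<integral>\<omega>. W \<omega> \<partial>M) = \<kappa>1 * (\<integral>\<omega>. exp (- \<nu> * \<xi> (X \<omega> 0)) * C (X \<omega> 0) \<partial>M) \<and>
       (\<integral>\<omega>. (W \<omega> - (\<integral>\<omega>'. W \<omega>' \<partial>M))\<^sup>2 \<partial>M)
         = \<kappa>2 * (\<Sum>k. \<kappa>1 ^ k * (\<integral>\<omega>. (C (X \<omega> k))\<^sup>2 * exp (- 2 * \<nu> * S \<omega> k) \<partial>M))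
           - \<kappa>1\<^sup>2 * (\<integral>\<omega>. exp (- \<nu> * \<xi> (X \<omega> 0)) * C (X \<omega> 0) \<partial>M)\<^sup>2 \<and>
       (AE \<omega> in M. ((\<lambda>t. ennreal (exp (- \<nu> * t)) * num_alive \<xi> \<kappa> (T \<omega>) t)
                        \<longlongrightarrow> ennreal (W \<omega>)) at_top)"
proof -
  have \<kappa>1: "0 \<le> \<kappa>1" using kappa_mean_ge_2 by simp
  have pw: "offspring_mean ^ k = ennreal (\<kappa>1 ^ k)" for k
    unfolding offspring_mean_eq using \<kappa>1 by (rule ennreal_power)
  let ?w3 = "\<lambda>k. \<integral>\<^sup>+\<omega>. ennreal ((C (X \<omega> k) + \<Psi> (X \<omega> k) + real k) * exp (- (\<nu> + \<delta>) * S \<omega> k)) \<partial>M"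
  have main_fin: "main_sum < \<infinity>" using hyp1 by (simp add: main_sum_def main_integral_def pw)
  \<comment> \<open>The hypothesis is stated with \<Psi>; the pointwise bound of \<open>err\<close>
    by \<Psi> transfers it.\<close>
  have err_fin: "(\<Sum>k. offspring_mean ^ k * error_integral k) < \<infinity>"
  proof (rule le_less_trans[OF _ hyp2])
    show "(\<Sum>k. offspring_mean ^ k * error_integral k) \<le> (\<Sum>k. ennreal (\<kappa>1 ^ k) *
            (\<integral>\<^sup>+\<omega>. ennreal (C (X \<omega> k) * \<Psi> (X \<omega> k) * exp (- (2 * \<nu> - \<delta>) * S \<omega> k)
                         + (\<Psi> (X \<omega> k))\<^sup>2 * exp (- 2 * (\<nu> - \<delta>) * S \<omega> k)) \<partial>M))"
      unfolding pw error_integral_def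
    proof (intro suminf_le summableI mult_left_mono nn_integral_mono ennreal_leI add_mono mult_right_mono)
      fix k \<omega> assume \<omega>: "\<omega> \<in> space M"
      note b = C_nonneg[OF X_space[OF \<omega>, of k]] err_nonneg[OF X_space[OF \<omega>, of k]] err_le_Psi[OF X_space[OF \<omega>, of k]]
      show "err (X \<omega> k) \<le> \<Psi> (X \<omega> k)" "0 \<le> C (X \<omega> k)" "(err (X \<omega> k))\<^sup>2 \<le> (\<Psi> (X \<omega> k))\<^sup>2"
        using b by (auto intro: power_mono)
    qed auto
  qed
  have anc_fin: "(\<Sum>k. offspring_mean ^ k * ancestor_integral k) < \<infinity>"
  proof (rule le_less_trans[OF _ hyp3])
    show "(\<Sum>k. offspring_mean ^ k * ancestor_integral k) \<le> (\<Sum>k. ennreal (\<kappa>1 ^ k) * ?w3 k)"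
      unfolding pw ancestor_integral_def
    proof (intro suminf_le summableI mult_left_mono nn_integral_mono ennreal_leI mult_right_mono)
      fix k \<omega> assume \<omega>: "\<omega> \<in> space M"
      show "C (X \<omega> k) + err (X \<omega> k) \<le> C (X \<omega> k) + \<Psi> (X \<omega> k) + real k"
        using err_le_Psi[OF X_space[OF \<omega>, of k]] by simp
    qed auto
  qed
  have diag_fin: "(\<Sum>k. offspring_mean ^ k * diagonal_integral k) < \<infinity>"
  proof -
    \<comment> \<open>The weight \<open>real k\<close> of the third hypothesis is at least 1 except
      in generation 0, where the diagonal integrand is itself at most 1; hence the additional term
      at k = 0.\<close>
    have le: "diagonal_integral k \<le> indicator {0} k + ?w3 k" for k
    proof (cases "k = 0")
      case True
      have "diagonal_integral k \<le> (\<integral>\<^sup>+\<omega>. 1 \<partial>M)"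
        unfolding diagonal_integral_def
      proof (rule nn_integral_mono)
        fix \<omega> assume "\<omega> \<in> space M"
        then show "ennreal (exp (- (\<nu> + \<delta>) * S \<omega> k)) \<le> 1"
          using lifetime_sum_nonneg[of \<omega> k] nu_pos delta_pos by (simp add: mult_le_0_iff)
      qed
      then show ?thesis using True by (simp add: emeasure_space_1 add_increasing2)
    next
      case False
      have "diagonal_integral k \<le> ?w3 k"
        unfolding diagonal_integral_def
      proof (intro nn_integral_mono ennreal_leI)
        fix \<omega> assume \<omega>: "\<omega> \<in> space M"
        have "1 \<le> C (X \<omega> k) + \<Psi> (X \<omega> k) + real k"
          using False C_nonneg[OF X_space[OF \<omega>, of k]] Psi_nonneg[of "X \<omega> k"] by linarith
        then have "1 * exp (- (\<nu> + \<delta>) * S \<omega> k) \<le> (C (X \<omega> k) + \<Psi> (X \<omega> k) + real k) * exp (- (\<nu> + \<delta>) * S \<omega> k)"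
          by (rule mult_right_mono) simp
        then show "exp (- (\<nu> + \<delta>) * S \<omega> k) \<le> (C (X \<omega> k) + \<Psi> (X \<omega> k) + real k) * exp (- (\<nu> + \<delta>) * S \<omega> k)" by simp
      qed
      then show ?thesis using False by simp
    qed
    have "(\<Sum>k. offspring_mean ^ k * diagonal_integral k) \<le> (\<Sum>k. offspring_mean ^ k * indicator {0} k + offspring_mean ^ k * ?w3 k)"
      unfolding distrib_left[symmetric] by (intro suminf_le summableI mult_left_mono le zero_le)
    also have "\<dots> = (\<Sum>k. offspring_mean ^ k * indicator {0} k) + (\<Sum>k. offspring_mean ^ k * ?w3 k)"
      by (rule suminf_add[symmetric, OF summableI summableI])
    also have "(\<Sum>k. offspring_mean ^ k * indicator {0::nat} k) = 1"
      by (subst suminf_finite[of "{0}"]) auto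
    also have "1 + (\<Sum>k. offspring_mean ^ k * ?w3 k) < \<infinity>" using hyp3 by (simp add: pw)
    finally show ?thesis .
  qed
  have rem_fin: "remainder_sum < \<infinity>"
  proof -
    have "remainder_sum = (\<Sum>k. offspring_mean ^ k * diagonal_integral k)
        + 2 * (\<Sum>k. offspring_mean ^ k * ancestor_integral k) + 2 * (\<Sum>k. offspring_mean ^ k * error_integral k)"
      unfolding remainder_sum_def ennreal_suminf_cmult[symmetric]
      by (subst suminf_add[OF summableI summableI])+ (simp only: distrib_left ac_simps)
    also have "\<dots> < \<infinity>" using diag_fin anc_fin err_fin by (simp add: ennreal_mult_less_top)
    finally show ?thesis .
  qed
  obtain m where m: "main_sum = ennreal m" "0 \<le> m" using main_fin by (cases main_sum) auto
  obtain r where r: "remainder_sum = ennreal r" "0 \<le> r" using rem_fin by (cases remainder_sum) auto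
  note \<kappa>2 = kappa_fact2_nonneg
  have gain_fin: "AE \<omega> in M. \<forall>t. total_gain t \<omega> < \<infinity>"
    using \<kappa>2 m(2) r(2) by (intro AE_total_gain_finite; unfold offspring_fact2_eq m(1) r(1)) (simp_all flip: ennreal_mult')

  \<comment> \<open>The initial cell is left out; it is put back at the end as the summand
    exp(-\<nu> * t) of the normalised population.\<close>
  define G where "G t \<omega> = exp (- \<nu> * t) * enn2real (total_gain t \<omega>)" for t \<omega>
  have G_meas[measurable]: "G t \<in> borel_measurable M" for t
    unfolding G_def[abs_def] by (intro borel_measurable_times borel_measurable_const borel_measurable_enn2real measurable_total_gain)
  have G_nonneg: "0 \<le> G t \<omega>" for t \<omega> by (simp add: G_def)
  have G_ennreal: "AE \<omega> in M. \<forall>t. ennreal (G t \<omega>) = ennreal (exp (- \<nu> * t)) * total_gain t \<omega>"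
    using gain_fin by (rule AE_mp) (auto intro!: AE_I2 simp: G_def ennreal_mult' less_top)

  have G_product: "integrable M (\<lambda>\<omega>. G s \<omega> * G t \<omega>)"
      "\<bar>(\<integral>\<omega>. G s \<omega> * G t \<omega> \<partial>M) - \<kappa>2 * m\<bar> \<le> (\<kappa>2 * r) * exp (- \<eta> * min s t)"
    if st: "0 \<le> s" "0 \<le> t" for s t
  proof -
    let ?q = "exp (- \<eta> * min s t)"
    have "(\<integral>\<^sup>+\<omega>. ennreal (G s \<omega> * G t \<omega>) \<partial>M) = (\<integral>\<^sup>+\<omega>. ennreal (exp (- \<nu> * (s + t))) * (total_gain s \<omega> * total_gain t \<omega>) \<partial>M)"
    proof (rule nn_integral_cong_AE, use G_ennreal in \<open>rule AE_mp\<close>, intro AE_I2 impI)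
      fix \<omega> assume e: "\<forall>t. ennreal (G t \<omega>) = ennreal (exp (- \<nu> * t)) * total_gain t \<omega>"
      have "exp (- \<nu> * (s + t)) = exp (- \<nu> * s) * exp (- \<nu> * t)"
        by (simp only: exp_add[symmetric] distrib_left)
      then have x: "ennreal (exp (- \<nu> * (s + t))) = ennreal (exp (- \<nu> * s)) * ennreal (exp (- \<nu> * t))"
        by (simp only: ennreal_mult exp_ge_zero)
      show "ennreal (G s \<omega> * G t \<omega>) = ennreal (exp (- \<nu> * (s + t))) * (total_gain s \<omega> * total_gain t \<omega>)"
        by (simp only: ennreal_mult G_nonneg e[rule_format] x ac_simps)
    qed
    also have "\<dots> = ennreal (exp (- \<nu> * (s + t))) * (\<integral>\<^sup>+\<omega>. total_gain s \<omega> * total_gain t \<omega> \<partial>M)"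
      by (intro nn_integral_cmult borel_measurable_times_ennreal measurable_total_gain)
    finally have N: "ennreal (exp (- \<nu> * (s + t))) * (\<integral>\<^sup>+\<omega>. total_gain s \<omega> * total_gain t \<omega> \<partial>M)
        = (\<integral>\<^sup>+\<omega>. ennreal (G s \<omega> * G t \<omega>) \<partial>M)" by (rule sym)
    have c: "offspring_fact2 * main_sum = ennreal (\<kappa>2 * m)"
      "offspring_fact2 * (ennreal ?q * remainder_sum) = ennreal ((\<kappa>2 * r) * ?q)"
      using \<kappa>2 m(2) r(2) unfolding offspring_fact2_eq m(1) r(1) by (simp_all add: ac_simps flip: ennreal_mult')
    note b = second_moment_bounds[OF st, unfolded N c]
    have nn: "0 \<le> \<kappa>2 * m" "0 \<le> (\<kappa>2 * r) * ?q" using \<kappa>2 m(2) r(2) by auto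
    have "(\<integral>\<^sup>+\<omega>. ennreal (G s \<omega> * G t \<omega>) \<partial>M) < \<infinity>" by (rule le_less_trans[OF b(1)]) simp
    then show i: "integrable M (\<lambda>\<omega>. G s \<omega> * G t \<omega>)" by (intro integrableI_nonneg) (auto simp: G_nonneg)
    have e: "(\<integral>\<^sup>+\<omega>. ennreal (G s \<omega> * G t \<omega>) \<partial>M) = ennreal (\<integral>\<omega>. G s \<omega> * G t \<omega> \<partial>M)"
      by (rule nn_integral_eq_integral[OF i]) (simp add: G_nonneg)
    have "0 \<le> (\<integral>\<omega>. G s \<omega> * G t \<omega> \<partial>M)" by (simp add: G_nonneg)
    then show "\<bar>(\<integral>\<omega>. G s \<omega> * G t \<omega> \<partial>M) - \<kappa>2 * m\<bar> \<le> (\<kappa>2 * r) * ?q"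
      using b nn unfolding e by (simp flip: ennreal_plus)
  qed
  have G_square: "integrable M (\<lambda>\<omega>. (G t \<omega>)\<^sup>2)" if "0 \<le> t" for t
    using G_product(1)[OF that that] by (simp add: power2_eq_square)
  have G_mono: "AE \<omega> in M. \<forall>s t. 0 \<le> s \<longrightarrow> s \<le> t \<longrightarrow> exp (\<nu> * s) * G s \<omega> \<le> exp (\<nu> * t) * G t \<omega>"
    using gain_fin
  proof (rule AE_mp, intro AE_I2 impI allI)
    fix \<omega> s t assume fin: "\<forall>t. total_gain t \<omega> < \<infinity>" and "s \<le> (t::real)"
    have e: "exp (\<nu> * u) * G u \<omega> = enn2real (total_gain u \<omega>)" for u
    proof -
      have "exp (\<nu> * u) * exp (- \<nu> * u) = 1" by (simp flip: exp_add)
      then show ?thesis by (simp only: G_def mult.assoc[symmetric] mult_1)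
    qed
    have "total_gain s \<omega> \<le> total_gain t \<omega>" using \<open>s \<le> t\<close> by (intro nn_integral_mono cell_gain_mono)
    then show "exp (\<nu> * s) * G s \<omega> \<le> exp (\<nu> * t) * G t \<omega>"
      unfolding e using fin by (intro enn2real_mono) auto
  qed
  obtain W where W: "W \<in> borel_measurable M" "\<And>\<omega>. 0 \<le> W \<omega>" "integrable M (\<lambda>\<omega>. (W \<omega>)\<^sup>2)"
    "\<And>t. 0 \<le> t \<Longrightarrow> (\<integral>\<omega>. (G t \<omega> - W \<omega>)\<^sup>2 \<partial>M) \<le> 4 * (\<kappa>2 * r) * exp (- \<eta> * t)"
    "(\<integral>\<omega>. (W \<omega>)\<^sup>2 \<partial>M) = \<kappa>2 * m" "((\<lambda>t. \<integral>\<omega>. G t \<omega> \<partial>M) \<longlongrightarrow> (\<integral>\<omega>. W \<omega> \<partial>M)) at_top"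
    "AE \<omega> in M. ((\<lambda>t. G t \<omega>) \<longlongrightarrow> W \<omega>) at_top"
    using quadratic_mean_limit[OF G_meas G_nonneg G_square G_product(2) eta_pos nu_pos G_mono] by blast
  note W(1)[measurable]
  have W_int: "integrable M W" by (rule square_integrable_imp_integrable[OF W(1,3)])

  let ?I = "\<integral>\<^sup>+\<omega>. ennreal (exp (- \<nu> * \<xi> (X \<omega> 0)) * C (X \<omega> 0)) \<partial>M"
  let ?J = "\<integral>\<^sup>+\<omega>. ennreal (exp (- (\<nu> - \<delta>) * \<xi> (X \<omega> 0)) * err (X \<omega> 0)) \<partial>M"
  let ?i = "\<integral>\<omega>. exp (- \<nu> * \<xi> (X \<omega> 0)) * C (X \<omega> 0) \<partial>M"
  have [measurable]: "(\<lambda>\<omega>. \<xi> (X \<omega> 0)) \<in> borel_measurable M" by (rule measurable_compose[OF measurable_X xi_measurable])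
  have I: "?I = ennreal ?i" and i_nonneg: "0 \<le> ?i"
  proof -
    have nn: "AE \<omega> in M. 0 \<le> exp (- \<nu> * \<xi> (X \<omega> 0)) * C (X \<omega> 0)" by (auto intro!: AE_I2 simp: C_nonneg[OF X_space])
    then show "0 \<le> ?i" by (rule integral_nonneg_AE)
    have "?I < \<infinity>" using hyp1 by simp
    then have "integrable M (\<lambda>\<omega>. exp (- \<nu> * \<xi> (X \<omega> 0)) * C (X \<omega> 0))" using nn by (intro integrableI_nonneg) auto
    then show "?I = ennreal ?i" using nn by (rule nn_integral_eq_integral)
  qed
  have J_fin: "?J < \<infinity>"
  proof (rule le_less_trans)
    show "?J \<le> (\<integral>\<^sup>+\<omega>. ennreal (exp (- (\<nu> - \<delta>) * \<xi> (X \<omega> 0)) * \<Psi> (X \<omega> 0)) \<partial>M)"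
      by (intro nn_integral_mono ennreal_leI mult_left_mono err_le_Psi X_space) auto
    show "\<dots> < \<infinity>" using hyp1 by simp
  qed
  then obtain j where j: "?J = ennreal j" "0 \<le> j" by (cases ?J) auto
  have mean: "(\<integral>\<omega>. W \<omega> \<partial>M) = \<kappa>1 * ?i"
  proof (rule tendsto_unique[OF trivial_limit_at_top_linorder W(6)])
    have b: "\<bar>(\<integral>\<omega>. G t \<omega> \<partial>M) - \<kappa>1 * ?i\<bar> \<le> exp (- \<nu> * t) * (\<kappa>1 - 1) + exp (- \<delta> * t) * (\<kappa>1 * j)" (is "_ \<le> ?e") if t: "0 \<le> t" for t
    proof -
      have "(\<integral>\<^sup>+\<omega>. ennreal (G t \<omega>) \<partial>M) = (\<integral>\<^sup>+\<omega>. ennreal (exp (- \<nu> * t)) * total_gain t \<omega> \<partial>M)"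
        by (rule nn_integral_cong_AE, use G_ennreal in \<open>rule AE_mp\<close>) auto
      also have "\<dots> = ennreal (exp (- \<nu> * t)) * (\<integral>\<^sup>+\<omega>. total_gain t \<omega> \<partial>M)"
        by (rule nn_integral_cmult[OF measurable_total_gain])
      finally have N: "ennreal (exp (- \<nu> * t)) * (\<integral>\<^sup>+\<omega>. total_gain t \<omega> \<partial>M) = (\<integral>\<^sup>+\<omega>. ennreal (G t \<omega>) \<partial>M)" by (rule sym)
      have "(\<integral>\<^sup>+\<omega>. ennreal (G t \<omega>) \<partial>M) = ennreal (\<integral>\<omega>. G t \<omega> \<partial>M)"
        by (rule nn_integral_eq_integral[OF square_integrable_imp_integrable[OF G_meas G_square[OF t]]]) (simp add: G_nonneg)
      note N = N[unfolded this]
      have e: "ennreal (exp (- \<nu> * t)) * mean_gain + ennreal (exp (- \<delta> * t)) * (offspring_mean * ennreal j) = ennreal ?e"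
        using kappa_mean_ge_2 j(2) unfolding mean_gain_eq offspring_mean_eq by (simp flip: ennreal_mult' ennreal_plus)
      have c: "offspring_mean * ennreal ?i = ennreal (\<kappa>1 * ?i)"
        using \<kappa>1 by (simp add: offspring_mean_eq flip: ennreal_mult')
      note b = first_moment_bounds[OF t, unfolded I j(1) e c N]
      have nn: "0 \<le> ?e" "0 \<le> \<kappa>1 * ?i" using kappa_mean_ge_2 j(2) i_nonneg by auto
      have "0 \<le> (\<integral>\<omega>. G t \<omega> \<partial>M)" by (simp add: G_nonneg)
      with b nn show ?thesis by (simp flip: ennreal_plus)
    qed
    show "((\<lambda>t. \<integral>\<omega>. G t \<omega> \<partial>M) \<longlongrightarrow> \<kappa>1 * ?i) at_top"
    proof (rule Lim_null[THEN iffD2], rule Lim_null_comparison)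
      show "\<forall>\<^sub>F t in at_top. norm ((\<integral>\<omega>. G t \<omega> \<partial>M) - \<kappa>1 * ?i) \<le> exp (- \<nu> * t) * (\<kappa>1 - 1) + exp (- \<delta> * t) * (\<kappa>1 * j)"
        using eventually_ge_at_top[of 0] by eventually_elim (simp only: real_norm_def b)
      have "((\<lambda>t. exp (- \<nu> * t)) \<longlongrightarrow> 0) at_top" "((\<lambda>t. exp (- \<delta> * t)) \<longlongrightarrow> 0) at_top"
        using nu_pos delta_pos by real_asymp+
      from tendsto_add[OF tendsto_mult_left_zero[OF this(1)] tendsto_mult_left_zero[OF this(2)]]
      show "((\<lambda>t. exp (- \<nu> * t) * (\<kappa>1 - 1) + exp (- \<delta> * t) * (\<kappa>1 * j)) \<longlongrightarrow> 0) at_top" by simp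
    qed
  qed
  have m_eq: "m = (\<Sum>k. \<kappa>1 ^ k * (\<integral>\<omega>. (C (X \<omega> k))\<^sup>2 * exp (- 2 * \<nu> * S \<omega> k) \<partial>M))"
  proof -
    have "m = enn2real (\<Sum>k. ennreal (\<kappa>1 ^ k) * (\<integral>\<^sup>+\<omega>. ennreal ((C (X \<omega> k))\<^sup>2 * exp (- 2 * \<nu> * S \<omega> k)) \<partial>M))"
      using m by (simp add: main_sum_def main_integral_def pw)
    also have "\<dots> = (\<Sum>k. \<kappa>1 ^ k * (\<integral>\<omega>. (C (X \<omega> k))\<^sup>2 * exp (- 2 * \<nu> * S \<omega> k) \<partial>M))"
      by (rule suminf_weighted_integral) (use hyp1 in auto)
    finally show ?thesis .
  qed
  \<comment> \<open>The second moment \<kappa>2 * m minus the squared mean; m is rewritten as a real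
    series by \<open>m_eq\<close>.\<close>
  have var: "(\<integral>\<omega>. (W \<omega> - (\<integral>\<omega>'. W \<omega>' \<partial>M))\<^sup>2 \<partial>M) = \<kappa>2 * m - \<kappa>1\<^sup>2 * ?i\<^sup>2"
    using variance_eq[OF W_int W(3)] by (simp only: W(5) mean power_mult_distrib)

  let ?Z = "\<lambda>t \<omega>. ennreal (exp (- \<nu> * t)) * num_alive \<xi> \<kappa> (T \<omega>) t"
  have Z: "AE \<omega> in M. \<forall>t\<ge>0. ?Z t \<omega> = ennreal (exp (- \<nu> * t) + G t \<omega>)"
  proof -
    have "AE \<omega> in M. \<omega> \<in> space M" by (rule AE_space)
    then show ?thesis using gain_fin G_ennreal
    proof (eventually_elim, intro allI impI)
      fix \<omega> and t :: real
      assume "\<omega> \<in> space M" "\<forall>t. total_gain t \<omega> < \<infinity>" "0 \<le> t"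
        and e: "\<forall>t. ennreal (G t \<omega>) = ennreal (exp (- \<nu> * t)) * total_gain t \<omega>"
      then have "num_alive \<xi> \<kappa> (T \<omega>) t = 1 + total_gain t \<omega>" by (intro num_alive_total_gain) auto
      then have "?Z t \<omega> = ennreal (exp (- \<nu> * t)) + ennreal (G t \<omega>)"
        by (simp only: e[rule_format] distrib_left mult_1_right)
      then show "?Z t \<omega> = ennreal (exp (- \<nu> * t) + G t \<omega>)" by (simp add: G_nonneg)
    qed
  qed
  have decay: "((\<lambda>t. exp (- \<nu> * t)) \<longlongrightarrow> 0) at_top" using nu_pos by real_asymp
  have "tends_in_quadratic_mean M ?Z W"
    unfolding tends_in_quadratic_mean_def
  proof (intro conjI allI impI W(1,3))
    fix t :: real assume t: "0 \<le> t"
    show m: "?Z t \<in> borel_measurable M"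
      by (intro borel_measurable_times_ennreal borel_measurable_const measurable_num_alive)
    show "AE \<omega> in M. ?Z t \<omega> < \<infinity>" using Z by (rule AE_mp) (use t in auto)
    have "integrable M (\<lambda>\<omega>. (G t \<omega> - (- exp (- \<nu> * t)))\<^sup>2)"
      by (rule integrable_power2_diff) (auto simp: G_square[OF t])
    then show "integrable M (\<lambda>\<omega>. (enn2real (?Z t \<omega>))\<^sup>2)"
    proof (rule integrable_cong_AE_imp)
      show "(\<lambda>\<omega>. (enn2real (?Z t \<omega>))\<^sup>2) \<in> borel_measurable M" using m by measurable
      show "AE \<omega> in M. (G t \<omega> - - exp (- \<nu> * t))\<^sup>2 = (enn2real (?Z t \<omega>))\<^sup>2"
        using Z by (rule AE_mp) (use t in \<open>auto intro!: AE_I2 simp: G_nonneg add.commute simp del: ennreal_plus\<close>)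
    qed
  next
    have bound: "norm (\<integral>\<omega>. (enn2real (?Z t \<omega>) - W \<omega>)\<^sup>2 \<partial>M) \<le> 2 * (exp (- \<nu> * t) * exp (- \<nu> * t)) + 2 * (4 * (\<kappa>2 * r) * exp (- \<eta> * t))"
      if t: "0 \<le> t" for t
    proof -
      have i: "integrable M (\<lambda>\<omega>. (G t \<omega> - W \<omega>)\<^sup>2)"
        by (rule integrable_power2_diff[OF G_meas W(1) G_square[OF t] W(3)])
      have m: "?Z t \<in> borel_measurable M"
        by (intro borel_measurable_times_ennreal borel_measurable_const measurable_num_alive)
      have "(\<integral>\<omega>. (enn2real (?Z t \<omega>) - W \<omega>)\<^sup>2 \<partial>M) = (\<integral>\<omega>. (exp (- \<nu> * t) + (G t \<omega> - W \<omega>))\<^sup>2 \<partial>M)"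
      proof (rule integral_cong_AE)
        show "(\<lambda>\<omega>. (enn2real (?Z t \<omega>) - W \<omega>)\<^sup>2) \<in> borel_measurable M" using m by measurable
        show "AE \<omega> in M. (enn2real (?Z t \<omega>) - W \<omega>)\<^sup>2 = (exp (- \<nu> * t) + (G t \<omega> - W \<omega>))\<^sup>2"
          using Z by (rule AE_mp) (use t in \<open>auto intro!: AE_I2 simp: G_nonneg add_diff_eq simp del: ennreal_plus\<close>)
      qed measurable
      also have "\<dots> \<le> (\<integral>\<omega>. 2 * (exp (- \<nu> * t) * exp (- \<nu> * t)) + 2 * (G t \<omega> - W \<omega>)\<^sup>2 \<partial>M)"
      proof (rule integral_mono')
        show "integrable M (\<lambda>\<omega>. 2 * (exp (- \<nu> * t) * exp (- \<nu> * t)) + 2 * (G t \<omega> - W \<omega>)\<^sup>2)" using i by simp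
        have "(a + b)\<^sup>2 \<le> 2 * (a * a) + 2 * b\<^sup>2" for a b :: real
          using zero_le_power2[of "a - b"] by (simp add: power2_eq_square algebra_simps)
        then show "(exp (- \<nu> * t) + (G t \<omega> - W \<omega>))\<^sup>2 \<le> 2 * (exp (- \<nu> * t) * exp (- \<nu> * t)) + 2 * (G t \<omega> - W \<omega>)\<^sup>2" for \<omega> .
      qed simp
      also have "\<dots> = 2 * (exp (- \<nu> * t) * exp (- \<nu> * t)) + 2 * (\<integral>\<omega>. (G t \<omega> - W \<omega>)\<^sup>2 \<partial>M)"
        using i by (simp add: prob_space)
      finally show ?thesis using W(4)[OF t] by simp
    qed
    show "((\<lambda>t. \<integral>\<omega>. (enn2real (?Z t \<omega>) - W \<omega>)\<^sup>2 \<partial>M) \<longlongrightarrow> 0) at_top"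
    proof (rule Lim_null_comparison)
      show "\<forall>\<^sub>F t in at_top. norm (\<integral>\<omega>. (enn2real (?Z t \<omega>) - W \<omega>)\<^sup>2 \<partial>M)
          \<le> 2 * (exp (- \<nu> * t) * exp (- \<nu> * t)) + 2 * (4 * (\<kappa>2 * r) * exp (- \<eta> * t))"
        using eventually_ge_at_top[of 0] by eventually_elim (rule bound)
      have "((\<lambda>t. exp (- \<eta> * t)) \<longlongrightarrow> 0) at_top" using eta_pos by real_asymp
      from tendsto_add[OF tendsto_mult_right_zero[OF tendsto_mult_zero[OF decay decay], of 2]
          tendsto_mult_right_zero[OF tendsto_mult_right_zero[OF this, of "4 * (\<kappa>2 * r)"], of 2]]
      show "((\<lambda>t. 2 * (exp (- \<nu> * t) * exp (- \<nu> * t)) + 2 * (4 * (\<kappa>2 * r) * exp (- \<eta> * t))) \<longlongrightarrow> 0) at_top" by simp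
    qed
  qed
  moreover have "AE \<omega> in M. ((\<lambda>t. ?Z t \<omega>) \<longlongrightarrow> ennreal (W \<omega>)) at_top"
    using W(7) Z
  proof eventually_elim
    fix \<omega> assume G: "((\<lambda>t. G t \<omega>) \<longlongrightarrow> W \<omega>) at_top" and e: "\<forall>t\<ge>0. ?Z t \<omega> = ennreal (exp (- \<nu> * t) + G t \<omega>)"
    have "((\<lambda>t. ennreal (exp (- \<nu> * t) + G t \<omega>)) \<longlongrightarrow> ennreal (0 + W \<omega>)) at_top"
      by (intro tendsto_ennrealI tendsto_add decay G)
    moreover have "\<forall>\<^sub>F t in at_top. ennreal (exp (- \<nu> * t) + G t \<omega>) = ?Z t \<omega>"
      using eventually_ge_at_top[of 0] by eventually_elim (use e in simp)
    ultimately show "((\<lambda>t. ?Z t \<omega>) \<longlongrightarrow> ennreal (W \<omega>)) at_top"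
      using Lim_transform_eventually by fastforce
  qed
  ultimately show ?thesis using W(1,3) mean var[unfolded m_eq] by blast
qed

end

theorem theorem3p6:
  fixes M :: "'w measure" and E :: "'x measure" and \<xi> :: "'x \<Rightarrow> real" and \<kappa> :: "'x \<Rightarrow> nat"
    and X :: "'w \<Rightarrow> nat \<Rightarrow> 'x" and T :: "'w \<Rightarrow> nat list \<Rightarrow> 'x"
    and Xk :: "nat \<Rightarrow> 'w \<Rightarrow> nat \<Rightarrow> 'x" and P :: "'x \<Rightarrow> 'x measure"
    and F :: "'x \<Rightarrow> complex \<Rightarrow> complex" and \<nu> \<delta> \<epsilon> \<kappa>1 \<kappa>2 :: real
    and S :: "'w \<Rightarrow> nat \<Rightarrow> real" and C \<Psi> :: "'x \<Rightarrow> real"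
  defines "\<kappa>1 \<equiv> kappa_mean M \<kappa> X"
    and "\<kappa>2 \<equiv> kappa_fact2 M \<kappa> X"
    and "S \<equiv> (\<lambda>\<omega>. lifetime_sum \<xi> (X \<omega>))"
    and "C \<equiv> C0 F"
    and "\<Psi> \<equiv> Psi0 F \<delta>"
  assumes "markov_independence M E \<xi> \<kappa> X T Xk P \<nu>"
    and "analyticity E \<xi> P \<kappa>1 \<nu> F \<delta> \<epsilon>"
    and "(\<integral>\<^sup>+\<omega>. ennreal (exp (- \<nu> * \<xi> (X \<omega> 0)) * C (X \<omega> 0)) \<partial>M)
       + (\<integral>\<^sup>+\<omega>. ennreal (exp (- (\<nu> - \<delta>) * \<xi> (X \<omega> 0)) * \<Psi> (X \<omega> 0)) \<partial>M)
       + (\<Sum>k. ennreal (\<kappa>1 ^ k) *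
            (\<integral>\<^sup>+\<omega>. ennreal ((C (X \<omega> k))\<^sup>2 * exp (- 2 * \<nu> * S \<omega> k)) \<partial>M)) < \<infinity>"
    and "(\<Sum>k. ennreal (\<kappa>1 ^ k) *
            (\<integral>\<^sup>+\<omega>. ennreal (C (X \<omega> k) * \<Psi> (X \<omega> k) * exp (- (2 * \<nu> - \<delta>) * S \<omega> k)
                         + (\<Psi> (X \<omega> k))\<^sup>2 * exp (- 2 * (\<nu> - \<delta>) * S \<omega> k)) \<partial>M)) < \<infinity>"
    and "(\<Sum>k. ennreal (\<kappa>1 ^ k) *
            (\<integral>\<^sup>+\<omega>. ennreal ((C (X \<omega> k) + \<Psi> (X \<omega> k) + real k) * exp (- (\<nu> + \<delta>) * S \<omega> k)) \<partial>M)) < \<infinity>"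
  shows "\<exists>W.
       W \<in> borel_measurable M \<and> integrable M (\<lambda>\<omega>. (W \<omega>)\<^sup>2) \<and>
       tends_in_quadratic_mean M (\<lambda>t \<omega>. ennreal (exp (- \<nu> * t)) * num_alive \<xi> \<kappa> (T \<omega>) t) W \<and>
       (\<integral>\<omega>. W \<omega> \<partial>M) = \<kappa>1 * (\<integral>\<omega>. exp (- \<nu> * \<xi> (X \<omega> 0)) * C (X \<omega> 0) \<partial>M) \<and>
       (\<integral>\<omega>. (W \<omega> - (\<integral>\<omega>'. W \<omega>' \<partial>M))\<^sup>2 \<partial>M)
         = \<kappa>2 * (\<Sum>k. \<kappa>1 ^ k * (\<integral>\<omega>. (C (X \<omega> k))\<^sup>2 * exp (- 2 * \<nu> * S \<omega> k) \<partial>M))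
           - \<kappa>1\<^sup>2 * (\<integral>\<omega>. exp (- \<nu> * \<xi> (X \<omega> 0)) * C (X \<omega> 0) \<partial>M)\<^sup>2 \<and>
       ((AE \<omega> in M. 0 < W \<omega>) \<longrightarrow>
          (AE \<omega> in M. ((\<lambda>t. ennreal (exp (- \<nu> * t)) * num_alive \<xi> \<kappa> (T \<omega>) t)
                        \<longlongrightarrow> ennreal (W \<omega>)) at_top))"
proof -
  note assm = assms(6-10)[unfolded assms(1-5)]
  interpret branching_analyticity M E \<xi> \<kappa> X T Xk P \<nu> F \<delta> \<epsilon>
    by (intro branching_analyticity.intro assm(1,2))
  show ?thesis
    unfolding assms(1-5) using normalized_population_limit[OF assm(3-5)] by blast
qed

end
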